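(* Let $s>5/2$, let $H^sG := H^s\mathrm{Diff}(S^1)\circledS H^{s-1}(S^1)$, and let $\Gamma$, $\nabla$ and $\langle\cdot,\cdot\rangle$ be the 2CH Christoffel map, the associated covariant derivative and the right-invariant metric on $H^sG$ defined in the context. Then: (1) $\Gamma$ defines a smooth spray on $H^sG$, i.e., the map $$(\varphi,f)\mapsto\Gamma_{(\varphi,f)}\colon H^sG\to\mathcal{L}^2_{\mathrm{sym}}\bigl(H^s(S^1)\times H^{s-1}(S^1);\,H^s(S^1)\times H^{s-1}(S^1)\bigr)$$ is smooth. (2) $\langle\cdot,\cdot\rangle$ is a smooth (weak) Riemannian metric on $H^sG$, i.e., the map $$(\varphi,f)\mapsto\langle\cdot,\cdot\rangle_{(\varphi,f)}\in\mathcal{L}^2_{\mathrm{sym}}\bigl(T_{(\varphi,f)}H^sG;\mathbb{R}\bigr)$$ is a smooth section of the bundle $\mathcal{L}^2_{\mathrm{sym}}(TH^sG;\mathbb{R})$ over $H^sG$. (3) The connection $\nabla$ and the metric $\langle\cdot,\cdot\rangle$ are compatible in the sense that $$X\langle Y,Z\rangle = \langle\nabla_XY,Z\rangle+\langle Y,\nabla_XZ\rangle$$ for all vector fields $X,Y,Z$ on $H^sG$.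
   Context: $S^1\simeq\mathbb{R}/\mathbb{Z}$. $H^s\mathrm{Diff}(S^1)$ is the space of orientation-preserving diffeomorphisms of $S^1$ of Sobolev class $H^s$; for $s>5/2$ it is a Hilbert manifold and a topological group. $H^sG=H^s\mathrm{Diff}(S^1)\circledS H^{s-1}(S^1)$ is the set $H^s\mathrm{Diff}(S^1)\times H^{s-1}(S^1)$ with group product $(\varphi,f)(\psi,g)=(\varphi\circ\psi,\,g+f\circ\psi)$; it is a topological group and a smooth manifold modeled on the Hilbert space $H^s(S^1)\times H^{s-1}(S^1)$. Identification of the tangent bundle: the map $\varphi\mapsto(\varphi(0),\varphi(x)-x-\varphi(0))$ identifies $H^s\mathrm{Diff}(S^1)$ with $S^1\times\{h\in H^s(S^1): h(0)=0,\ h_x>-1\}$, and this gives a natural smooth identification $TH^sG\simeq H^sG\times(H^s(S^1)\times H^{s-1}(S^1))$. Using it, vector fields on $H^sG$ are regarded as maps $H^sG\to H^s(S^1)\times H^{s-1}(S^1)$, and $D$ denotes their derivative in this trivialization. Let $A=1-\partial_x^2$ (an isomorphism $H^r(S^1)\to H^{r-2}(S^1)$). The 2CH Christoffel map at $(\mathrm{id},0)$ is the bilinear operator on $H^s(S^1)\times H^{s-1}(S^1)$ $$\Gamma_{(\mathrm{id},0)}((u,\rho),(v,\tau))=\Bigl(\Gamma^0_{\mathrm{id}}(u,v)-\tfrac12A^{-1}\partial_x(\rho\tau),\ -\tfrac12(u_x\tau+v_x\rho)\Bigr),\qquad \Gamma^0_{\mathrm{id}}(u,v)=-A^{-1}\partial_x\bigl(uv+\tfrac12u_xv_x\bigr),$$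 extended to $H^sG$ by right-invariance: $$\Gamma_{(\varphi,f)}(X,Y)=\Gamma_{(\mathrm{id},0)}\bigl(X\circ\varphi^{-1},Y\circ\varphi^{-1}\bigr)\circ\varphi,\qquad X,Y\in H^s(S^1)\times H^{s-1}(S^1),$$ where composition acts on each component. The covariant derivative is $$(\nabla_XY)(\varphi,f)=DY(\varphi,f)\cdot X(\varphi,f)-\Gamma_{(\varphi,f)}(Y(\varphi,f),X(\varphi,f)).$$ The metric is $$\langle(u,\rho),(v,\tau)\rangle_{(\mathrm{id},0)}=\int_{S^1}(uv+u_xv_x)\,dx+\int_{S^1}\rho\tau\,dx,\qquad \langle X,Y\rangle_{(\varphi,f)}=\langle X\circ\varphi^{-1},Y\circ\varphi^{-1}\rangle_{(\mathrm{id},0)}.$$ For Banach spaces $E,F$, $\mathcal{L}^2_{\mathrm{sym}}(E;F)$ denotes the Banach space of (bounded) symmetric bilinear maps from $E$ to $F$; for a manifold $M$, $\mathcal{L}^2_{\mathrm{sym}}(TM;F)$ is the bundle over $M$ with fiber $\mathcal{L}^2_{\mathrm{sym}}(T_xM;F)$ over $x\in M$. A weak Riemannian metric is one whose induced topology on each tangent space may be weaker than the natural one. *)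

theory Defs
  imports "HOL-Analysis.Analysis" "HOL-Library.Function_Algebras"
begin

section \<open>Functions as a real vector space\<close>

instantiation "fun" :: (type, real_vector) real_vector
begin

definition scaleR_fun :: "real \<Rightarrow> ('a \<Rightarrow> 'b) \<Rightarrow> 'a \<Rightarrow> 'b"
  where "scaleR_fun c f = (\<lambda>x. c *\<^sub>R f x)"

instance
  by standard
    (auto simp: scaleR_fun_def fun_eq_iff plus_fun_def scaleR_add_right scaleR_add_left)

end

section \<open>Differential calculus on normed spaces of functions\<close>

text \<open>
  The Sobolev order is a real parameter, so the Sobolev spaces cannot be types of class
  real_normed_vector.  A normed space is therefore a linear subspace of an
  ambient real vector space together with a norm on it.
\<close>

record 'a nspace =
  carr :: "'a set"
  nrm :: "'a \<Rightarrow> real"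

definition real_ns :: "real nspace"
  where "real_ns = \<lparr>carr = UNIV, nrm = abs\<rparr>"

definition prod_ns :: "'a nspace \<Rightarrow> 'b nspace \<Rightarrow> ('a \<times> 'b) nspace"
  where "prod_ns E F =
    \<lparr>carr = carr E \<times> carr F, nrm = (\<lambda>(x, y). sqrt ((nrm E x)\<^sup>2 + (nrm F y)\<^sup>2))\<rparr>"

definition lin_on :: "('a::real_vector) nspace \<Rightarrow> ('b::real_vector) nspace \<Rightarrow> ('a \<Rightarrow> 'b) \<Rightarrow> bool"
  where "lin_on E F T \<longleftrightarrow>
    (\<forall>x\<in>carr E. T x \<in> carr F) \<and>
    (\<forall>x\<in>carr E. \<forall>y\<in>carr E. T (x + y) = T x + T y) \<and>
    (\<forall>c. \<forall>x\<in>carr E. T (c *\<^sub>R x) = c *\<^sub>R T x)"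

text \<open>
  The spaces of bounded \<open>k\<close>-linear maps and of bounded symmetric bilinear maps, with the operator
  norm.  A map defined on \<open>carr E\<close> is represented by its extension by zero, so that
  the norm is definite.
\<close>

definition args :: "nat \<Rightarrow> 'a nspace \<Rightarrow> 'a list set"
  where "args k E = {vs. length vs = k \<and> set vs \<subseteq> carr E}"

definition multilin :: "nat \<Rightarrow> ('a::real_vector) nspace \<Rightarrow> ('b::real_vector) nspace \<Rightarrow> ('a list \<Rightarrow> 'b) nspace"
  where "multilin k E F =
    \<lparr>carr = {T.
        (\<forall>vs\<in>args k E. T vs \<in> carr F) \<and>
        (\<forall>vs\<in>args k E. \<forall>i<k. lin_on E F (\<lambda>v. T (vs[i := v]))) \<and>
        (\<exists>C. \<forall>vs\<in>args k E. nrm F (T vs) \<le> C * prod_list (map (nrm E) vs)) \<and>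
        (\<forall>vs. vs \<notin> args k E \<longrightarrow> T vs = 0)},
     nrm = (\<lambda>T. Sup {nrm F (T vs) | vs. vs \<in> args k E \<and> (\<forall>v\<in>set vs. nrm E v \<le> 1)})\<rparr>"

definition sym_bilin :: "('a::real_vector) nspace \<Rightarrow> ('b::real_vector) nspace \<Rightarrow> ('a \<Rightarrow> 'a \<Rightarrow> 'b) nspace"
  where "sym_bilin E F =
    \<lparr>carr = {B.
        (\<forall>u\<in>carr E. lin_on E F (\<lambda>v. B u v)) \<and>
        (\<forall>v\<in>carr E. lin_on E F (\<lambda>u. B u v)) \<and>
        (\<forall>u\<in>carr E. \<forall>v\<in>carr E. B u v = B v u) \<and>
        (\<exists>C. \<forall>u\<in>carr E. \<forall>v\<in>carr E. nrm F (B u v) \<le> C * nrm E u * nrm E v) \<and>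
        (\<forall>u v. u \<notin> carr E \<or> v \<notin> carr E \<longrightarrow> B u v = 0)},
     nrm = (\<lambda>B. Sup {nrm F (B u v) | u v.
        u \<in> carr E \<and> v \<in> carr E \<and> nrm E u \<le> 1 \<and> nrm E v \<le> 1})\<rparr>"

text \<open>Frechet differentiability at \<open>x\<close> of a map defined on an open subset \<open>U\<close> of \<open>E\<close>.\<close>

definition has_fderiv ::
  "('a::real_vector) nspace \<Rightarrow> ('b::real_vector) nspace \<Rightarrow> 'a set \<Rightarrow> ('a \<Rightarrow> 'b) \<Rightarrow> ('a \<Rightarrow> 'b) \<Rightarrow> 'a \<Rightarrow> bool"
  where "has_fderiv E F U f f' x \<longleftrightarrow>
    lin_on E F f' \<and>
    (\<exists>C. \<forall>h\<in>carr E. nrm F (f' h) \<le> C * nrm E h) \<and>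
    (\<forall>\<epsilon>>0. \<exists>\<delta>>0. \<forall>h\<in>carr E. x + h \<in> U \<and> nrm E h < \<delta> \<longrightarrow>
        nrm F (f (x + h) - f x - f' h) \<le> \<epsilon> * nrm E h)"

text \<open>For open \<open>U\<close> the values of the derivative on \<open>carr E\<close> are unique.\<close>

definition fderiv ::
  "('a::real_vector) nspace \<Rightarrow> ('b::real_vector) nspace \<Rightarrow> 'a set \<Rightarrow> ('a \<Rightarrow> 'b) \<Rightarrow> 'a \<Rightarrow> 'a \<Rightarrow> 'b"
  where "fderiv E F U f x = (SOME f'. has_fderiv E F U f f' x)"

text \<open>
  \<open>f\<close> is of class \<open>C\<^sup>\<infinity>\<close> in the Frechet sense: \<open>D k\<close> is the \<open>k\<close>-th derivative of \<open>f\<close>, a map from \<open>U\<close>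
  to the \<open>k\<close>-linear maps, and the derivative of \<open>D k\<close> with respect to the operator norm is
  \<open>D (Suc k)\<close> under the identification of \<open>L(E; L\<^sup>k(E; F))\<close> with \<open>L\<^sup>k\<^sup>+\<^sup>1(E; F)\<close>.
\<close>

definition smooth_map ::
  "('a::real_vector) nspace \<Rightarrow> ('b::real_vector) nspace \<Rightarrow> 'a set \<Rightarrow> ('a \<Rightarrow> 'b) \<Rightarrow> bool"
  where "smooth_map E F U f \<longleftrightarrow>
    (\<exists>D. (\<forall>x\<in>U. D 0 x [] = f x) \<and>
      (\<forall>k. \<forall>x\<in>U. D k x \<in> carr (multilin k E F) \<and>
        has_fderiv E (multilin k E F) U (D k) (\<lambda>h vs. D (Suc k) x (h # vs)) x))"

section \<open>The circle and its Sobolev spaces\<close>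

definition circle_rel :: "real \<Rightarrow> real \<Rightarrow> bool"
  where "circle_rel x y \<longleftrightarrow> x - y \<in> \<int>"

quotient_type circle = real / circle_rel
proof (rule equivpI)
  show "reflp circle_rel"
    by (simp add: reflp_def circle_rel_def)
  show "symp circle_rel"
    unfolding symp_def circle_rel_def by (metis Ints_minus minus_diff_eq)
  show "transp circle_rel"
    unfolding transp_def circle_rel_def by (metis Ints_add add_diff_eq diff_add_cancel)
qed

lift_definition cir :: "real \<Rightarrow> circle" is "\<lambda>x. x" .

instantiation circle :: ab_group_add
begin

lift_definition zero_circle :: circle is 0 .

lift_definition plus_circle :: "circle \<Rightarrow> circle \<Rightarrow> circle" is "(+)"
  unfolding circle_rel_def by (metis Ints_add add_diff_add)

lift_definition uminus_circle :: "circle \<Rightarrow> circle" is uminus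
  unfolding circle_rel_def by (metis Ints_minus minus_diff_minus)

lift_definition minus_circle :: "circle \<Rightarrow> circle \<Rightarrow> circle" is "(-)"
  unfolding circle_rel_def by (metis Ints_diff diff_diff_add diff_add_eq diff_diff_eq2 add.commute)

instance
  by standard (transfer; simp add: circle_rel_def)+

end

definition cderiv :: "(circle \<Rightarrow> real) \<Rightarrow> circle \<Rightarrow> real"
  where "cderiv u x = deriv (\<lambda>t. u (x + cir t)) 0"

definition cintegral :: "(circle \<Rightarrow> real) \<Rightarrow> real"
  where "cintegral u = integral {0..1} (\<lambda>t. u (cir t))"

definition fourier_coeff :: "(circle \<Rightarrow> real) \<Rightarrow> int \<Rightarrow> complex"
  where "fourier_coeff u k =
    integral {0..1} (\<lambda>t. complex_of_real (u (cir t)) * cis (- 2 * pi * of_int k * t))"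

text \<open>
  \<open>H\<^sup>r(S\<^sup>1)\<close> for \<open>r > 1/2\<close>.  In this range every class has exactly one continuous representative,
  and the space consists of these representatives.  The weight is the \<open>r\<close>-th power of the symbol
  of \<open>1 - \<partial>\<^sub>x\<^sup>2\<close> on \<open>\<real>/\<int>\<close>.
\<close>

definition sobolev_weight :: "real \<Rightarrow> (circle \<Rightarrow> real) \<Rightarrow> int \<Rightarrow> real"
  where "sobolev_weight r u k = (1 + (2 * pi * of_int k)\<^sup>2) powr r * (cmod (fourier_coeff u k))\<^sup>2"

definition Hs :: "real \<Rightarrow> (circle \<Rightarrow> real) nspace"
  where "Hs r =
    \<lparr>carr = {u. continuous_on UNIV (\<lambda>t. u (cir t)) \<and> sobolev_weight r u summable_on UNIV},
     nrm = (\<lambda>u. sqrt (infsum (sobolev_weight r u) UNIV))\<rparr>"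

section \<open>The manifold \<open>H\<^sup>sG\<close>\<close>

type_synonym gpoint = "(circle \<Rightarrow> circle) \<times> (circle \<Rightarrow> real)"
type_synonym gvec = "(circle \<Rightarrow> real) \<times> (circle \<Rightarrow> real)"

text \<open>
  A diffeomorphism \<open>\<phi>\<close> corresponds to a pair \<open>(a, h)\<close>, where \<open>a \<in> S\<^sup>1\<close>, \<open>h \<in> H\<^sup>s\<close>, \<open>h(0) = 0\<close> and
  \<open>h\<^sub>x > -1\<close>, by \<open>\<phi>(x) = x + a + h(x)\<close>.  Lifting \<open>a\<close> to \<open>\<alpha> \<in> \<real>\<close> and putting \<open>u = \<alpha> + h\<close>, the open set
  of all \<open>u \<in> H\<^sup>s\<close> with \<open>u\<^sub>x > -1\<close> covers \<open>H\<^sup>sDiff(S\<^sup>1)\<close> by the local diffeomorphism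
  \<open>u \<mapsto> id + u\<close>, whose fibres are the cosets of the integer constants.  The trivialization of the tangent
  bundle of \<open>S\<^sup>1 \<times> {h. h(0) = 0, h\<^sub>x > -1}\<close> is the one given by the coordinate \<open>u\<close>.
\<close>

definition diff_of :: "(circle \<Rightarrow> real) \<Rightarrow> circle \<Rightarrow> circle"
  where "diff_of u = (\<lambda>x. x + cir (u x))"

definition diff_dom :: "real \<Rightarrow> (circle \<Rightarrow> real) set"
  where "diff_dom s = {u \<in> carr (Hs s). \<forall>x. cderiv u x > -1}"

definition HsDiff :: "real \<Rightarrow> (circle \<Rightarrow> circle) set"
  where "HsDiff s = diff_of ` diff_dom s"

definition HsG :: "real \<Rightarrow> gpoint set"
  where "HsG s = HsDiff s \<times> carr (Hs (s - 1))"

definition HsE :: "real \<Rightarrow> gvec nspace"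
  where "HsE s = prod_ns (Hs s) (Hs (s - 1))"

definition G_cover :: "gvec \<Rightarrow> gpoint"
  where "G_cover = map_prod diff_of id"

definition G_dom :: "real \<Rightarrow> gvec set"
  where "G_dom s = diff_dom s \<times> carr (Hs (s - 1))"

definition smooth_G :: "real \<Rightarrow> ('b::real_vector) nspace \<Rightarrow> (gpoint \<Rightarrow> 'b) \<Rightarrow> bool"
  where "smooth_G s W F \<longleftrightarrow> smooth_map (HsE s) W (G_dom s) (F \<circ> G_cover)"

text \<open>
  \<open>D_G s W F p V\<close> is \<open>DF(p)\<cdot>V\<close> in the trivialization.  Any two preimages of \<open>p\<close> under the
  covering differ by an integer constant, so the choice of the preimage is irrelevant.
\<close>

definition D_G :: "real \<Rightarrow> ('b::real_vector) nspace \<Rightarrow> (gpoint \<Rightarrow> 'b) \<Rightarrow> gpoint \<Rightarrow> gvec \<Rightarrow> 'b"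
  where "D_G s W F p V =
    fderiv (HsE s) W (G_dom s) (F \<circ> G_cover) (inv_into (G_dom s) G_cover p) V"

text \<open>In the trivialization of the tangent bundle a vector field is a map into \<open>H\<^sup>s \<times> H\<^sup>s\<^sup>-\<^sup>1\<close>.\<close>

definition vector_field :: "real \<Rightarrow> (gpoint \<Rightarrow> gvec) \<Rightarrow> bool"
  where "vector_field s X \<longleftrightarrow> smooth_G s (HsE s) X"

section \<open>Christoffel map, connection and metric\<close>

definition A_op :: "(circle \<Rightarrow> real) \<Rightarrow> circle \<Rightarrow> real"
  where "A_op u = u - cderiv (cderiv u)"

text \<open>Inverse of \<open>A : H\<^sup>s \<rightarrow> H\<^sup>s\<^sup>-\<^sup>2\<close>; for \<open>s > 5/2\<close> the elements of \<open>H\<^sup>s\<close> are of class \<open>C\<^sup>2\<close>.\<close>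

definition A_inv :: "real \<Rightarrow> (circle \<Rightarrow> real) \<Rightarrow> circle \<Rightarrow> real"
  where "A_inv s = the_inv_into (carr (Hs s)) A_op"

definition christoffel0_id :: "real \<Rightarrow> (circle \<Rightarrow> real) \<Rightarrow> (circle \<Rightarrow> real) \<Rightarrow> circle \<Rightarrow> real"
  where "christoffel0_id s u v = - A_inv s (cderiv (u * v + (1/2) *\<^sub>R (cderiv u * cderiv v)))"

fun christoffel_id :: "real \<Rightarrow> gvec \<Rightarrow> gvec \<Rightarrow> gvec"
  where "christoffel_id s (u, \<rho>) (v, \<tau>) =
    (christoffel0_id s u v - (1/2) *\<^sub>R A_inv s (cderiv (\<rho> * \<tau>)),
     - ((1/2) *\<^sub>R (cderiv u * \<tau> + cderiv v * \<rho>)))"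

definition vcomp :: "gvec \<Rightarrow> (circle \<Rightarrow> circle) \<Rightarrow> gvec"
  where "vcomp X \<phi> = (fst X \<circ> \<phi>, snd X \<circ> \<phi>)"

text \<open>\<open>christoffel s p\<close> and \<open>metric2CH s p\<close> are bilinear maps on \<open>H\<^sup>s \<times> H\<^sup>s\<^sup>-\<^sup>1\<close>, extended by zero.\<close>

fun christoffel :: "real \<Rightarrow> gpoint \<Rightarrow> gvec \<Rightarrow> gvec \<Rightarrow> gvec"
  where "christoffel s (\<phi>, f) X Y =
    (if X \<in> carr (HsE s) \<and> Y \<in> carr (HsE s)
     then vcomp (christoffel_id s (vcomp X (inv \<phi>)) (vcomp Y (inv \<phi>))) \<phi>
     else 0)"

definition nabla :: "real \<Rightarrow> (gpoint \<Rightarrow> gvec) \<Rightarrow> (gpoint \<Rightarrow> gvec) \<Rightarrow> gpoint \<Rightarrow> gvec"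
  where "nabla s X Y p = D_G s (HsE s) Y p (X p) - christoffel s p (Y p) (X p)"

fun metric2CH_id :: "gvec \<Rightarrow> gvec \<Rightarrow> real"
  where "metric2CH_id (u, \<rho>) (v, \<tau>) =
    cintegral (u * v + cderiv u * cderiv v) + cintegral (\<rho> * \<tau>)"

fun metric2CH :: "real \<Rightarrow> gpoint \<Rightarrow> gvec \<Rightarrow> gvec \<Rightarrow> real"
  where "metric2CH s (\<phi>, f) X Y =
    (if X \<in> carr (HsE s) \<and> Y \<in> carr (HsE s)
     then metric2CH_id (vcomp X (inv \<phi>)) (vcomp Y (inv \<phi>))
     else 0)"

definition smooth_spray :: "real \<Rightarrow> (gpoint \<Rightarrow> gvec \<Rightarrow> gvec \<Rightarrow> gvec) \<Rightarrow> bool"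
  where "smooth_spray s G \<longleftrightarrow> smooth_G s (sym_bilin (HsE s) (HsE s)) G"

text \<open>
  In the trivialization, a section of the bundle of bounded symmetric bilinear forms is a map into
  \<open>L\<^sup>2\<^sub>s\<^sub>y\<^sub>m(H\<^sup>s \<times> H\<^sup>s\<^sup>-\<^sup>1; \<real>)\<close>.  The metric is weak: beyond
  boundedness, only positive definiteness is required, and the induced norm may be weaker than that of
  \<open>H\<^sup>s \<times> H\<^sup>s\<^sup>-\<^sup>1\<close>.
\<close>

definition smooth_weak_metric :: "real \<Rightarrow> (gpoint \<Rightarrow> gvec \<Rightarrow> gvec \<Rightarrow> real) \<Rightarrow> bool"
  where "smooth_weak_metric s g \<longleftrightarrow>
    smooth_G s (sym_bilin (HsE s) real_ns) g \<and>
    (\<forall>p\<in>HsG s. \<forall>V\<in>carr (HsE s). V \<noteq> 0 \<longrightarrow> g p V V > 0)"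

end

theory Submission
  imports Defs
begin

text \<open>
  Let \<open>\<phi> = id + u\<close>, \<open>b = \<phi>\<^sub>x\<close>, \<open>a = 1/b\<close>.  Conjugation by the composition with \<open>\<phi>\<close> turns \<open>\<partial>\<^sub>x\<close> into \<open>a \<partial>\<^sub>x\<close>, so no
  composition is left in the formulas: with \<open>Q = X\<^sub>1Y\<^sub>1 + X\<^sub>2Y\<^sub>2/2 + a\<^sup>2X\<^sub>1'Y\<^sub>1'/2\<close>, the first component \<open>\<Gamma>\<^sub>1\<close> of
  the Christoffel map solves \<open>b \<Gamma>\<^sub>1 - (a \<Gamma>\<^sub>1')' = - Q'\<close>, the second one is \<open>- a (X\<^sub>1'Y\<^sub>2 + Y\<^sub>1'X\<^sub>2)/2\<close>, and the metric
  is \<open>\<integral> b (X\<^sub>1Y\<^sub>1 + X\<^sub>2Y\<^sub>2) + a X\<^sub>1'Y\<^sub>1'\<close>.  Since \<open>H\<^sup>s\<^sup>-\<^sup>1\<close> is a Banach algebra, smoothness follows from the smoothness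
  of two inversions, \<open>b \<mapsto> 1/b\<close> and that of the operator \<open>w \<mapsto> b w - (a w')'\<close> from \<open>H\<^sup>s\<close> to \<open>H\<^sup>s\<^sup>-\<^sup>2\<close>; in both cases
  \<open>g(x + h) - g(x) = - g(x + h) (f(x + h) - f(x)) g(x)\<close>.  That the operator is invertible, and that \<open>A\<^sup>-\<^sup>1\<close> is
  applied to an element of \<open>H\<^sup>s\<^sup>-\<^sup>2\<close>, rests on the invariance of \<open>H\<^sup>r\<close>, \<open>1/2 < r \<le> s\<close>, under the composition with \<open>\<phi>\<close>
  and \<open>\<phi>\<^sup>-\<^sup>1\<close>.  For \<open>r \<le> 3/2\<close> it is obtained by interpolation between \<open>L\<^sup>2\<close> and \<open>H\<^sup>2\<close>, as \<open>\<phi>\<close> is of class \<open>C\<^sup>2\<close>; for larger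
  \<open>r\<close> by induction through the chain rule.  Compatibility is an integration by parts.
\<close>

section \<open>Normed spaces and bounded maps\<close>

text \<open>For fixed \<open>w\<close> in \<open>H\<^sup>r\<close>, differentiating \<phi> \<mapsto>
  \<open>w \<circ> \<phi>\<close> costs one derivative of \<open>w\<close>, so smoothness cannot be
  checked on the separate factors of the defining formula; only the conjugated operator depends
  smoothly on \<phi>. Boundedness of composition is therefore used for one \<phi> at a time, with no
  uniformity in \<phi>: it shows that the inverse operator exists and is bounded at each point, and
  the difference equation itself then yields the local bounds, continuity and all derivatives. The
  inverse of A is applied on order s - 2, which may be any number above 1/2. Below 3/2 the chain
  rule would lead to orders under 1/2, where neither continuous representatives nor the algebra
  property are at hand; this gap is what interpolation has to fill. Derivatives of all orders are
  kept in one function of a list of directions. Raising the order then needs a single level of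
  currying and no iterated spaces of operators.\<close>

definition normed_ns :: "('a::real_vector) nspace \<Rightarrow> bool"
  where "normed_ns E \<longleftrightarrow> 0 \<in> carr E \<and>
    (\<forall>x\<in>carr E. \<forall>y\<in>carr E. x + y \<in> carr E \<and> nrm E (x + y) \<le> nrm E x + nrm E y) \<and>
    (\<forall>c. \<forall>x\<in>carr E. c *\<^sub>R x \<in> carr E \<and> nrm E (c *\<^sub>R x) = \<bar>c\<bar> * nrm E x) \<and>
    (\<forall>x\<in>carr E. nrm E x = 0 \<longrightarrow> x = 0)"

lemma ns_zero: "normed_ns E \<Longrightarrow> 0 \<in> carr E"
  and ns_add: "normed_ns E \<Longrightarrow> x \<in> carr E \<Longrightarrow> y \<in> carr E \<Longrightarrow> x + y \<in> carr E"
  and ns_scale: "normed_ns E \<Longrightarrow> x \<in> carr E \<Longrightarrow> c *\<^sub>R x \<in> carr E"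
  and nrm_triangle: "normed_ns E \<Longrightarrow> x \<in> carr E \<Longrightarrow> y \<in> carr E \<Longrightarrow> nrm E (x + y) \<le> nrm E x + nrm E y"
  and nrm_scale: "normed_ns E \<Longrightarrow> x \<in> carr E \<Longrightarrow> nrm E (c *\<^sub>R x) = \<bar>c\<bar> * nrm E x"
  and nrm_eq0: "normed_ns E \<Longrightarrow> x \<in> carr E \<Longrightarrow> nrm E x = 0 \<Longrightarrow> x = 0"
  by (auto simp: normed_ns_def)

lemma ns_uminus: "normed_ns E \<Longrightarrow> x \<in> carr E \<Longrightarrow> - x \<in> carr E"
  using ns_scale[of E x "-1"] by simp

lemma ns_diff: "normed_ns E \<Longrightarrow> x \<in> carr E \<Longrightarrow> y \<in> carr E \<Longrightarrow> x - y \<in> carr E"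
  using ns_add[of E x "- y"] ns_uminus[of E y] by simp

lemma nrm_zero [simp]: "normed_ns E \<Longrightarrow> nrm E 0 = 0"
  using nrm_scale[of E 0 0] ns_zero[of E] by simp

lemma nrm_uminus: "normed_ns E \<Longrightarrow> x \<in> carr E \<Longrightarrow> nrm E (- x) = nrm E x"
  using nrm_scale[of E x "-1"] by simp

lemma nrm_ge0: "normed_ns E \<Longrightarrow> x \<in> carr E \<Longrightarrow> 0 \<le> nrm E x"
  using nrm_triangle[of E x "- x"] nrm_uminus[of E x] ns_uminus[of E x] by simp

lemma nrm_diff: "normed_ns E \<Longrightarrow> x \<in> carr E \<Longrightarrow> y \<in> carr E \<Longrightarrow> nrm E (x - y) \<le> nrm E x + nrm E y"
  using nrm_triangle[of E x "- y"] nrm_uminus[of E y] ns_uminus[of E y] by simp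

lemma normed_nsI:
  assumes "0 \<in> carr E"
    and "\<And>x y. x \<in> carr E \<Longrightarrow> y \<in> carr E \<Longrightarrow> x + y \<in> carr E"
    and "\<And>x y. x \<in> carr E \<Longrightarrow> y \<in> carr E \<Longrightarrow> nrm E (x + y) \<le> nrm E x + nrm E y"
    and "\<And>c x. x \<in> carr E \<Longrightarrow> c *\<^sub>R x \<in> carr E"
    and "\<And>c x. x \<in> carr E \<Longrightarrow> nrm E (c *\<^sub>R x) = \<bar>c\<bar> * nrm E x"
    and "\<And>x. x \<in> carr E \<Longrightarrow> nrm E x = 0 \<Longrightarrow> x = 0"
  shows "normed_ns E"
  unfolding normed_ns_def by (intro conjI ballI allI impI assms)

lemma lin_onD:
  assumes "lin_on E F T"
  shows "x \<in> carr E \<Longrightarrow> T x \<in> carr F"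
    and "x \<in> carr E \<Longrightarrow> y \<in> carr E \<Longrightarrow> T (x + y) = T x + T y"
    and "x \<in> carr E \<Longrightarrow> T (c *\<^sub>R x) = c *\<^sub>R T x"
  using assms by (auto simp: lin_on_def)

lemma lin_on_comb:
  assumes "lin_on E F T" "normed_ns E" "x \<in> carr E" "y \<in> carr E"
  shows "T (a *\<^sub>R x + b *\<^sub>R y) = a *\<^sub>R T x + b *\<^sub>R T y"
  using assms by (simp add: lin_onD ns_scale)

lemma lin_on_combI:
  assumes "\<And>x. x \<in> carr E \<Longrightarrow> T x \<in> carr F"
    and "\<And>a b x y. x \<in> carr E \<Longrightarrow> y \<in> carr E \<Longrightarrow> T (a *\<^sub>R x + b *\<^sub>R y) = a *\<^sub>R T x + b *\<^sub>R T y"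
  shows "lin_on E F T"
  unfolding lin_on_def
proof (intro conjI ballI allI)
  fix x y c assume "x \<in> carr E" "y \<in> carr E"
  then show "T (x + y) = T x + T y" using assms(2)[of x y 1 1] by simp
next
  fix c x assume "x \<in> carr E"
  then show "T (c *\<^sub>R x) = c *\<^sub>R T x" using assms(2)[of x x c 0] by simp
qed (use assms(1) in auto)

lemma lin_on_diff:
  assumes "lin_on E F T" "normed_ns E" "x \<in> carr E" "y \<in> carr E"
  shows "T (x - y) = T x - T y"
  using lin_on_comb[OF assms, of 1 "-1"] by simp

lemma lin_on_zero: "lin_on E F T \<Longrightarrow> normed_ns E \<Longrightarrow> T 0 = 0"
  using lin_onD(3)[of E F T 0 0] ns_zero[of E] by simp

definition bdd_lin :: "('a::real_vector) nspace \<Rightarrow> ('b::real_vector) nspace \<Rightarrow> ('a \<Rightarrow> 'b) \<Rightarrow> bool"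
  where "bdd_lin E F T \<longleftrightarrow> lin_on E F T \<and> (\<exists>C\<ge>0. \<forall>x\<in>carr E. nrm F (T x) \<le> C * nrm E x)"

lemma bdd_linI:
  assumes "lin_on E F T" "normed_ns E" "\<And>x. x \<in> carr E \<Longrightarrow> nrm F (T x) \<le> C * nrm E x"
  shows "bdd_lin E F T"
  unfolding bdd_lin_def
proof (intro conjI exI[of _ "max C 0"] ballI)
  fix x assume x: "x \<in> carr E"
  have "C * nrm E x \<le> max C 0 * nrm E x"
    by (intro mult_right_mono) (use nrm_ge0[OF assms(2) x] in auto)
  then show "nrm F (T x) \<le> max C 0 * nrm E x" using assms(3)[OF x] by linarith
qed (use assms(1) in auto)

definition bdd_bil :: "('a::real_vector) nspace \<Rightarrow> ('b::real_vector) nspace \<Rightarrow> ('c::real_vector) nspace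
    \<Rightarrow> ('a \<Rightarrow> 'b \<Rightarrow> 'c) \<Rightarrow> bool"
  where "bdd_bil E F G B \<longleftrightarrow> (\<forall>x\<in>carr E. lin_on F G (B x)) \<and> (\<forall>y\<in>carr F. lin_on E G (\<lambda>x. B x y)) \<and>
    (\<exists>C\<ge>0. \<forall>x\<in>carr E. \<forall>y\<in>carr F. nrm G (B x y) \<le> C * nrm E x * nrm F y)"

lemma bdd_bil_flip:
  assumes "bdd_bil E F G B"
  shows "bdd_bil F E G (\<lambda>y x. B x y)"
proof -
  obtain C where "C \<ge> 0" "\<forall>x\<in>carr E. \<forall>y\<in>carr F. nrm G (B x y) \<le> C * nrm E x * nrm F y"
    using assms unfolding bdd_bil_def by blast
  then have "\<exists>C\<ge>0. \<forall>y\<in>carr F. \<forall>x\<in>carr E. nrm G (B x y) \<le> C * nrm F y * nrm E x"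
    by (intro exI[of _ C]) (simp add: ac_simps)
  then show ?thesis using assms unfolding bdd_bil_def by simp
qed

lemma bdd_bilI:
  assumes "normed_ns E" "normed_ns F"
    and "\<And>x y. x \<in> carr E \<Longrightarrow> y \<in> carr F \<Longrightarrow> B x y \<in> carr G"
    and "\<And>a b x x' y. x \<in> carr E \<Longrightarrow> x' \<in> carr E \<Longrightarrow> y \<in> carr F \<Longrightarrow>
      B (a *\<^sub>R x + b *\<^sub>R x') y = a *\<^sub>R B x y + b *\<^sub>R B x' y"
    and "\<And>a b x y y'. x \<in> carr E \<Longrightarrow> y \<in> carr F \<Longrightarrow> y' \<in> carr F \<Longrightarrow>
      B x (a *\<^sub>R y + b *\<^sub>R y') = a *\<^sub>R B x y + b *\<^sub>R B x y'"
    and "\<And>x y. x \<in> carr E \<Longrightarrow> y \<in> carr F \<Longrightarrow> nrm G (B x y) \<le> C * nrm E x * nrm F y"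
  shows "bdd_bil E F G B"
  unfolding bdd_bil_def
proof (intro conjI ballI)
  show "\<exists>C\<ge>0. \<forall>x\<in>carr E. \<forall>y\<in>carr F. nrm G (B x y) \<le> C * nrm E x * nrm F y"
  proof (intro exI[of _ "max C 0"] conjI ballI)
    fix x y assume xy: "x \<in> carr E" "y \<in> carr F"
    have "C * nrm E x * nrm F y \<le> max C 0 * nrm E x * nrm F y"
      by (intro mult_right_mono) (use nrm_ge0[OF assms(1) xy(1)] nrm_ge0[OF assms(2) xy(2)] in auto)
    then show "nrm G (B x y) \<le> max C 0 * nrm E x * nrm F y" using assms(6)[OF xy] by linarith
  qed simp
qed (auto intro!: lin_on_combI assms)

lemma bdd_bilD:
  assumes "bdd_bil E F G B"
  shows "x \<in> carr E \<Longrightarrow> y \<in> carr F \<Longrightarrow> B x y \<in> carr G"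
    and "normed_ns E \<Longrightarrow> x \<in> carr E \<Longrightarrow> x' \<in> carr E \<Longrightarrow> y \<in> carr F \<Longrightarrow>
      B (a *\<^sub>R x + b *\<^sub>R x') y = a *\<^sub>R B x y + b *\<^sub>R B x' y"
    and "normed_ns F \<Longrightarrow> x \<in> carr E \<Longrightarrow> y \<in> carr F \<Longrightarrow> y' \<in> carr F \<Longrightarrow>
      B x (a *\<^sub>R y + b *\<^sub>R y') = a *\<^sub>R B x y + b *\<^sub>R B x y'"
proof -
  show "x \<in> carr E \<Longrightarrow> y \<in> carr F \<Longrightarrow> B x y \<in> carr G"
    using assms lin_onD(1) unfolding bdd_bil_def by blast
  show "normed_ns E \<Longrightarrow> x \<in> carr E \<Longrightarrow> x' \<in> carr E \<Longrightarrow> y \<in> carr F \<Longrightarrow>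
      B (a *\<^sub>R x + b *\<^sub>R x') y = a *\<^sub>R B x y + b *\<^sub>R B x' y"
    using assms lin_on_comb[of E G "\<lambda>x. B x y"] unfolding bdd_bil_def by blast
  show "normed_ns F \<Longrightarrow> x \<in> carr E \<Longrightarrow> y \<in> carr F \<Longrightarrow> y' \<in> carr F \<Longrightarrow>
      B x (a *\<^sub>R y + b *\<^sub>R y') = a *\<^sub>R B x y + b *\<^sub>R B x y'"
    using assms lin_on_comb[of F G "B x"] unfolding bdd_bil_def by blast
qed

lemma bdd_bil_bound:
  assumes "bdd_bil E F G B"
  obtains C where "C \<ge> 0" "\<And>x y. x \<in> carr E \<Longrightarrow> y \<in> carr F \<Longrightarrow> nrm G (B x y) \<le> C * nrm E x * nrm F y"
  using assms unfolding bdd_bil_def by blast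

section \<open>Products of multilinear families\<close>

abbreviation pnrm :: "'a nspace \<Rightarrow> 'a list \<Rightarrow> real"
  where "pnrm E vs \<equiv> prod_list (map (nrm E) vs)"

lemma pnrm_ge0: "normed_ns E \<Longrightarrow> set vs \<subseteq> carr E \<Longrightarrow> 0 \<le> pnrm E vs"
  by (induction vs) (auto simp: nrm_ge0)

text \<open>
  A family \<open>p\<close> of multilinear maps of all degrees up to \<open>n\<close>, the degree being the length of the
  argument list.
\<close>

definition bnd :: "nat \<Rightarrow> 'a nspace \<Rightarrow> 'b nspace \<Rightarrow> real \<Rightarrow> ('a list \<Rightarrow> 'b) \<Rightarrow> bool"
  where "bnd n E F C p \<longleftrightarrow> (\<forall>vs. set vs \<subseteq> carr E \<longrightarrow> length vs \<le> n \<longrightarrow> p vs \<in> carr F \<and> nrm F (p vs) \<le> C * pnrm E vs)"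

text \<open>All orders up to \<open>n\<close> share one constant, since a jet is estimated in all
  orders at once. The slot is given by splitting the list, which fits recursion on its head;
  \<open>length xs + length ys < n\<close> leaves room for the inserted \<open>v\<close>.\<close>

definition mlin :: "nat \<Rightarrow> ('a::real_vector) nspace \<Rightarrow> ('b::real_vector) nspace \<Rightarrow> ('a list \<Rightarrow> 'b) \<Rightarrow> bool"
  where "mlin n E F p \<longleftrightarrow> (\<exists>C\<ge>0. bnd n E F C p) \<and>
    (\<forall>xs ys. set xs \<subseteq> carr E \<longrightarrow> set ys \<subseteq> carr E \<longrightarrow> length xs + length ys < n \<longrightarrow> lin_on E F (\<lambda>v. p (xs @ v # ys)))"

lemma bndD:
  assumes "bnd n E F C p" "set vs \<subseteq> carr E" "length vs \<le> n"
  shows "p vs \<in> carr F" "nrm F (p vs) \<le> C * pnrm E vs"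
  using assms by (auto simp: bnd_def)

lemma mlin_carr: "mlin n E F p \<Longrightarrow> set vs \<subseteq> carr E \<Longrightarrow> length vs \<le> n \<Longrightarrow> p vs \<in> carr F"
  by (auto simp: mlin_def bnd_def)

lemma bnd_mono: "bnd n E F C p \<Longrightarrow> m \<le> n \<Longrightarrow> bnd m E F C p"
  by (auto simp: bnd_def)

lemma bnd_le: "bnd n E F C p \<Longrightarrow> normed_ns E \<Longrightarrow> C \<le> C' \<Longrightarrow> bnd n E F C' p"
  unfolding bnd_def using mult_right_mono[OF _ pnrm_ge0] order_trans by blast

lemma mlin_mono: "mlin n E F p \<Longrightarrow> m \<le> n \<Longrightarrow> mlin m E F p"
  unfolding mlin_def by (meson bnd_mono order_less_le_trans)

lemma bnd_shift:
  assumes "bnd (Suc n) E F C p" "v \<in> carr E"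
  shows "bnd n E F (C * nrm E v) (\<lambda>a. p (v # a))"
  unfolding bnd_def using bndD[OF assms(1), of "v # _"] assms(2) by (simp add: mult.assoc)

lemma bnd_add:
  assumes "normed_ns F" "bnd n E F C p" "bnd n E F C' q"
  shows "bnd n E F (C + C') (\<lambda>a. p a + q a)"
  unfolding bnd_def
proof (intro allI impI conjI)
  fix vs assume vs: "set vs \<subseteq> carr E" "length vs \<le> n"
  note p = bndD[OF assms(2) vs] and q = bndD[OF assms(3) vs]
  show "p vs + q vs \<in> carr F" using p q assms(1) by (simp add: ns_add)
  show "nrm F (p vs + q vs) \<le> (C + C') * pnrm E vs"
    using nrm_triangle[OF assms(1) p(1) q(1)] p(2) q(2) by (simp add: algebra_simps)
qed

text \<open>The iterated product rule: each direction differentiates one of the two factors, so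
  unfolding gives \<open>2 ^ length vs\<close> terms, and in each of them the directions keep their
  order.\<close>

primrec leib :: "('b \<Rightarrow> 'c \<Rightarrow> 'd::plus) \<Rightarrow> ('a list \<Rightarrow> 'b) \<Rightarrow> ('a list \<Rightarrow> 'c) \<Rightarrow> 'a list \<Rightarrow> 'd"
  where
    "leib B p q [] = B (p []) (q [])"
  | "leib B p q (v # vs) = leib B (\<lambda>a. p (v # a)) q vs + leib B p (\<lambda>a. q (v # a)) vs"

lemma leib_flip: "leib B p q vs = leib (\<lambda>y x. B x y) q p (vs :: 'a list)" for B :: "'b \<Rightarrow> 'c \<Rightarrow> 'd::ab_semigroup_add"
  by (induction vs arbitrary: p q) (auto simp: add.commute)

lemma leib_cong:
  assumes "set vs \<subseteq> S"
    and "\<And>a. set a \<subseteq> S \<Longrightarrow> length a \<le> length vs \<Longrightarrow> p a = p' a"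
    and "\<And>a. set a \<subseteq> S \<Longrightarrow> length a \<le> length vs \<Longrightarrow> q a = q' a"
  shows "leib B p q vs = leib B p' q' vs"
  using assms
proof (induction vs arbitrary: p q p' q')
  case (Cons v vs)
  have "leib B (\<lambda>a. p (v # a)) q vs = leib B (\<lambda>a. p' (v # a)) q' vs"
    by (rule Cons.IH) (use Cons.prems in simp_all)
  moreover have "leib B p (\<lambda>a. q (v # a)) vs = leib B p' (\<lambda>a. q' (v # a)) vs"
    by (rule Cons.IH) (use Cons.prems in simp_all)
  ultimately show ?case by simp
qed simp

lemma leib_comb_left:
  assumes "bdd_bil F G H B" "normed_ns F" "set vs \<subseteq> carr E"
    and "\<And>a. set a \<subseteq> carr E \<Longrightarrow> length a \<le> length vs \<Longrightarrow> p a \<in> carr F \<and> p' a \<in> carr F \<and> q a \<in> carr G"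
    and "\<And>a. set a \<subseteq> carr E \<Longrightarrow> length a \<le> length vs \<Longrightarrow> r a = c *\<^sub>R p a + c' *\<^sub>R p' a"
  shows "leib B r q vs = c *\<^sub>R leib B p q vs + c' *\<^sub>R leib B p' q vs"
  using assms(3-)
proof (induction vs arbitrary: p q p' r)
  case Nil
  then show ?case using bdd_bilD(2)[OF assms(1,2)] by simp
next
  case (Cons v vs)
  have "leib B (\<lambda>a. r (v # a)) q vs = c *\<^sub>R leib B (\<lambda>a. p (v # a)) q vs + c' *\<^sub>R leib B (\<lambda>a. p' (v # a)) q vs"
    by (rule Cons.IH) (use Cons.prems in simp_all)
  moreover have "leib B r (\<lambda>a. q (v # a)) vs = c *\<^sub>R leib B p (\<lambda>a. q (v # a)) vs + c' *\<^sub>R leib B p' (\<lambda>a. q (v # a)) vs"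
    by (rule Cons.IH) (use Cons.prems in simp_all)
  ultimately show ?case by (simp add: algebra_simps)
qed

lemma leib_comb_right:
  assumes "bdd_bil F G H B" "normed_ns G" "set vs \<subseteq> carr E"
    and "\<And>a. set a \<subseteq> carr E \<Longrightarrow> length a \<le> length vs \<Longrightarrow> q a \<in> carr G \<and> q' a \<in> carr G \<and> p a \<in> carr F"
    and "\<And>a. set a \<subseteq> carr E \<Longrightarrow> length a \<le> length vs \<Longrightarrow> r a = c *\<^sub>R q a + c' *\<^sub>R q' a"
  shows "leib B p r vs = c *\<^sub>R leib B p q vs + c' *\<^sub>R leib B p q' vs"
  using leib_comb_left[OF bdd_bil_flip[OF assms(1)] assms(2-)] by (simp add: leib_flip[of B])

lemma leib_bound:
  assumes "bdd_bil F G H B" "normed_ns E" "normed_ns F" "normed_ns G" "normed_ns H" "K \<ge> 0"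
    and K: "\<And>x y. x \<in> carr F \<Longrightarrow> y \<in> carr G \<Longrightarrow> nrm H (B x y) \<le> K * nrm F x * nrm G y"
    and "set vs \<subseteq> carr E" "bnd (length vs) E F C p" "bnd (length vs) E G C' q" "C \<ge> 0" "C' \<ge> 0"
  shows "leib B p q vs \<in> carr H \<and> nrm H (leib B p q vs) \<le> 2 ^ length vs * K * C * C' * pnrm E vs"
  using assms(8-)
proof (induction vs arbitrary: p q C C')
  case Nil
  have p: "p [] \<in> carr F" "nrm F (p []) \<le> C" and q: "q [] \<in> carr G" "nrm G (q []) \<le> C'"
    using Nil by (auto simp: bnd_def)
  have "nrm H (B (p []) (q [])) \<le> K * nrm F (p []) * nrm G (q [])" by (rule K[OF p(1) q(1)])
  also have "\<dots> \<le> K * C * C'"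
    using p q Nil assms(6) nrm_ge0[OF assms(3) p(1)] nrm_ge0[OF assms(4) q(1)] by (intro mult_mono) auto
  finally show ?case using bdd_bilD(1)[OF assms(1) p(1) q(1)] by simp
next
  case (Cons v vs)
  have v: "v \<in> carr E" using Cons.prems by simp
  with nrm_ge0[OF assms(2)] have v0: "0 \<le> nrm E v" by blast
  have 1: "leib B (\<lambda>a. p (v # a)) q vs \<in> carr H \<and>
    nrm H (leib B (\<lambda>a. p (v # a)) q vs) \<le> 2 ^ length vs * K * (C * nrm E v) * C' * pnrm E vs"
    by (rule Cons.IH) (use Cons.prems v v0 bnd_mono[of "Suc (length vs)" E F C p] bnd_mono[of "Suc (length vs)" E G C' q] bnd_shift[of "length vs" E F C p] bnd_shift[of "length vs" E G C' q] in simp_all)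
  have 2: "leib B p (\<lambda>a. q (v # a)) vs \<in> carr H \<and>
    nrm H (leib B p (\<lambda>a. q (v # a)) vs) \<le> 2 ^ length vs * K * C * (C' * nrm E v) * pnrm E vs"
    by (rule Cons.IH) (use Cons.prems v v0 bnd_mono[of "Suc (length vs)" E F C p] bnd_mono[of "Suc (length vs)" E G C' q] bnd_shift[of "length vs" E F C p] bnd_shift[of "length vs" E G C' q] in simp_all)
  from 1 2 show ?case
    using nrm_triangle[OF assms(5), of "leib B (\<lambda>a. p (v # a)) q vs" "leib B p (\<lambda>a. q (v # a)) vs"]
    by (auto intro!: ns_add assms simp: algebra_simps)
qed

lemma mlin_slot: "mlin n E F p \<Longrightarrow> set xs \<subseteq> carr E \<Longrightarrow> set ys \<subseteq> carr E \<Longrightarrow> length xs + length ys < n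
   \<Longrightarrow> lin_on E F (\<lambda>v. p (xs @ v # ys))"
  by (auto simp: mlin_def)

lemma mlin_shift:
  assumes "mlin (Suc n) E F p" "v \<in> carr E" "normed_ns E"
  shows "mlin n E F (\<lambda>a. p (v # a))"
  unfolding mlin_def
proof (intro conjI allI impI)
  show "\<exists>C\<ge>0. bnd n E F C (\<lambda>a. p (v # a))"
  proof -
    obtain C where "C \<ge> 0" "bnd (Suc n) E F C p" using assms(1) by (auto simp: mlin_def)
    then show ?thesis
      using bnd_shift[OF _ assms(2)] nrm_ge0[OF assms(3,2)] by (intro exI[of _ "C * nrm E v"]) auto
  qed
next
  fix xs ys assume "set xs \<subseteq> carr E" "set ys \<subseteq> carr E" "length xs + length ys < n"
  then show "lin_on E F (\<lambda>w. p (v # xs @ w # ys))"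
    using mlin_slot[OF assms(1), of "v # xs" ys] assms(2) by simp
qed

lemma leib_bnd:
  assumes B: "bdd_bil F G H B" and ns: "normed_ns E" "normed_ns F" "normed_ns G" "normed_ns H" and K: "K \<ge> 0"
    "\<And>x y. x \<in> carr F \<Longrightarrow> y \<in> carr G \<Longrightarrow> nrm H (B x y) \<le> K * nrm F x * nrm G y"
    and C: "bnd n E F C p" "bnd n E G C' q" "C \<ge> 0" "C' \<ge> 0"
  shows "bnd n E H (2 ^ n * K * C * C') (leib B p q)"
  unfolding bnd_def
proof (intro allI impI)
  fix vs assume vs: "set vs \<subseteq> carr E" "length vs \<le> n"
  have *: "leib B p q vs \<in> carr H \<and> nrm H (leib B p q vs) \<le> 2 ^ length vs * K * C * C' * pnrm E vs"
    by (rule leib_bound[OF B ns K vs(1)]) (use C vs bnd_mono in blast)+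
  have "2 ^ length vs * K * C * C' * pnrm E vs \<le> 2 ^ n * K * C * C' * pnrm E vs"
    using vs K C pnrm_ge0[OF ns(1) vs(1)] by (intro mult_right_mono) auto
  with * show "leib B p q vs \<in> carr H \<and> nrm H (leib B p q vs) \<le> 2 ^ n * K * C * C' * pnrm E vs"
    by auto
qed

lemma leib_mlin:
  assumes B: "bdd_bil F G H B" and ns: "normed_ns E" "normed_ns F" "normed_ns G" "normed_ns H"
    and p: "mlin n E F p" and q: "mlin n E G q"
  shows "mlin n E H (leib B p q)"
proof -
  obtain K where K: "K \<ge> 0" "\<And>x y. x \<in> carr F \<Longrightarrow> y \<in> carr G \<Longrightarrow> nrm H (B x y) \<le> K * nrm F x * nrm G y"
    using bdd_bil_bound[OF B] by blast
  obtain C C' where C: "C \<ge> 0" "bnd n E F C p" "C' \<ge> 0" "bnd n E G C' q"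
    using p q by (auto simp: mlin_def)
  have "bnd n E H (2 ^ n * K * C * C') (leib B p q)"
    by (rule leib_bnd[OF B ns K]) (use C in auto)
  moreover have "lin_on E H (\<lambda>v. leib B p q (xs @ v # ys))"
    if "set xs \<subseteq> carr E" "set ys \<subseteq> carr E" "length xs + length ys < n" for xs ys
    using that(1) that(2,3) p q
  \<comment> \<open>The arguments in front of the slot are distributed one at a time, each lowering
    the order by one. Once the slot is at the head, linearity of the two factors enters.\<close>
  proof (induction xs arbitrary: p q n)
    case Nil
    have car: "leib B p q (v # ys) \<in> carr H" if v: "v \<in> carr E" for v
    proof -
      obtain C C' where C: "C \<ge> 0" "bnd n E F C p" "C' \<ge> 0" "bnd n E G C' q"
        using Nil.prems by (auto simp: mlin_def)
      have "leib B p q (v # ys) \<in> carr H \<and> nrm H (leib B p q (v # ys)) \<le> 2 ^ length (v # ys) * K * C * C' * pnrm E (v # ys)"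
        by (rule leib_bound[OF B ns K]) (use C Nil.prems v in \<open>auto intro: bnd_mono\<close>)
      then show ?thesis ..
    qed
    show ?case
    proof (rule lin_on_combI)
      fix v assume "v \<in> carr E"
      then show "leib B p q ([] @ v # ys) \<in> carr H" using car by simp
    next
      fix a b x y assume xy: "x \<in> carr E" "y \<in> carr E"
      have sl: "\<And>zs. set zs \<subseteq> carr E \<Longrightarrow> length zs \<le> length ys \<Longrightarrow> lin_on E F (\<lambda>v. p (v # zs)) \<and> lin_on E G (\<lambda>v. q (v # zs))"
        using mlin_slot[OF Nil.prems(4), of "[]"] mlin_slot[OF Nil.prems(5), of "[]"] Nil.prems(3) by auto
      have pc: "\<And>zs. set zs \<subseteq> carr E \<Longrightarrow> length zs \<le> Suc (length ys) \<Longrightarrow> p zs \<in> carr F \<and> q zs \<in> carr G"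
        using mlin_carr[OF Nil.prems(4)] mlin_carr[OF Nil.prems(5)] Nil.prems(3) by auto
      have cm: "p ((a *\<^sub>R x + b *\<^sub>R y) # zs) = a *\<^sub>R p (x # zs) + b *\<^sub>R p (y # zs)"
          "q ((a *\<^sub>R x + b *\<^sub>R y) # zs) = a *\<^sub>R q (x # zs) + b *\<^sub>R q (y # zs)"
        if "set zs \<subseteq> carr E" "length zs \<le> length ys" for zs
        using lin_on_comb[OF conjunct1[OF sl[OF that]] ns(1) xy] lin_on_comb[OF conjunct2[OF sl[OF that]] ns(1) xy] by auto
      have 1: "leib B (\<lambda>zs. p ((a *\<^sub>R x + b *\<^sub>R y) # zs)) q ys = a *\<^sub>R leib B (\<lambda>zs. p (x # zs)) q ys + b *\<^sub>R leib B (\<lambda>zs. p (y # zs)) q ys"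
        by (rule leib_comb_left[OF B ns(2), of _ E])
           (use Nil.prems xy pc cm in simp_all)
      have 2: "leib B p (\<lambda>zs. q ((a *\<^sub>R x + b *\<^sub>R y) # zs)) ys = a *\<^sub>R leib B p (\<lambda>zs. q (x # zs)) ys + b *\<^sub>R leib B p (\<lambda>zs. q (y # zs)) ys"
        by (rule leib_comb_right[OF B ns(3), of _ E])
           (use Nil.prems xy pc cm in simp_all)
      show "leib B p q ([] @ (a *\<^sub>R x + b *\<^sub>R y) # ys) = a *\<^sub>R leib B p q ([] @ x # ys) + b *\<^sub>R leib B p q ([] @ y # ys)"
        using 1 2 by (simp add: algebra_simps)
    qed
  next
    case (Cons x xs)
    then obtain m where m: "n = Suc m" by (cases n) auto
    have x: "x \<in> carr E" using Cons.prems by simp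
    have 1: "lin_on E H (\<lambda>v. leib B (\<lambda>a. p (x # a)) q (xs @ v # ys))"
      by (rule Cons.IH[of m]) (use Cons.prems m x mlin_shift[OF _ x ns(1), of m F p] mlin_shift[OF _ x ns(1), of m G q] mlin_mono[of n E F p] mlin_mono[of n E G q] in auto)
    have 2: "lin_on E H (\<lambda>v. leib B p (\<lambda>a. q (x # a)) (xs @ v # ys))"
      by (rule Cons.IH[of m]) (use Cons.prems m x mlin_shift[OF _ x ns(1), of m F p] mlin_shift[OF _ x ns(1), of m G q] mlin_mono[of n E F p] mlin_mono[of n E G q] in auto)
    show ?case using 1 2 ns(4) unfolding lin_on_def by (simp add: ns_add scaleR_add_right)
  qed
  ultimately show ?thesis unfolding mlin_def using K C by (auto intro!: exI[of _ "2 ^ n * K * C * C'"])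
qed

section \<open>Jets of smooth maps\<close>

text \<open>
  \<open>d x vs\<close> is the derivative of order \<open>length vs\<close> at \<open>x\<close> in the directions \<open>vs\<close>; the most recent
  differentiation is at the head of the list.
\<close>

definition jetn :: "nat \<Rightarrow> ('a::real_vector) nspace \<Rightarrow> ('b::real_vector) nspace \<Rightarrow> 'a set \<Rightarrow> ('a \<Rightarrow> 'a list \<Rightarrow> 'b) \<Rightarrow> bool"
  where "jetn n E F U d \<longleftrightarrow> (\<forall>x\<in>U. mlin n E F (d x)) \<and>
    (\<forall>m x. n = Suc m \<longrightarrow> x \<in> U \<longrightarrow> (\<forall>\<epsilon>>0. \<exists>\<delta>>0. \<forall>h\<in>carr E. x + h \<in> U \<longrightarrow> nrm E h < \<delta> \<longrightarrow>
      bnd m E F (\<epsilon> * nrm E h) (\<lambda>vs. d (x + h) vs - d x vs - d x (h # vs))))"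

definition jet :: "('a::real_vector) nspace \<Rightarrow> ('b::real_vector) nspace \<Rightarrow> 'a set \<Rightarrow> ('a \<Rightarrow> 'a list \<Rightarrow> 'b) \<Rightarrow> bool"
  where "jet E F U d \<longleftrightarrow> (\<forall>n. jetn n E F U d)"

lemma jetn_mlin: "jetn n E F U d \<Longrightarrow> x \<in> U \<Longrightarrow> mlin n E F (d x)"
  by (auto simp: jetn_def)

lemma jetn_diff:
  assumes "jetn (Suc m) E F U d" "x \<in> U" "\<epsilon> > 0"
  obtains \<delta> where "\<delta> > 0" "\<And>h. h \<in> carr E \<Longrightarrow> x + h \<in> U \<Longrightarrow> nrm E h < \<delta> \<Longrightarrow>
      bnd m E F (\<epsilon> * nrm E h) (\<lambda>vs. d (x + h) vs - d x vs - d x (h # vs))"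
  using assms unfolding jetn_def by blast

lemma jetnI:
  assumes "\<And>x. x \<in> U \<Longrightarrow> mlin n E F (d x)"
    and "\<And>m x \<epsilon>. n = Suc m \<Longrightarrow> x \<in> U \<Longrightarrow> \<epsilon> > 0 \<Longrightarrow> \<exists>\<delta>>0. \<forall>h\<in>carr E. x + h \<in> U \<longrightarrow> nrm E h < \<delta> \<longrightarrow>
      bnd m E F (\<epsilon> * nrm E h) (\<lambda>vs. d (x + h) vs - d x vs - d x (h # vs))"
  shows "jetn n E F U d"
  using assms unfolding jetn_def by blast

text \<open>With first order remainders \<open>Rp\<close>, \<open>Rq\<close> and differentials
  \<open>Dp\<close>, \<open>Dq\<close>, the remainder of a product is B(Rp, q(x+h)) + B(Dp, q(x+h) -
  q(x)) + B(p(x), Rq). Two terms contain a remainder and the middle one is quadratic in the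
  increment. The same algebra holds with \<open>leib B\<close> in place of B.\<close>

lemma jetn_leib:
  assumes B: "bdd_bil F G H B" and ns: "normed_ns E" "normed_ns F" "normed_ns G" "normed_ns H"
    and p: "jetn n E F U p" and q: "jetn n E G U q"
  shows "jetn n E H U (\<lambda>x. leib B (p x) (q x))"
proof (rule jetnI)
  fix x assume "x \<in> U"
  then show "mlin n E H (leib B (p x) (q x))" using leib_mlin[OF B ns jetn_mlin[OF p] jetn_mlin[OF q]] by simp
next
  fix m x and \<epsilon> :: real assume n: "n = Suc m" and x: "x \<in> U" and \<epsilon>: "\<epsilon> > 0"
  obtain K where K: "K \<ge> 0" "\<And>x y. x \<in> carr F \<Longrightarrow> y \<in> carr G \<Longrightarrow> nrm H (B x y) \<le> K * nrm F x * nrm G y"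
    using bdd_bil_bound[OF B] by blast
  obtain C C' where C: "C \<ge> 0" "bnd n E F C (p x)" "C' \<ge> 0" "bnd n E G C' (q x)"
    using jetn_mlin[OF p x] jetn_mlin[OF q x] by (auto simp: mlin_def)
  \<comment> \<open>Collects the bounds of the three products: \<open>2 * C' + 1\<close> is for
    \<open>q (x + h)\<close>, \<open>1 + C'\<close> for its increment, and the final
    \<open>+ 1\<close> makes \<open>M\<close> positive.\<close>
  define M where "M = 2 ^ m * K * (2 * C' + 1 + C * (1 + C') + C) + 1"
  have "2 ^ m * K * (2 * C' + 1 + C * (1 + C') + C) \<ge> 0" using K C by simp
  then have M: "M > 0" unfolding M_def by linarith
  define \<tau> where "\<tau> = min 1 (\<epsilon> / M)"
  have \<tau>: "\<tau> > 0" "\<tau> \<le> 1" "M * \<tau> \<le> \<epsilon>" using M \<epsilon> by (auto simp: \<tau>_def min_def field_simps)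
  obtain \<delta>1 where \<delta>1: "\<delta>1 > 0" "\<And>h. h \<in> carr E \<Longrightarrow> x + h \<in> U \<Longrightarrow> nrm E h < \<delta>1 \<Longrightarrow>
      bnd m E F (\<tau> * nrm E h) (\<lambda>vs. p (x + h) vs - p x vs - p x (h # vs))"
    using jetn_diff[OF p[unfolded n] x \<tau>(1)] by blast
  obtain \<delta>2 where \<delta>2: "\<delta>2 > 0" "\<And>h. h \<in> carr E \<Longrightarrow> x + h \<in> U \<Longrightarrow> nrm E h < \<delta>2 \<Longrightarrow>
      bnd m E G (\<tau> * nrm E h) (\<lambda>vs. q (x + h) vs - q x vs - q x (h # vs))"
    using jetn_diff[OF q[unfolded n] x \<tau>(1)] by blast
  show "\<exists>\<delta>>0. \<forall>h\<in>carr E. x + h \<in> U \<longrightarrow> nrm E h < \<delta> \<longrightarrow> bnd m E H (\<epsilon> * nrm E h)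
      (\<lambda>vs. leib B (p (x + h)) (q (x + h)) vs - leib B (p x) (q x) vs - leib B (p x) (q x) (h # vs))"
  \<comment> \<open>Requiring \<open>nrm E h < \<tau>\<close> turns the quadratic middle term into a
    multiple of \<open>\<tau> * nrm E h\<close>.\<close>
  proof (intro exI[of _ "min \<tau> (min \<delta>1 \<delta>2)"] conjI ballI impI)
    show "0 < min \<tau> (min \<delta>1 \<delta>2)" using \<tau> \<delta>1 \<delta>2 by simp
    fix h assume h: "h \<in> carr E" "x + h \<in> U" "nrm E h < min \<tau> (min \<delta>1 \<delta>2)"
    define N where "N = nrm E h"
    have N: "N \<ge> 0" "N \<le> \<tau>" "N \<le> 1" using h \<tau> nrm_ge0[OF ns(1) h(1)] by (auto simp: N_def)
    define Rp where "Rp = (\<lambda>vs. p (x + h) vs - p x vs - p x (h # vs))"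
    define Rq where "Rq = (\<lambda>vs. q (x + h) vs - q x vs - q x (h # vs))"
    define Dp where "Dp = (\<lambda>vs. p x (h # vs))"
    define Dq where "Dq = (\<lambda>vs. q x (h # vs))"
    have Rp: "bnd m E F (\<tau> * N) Rp" unfolding Rp_def N_def using \<delta>1(2) h by auto
    have Rq: "bnd m E G (\<tau> * N) Rq" unfolding Rq_def N_def using \<delta>2(2) h by auto
    have Dp: "bnd m E F (C * N) Dp" unfolding Dp_def N_def using bnd_shift[OF C(2)[unfolded n] h(1)] .
    have Dq: "bnd m E G (C' * N) Dq" unfolding Dq_def N_def using bnd_shift[OF C(4)[unfolded n] h(1)] .
    have px: "bnd m E F C (p x)" and qx: "bnd m E G C' (q x)" using C n by (auto intro: bnd_mono)
    have \<tau>N: "0 \<le> \<tau> * N" "\<tau> * N \<le> 1" using N \<tau> mult_mono[of \<tau> 1 N 1] by auto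
    have DDq: "bnd m E G ((1 + C') * N) (\<lambda>a. q (x + h) a - q x a)"
    proof -
      have "bnd m E G (\<tau> * N + C' * N) (\<lambda>a. Rq a + Dq a)" by (rule bnd_add[OF ns(3) Rq Dq])
      moreover have "\<tau> * N + C' * N \<le> (1 + C') * N"
        using N \<tau> by (simp add: algebra_simps mult_left_le_one_le mult_right_le_one_le)
      ultimately show ?thesis using bnd_le[OF _ ns(1)] by (simp add: Rq_def Dq_def) blast
    qed
    have Q1: "bnd m E G (2 * C' + 1) (q (x + h))"
    proof -
      have b: "bnd m E G (C' + (1 + C') * N) (\<lambda>a. q x a + (q (x + h) a - q x a))" by (rule bnd_add[OF ns(3) qx DDq])
      have "C' + (1 + C') * N \<le> 2 * C' + 1"
        using N C mult_left_mono[of N 1 "1 + C'"] by (simp add: algebra_simps)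
      from bnd_le[OF b ns(1) this] show ?thesis by simp
    qed
    have P1: "bnd m E F (C + (\<tau> * N + C * N)) (p (x + h))"
      using bnd_add[OF ns(2) px bnd_add[OF ns(2) Rp Dp]] by (simp add: Rp_def Dp_def)
    have N2: "bnd m E H (2 ^ m * K * (\<tau> * N) * (2 * C' + 1)) (leib B Rp (q (x + h)))"
      by (rule leib_bnd[OF B ns K Rp Q1]) (use \<tau>N C in auto)
    have N3: "bnd m E H (2 ^ m * K * (C * N) * ((1 + C') * N)) (leib B Dp (\<lambda>a. q (x + h) a - q x a))"
      by (rule leib_bnd[OF B ns K Dp DDq]) (use N C in auto)
    have N4: "bnd m E H (2 ^ m * K * C * (\<tau> * N)) (leib B (p x) Rq)"
      by (rule leib_bnd[OF B ns K px Rq]) (use \<tau>N C in auto)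
    have sum: "bnd m E H (2 ^ m * K * (\<tau> * N) * (2 * C' + 1) + (2 ^ m * K * (C * N) * ((1 + C') * N) + 2 ^ m * K * C * (\<tau> * N)))
       (\<lambda>vs. leib B Rp (q (x + h)) vs + (leib B Dp (\<lambda>a. q (x + h) a - q x a) vs + leib B (p x) Rq vs))"
      by (intro bnd_add ns N2 N3 N4)
    have le: "2 ^ m * K * (\<tau> * N) * (2 * C' + 1) + (2 ^ m * K * (C * N) * ((1 + C') * N) + 2 ^ m * K * C * (\<tau> * N)) \<le> \<epsilon> * N"
    proof -
      have "2 ^ m * K * (C * N) * ((1 + C') * N) \<le> 2 ^ m * K * (C * \<tau>) * ((1 + C') * N)"
        using N C K by (intro mult_mono) auto
      then have "2 ^ m * K * (\<tau> * N) * (2 * C' + 1) + (2 ^ m * K * (C * N) * ((1 + C') * N) + 2 ^ m * K * C * (\<tau> * N))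
        \<le> (M - 1) * \<tau> * N" by (simp add: M_def algebra_simps)
      also have "\<dots> \<le> M * \<tau> * N" using \<tau> N by (intro mult_right_mono) auto
      also have "\<dots> \<le> \<epsilon> * N" using \<tau> N by (intro mult_right_mono) auto
      finally show ?thesis .
    qed
    have eq: "leib B Rp (q (x + h)) vs + (leib B Dp (\<lambda>a. q (x + h) a - q x a) vs + leib B (p x) Rq vs)
      = leib B (p (x + h)) (q (x + h)) vs - leib B (p x) (q x) vs - leib B (p x) (q x) (h # vs)"
      if vs: "set vs \<subseteq> carr E" "length vs \<le> m" for vs
    proof -
      note car = bndD(1)[OF px] bndD(1)[OF qx] bndD(1)[OF P1] bndD(1)[OF Q1] bndD(1)[OF Dp] bndD(1)[OF Dq]
        bndD(1)[OF Rp] bndD(1)[OF Rq]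
      have 1: "leib B (\<lambda>a. p x a + Dp a) (q (x + h)) vs = leib B (p x) (q (x + h)) vs + leib B Dp (q (x + h)) vs"
        using leib_comb_left[OF B ns(2) vs(1), of "p x" Dp "q (x + h)" "\<lambda>a. p x a + Dp a" 1 1] car vs(2) by simp
      have 2: "leib B Rp (q (x + h)) vs = leib B (p (x + h)) (q (x + h)) vs - leib B (\<lambda>a. p x a + Dp a) (q (x + h)) vs"
        using leib_comb_left[OF B ns(2) vs(1), of "p (x + h)" "\<lambda>a. p x a + Dp a" "q (x + h)" Rp 1 "-1"] car vs(2)
        by (simp add: Rp_def Dp_def ns_add ns(2) algebra_simps)
      have 3: "leib B Dp (\<lambda>a. q (x + h) a - q x a) vs = leib B Dp (q (x + h)) vs - leib B Dp (q x) vs"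
        using leib_comb_right[OF B ns(3) vs(1), of "q (x + h)" "q x" Dp "\<lambda>a. q (x + h) a - q x a" 1 "-1"] car vs(2) by simp
      have 4: "leib B (p x) (\<lambda>a. q x a + Dq a) vs = leib B (p x) (q x) vs + leib B (p x) Dq vs"
        using leib_comb_right[OF B ns(3) vs(1), of "q x" Dq "p x" "\<lambda>a. q x a + Dq a" 1 1] car vs(2) by simp
      have 5: "leib B (p x) Rq vs = leib B (p x) (q (x + h)) vs - leib B (p x) (\<lambda>a. q x a + Dq a) vs"
        using leib_comb_right[OF B ns(3) vs(1), of "q (x + h)" "\<lambda>a. q x a + Dq a" "p x" Rq 1 "-1"] car vs(2)
        by (simp add: Rq_def Dq_def ns_add ns(3) algebra_simps)
      show ?thesis unfolding 2 3 5 1 4 by (simp add: Dp_def Dq_def algebra_simps)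
    qed
    show "bnd m E H (\<epsilon> * nrm E h)
      (\<lambda>vs. leib B (p (x + h)) (q (x + h)) vs - leib B (p x) (q x) vs - leib B (p x) (q x) (h # vs))"
      using bnd_le[OF sum ns(1) le] eq unfolding bnd_def N_def[symmetric] by simp
  qed
qed

lemma mlin_lin:
  assumes "bdd_lin F G T" "normed_ns E" "normed_ns F" "mlin n E F p"
  shows "mlin n E G (\<lambda>vs. T (p vs))"
proof -
  obtain K where K: "K \<ge> 0" "\<And>x. x \<in> carr F \<Longrightarrow> nrm G (T x) \<le> K * nrm F x" and T: "lin_on F G T"
    using assms(1) unfolding bdd_lin_def by blast
  obtain C where C: "C \<ge> 0" "bnd n E F C p" using assms(4) by (auto simp: mlin_def)
  have "bnd n E G (K * C) (\<lambda>vs. T (p vs))"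
    unfolding bnd_def
  proof (intro allI impI conjI)
    fix vs assume vs: "set vs \<subseteq> carr E" "length vs \<le> n"
    note p = bndD[OF C(2) vs]
    show "T (p vs) \<in> carr G" using lin_onD(1)[OF T p(1)] .
    have "nrm G (T (p vs)) \<le> K * nrm F (p vs)" by (rule K(2)[OF p(1)])
    also have "\<dots> \<le> K * (C * pnrm E vs)" by (rule mult_left_mono[OF p(2) K(1)])
    finally show "nrm G (T (p vs)) \<le> K * C * pnrm E vs" by (simp add: mult.assoc)
  qed
  moreover have "lin_on E G (\<lambda>v. T (p (xs @ v # ys)))"
    if "set xs \<subseteq> carr E" "set ys \<subseteq> carr E" "length xs + length ys < n" for xs ys
    using mlin_slot[OF assms(4) that] T unfolding lin_on_def by simp
  ultimately show ?thesis unfolding mlin_def using K C by (auto intro!: exI[of _ "K * C"])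
qed

lemma jetn_lin:
  assumes "bdd_lin F G T" "normed_ns E" "normed_ns F" "jetn n E F U d"
  shows "jetn n E G U (\<lambda>x vs. T (d x vs))"
proof (rule jetnI)
  fix x assume "x \<in> U"
  then show "mlin n E G (\<lambda>vs. T (d x vs))" using mlin_lin[OF assms(1-3)] jetn_mlin[OF assms(4)] by blast
next
  fix m x and \<epsilon> :: real assume n: "n = Suc m" and x: "x \<in> U" and \<epsilon>: "\<epsilon> > 0"
  obtain K where K: "K \<ge> 0" "\<And>x. x \<in> carr F \<Longrightarrow> nrm G (T x) \<le> K * nrm F x" and T: "lin_on F G T"
    using assms(1) unfolding bdd_lin_def by blast
  have "\<epsilon> / (K + 1) > 0" using \<epsilon> K by simp
  then obtain \<delta> where \<delta>: "\<delta> > 0" "\<And>h. h \<in> carr E \<Longrightarrow> x + h \<in> U \<Longrightarrow> nrm E h < \<delta> \<Longrightarrow>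
      bnd m E F (\<epsilon> / (K + 1) * nrm E h) (\<lambda>vs. d (x + h) vs - d x vs - d x (h # vs))"
    using jetn_diff[OF assms(4)[unfolded n] x] by blast
  have "bnd m E G (\<epsilon> * nrm E h) (\<lambda>vs. T (d (x + h) vs) - T (d x vs) - T (d x (h # vs)))"
    if h: "h \<in> carr E" "x + h \<in> U" "nrm E h < \<delta>" for h
    unfolding bnd_def
  proof (intro allI impI)
    fix vs assume vs: "set vs \<subseteq> carr E" "length vs \<le> m"
    let ?r = "d (x + h) vs - d x vs - d x (h # vs)"
    note r = bndD[OF \<delta>(2)[OF h] vs]
    have car: "d (x + h) vs \<in> carr F" "d x vs \<in> carr F" "d x (h # vs) \<in> carr F"
      using mlin_carr[OF jetn_mlin[OF assms(4)]] n vs h x by auto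
    have eq: "T (d (x + h) vs) - T (d x vs) - T (d x (h # vs)) = T ?r"
      using lin_on_diff[OF T assms(3)] car by (simp add: ns_diff assms(3))
    have "nrm G (T ?r) \<le> K * nrm F ?r" by (rule K(2)[OF r(1)])
    also have "\<dots> \<le> K * (\<epsilon> / (K + 1) * nrm E h * pnrm E vs)" by (rule mult_left_mono[OF r(2) K(1)])
    also have "\<dots> = K / (K + 1) * (\<epsilon> * nrm E h * pnrm E vs)" by simp
    also have "\<dots> \<le> 1 * (\<epsilon> * nrm E h * pnrm E vs)"
      using K \<epsilon> nrm_ge0[OF assms(2) h(1)] pnrm_ge0[OF assms(2) vs(1)] by (intro mult_right_mono) auto
    finally show "T (d (x + h) vs) - T (d x vs) - T (d x (h # vs)) \<in> carr G \<and>
        nrm G (T (d (x + h) vs) - T (d x vs) - T (d x (h # vs))) \<le> \<epsilon> * nrm E h * pnrm E vs"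
      unfolding eq using lin_onD(1)[OF T r(1)] by simp
  qed
  then show "\<exists>\<delta>>0. \<forall>h\<in>carr E. x + h \<in> U \<longrightarrow> nrm E h < \<delta> \<longrightarrow>
      bnd m E G (\<epsilon> * nrm E h) (\<lambda>vs. T (d (x + h) vs) - T (d x vs) - T (d x (h # vs)))"
    using \<delta>(1) by blast
qed

lemma jetn_add:
  assumes "normed_ns E" "normed_ns F" "jetn n E F U d" "jetn n E F U e"
  shows "jetn n E F U (\<lambda>x vs. d x vs + e x vs)"
proof (rule jetnI)
  fix x assume x: "x \<in> U"
  obtain C C' where C: "C \<ge> 0" "bnd n E F C (d x)" "C' \<ge> 0" "bnd n E F C' (e x)"
    using jetn_mlin[OF assms(3) x] jetn_mlin[OF assms(4) x] by (auto simp: mlin_def)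
  have "lin_on E F (\<lambda>v. d x (xs @ v # ys) + e x (xs @ v # ys))"
    if "set xs \<subseteq> carr E" "set ys \<subseteq> carr E" "length xs + length ys < n" for xs ys
    using mlin_slot[OF jetn_mlin[OF assms(3) x] that] mlin_slot[OF jetn_mlin[OF assms(4) x] that] assms(2)
    unfolding lin_on_def by (simp add: ns_add scaleR_add_right)
  then show "mlin n E F (\<lambda>vs. d x vs + e x vs)"
    unfolding mlin_def using C bnd_add[OF assms(2) C(2) C(4)] by (auto intro!: exI[of _ "C + C'"])
next
  fix m x and \<epsilon> :: real assume n: "n = Suc m" and x: "x \<in> U" and \<epsilon>: "\<epsilon> > 0"
  have \<epsilon>2: "\<epsilon> / 2 > 0" using \<epsilon> by simp
  obtain \<delta>1 where \<delta>1: "\<delta>1 > 0" "\<And>h. h \<in> carr E \<Longrightarrow> x + h \<in> U \<Longrightarrow> nrm E h < \<delta>1 \<Longrightarrow>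
      bnd m E F (\<epsilon> / 2 * nrm E h) (\<lambda>vs. d (x + h) vs - d x vs - d x (h # vs))"
    using jetn_diff[OF assms(3)[unfolded n] x \<epsilon>2] by blast
  obtain \<delta>2 where \<delta>2: "\<delta>2 > 0" "\<And>h. h \<in> carr E \<Longrightarrow> x + h \<in> U \<Longrightarrow> nrm E h < \<delta>2 \<Longrightarrow>
      bnd m E F (\<epsilon> / 2 * nrm E h) (\<lambda>vs. e (x + h) vs - e x vs - e x (h # vs))"
    using jetn_diff[OF assms(4)[unfolded n] x \<epsilon>2] by blast
  have "bnd m E F (\<epsilon> * nrm E h) (\<lambda>vs. d (x + h) vs + e (x + h) vs - (d x vs + e x vs) - (d x (h # vs) + e x (h # vs)))"
    if "h \<in> carr E" "x + h \<in> U" "nrm E h < min \<delta>1 \<delta>2" for h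
    using bnd_add[OF assms(2) \<delta>1(2) \<delta>2(2), of h h] that by (simp add: algebra_simps)
  then show "\<exists>\<delta>>0. \<forall>h\<in>carr E. x + h \<in> U \<longrightarrow> nrm E h < \<delta> \<longrightarrow>
      bnd m E F (\<epsilon> * nrm E h) (\<lambda>vs. d (x + h) vs + e (x + h) vs - (d x vs + e x vs) - (d x (h # vs) + e x (h # vs)))"
    using \<delta>1(1) \<delta>2(1) by (intro exI[of _ "min \<delta>1 \<delta>2"]) auto
qed

text \<open>The seed of the coefficient jets: the first order remainder vanishes identically, and
  all orders above one are zero.\<close>

lemma jetn_affine:
  assumes "normed_ns E" "normed_ns F" "bdd_lin E F T" "c \<in> carr F" "U \<subseteq> carr E"
  shows "jetn n E F U (\<lambda>x vs. case vs of [] \<Rightarrow> c + T x | [v] \<Rightarrow> T v | _ \<Rightarrow> 0)"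
    (is "jetn n E F U ?d")
proof (rule jetnI)
  fix x assume x: "x \<in> U"
  obtain K where K: "K \<ge> 0" "\<And>x. x \<in> carr E \<Longrightarrow> nrm F (T x) \<le> K * nrm E x" and T: "lin_on E F T"
    using assms(3) unfolding bdd_lin_def by blast
  have cx: "c + T x \<in> carr F" using assms x lin_onD(1)[OF T] by (auto intro!: ns_add)
  have "bnd n E F (max K (nrm F (c + T x))) (?d x)"
    unfolding bnd_def
  proof (intro allI impI conjI)
    fix vs assume vs: "set vs \<subseteq> carr E"
    show "?d x vs \<in> carr F" using vs cx lin_onD(1)[OF T] by (auto split: list.split simp: ns_zero assms)
    have "K * nrm E v \<le> max K (nrm F (c + T x)) * nrm E v" if "v \<in> carr E" for v
      using nrm_ge0[OF assms(1) that] by (intro mult_right_mono) auto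
    with K(2) have "nrm F (T v) \<le> max K (nrm F (c + T x)) * nrm E v" if "v \<in> carr E" for v
      using that by (meson order_trans)
    then show "nrm F (?d x vs) \<le> max K (nrm F (c + T x)) * pnrm E vs"
      using vs K pnrm_ge0[OF assms(1) vs] by (auto split: list.split simp: assms)
  qed
  moreover have "lin_on E F (\<lambda>v. ?d x (xs @ v # ys))" for xs ys
    by (cases xs; cases ys; cases "tl xs") (use T assms(2) in \<open>auto simp: lin_on_def ns_zero split: list.split\<close>)
  ultimately show "mlin n E F (?d x)" unfolding mlin_def using K by (auto intro!: exI[of _ "max K (nrm F (c + T x))"])
next
  fix m x and \<epsilon> :: real assume n: "n = Suc m" and x: "x \<in> U" and \<epsilon>: "\<epsilon> > 0"
  have T: "lin_on E F T" using assms(3) unfolding bdd_lin_def by blast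
  have "?d (x + h) vs - ?d x vs - ?d x (h # vs) = 0" if "h \<in> carr E" "x + h \<in> U" "set vs \<subseteq> carr E" for h vs
    using that x assms lin_onD(2)[OF T, of x h] by (auto split: list.split)
  then have "bnd m E F (\<epsilon> * nrm E h) (\<lambda>vs. ?d (x + h) vs - ?d x vs - ?d x (h # vs))" if "h \<in> carr E" "x + h \<in> U" for h
    using that \<epsilon> nrm_ge0[OF assms(1), of h] pnrm_ge0[OF assms(1)] unfolding bnd_def by (simp add: assms ns_zero)
  then show "\<exists>\<delta>>0. \<forall>h\<in>carr E. x + h \<in> U \<longrightarrow> nrm E h < \<delta> \<longrightarrow> bnd m E F (\<epsilon> * nrm E h) (\<lambda>vs. ?d (x + h) vs - ?d x vs - ?d x (h # vs))"
    by (intro exI[of _ 1]) auto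
qed

lemma jet_jetn: "jet E F U d \<Longrightarrow> jetn n E F U d"
  by (simp add: jet_def)

lemma jet_leib:
  "bdd_bil F G H B \<Longrightarrow> normed_ns E \<Longrightarrow> normed_ns F \<Longrightarrow> normed_ns G \<Longrightarrow> normed_ns H \<Longrightarrow>
    jet E F U p \<Longrightarrow> jet E G U q \<Longrightarrow> jet E H U (\<lambda>x. leib B (p x) (q x))"
  using jetn_leib[of F G H B E _ U p q] by (simp add: jet_def)

lemma jet_lin:
  "bdd_lin F G T \<Longrightarrow> normed_ns E \<Longrightarrow> normed_ns F \<Longrightarrow> jet E F U d \<Longrightarrow> jet E G U (\<lambda>x vs. T (d x vs))"
  using jetn_lin[of F G T E _ U d] by (simp add: jet_def)

lemma jet_add:
  "normed_ns E \<Longrightarrow> normed_ns F \<Longrightarrow> jet E F U d \<Longrightarrow> jet E F U e \<Longrightarrow> jet E F U (\<lambda>x vs. d x vs + e x vs)"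
  using jetn_add[of E F _ U d e] by (simp add: jet_def)

section \<open>Spaces of bounded linear and bilinear maps\<close>

text \<open>Operators vanish off \<open>carr E\<close> for the same reason as in
  \<open>multilin\<close>: otherwise operator norm 0 would not force the zero function.\<close>

definition blin :: "('a::real_vector) nspace \<Rightarrow> ('b::real_vector) nspace \<Rightarrow> ('a \<Rightarrow> 'b) nspace"
  where "blin E F =
    \<lparr>carr = {T. lin_on E F T \<and> (\<exists>C. \<forall>x\<in>carr E. nrm F (T x) \<le> C * nrm E x) \<and> (\<forall>x. x \<notin> carr E \<longrightarrow> T x = 0)},
     nrm = (\<lambda>T. Sup {nrm F (T x) | x. x \<in> carr E \<and> nrm E x \<le> 1})\<rparr>"

lemma blin_nrm_le:
  assumes "normed_ns E" "C \<ge> 0" "\<And>x. x \<in> carr E \<Longrightarrow> nrm F (T x) \<le> C * nrm E x"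
  shows "nrm (blin E F) T \<le> C"
  unfolding blin_def nspace.simps
proof (rule cSup_least)
  show "{nrm F (T x) |x. x \<in> carr E \<and> nrm E x \<le> 1} \<noteq> {}"
    using ns_zero[OF assms(1)] nrm_zero[OF assms(1)] by fastforce
  fix y assume "y \<in> {nrm F (T x) |x. x \<in> carr E \<and> nrm E x \<le> 1}"
  then obtain x where x: "y = nrm F (T x)" "x \<in> carr E" "nrm E x \<le> 1" by blast
  then show "y \<le> C" using assms(3)[OF x(2)] mult_left_mono[OF x(3) assms(2)] by simp
qed

lemma blinI:
  assumes "normed_ns E" "\<And>x. x \<in> carr E \<Longrightarrow> T x \<in> carr F"
    "\<And>a b x y. x \<in> carr E \<Longrightarrow> y \<in> carr E \<Longrightarrow> T (a *\<^sub>R x + b *\<^sub>R y) = a *\<^sub>R T x + b *\<^sub>R T y"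
    "\<And>x. x \<in> carr E \<Longrightarrow> nrm F (T x) \<le> C * nrm E x" "\<And>x. x \<notin> carr E \<Longrightarrow> T x = 0"
  shows "T \<in> carr (blin E F)"
  using assms unfolding blin_def by (auto intro!: lin_on_combI exI[of _ C])

lemma blin_lin: "T \<in> carr (blin E F) \<Longrightarrow> lin_on E F T"
  and blin_out: "T \<in> carr (blin E F) \<Longrightarrow> x \<notin> carr E \<Longrightarrow> T x = 0"
  by (auto simp: blin_def)

lemma blin_ge0_upper:
  assumes "normed_ns E" "normed_ns F" "T \<in> carr (blin E F)"
  shows "0 \<le> nrm (blin E F) T"
    and "x \<in> carr E \<Longrightarrow> nrm E x \<le> 1 \<Longrightarrow> nrm F (T x) \<le> nrm (blin E F) T"
proof -
  obtain C where C: "\<And>x. x \<in> carr E \<Longrightarrow> nrm F (T x) \<le> C * nrm E x" using assms(3) by (auto simp: blin_def)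
  show *: "nrm F (T x) \<le> nrm (blin E F) T" if "x \<in> carr E" "nrm E x \<le> 1" for x
    unfolding blin_def nspace.simps
  proof (rule cSup_upper)
    show "nrm F (T x) \<in> {nrm F (T x) |x. x \<in> carr E \<and> nrm E x \<le> 1}" using that by blast
    show "bdd_above {nrm F (T x) |x. x \<in> carr E \<and> nrm E x \<le> 1}"
    proof (rule bdd_aboveI[of _ "\<bar>C\<bar>"], clarify)
      fix z assume z: "z \<in> carr E" "nrm E z \<le> 1"
      have "C * nrm E z \<le> \<bar>C\<bar> * 1" using z nrm_ge0[OF assms(1) z(1)] by (intro mult_mono) auto
      then show "nrm F (T z) \<le> \<bar>C\<bar>" using C[OF z(1)] by simp
    qed
  qed
  show "0 \<le> nrm (blin E F) T"
    using *[of 0] lin_on_zero[OF blin_lin[OF assms(3)] assms(1)] assms ns_zero by auto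
qed

lemmas blin_ge0 = blin_ge0_upper(1)

lemma blin_apply:
  assumes "normed_ns E" "normed_ns F" "T \<in> carr (blin E F)" "x \<in> carr E"
  shows "nrm F (T x) \<le> nrm (blin E F) T * nrm E x"
proof (cases "nrm E x = 0")
  case True
  then have "x = 0" using nrm_eq0[OF assms(1,4)] by simp
  then show ?thesis using lin_on_zero[OF blin_lin[OF assms(3)] assms(1)] assms by simp
next
  case False
  define N where "N = nrm E x"
  have N: "N > 0" using False nrm_ge0[OF assms(1,4)] by (simp add: N_def)
  have "nrm F (T ((1 / N) *\<^sub>R x)) \<le> nrm (blin E F) T"
    by (rule blin_ge0_upper(2)[OF assms(1-3)]) (use N assms(1,4) in \<open>auto simp: ns_scale nrm_scale N_def\<close>)
  moreover have "nrm F (T ((1 / N) *\<^sub>R x)) = 1 / N * nrm F (T x)"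
    using lin_onD(3)[OF blin_lin[OF assms(3)] assms(4)] lin_onD(1)[OF blin_lin[OF assms(3)] assms(4)] N assms(2)
    by (simp add: nrm_scale)
  ultimately show ?thesis using N by (simp add: N_def field_simps)
qed

lemma normed_blin:
  assumes "normed_ns E" "normed_ns F"
  shows "normed_ns (blin E F)"
proof (rule normed_nsI)
  show "0 \<in> carr (blin E F)"
    by (rule blinI[of _ _ _ 0]) (use assms ns_zero in auto)
next
  fix S T assume ST: "S \<in> carr (blin E F)" "T \<in> carr (blin E F)"
  have le: "nrm F (S x + T x) \<le> (nrm (blin E F) S + nrm (blin E F) T) * nrm E x" if "x \<in> carr E" for x
    using nrm_triangle[OF assms(2) lin_onD(1)[OF blin_lin[OF ST(1)] that] lin_onD(1)[OF blin_lin[OF ST(2)] that]]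
      blin_apply[OF assms ST(1) that] blin_apply[OF assms ST(2) that] by (simp add: algebra_simps)
  show "S + T \<in> carr (blin E F)"
    by (rule blinI[OF assms(1), of _ _ "nrm (blin E F) S + nrm (blin E F) T"])
       (use ST le assms in \<open>auto simp: blin_out lin_onD(1)[OF blin_lin] lin_on_comb[OF blin_lin] ns_add algebra_simps\<close>)
  show "nrm (blin E F) (S + T) \<le> nrm (blin E F) S + nrm (blin E F) T"
    by (rule blin_nrm_le) (use assms ST le blin_ge0[OF assms] in auto)
next
  fix c S assume S: "S \<in> carr (blin E F)"
  have Sx: "S x \<in> carr F" if "x \<in> carr E" for x using lin_onD(1)[OF blin_lin[OF S] that] .
  have le: "nrm F (c *\<^sub>R S x) \<le> (\<bar>c\<bar> * nrm (blin E F) S) * nrm E x" if "x \<in> carr E" for x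
    using nrm_scale[OF assms(2) Sx[OF that]] mult_left_mono[OF blin_apply[OF assms S that], of "\<bar>c\<bar>"]
    by (simp add: mult.assoc)
  show cS: "c *\<^sub>R S \<in> carr (blin E F)"
    by (rule blinI[OF assms(1), of _ _ "\<bar>c\<bar> * nrm (blin E F) S"])
       (use S le Sx assms in \<open>auto simp: scaleR_fun_def blin_out lin_on_comb[OF blin_lin] ns_scale algebra_simps\<close>)
  have 1: "nrm (blin E F) (c *\<^sub>R S) \<le> \<bar>c\<bar> * nrm (blin E F) S"
    by (rule blin_nrm_le) (use assms S le blin_ge0[OF assms] in \<open>auto simp: scaleR_fun_def\<close>)
  have "\<bar>c\<bar> * nrm (blin E F) S \<le> nrm (blin E F) (c *\<^sub>R S)"
  proof (cases "c = 0")
    case True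
    then show ?thesis using blin_ge0[OF assms cS] by simp
  next
    case False
    have "nrm (blin E F) S \<le> nrm (blin E F) (c *\<^sub>R S) / \<bar>c\<bar>"
    proof (rule blin_nrm_le)
      fix x assume x: "x \<in> carr E"
      have "\<bar>c\<bar> * nrm F (S x) \<le> nrm (blin E F) (c *\<^sub>R S) * nrm E x"
        using blin_apply[OF assms cS x] nrm_scale[OF assms(2) Sx[OF x]] by (simp add: scaleR_fun_def)
      then show "nrm F (S x) \<le> nrm (blin E F) (c *\<^sub>R S) / \<bar>c\<bar> * nrm E x"
        using False by (simp add: field_simps)
    qed (use assms blin_ge0[OF assms cS] in auto)
    then show ?thesis using False by (simp add: field_simps)
  qed
  with 1 show "nrm (blin E F) (c *\<^sub>R S) = \<bar>c\<bar> * nrm (blin E F) S" by simp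
next
  fix S assume S: "S \<in> carr (blin E F)" "nrm (blin E F) S = 0"
  show "S = 0"
  proof
    fix x show "S x = 0 x"
    proof (cases "x \<in> carr E")
      case True
      then have "nrm F (S x) \<le> 0" using blin_apply[OF assms S(1) True] S(2) by simp
      moreover have "S x \<in> carr F" using lin_onD(1)[OF blin_lin[OF S(1)] True] .
      ultimately show ?thesis using nrm_eq0[OF assms(2)] nrm_ge0[OF assms(2)] by force
    next
      case False
      then show ?thesis using blin_out[OF S(1)] by simp
    qed
  qed
qed

text \<open>For \<open>jet_quadratic\<close>: the curried derivative of \<open>f\<close> takes
  values in operators on \<open>E\<close>, and its product with \<open>g\<close> has to be bounded
  bilinear again.\<close>

lemma bdd_bil_blin_right:
  assumes ns: "normed_ns E" "normed_ns F" "normed_ns G" "normed_ns H" and B: "bdd_bil F G H B"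
  shows "bdd_bil F (blin E G) (blin E H) (\<lambda>w L v. if v \<in> carr E then B w (L v) else 0)"
proof -
  obtain K where K: "K \<ge> 0" "\<And>x y. x \<in> carr F \<Longrightarrow> y \<in> carr G \<Longrightarrow> nrm H (B x y) \<le> K * nrm F x * nrm G y"
    using bdd_bil_bound[OF B] by blast
  have le: "nrm H (B w (L v)) \<le> K * nrm F w * nrm (blin E G) L * nrm E v"
    if "w \<in> carr F" "L \<in> carr (blin E G)" "v \<in> carr E" for w L v
  proof -
    have "nrm H (B w (L v)) \<le> K * nrm F w * nrm G (L v)" using K(2) that lin_onD(1)[OF blin_lin] by blast
    also have "\<dots> \<le> K * nrm F w * (nrm (blin E G) L * nrm E v)"
      using blin_apply[OF ns(1,3) that(2,3)] K(1) nrm_ge0[OF ns(2) that(1)] by (intro mult_left_mono) auto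
    finally show ?thesis by (simp add: mult.assoc)
  qed
  show ?thesis
  proof (rule bdd_bilI)
    fix w L assume wL: "w \<in> carr F" "L \<in> carr (blin E G)"
    show "(\<lambda>v. if v \<in> carr E then B w (L v) else 0) \<in> carr (blin E H)"
    proof (rule blinI[OF ns(1)])
      fix x assume "x \<in> carr E"
      then show "nrm H (if x \<in> carr E then B w (L x) else 0) \<le> (K * nrm F w * nrm (blin E G) L) * nrm E x"
        using le wL by simp
    qed (use wL in \<open>auto simp: ns_add ns_scale ns bdd_bilD(1)[OF B] lin_onD(1)[OF blin_lin]
         lin_on_comb[OF blin_lin ns(1)] bdd_bilD(3)[OF B ns(3)]\<close>)
    show "nrm (blin E H) (\<lambda>v. if v \<in> carr E then B w (L v) else 0) \<le> K * nrm F w * nrm (blin E G) L"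
      by (rule blin_nrm_le[OF ns(1)])
         (use wL le K nrm_ge0[OF ns(2)] blin_ge0[OF ns(1,3)] in auto)
  next
    fix a b x x' y assume "x \<in> carr F" "x' \<in> carr F" "y \<in> carr (blin E G)"
    then show "(\<lambda>v. if v \<in> carr E then B (a *\<^sub>R x + b *\<^sub>R x') (y v) else 0) =
       a *\<^sub>R (\<lambda>v. if v \<in> carr E then B x (y v) else 0) + b *\<^sub>R (\<lambda>v. if v \<in> carr E then B x' (y v) else 0)"
      by (auto simp: fun_eq_iff scaleR_fun_def bdd_bilD(2)[OF B ns(2)] lin_onD(1)[OF blin_lin])
  next
    fix a b x y y' assume "x \<in> carr F" "y \<in> carr (blin E G)" "y' \<in> carr (blin E G)"
    then show "(\<lambda>v. if v \<in> carr E then B x ((a *\<^sub>R y + b *\<^sub>R y') v) else 0) =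
       a *\<^sub>R (\<lambda>v. if v \<in> carr E then B x (y v) else 0) + b *\<^sub>R (\<lambda>v. if v \<in> carr E then B x (y' v) else 0)"
      by (auto simp: fun_eq_iff scaleR_fun_def bdd_bilD(3)[OF B ns(3)] lin_onD(1)[OF blin_lin])
  qed (use ns normed_blin in auto)
qed

lemma bdd_bil_blin_left:
  assumes ns: "normed_ns E" "normed_ns F" "normed_ns G" "normed_ns H" and B: "bdd_bil G F H B"
  shows "bdd_bil (blin E G) F (blin E H) (\<lambda>L w v. if v \<in> carr E then B (L v) w else 0)"
  using bdd_bil_flip[OF bdd_bil_blin_right[OF ns bdd_bil_flip[OF B]]] by simp

section \<open>Solutions of a quadratic difference equation are smooth\<close>

text \<open>The last list entry is the direction of the first differentiation. Detaching it exhibits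
  a derivative of order \<open>n + 1\<close> as a derivative of order \<open>n\<close> of the
  operator-valued first derivative.\<close>

definition cur :: "('a::real_vector) nspace \<Rightarrow> ('a \<Rightarrow> 'a list \<Rightarrow> 'b::real_vector) \<Rightarrow> 'a \<Rightarrow> 'a list \<Rightarrow> 'a \<Rightarrow> 'b"
  where "cur E d x b = (\<lambda>v. if v \<in> carr E then d x (b @ [v]) else 0)"

lemma bnd_cur:
  assumes "normed_ns E" "C \<ge> 0" "bnd (Suc n) E F C p"
    "\<And>xs. set xs \<subseteq> carr E \<Longrightarrow> length xs \<le> n \<Longrightarrow> lin_on E F (\<lambda>v. p (xs @ [v]))"
  shows "bnd n E (blin E F) C (\<lambda>b v. if v \<in> carr E then p (b @ [v]) else 0)"
  unfolding bnd_def
proof (intro allI impI conjI)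
  fix vs assume vs: "set vs \<subseteq> carr E" "length vs \<le> n"
  have le: "nrm F (p (vs @ [v])) \<le> C * pnrm E vs * nrm E v" if "v \<in> carr E" for v
    using bndD(2)[OF assms(3), of "vs @ [v]"] vs that by (simp add: mult.assoc)
  show "(\<lambda>v. if v \<in> carr E then p (vs @ [v]) else 0) \<in> carr (blin E F)"
    by (rule blinI[OF assms(1), of _ _ "C * pnrm E vs"])
       (use vs le lin_onD(1)[OF assms(4)[OF vs]] lin_on_comb[OF assms(4)[OF vs] assms(1)] assms(1)
        in \<open>auto simp: ns_add ns_scale\<close>)
  show "nrm (blin E F) (\<lambda>v. if v \<in> carr E then p (vs @ [v]) else 0) \<le> C * pnrm E vs"
    by (rule blin_nrm_le[OF assms(1)]) (use le assms(2) pnrm_ge0[OF assms(1) vs(1)] in auto)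
qed

lemma lin_on_sub:
  assumes "normed_ns F" "lin_on E F S" "lin_on E F T"
  shows "lin_on E F (\<lambda>v. S v - T v)"
  using assms unfolding lin_on_def by (simp add: ns_diff scaleR_diff_right)

lemma jetn_cur:
  assumes "normed_ns E" "normed_ns F" "jetn (Suc n) E F U d" "U \<subseteq> carr E"
  shows "jetn n E (blin E F) U (cur E d)"
proof (rule jetnI)
  fix x assume x: "x \<in> U"
  note m = jetn_mlin[OF assms(3) x]
  obtain C where C: "C \<ge> 0" "bnd (Suc n) E F C (d x)" using m by (auto simp: mlin_def)
  have "lin_on E F (\<lambda>v. d x (xs @ [v]))" if "set xs \<subseteq> carr E" "length xs \<le> n" for xs
    using mlin_slot[OF m that(1), of "[]"] that by simp
  note b = bnd_cur[OF assms(1) C this]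
  have "lin_on E (blin E F) (\<lambda>v. cur E d x (xs @ v # ys))"
    if "set xs \<subseteq> carr E" "set ys \<subseteq> carr E" "length xs + length ys < n" for xs ys
  proof (rule lin_on_combI)
    fix v assume "v \<in> carr E"
    then show "cur E d x (xs @ v # ys) \<in> carr (blin E F)"
      using bndD(1)[OF b, of "xs @ v # ys"] that by (simp add: cur_def)
  next
    fix a b v w assume vw: "v \<in> carr E" "w \<in> carr E"
    have "d x (xs @ (a *\<^sub>R v + b *\<^sub>R w) # ys @ [z]) = a *\<^sub>R d x (xs @ v # ys @ [z]) + b *\<^sub>R d x (xs @ w # ys @ [z])"
      if "z \<in> carr E" for z
      using lin_on_comb[OF mlin_slot[OF m, of xs "ys @ [z]"] assms(1) vw, of a b]
        \<open>set xs \<subseteq> carr E\<close> \<open>set ys \<subseteq> carr E\<close> \<open>length xs + length ys < n\<close> that by simp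
    then show "cur E d x (xs @ (a *\<^sub>R v + b *\<^sub>R w) # ys) = a *\<^sub>R cur E d x (xs @ v # ys) + b *\<^sub>R cur E d x (xs @ w # ys)"
      by (auto simp: cur_def fun_eq_iff scaleR_fun_def)
  qed
  then show "mlin n E (blin E F) (cur E d x)"
    unfolding mlin_def using b C(1) by (auto simp: cur_def[abs_def])
next
  fix m x and \<epsilon> :: real assume n: "n = Suc m" and x: "x \<in> U" and \<epsilon>: "\<epsilon> > 0"
  obtain \<delta> where \<delta>: "\<delta> > 0" "\<And>h. h \<in> carr E \<Longrightarrow> x + h \<in> U \<Longrightarrow> nrm E h < \<delta> \<Longrightarrow>
      bnd n E F (\<epsilon> * nrm E h) (\<lambda>vs. d (x + h) vs - d x vs - d x (h # vs))"
    using jetn_diff[OF assms(3) x \<epsilon>] by blast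
  have "bnd m E (blin E F) (\<epsilon> * nrm E h) (\<lambda>vs. cur E d (x + h) vs - cur E d x vs - cur E d x (h # vs))"
    if h: "h \<in> carr E" "x + h \<in> U" "nrm E h < \<delta>" for h
  proof -
    have eq: "(\<lambda>vs. cur E d (x + h) vs - cur E d x vs - cur E d x (h # vs)) =
      (\<lambda>b v. if v \<in> carr E then (\<lambda>vs. d (x + h) vs - d x vs - d x (h # vs)) (b @ [v]) else 0)"
      by (auto simp: cur_def fun_eq_iff)
    show ?thesis
      unfolding eq
    proof (rule bnd_cur)
      show "bnd (Suc m) E F (\<epsilon> * nrm E h) (\<lambda>vs. d (x + h) vs - d x vs - d x (h # vs))"
        using \<delta>(2)[OF h] n by simp
      fix xs assume xs: "set xs \<subseteq> carr E" "length xs \<le> m"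
      have "lin_on E F (\<lambda>v. d (x + h) (xs @ [v]))" "lin_on E F (\<lambda>v. d x (xs @ [v]))" "lin_on E F (\<lambda>v. d x ((h # xs) @ [v]))"
        using mlin_slot[OF jetn_mlin[OF assms(3) h(2)], of xs "[]"] mlin_slot[OF jetn_mlin[OF assms(3) x], of xs "[]"]
          mlin_slot[OF jetn_mlin[OF assms(3) x], of "h # xs" "[]"] xs n h(1) by auto
      then show "lin_on E F (\<lambda>v. d (x + h) (xs @ [v]) - d x (xs @ [v]) - d x (h # xs @ [v]))"
        by (intro lin_on_sub assms) simp_all
    qed (use assms(1) \<epsilon> nrm_ge0[OF assms(1) h(1)] in auto)
  qed
  then show "\<exists>\<delta>>0. \<forall>h\<in>carr E. x + h \<in> U \<longrightarrow> nrm E h < \<delta> \<longrightarrow>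
      bnd m E (blin E F) (\<epsilon> * nrm E h) (\<lambda>vs. cur E d (x + h) vs - cur E d x vs - cur E d x (h # vs))"
    using \<delta>(1) by blast
qed

text \<open>Every nonempty list is \<open>ws @ [w]\<close>, and there all conditions on
  \<open>d\<close> are those on \<open>e\<close> at \<open>ws\<close>, evaluated at
  \<open>w\<close>; only the empty list needs the separate hypothesis \<open>diff\<close>. This is
  the step that raises the order in \<open>jet_quadratic\<close>.\<close>

lemma jetn_uncur:
  assumes ns: "normed_ns E" "normed_ns F" and e: "jetn n E (blin E F) U e" and U: "U \<subseteq> carr E"
    and d: "\<And>x vs v. x \<in> U \<Longrightarrow> set vs \<subseteq> carr E \<Longrightarrow> v \<in> carr E \<Longrightarrow> length vs \<le> n \<Longrightarrow> d x (vs @ [v]) = e x vs v"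
    and d0: "\<And>x. x \<in> U \<Longrightarrow> d x [] \<in> carr F"
    and diff: "\<And>x \<epsilon>. x \<in> U \<Longrightarrow> \<epsilon> > 0 \<Longrightarrow> \<exists>\<delta>>0. \<forall>h\<in>carr E. x + h \<in> U \<longrightarrow> nrm E h < \<delta> \<longrightarrow>
      nrm F (d (x + h) [] - d x [] - e x [] h) \<le> \<epsilon> * nrm E h"
  shows "jetn (Suc n) E F U d"
proof (rule jetnI)
  fix x assume x: "x \<in> U"
  note m = jetn_mlin[OF e x]
  obtain C where C: "C \<ge> 0" "bnd n E (blin E F) C (e x)" using m by (auto simp: mlin_def)
  have b: "bnd (Suc n) E F (max C (nrm F (d x []))) (d x)"
    unfolding bnd_def
  proof (intro allI impI)
    fix vs assume vs: "set vs \<subseteq> carr E" "length vs \<le> Suc n"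
    show "d x vs \<in> carr F \<and> nrm F (d x vs) \<le> max C (nrm F (d x [])) * pnrm E vs"
    proof (cases vs rule: rev_cases)
      case Nil
      then show ?thesis using d0[OF x] by simp
    next
      case (snoc ws w)
      have ws: "set ws \<subseteq> carr E" "length ws \<le> n" "w \<in> carr E" using snoc vs by auto
      note ew = bndD[OF C(2) ws(1,2)]
      have "nrm F (e x ws w) \<le> nrm (blin E F) (e x ws) * nrm E w" by (rule blin_apply[OF ns ew(1) ws(3)])
      also have "\<dots> \<le> (max C (nrm F (d x [])) * pnrm E ws) * nrm E w"
      proof (rule mult_right_mono)
        have "C * pnrm E ws \<le> max C (nrm F (d x [])) * pnrm E ws"
          by (rule mult_right_mono) (use pnrm_ge0[OF ns(1) ws(1)] in auto)
        then show "nrm (blin E F) (e x ws) \<le> max C (nrm F (d x [])) * pnrm E ws" using ew(2) by linarith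
      qed (use nrm_ge0[OF ns(1) ws(3)] in auto)
      finally show ?thesis
        using lin_onD(1)[OF blin_lin[OF ew(1)] ws(3)] d[OF x ws(1,3,2)] snoc by (simp add: mult.assoc)
    qed
  qed
  moreover have "lin_on E F (\<lambda>v. d x (xs @ v # ys))"
    if xy: "set xs \<subseteq> carr E" "set ys \<subseteq> carr E" "length xs + length ys < Suc n" for xs ys
  proof (cases ys rule: rev_cases)
    case Nil
    have "lin_on E F (e x xs)" using mlin_carr[OF m xy(1)] xy blin_lin by auto
    then show ?thesis using d[OF x xy(1)] xy ns(1) Nil unfolding lin_on_def by (simp add: ns_add ns_scale)
  next
    case (snoc ws w)
    have w: "w \<in> carr E" "set ws \<subseteq> carr E" "length xs + length ws < n" using xy snoc by auto
    have "d x (xs @ v # ys) = e x (xs @ v # ws) w" if "v \<in> carr E" for v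
      using d[OF x, of "xs @ v # ws" w] xy w that snoc by simp
    moreover have "lin_on E F (\<lambda>v. e x (xs @ v # ws) w)"
    proof (rule lin_on_combI)
      note l = mlin_slot[OF m xy(1) w(2,3)]
      fix v assume "v \<in> carr E"
      then show "e x (xs @ v # ws) w \<in> carr F" using lin_onD(1)[OF l] lin_onD(1)[OF blin_lin] w by blast
    next
      note l = mlin_slot[OF m xy(1) w(2,3)]
      fix a b v v' assume "v \<in> carr E" "v' \<in> carr E"
      then show "e x (xs @ (a *\<^sub>R v + b *\<^sub>R v') # ws) w = a *\<^sub>R e x (xs @ v # ws) w + b *\<^sub>R e x (xs @ v' # ws) w"
        using lin_on_comb[OF l ns(1)] by (simp add: scaleR_fun_def)
    qed
    ultimately show ?thesis using ns(1) unfolding lin_on_def by (simp add: ns_add ns_scale)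
  qed
  ultimately show "mlin (Suc n) E F (d x)"
    unfolding mlin_def using C by (auto intro!: exI[of _ "max C (nrm F (d x []))"])
next
  fix m x and \<epsilon> :: real assume m: "Suc n = Suc m" and x: "x \<in> U" and \<epsilon>: "\<epsilon> > 0"
  obtain \<delta>1 where \<delta>1: "\<delta>1 > 0" "\<And>h. h \<in> carr E \<Longrightarrow> x + h \<in> U \<Longrightarrow> nrm E h < \<delta>1 \<Longrightarrow>
      nrm F (d (x + h) [] - d x [] - e x [] h) \<le> \<epsilon> * nrm E h"
    using diff[OF x \<epsilon>] by blast
  \<comment> \<open>The strict \<open>length vs < n\<close> makes the claim vacuous for
    \<open>n = 0\<close>, where a jet carries no remainder condition.\<close>
  have "\<exists>\<delta>>0. \<forall>h\<in>carr E. x + h \<in> U \<longrightarrow> nrm E h < \<delta> \<longrightarrow> (\<forall>vs. set vs \<subseteq> carr E \<longrightarrow> length vs < n \<longrightarrow>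
     e (x + h) vs - e x vs - e x (h # vs) \<in> carr (blin E F) \<and>
     nrm (blin E F) (e (x + h) vs - e x vs - e x (h # vs)) \<le> \<epsilon> * nrm E h * pnrm E vs)"
  proof (cases n)
    case 0
    then show ?thesis by (intro exI[of _ 1]) simp
  next
    case (Suc k)
    show ?thesis using jetn_diff[OF e[unfolded Suc] x \<epsilon>] unfolding bnd_def Suc less_Suc_eq_le by metis
  qed
  then obtain \<delta>2 where \<delta>2: "\<delta>2 > 0" "\<And>h vs. h \<in> carr E \<Longrightarrow> x + h \<in> U \<Longrightarrow> nrm E h < \<delta>2 \<Longrightarrow> set vs \<subseteq> carr E \<Longrightarrow> length vs < n \<Longrightarrow>
     e (x + h) vs - e x vs - e x (h # vs) \<in> carr (blin E F) \<and>
     nrm (blin E F) (e (x + h) vs - e x vs - e x (h # vs)) \<le> \<epsilon> * nrm E h * pnrm E vs" by blast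
  have "bnd m E F (\<epsilon> * nrm E h) (\<lambda>vs. d (x + h) vs - d x vs - d x (h # vs))"
    if h: "h \<in> carr E" "x + h \<in> U" "nrm E h < min \<delta>1 \<delta>2" for h
    unfolding bnd_def
  proof (intro allI impI)
    fix vs assume vs: "set vs \<subseteq> carr E" "length vs \<le> m"
    show "d (x + h) vs - d x vs - d x (h # vs) \<in> carr F \<and>
      nrm F (d (x + h) vs - d x vs - d x (h # vs)) \<le> \<epsilon> * nrm E h * pnrm E vs"
    proof (cases vs rule: rev_cases)
      case Nil
      have "d x ([] @ [h]) = e x [] h" using d[OF x, of "[]" h] h by simp
      moreover have "e x [] h \<in> carr F" using mlin_carr[OF jetn_mlin[OF e x], of "[]"] lin_onD(1)[OF blin_lin] h by force
      ultimately show ?thesis using Nil \<delta>1(2)[of h] h d0 x ns by (simp add: ns_diff)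
    next
      case (snoc ws w)
      have ws: "set ws \<subseteq> carr E" "length ws < n" "w \<in> carr E" using snoc vs m by auto
      let ?r = "e (x + h) ws - e x ws - e x (h # ws)"
      have r: "?r \<in> carr (blin E F)" "nrm (blin E F) ?r \<le> \<epsilon> * nrm E h * pnrm E ws"
        using \<delta>2(2)[OF h(1,2) _ ws(1,2)] h(3) by auto
      have eq: "d (x + h) vs - d x vs - d x (h # vs) = ?r w"
        using d[OF x, of ws w] d[OF h(2), of ws w] d[OF x, of "h # ws" w] ws h(1) snoc by simp
      have "nrm F (?r w) \<le> nrm (blin E F) ?r * nrm E w" by (rule blin_apply[OF ns r(1) ws(3)])
      also have "\<dots> \<le> (\<epsilon> * nrm E h * pnrm E ws) * nrm E w"
        by (rule mult_right_mono[OF r(2) nrm_ge0[OF ns(1) ws(3)]])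
      finally show ?thesis unfolding eq using lin_onD(1)[OF blin_lin[OF r(1)] ws(3)] snoc by (simp add: mult.assoc)
    qed
  qed
  then show "\<exists>\<delta>>0. \<forall>h\<in>carr E. x + h \<in> U \<longrightarrow> nrm E h < \<delta> \<longrightarrow>
      bnd m E F (\<epsilon> * nrm E h) (\<lambda>vs. d (x + h) vs - d x vs - d x (h # vs))"
    using \<delta>1(1) \<delta>2(1) by (intro exI[of _ "min \<delta>1 \<delta>2"]) auto
qed

text \<open>If \<open>g\<close> satisfies \<open>Dg = B2 (B1 g Df) g\<close>, then the derivatives of \<open>g\<close> of order \<open>n + 1\<close> arise by applying the
  Leibniz rule \<open>n\<close> times to the right-hand side.  The direction of the first differentiation is the last
  element of the list; it is kept apart by currying.\<close>

primrec invs :: "('w::ab_semigroup_add \<Rightarrow> 'v \<Rightarrow> 'u::plus) \<Rightarrow> ('u \<Rightarrow> 'w \<Rightarrow> 'a \<Rightarrow> 'w) \<Rightarrow> 'w \<Rightarrow> ('a list \<Rightarrow> 'v) \<Rightarrow> nat \<Rightarrow> 'a list \<Rightarrow> 'w"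
  where
    "invs B1 B2 g f 0 = (\<lambda>vs. g)"
  | "invs B1 B2 g f (Suc n) = (\<lambda>vs. if vs = [] then g else
      leib B2 (leib B1 (invs B1 B2 g f n) f) (invs B1 B2 g f n) (butlast vs) (last vs))"

lemma invs_Nil: "invs B1 B2 g f n [] = g"
  by (cases n) auto

text \<open>The index is only the recursion depth: the entry at a list is final once the index
  reaches its length. Hence \<open>jet_quadratic\<close> may take \<open>length vs\<close> as the
  index.\<close>

lemma invs_stable:
  assumes "length vs \<le> n" "length vs \<le> m"
  shows "invs B1 B2 g f n vs = invs B1 B2 g f m vs"
  using assms
proof (induction n arbitrary: vs m)
  case 0
  then show ?case by (simp add: invs_Nil)
next
  case (Suc n)
  show ?case
  proof (cases vs rule: rev_cases)
    case Nil
    then show ?thesis by (simp add: invs_Nil)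
  next
    case (snoc ws w)
    then obtain k where m: "m = Suc k" using Suc.prems by (cases m) auto
    have "leib B2 (leib B1 (invs B1 B2 g f n) f) (invs B1 B2 g f n) ws = leib B2 (leib B1 (invs B1 B2 g f k) f) (invs B1 B2 g f k) ws"
    proof (rule leib_cong[of _ UNIV])
      fix a :: "'a list" assume a: "length a \<le> length ws"
      then show "invs B1 B2 g f n a = invs B1 B2 g f k a" by (intro Suc.IH) (use a Suc.prems snoc m in auto)
      show "leib B1 (invs B1 B2 g f n) f a = leib B1 (invs B1 B2 g f k) f a"
      proof (rule leib_cong[of _ UNIV])
        fix b :: "'a list" assume b: "length b \<le> length a"
        show "invs B1 B2 g f n b = invs B1 B2 g f k b" by (intro Suc.IH) (use a b Suc.prems snoc m in auto)
      qed auto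
    qed auto
    then show ?thesis using snoc m by simp
  qed
qed

text \<open>Continuity of \<open>g\<close> comes from the equation: near \<open>x\<close> it bounds
  \<open>g (x + h) - g x\<close> by a small multiple of the norm of \<open>g (x + h)\<close>, so
  \<open>g (x + h)\<close> is at most twice as large as \<open>g x\<close>. Inserting this bound
  again gives the derivative \<open>B2 (B1 g Df) g\<close>. If \<open>g\<close> has a jet of order
  \<open>n\<close>, so has this expression by the Leibniz rule, and \<open>jetn_uncur\<close> raises
  the order. The intermediate space \<open>W1\<close> admits products of operators between different
  spaces.\<close>

lemma jet_quadratic:
  fixes g :: "'a::real_vector \<Rightarrow> 'w::real_vector"
  assumes ns: "normed_ns E" "normed_ns V" "normed_ns W" "normed_ns W1" and U: "U \<subseteq> carr E"
    and B1: "bdd_bil W V W1 B1" and B2: "bdd_bil W1 W W B2" and f: "jet E V U f"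
    and g: "\<And>x. x \<in> U \<Longrightarrow> g x \<in> carr W"
    and eq: "\<And>x h. x \<in> U \<Longrightarrow> h \<in> carr E \<Longrightarrow> x + h \<in> U \<Longrightarrow>
      g (x + h) - g x = B2 (B1 (g (x + h)) (f (x + h) [] - f x [])) (g x)"
  obtains d where "jet E W U d" "\<And>x. d x [] = g x"
    "\<And>x h. h \<in> carr E \<Longrightarrow> d x [h] = B2 (B1 (g x) (f x [h])) (g x)"
proof -
  define C1 where "C1 = (\<lambda>w L v. if v \<in> carr E then B1 w (L v) else 0)"
  define C2 where "C2 = (\<lambda>L w v. if v \<in> carr E then B2 (L v) w else 0)"
  have C1: "bdd_bil W (blin E V) (blin E W1) C1"
    unfolding C1_def by (rule bdd_bil_blin_right[OF ns(1,3,2,4) B1])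
  have C2: "bdd_bil (blin E W1) W (blin E W) C2"
    unfolding C2_def by (rule bdd_bil_blin_left[OF ns(1,3,4,3) B2])
  define d where "d = (\<lambda>x vs. invs C1 C2 (g x) (cur E f x) (length vs) vs)"
  define e where "e = (\<lambda>x. leib C2 (leib C1 (d x) (cur E f x)) (d x))"
  have d0: "d x [] = g x" for x by (simp add: d_def)
  have ds: "d x (vs @ [v]) = e x vs v" for x vs v
  proof -
    have "leib C2 (leib C1 (invs C1 C2 (g x) (cur E f x) (length vs)) (cur E f x)) (invs C1 C2 (g x) (cur E f x) (length vs)) vs
       = leib C2 (leib C1 (d x) (cur E f x)) (d x) vs"
    proof (rule leib_cong[of _ UNIV])
      fix a :: "'a list" assume a: "length a \<le> length vs"
      then show "invs C1 C2 (g x) (cur E f x) (length vs) a = d x a" unfolding d_def by (intro invs_stable) auto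
      show "leib C1 (invs C1 C2 (g x) (cur E f x) (length vs)) (cur E f x) a = leib C1 (d x) (cur E f x) a"
      proof (rule leib_cong[of _ UNIV])
        fix b :: "'a list" assume b: "length b \<le> length a"
        show "invs C1 C2 (g x) (cur E f x) (length vs) b = d x b" unfolding d_def by (rule invs_stable) (use a b in auto)
      qed auto
    qed auto
    then show ?thesis by (simp add: d_def[of] e_def)
  qed
  have e0: "e x [] h = B2 (B1 (g x) (f x [h])) (g x)" if "h \<in> carr E" for x h
    using that by (simp add: e_def d0 C1_def C2_def cur_def)
  obtain K1 where K1: "K1 \<ge> 0" "\<And>x y. x \<in> carr W \<Longrightarrow> y \<in> carr V \<Longrightarrow> nrm W1 (B1 x y) \<le> K1 * nrm W x * nrm V y"
    using bdd_bil_bound[OF B1] by blast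
  obtain K2 where K2: "K2 \<ge> 0" "\<And>x y. x \<in> carr W1 \<Longrightarrow> y \<in> carr W \<Longrightarrow> nrm W (B2 x y) \<le> K2 * nrm W1 x * nrm W y"
    using bdd_bil_bound[OF B2] by blast
  define K where "K = K2 * K1"
  have K0: "K \<ge> 0" using K1 K2 by (simp add: K_def)
  have K: "nrm W (B2 (B1 a b) c) \<le> K * nrm W a * nrm V b * nrm W c"
    if "a \<in> carr W" "b \<in> carr V" "c \<in> carr W" for a b c
  proof -
    have "nrm W (B2 (B1 a b) c) \<le> K2 * nrm W1 (B1 a b) * nrm W c"
      using K2(2) bdd_bilD(1)[OF B1 that(1,2)] that(3) by blast
    also have "\<dots> \<le> K2 * (K1 * nrm W a * nrm V b) * nrm W c"
      using K1(2)[OF that(1,2)] K2(1) nrm_ge0[OF ns(3) that(3)] by (intro mult_right_mono mult_left_mono) auto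
    finally show ?thesis by (simp add: K_def ac_simps)
  qed
  have fc: "f x vs \<in> carr V" if "x \<in> U" "set vs \<subseteq> carr E" for x vs
    using mlin_carr[OF jetn_mlin[of "length vs"]] f that unfolding jet_def by blast
  have base: "\<exists>\<delta>>0. \<forall>h\<in>carr E. x + h \<in> U \<longrightarrow> nrm E h < \<delta> \<longrightarrow>
      nrm W (d (x + h) [] - d x [] - e x [] h) \<le> \<epsilon> * nrm E h" if x: "x \<in> U" and \<epsilon>: "\<epsilon> > 0" for x \<epsilon>
  proof -
    have f1: "jetn (Suc 0) E V U f" using f by (simp add: jet_def)
    obtain Cf where Cf: "Cf \<ge> 0" "bnd (Suc 0) E V Cf (f x)" using jetn_mlin[OF f1 x] by (auto simp: mlin_def)
    define G where "G = nrm W (g x)"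
    have G: "G \<ge> 0" using nrm_ge0[OF ns(3) g[OF x]] by (simp add: G_def)
    \<comment> \<open>The first summand is for the term containing \<open>g' - g x\<close>,
      quadratic in \<open>h\<close>; \<open>K * G * G\<close> is for the term containing the
      remainder of \<open>f\<close>.\<close>
    define M where "M = 2 * K * K * G * G * G * (1 + Cf) * (1 + Cf) + K * G * G + 1"
    have M: "M > 0" using K0 G Cf by (auto simp: M_def intro!: add_nonneg_pos)
    define \<tau> where "\<tau> = min 1 (\<epsilon> / M)"
    have \<tau>: "\<tau> > 0" "\<tau> \<le> 1" "M * \<tau> \<le> \<epsilon>" using M \<epsilon> by (auto simp: \<tau>_def min_def field_simps)
    obtain \<delta>1 where \<delta>1: "\<delta>1 > 0" "\<And>h. h \<in> carr E \<Longrightarrow> x + h \<in> U \<Longrightarrow> nrm E h < \<delta>1 \<Longrightarrow>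
      bnd 0 E V (\<tau> * nrm E h) (\<lambda>vs. f (x + h) vs - f x vs - f x (h # vs))"
      using jetn_diff[OF f1 x \<tau>(1)] by blast
    \<comment> \<open>For \<open>N * P \<le> 1\<close> the equation gives that the norm of
      \<open>g' - g x\<close> is at most half the norm of \<open>g'\<close>; absorbing it leaves
      \<open>nrm W g' \<le> 2 * G\<close>.\<close>
    define P where "P = 2 * K * (1 + Cf) * G + 1"
    have P: "P > 0" using K0 G Cf by (auto simp: P_def intro!: add_nonneg_pos)
    have "nrm W (d (x + h) [] - d x [] - e x [] h) \<le> \<epsilon> * nrm E h"
      if h: "h \<in> carr E" "x + h \<in> U" "nrm E h < min \<delta>1 (min \<tau> (1 / P))" for h
    proof -
      define N where "N = nrm E h"
      have N: "N \<ge> 0" "N \<le> \<tau>" "N * P \<le> 1" using h nrm_ge0[OF ns(1) h(1)] P by (auto simp: N_def field_simps)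
      define \<Delta> where "\<Delta> = f (x + h) [] - f x []"
      define g' where "g' = g (x + h)"
      have c: "\<Delta> \<in> carr V" "f x [h] \<in> carr V" "g' \<in> carr W" "g x \<in> carr W" "\<Delta> - f x [h] \<in> carr V" "g' - g x \<in> carr W"
        using fc x h g ns by (auto simp: \<Delta>_def g'_def ns_diff)
      have r: "nrm V (\<Delta> - f x [h]) \<le> \<tau> * N"
        using bndD(2)[OF \<delta>1(2)[OF h(1,2)], of "[]"] h(3) by (simp add: \<Delta>_def N_def)
      have "nrm V (f x [h]) \<le> Cf * N" using bndD(2)[OF Cf(2), of "[h]"] h(1) by (simp add: N_def)
      then have "nrm V \<Delta> \<le> \<tau> * N + Cf * N"
        using nrm_triangle[OF ns(2) c(5,2)] r by simp
      also have "\<dots> \<le> (1 + Cf) * N" using \<tau> N mult_right_mono[of \<tau> 1 N] by (simp add: algebra_simps)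
      finally have \<Delta>: "nrm V \<Delta> \<le> (1 + Cf) * N" .
      have eqh: "g' - g x = B2 (B1 g' \<Delta>) (g x)" using eq[OF x h(1,2)] by (simp add: g'_def \<Delta>_def)
      have g'0: "nrm W g' \<ge> 0" and \<Delta>0: "nrm V \<Delta> \<ge> 0" using nrm_ge0 ns c by blast+
      have dg: "nrm W (g' - g x) \<le> K * nrm W g' * ((1 + Cf) * N) * G"
      proof -
        have "nrm W (g' - g x) \<le> K * nrm W g' * nrm V \<Delta> * G" unfolding eqh G_def by (rule K[OF c(3,1,4)])
        also have "\<dots> \<le> K * nrm W g' * ((1 + Cf) * N) * G"
          using \<Delta> g'0 K0 G by (intro mult_right_mono mult_left_mono) auto
        finally show ?thesis .
      qed
      have "nrm W g' \<le> 2 * G"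
      proof -
        have "nrm W g' \<le> nrm W (g' - g x) + G" using nrm_triangle[OF ns(3) c(6,4)] by (simp add: G_def)
        moreover have "K * nrm W g' * ((1 + Cf) * N) * G \<le> 1/2 * nrm W g'"
        proof -
          have "2 * K * (1 + Cf) * G * N \<le> 1" using N by (simp add: P_def algebra_simps)
          then have "(2 * K * (1 + Cf) * G * N) * nrm W g' \<le> 1 * nrm W g'" using g'0 by (rule mult_right_mono)
          then show ?thesis by (simp add: algebra_simps)
        qed
        ultimately show ?thesis using dg by linarith
      qed
      then have "K * nrm W g' * ((1 + Cf) * N) * G \<le> K * (2 * G) * ((1 + Cf) * N) * G"
        using K0 Cf N G by (intro mult_right_mono mult_left_mono) auto
      with dg have dg2: "nrm W (g' - g x) \<le> K * (2 * G) * ((1 + Cf) * N) * G" by linarith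
      \<comment> \<open>In the difference equation, \<open>g'\<close> is replaced by
        \<open>g x\<close> and the increment of \<open>f\<close> by its differential, one at a
        time.\<close>
      have split: "d (x + h) [] - d x [] - e x [] h = B2 (B1 (g' - g x) \<Delta>) (g x) + B2 (B1 (g x) (\<Delta> - f x [h])) (g x)"
      proof -
        have 1: "B1 (g' - g x) \<Delta> = B1 g' \<Delta> - B1 (g x) \<Delta>"
          using bdd_bilD(2)[OF B1 ns(3) c(3,4,1), of 1 "-1"] by simp
        have 2: "B1 (g x) (\<Delta> - f x [h]) = B1 (g x) \<Delta> - B1 (g x) (f x [h])"
          using bdd_bilD(3)[OF B1 ns(2) c(4,1,2), of 1 "-1"] by simp
        have 3: "B2 (B1 g' \<Delta> - B1 (g x) \<Delta>) (g x) = B2 (B1 g' \<Delta>) (g x) - B2 (B1 (g x) \<Delta>) (g x)"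
          using bdd_bilD(2)[OF B2 ns(4) bdd_bilD(1)[OF B1 c(3,1)] bdd_bilD(1)[OF B1 c(4,1)] c(4), of 1 "-1"] by simp
        have 4: "B2 (B1 (g x) \<Delta> - B1 (g x) (f x [h])) (g x) = B2 (B1 (g x) \<Delta>) (g x) - B2 (B1 (g x) (f x [h])) (g x)"
          using bdd_bilD(2)[OF B2 ns(4) bdd_bilD(1)[OF B1 c(4,1)] bdd_bilD(1)[OF B1 c(4,2)] c(4), of 1 "-1"] by simp
        show ?thesis unfolding 1 2 3 4 using eqh by (simp add: d0 e0[OF h(1)] g'_def)
      qed
      have t1: "nrm W (B2 (B1 (g' - g x) \<Delta>) (g x)) \<le> (2 * K * K * G * G * G * (1 + Cf) * (1 + Cf)) * (\<tau> * N)"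
      proof -
        have "nrm W (B2 (B1 (g' - g x) \<Delta>) (g x)) \<le> K * nrm W (g' - g x) * nrm V \<Delta> * G"
          unfolding G_def by (rule K[OF c(6,1,4)])
        also have "\<dots> \<le> K * (K * (2 * G) * ((1 + Cf) * N) * G) * ((1 + Cf) * N) * G"
          using dg2 \<Delta> \<Delta>0 K0 G Cf N nrm_ge0[OF ns(3) c(6)] by (intro mult_mono) auto
        also have "\<dots> = (2 * K * K * G * G * G * (1 + Cf) * (1 + Cf)) * (N * N)" by simp
        also have "\<dots> \<le> (2 * K * K * G * G * G * (1 + Cf) * (1 + Cf)) * (\<tau> * N)"
          using N K0 G Cf by (intro mult_left_mono mult_right_mono) auto
        finally show ?thesis .
      qed
      have t2: "nrm W (B2 (B1 (g x) (\<Delta> - f x [h])) (g x)) \<le> (K * G * G) * (\<tau> * N)"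
      proof -
        have "nrm W (B2 (B1 (g x) (\<Delta> - f x [h])) (g x)) \<le> K * G * nrm V (\<Delta> - f x [h]) * G"
          unfolding G_def by (rule K[OF c(4,5,4)])
        also have "\<dots> \<le> K * G * (\<tau> * N) * G" using r K0 G by (intro mult_right_mono mult_left_mono) auto
        finally show ?thesis by (simp add: ac_simps)
      qed
      have "nrm W (d (x + h) [] - d x [] - e x [] h) \<le> (M - 1) * (\<tau> * N)"
        unfolding split using t1 t2 nrm_triangle[OF ns(3) bdd_bilD(1)[OF B2 bdd_bilD(1)[OF B1 c(6,1)] c(4)]
          bdd_bilD(1)[OF B2 bdd_bilD(1)[OF B1 c(4,5)] c(4)]] by (simp add: M_def distrib_right)
      also have "\<dots> \<le> M * (\<tau> * N)" using \<tau> N by (intro mult_right_mono) auto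
      also have "\<dots> \<le> \<epsilon> * N" using mult_right_mono[OF \<tau>(3) N(1)] by (simp add: mult.assoc)
      finally show ?thesis by (simp add: N_def)
    qed
    then show ?thesis using \<delta>1(1) \<tau>(1) P by (intro exI[of _ "min \<delta>1 (min \<tau> (1 / P))"]) auto
  qed
  have "jetn n E W U d" for n
  proof (induction n)
    case 0
    have "bnd 0 E W (nrm W (g x)) (d x)" if "x \<in> U" for x using g[OF that] by (auto simp: bnd_def d0)
    then have "mlin 0 E W (d x)" if "x \<in> U" for x
      using that nrm_ge0[OF ns(3) g[OF that]] by (auto simp: mlin_def)
    then show ?case by (auto intro: jetnI)
  next
    case (Suc n)
    \<comment> \<open>Currying costs one order of \<open>f\<close>, which has jets of every order,
      but none of \<open>g\<close>.\<close>
    have "jetn (Suc n) E V U f" using f by (simp add: jet_def)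
    note jf = jetn_cur[OF ns(1,2) this U]
    have "jetn n E (blin E W) U e"
      unfolding e_def
      by (intro jetn_leib[OF C2] jetn_leib[OF C1] jf Suc normed_blin ns)
    then show ?case by (rule jetn_uncur[OF ns(1,3) _ U]) (use ds d0 g base in auto)
  qed
  then have "jet E W U d" by (simp add: jet_def)
  moreover have "d x [h] = B2 (B1 (g x) (f x [h])) (g x)" if "h \<in> carr E" for x h
    using ds[of x "[]" h] e0[OF that] by simp
  ultimately show thesis using that d0 by blast
qed

section \<open>Smoothness and derivatives from jets\<close>

lemma multilin_nrm_le:
  assumes "normed_ns E" "C \<ge> 0" "\<And>vs. vs \<in> args k E \<Longrightarrow> nrm F (T vs) \<le> C * pnrm E vs"
  shows "nrm (multilin k E F) T \<le> C"
  unfolding multilin_def nspace.simps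
proof (rule cSup_least)
  have "replicate k 0 \<in> args k E \<and> (\<forall>v\<in>set (replicate k 0). nrm E v \<le> 1)"
    using ns_zero[OF assms(1)] nrm_zero[OF assms(1)] by (auto simp: args_def)
  then show "{nrm F (T vs) |vs. vs \<in> args k E \<and> (\<forall>v\<in>set vs. nrm E v \<le> 1)} \<noteq> {}" by blast
  fix y assume "y \<in> {nrm F (T vs) |vs. vs \<in> args k E \<and> (\<forall>v\<in>set vs. nrm E v \<le> 1)}"
  then obtain vs where vs: "y = nrm F (T vs)" "vs \<in> args k E" "\<forall>v\<in>set vs. nrm E v \<le> 1" by blast
  have "pnrm E ws \<le> 1" if "set ws \<subseteq> carr E" "\<forall>v\<in>set ws. nrm E v \<le> 1" for ws
    using that
  proof (induction ws)
    case (Cons w ws)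
    then have "pnrm E ws \<le> 1" "nrm E w \<le> 1" "0 \<le> nrm E w" "0 \<le> pnrm E ws"
      using nrm_ge0[OF assms(1)] pnrm_ge0[OF assms(1), of ws] by auto
    then show ?case using mult_mono[of "nrm E w" 1 "pnrm E ws" 1] by simp
  qed simp
  then have "pnrm E vs \<le> 1" using vs by (auto simp: args_def)
  then show "y \<le> C" using assms(3)[OF vs(2)] mult_left_mono[of "pnrm E vs" 1 C] assms(2) vs(1) by simp
qed

text \<open>The entries of \<open>d\<close> at lists of length \<open>k\<close> form the derivative
  of order \<open>k\<close>; setting them to 0 off \<open>args k E\<close> gives the representatives
  that \<open>multilin\<close> asks for.\<close>

lemma jet_smooth_map:
  assumes ns: "normed_ns E" "normed_ns F" and U: "U \<subseteq> carr E" and d: "jet E F U d" "\<And>x. x \<in> U \<Longrightarrow> d x [] = f x"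
  shows "smooth_map E F U f"
  unfolding smooth_map_def
proof (intro exI[of _ "\<lambda>k x vs. if vs \<in> args k E then d x vs else 0"] conjI ballI allI)
  fix x assume "x \<in> U"
  then show "(if [] \<in> args 0 E then d x [] else 0) = f x" using d(2) by (simp add: args_def)
next
  fix k x assume x: "x \<in> U"
  have j: "jetn n E F U d" for n using d(1) by (simp add: jet_def)
  note m = jetn_mlin[OF j x]
  let ?D = "\<lambda>k x vs. if vs \<in> args k E then d x vs else 0"
  obtain C where C: "C \<ge> 0" "bnd (Suc k) E F C (d x)" using m[of "Suc k"] by (auto simp: mlin_def)
  show carr: "?D k x \<in> carr (multilin k E F)" for k
  proof -
    obtain C where C: "C \<ge> 0" "bnd k E F C (d x)" using m[of k] by (auto simp: mlin_def)
    have "lin_on E F (\<lambda>v. ?D k x (vs[i := v]))" if vs: "vs \<in> args k E" and i: "i < k" for vs i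
    proof -
      have s: "set (take i vs) \<subseteq> carr E" "set (drop (Suc i) vs) \<subseteq> carr E" "length (take i vs) + length (drop (Suc i) vs) < k"
        using vs i set_take_subset[of i vs] set_drop_subset[of "Suc i" vs] by (auto simp: args_def)
      have "vs[i := v] = take i vs @ v # drop (Suc i) vs" for v
        using vs i by (simp add: args_def upd_conv_take_nth_drop)
      moreover have "vs[i := v] \<in> args k E" if "v \<in> carr E" for v
        using vs that set_update_subset_insert[of vs i v] by (auto simp: args_def)
      ultimately show ?thesis using mlin_slot[OF m s] ns(1) unfolding lin_on_def by (simp add: ns_add ns_scale)
    qed
    moreover have "\<forall>vs\<in>args k E. ?D k x vs \<in> carr F" using bndD(1)[OF C(2)] by (auto simp: args_def)
    moreover have "\<exists>C. \<forall>vs\<in>args k E. nrm F (?D k x vs) \<le> C * pnrm E vs"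
      using bndD(2)[OF C(2)] by (intro exI[of _ C]) (auto simp: args_def)
    ultimately show ?thesis unfolding multilin_def by simp
  qed
  show "has_fderiv E (multilin k E F) U (?D k) (\<lambda>h vs. ?D (Suc k) x (h # vs)) x"
    unfolding has_fderiv_def
  proof (intro conjI allI impI)
    show "lin_on E (multilin k E F) (\<lambda>h vs. ?D (Suc k) x (h # vs))"
    proof (rule lin_on_combI)
      fix h assume h: "h \<in> carr E"
      have eq: "(\<lambda>vs. ?D (Suc k) x (h # vs)) = (\<lambda>vs. if vs \<in> args k E then d x (h # vs) else 0)"
        using h by (auto simp: args_def fun_eq_iff)
      have "(\<lambda>vs. if vs \<in> args k E then d x (h # vs) else 0) \<in> carr (multilin k E F)"
      proof -
        have "lin_on E F (\<lambda>v. ?D (Suc k) x ((h # vs)[Suc i := v]))" if "vs \<in> args k E" "i < k" for vs i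
        proof -
          have "\<forall>vs\<in>args (Suc k) E. \<forall>i<Suc k. lin_on E F (\<lambda>v. ?D (Suc k) x (vs[i := v]))"
            using carr[of "Suc k"] unfolding multilin_def nspace.simps mem_Collect_eq by blast
          moreover have "h # vs \<in> args (Suc k) E" using that h by (simp add: args_def)
          ultimately show ?thesis using that(2) by blast
        qed
        then have "lin_on E F (\<lambda>v. ?D (Suc k) x (h # vs[i := v]))" if "vs \<in> args k E" "i < k" for vs i
          using that by (simp only: list_update.simps nat.case)
        moreover have "?D (Suc k) x (h # vs) = (if vs \<in> args k E then d x (h # vs) else 0)" for vs
          using h by (auto simp: args_def)
        ultimately have "lin_on E F (\<lambda>v. if vs[i := v] \<in> args k E then d x (h # vs[i := v]) else 0)" if "vs \<in> args k E" "i < k" for vs i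
          using that by simp
        moreover have "nrm F (d x (h # vs)) \<le> (C * nrm E h) * pnrm E vs \<and> d x (h # vs) \<in> carr F" if "vs \<in> args k E" for vs
          using bndD[OF C(2), of "h # vs"] that h by (simp add: args_def mult.assoc)
        ultimately show ?thesis unfolding multilin_def by (auto intro!: exI[of _ "C * nrm E h"])
      qed
      then show "(\<lambda>vs. ?D (Suc k) x (h # vs)) \<in> carr (multilin k E F)" unfolding eq .
    next
      fix a b h h' assume h: "h \<in> carr E" "h' \<in> carr E"
      have "d x ((a *\<^sub>R h + b *\<^sub>R h') # vs) = a *\<^sub>R d x (h # vs) + b *\<^sub>R d x (h' # vs)" if "vs \<in> args k E" for vs
        using lin_on_comb[OF mlin_slot[OF m[of "Suc k"], of "[]" vs] ns(1) h] that by (simp add: args_def)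
      then show "(\<lambda>vs. ?D (Suc k) x ((a *\<^sub>R h + b *\<^sub>R h') # vs)) =
          a *\<^sub>R (\<lambda>vs. ?D (Suc k) x (h # vs)) + b *\<^sub>R (\<lambda>vs. ?D (Suc k) x (h' # vs))"
        using h ns(1) by (auto simp: fun_eq_iff scaleR_fun_def args_def ns_add ns_scale)
    qed
    show "\<exists>C. \<forall>h\<in>carr E. nrm (multilin k E F) (\<lambda>vs. ?D (Suc k) x (h # vs)) \<le> C * nrm E h"
    proof (intro exI[of _ C] ballI)
      fix h assume h: "h \<in> carr E"
      show "nrm (multilin k E F) (\<lambda>vs. ?D (Suc k) x (h # vs)) \<le> C * nrm E h"
        by (rule multilin_nrm_le[OF ns(1)])
           (use C bndD(2)[OF C(2), of "h # _"] h nrm_ge0[OF ns(1) h] in \<open>auto simp: args_def mult.assoc\<close>)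
    qed
    fix \<epsilon> :: real assume \<epsilon>: "\<epsilon> > 0"
    obtain \<delta> where \<delta>: "\<delta> > 0" "\<And>h. h \<in> carr E \<Longrightarrow> x + h \<in> U \<Longrightarrow> nrm E h < \<delta> \<Longrightarrow>
      bnd k E F (\<epsilon> * nrm E h) (\<lambda>vs. d (x + h) vs - d x vs - d x (h # vs))"
      using jetn_diff[OF j x \<epsilon>] by blast
    show "\<exists>\<delta>>0. \<forall>h\<in>carr E. x + h \<in> U \<and> nrm E h < \<delta> \<longrightarrow>
      nrm (multilin k E F) (?D k (x + h) - ?D k x - (\<lambda>vs. ?D (Suc k) x (h # vs))) \<le> \<epsilon> * nrm E h"
    proof (intro exI[of _ \<delta>] conjI ballI impI)
      fix h assume h: "h \<in> carr E" "x + h \<in> U \<and> nrm E h < \<delta>"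
      show "nrm (multilin k E F) (?D k (x + h) - ?D k x - (\<lambda>vs. ?D (Suc k) x (h # vs))) \<le> \<epsilon> * nrm E h"
        by (rule multilin_nrm_le[OF ns(1)])
           (use \<delta>(2)[of h] h \<epsilon> nrm_ge0[OF ns(1) h(1)] in \<open>auto simp: args_def bnd_def\<close>)
    qed (rule \<delta>)
  qed
qed

lemma jetn_has_fderiv:
  assumes ns: "normed_ns E" "normed_ns F" and d: "jetn 1 E F U d" "x \<in> U"
  shows "has_fderiv E F U (\<lambda>x. d x []) (\<lambda>h. d x [h]) x"
proof -
  note m = jetn_mlin[OF d]
  obtain C where C: "C \<ge> 0" "bnd 1 E F C (d x)" using m by (auto simp: mlin_def)
  have 1: "lin_on E F (\<lambda>h. d x [h])" using mlin_slot[OF m, of "[]" "[]"] by simp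
  have 2: "\<forall>h\<in>carr E. nrm F (d x [h]) \<le> C * nrm E h" using bndD(2)[OF C(2), of "[_]"] by simp
  have 3: "\<exists>\<delta>>0. \<forall>h\<in>carr E. x + h \<in> U \<and> nrm E h < \<delta> \<longrightarrow> nrm F (d (x + h) [] - d x [] - d x [h]) \<le> \<epsilon> * nrm E h"
    if \<epsilon>: "\<epsilon> > 0" for \<epsilon>
  proof -
    obtain \<delta> where \<delta>: "\<delta> > 0" "\<And>h. h \<in> carr E \<Longrightarrow> x + h \<in> U \<Longrightarrow> nrm E h < \<delta> \<Longrightarrow>
      bnd 0 E F (\<epsilon> * nrm E h) (\<lambda>vs. d (x + h) vs - d x vs - d x (h # vs))"
      using jetn_diff[OF d[unfolded One_nat_def] \<epsilon>] by blast
    then show ?thesis by (intro exI[of _ \<delta>]) (auto simp: bnd_def)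
  qed
  show ?thesis unfolding has_fderiv_def using 1 2 3 by blast
qed

text \<open>Order 1 suffices for compatibility, where vector fields are differentiated once. A jet
  of order 1 makes no demand at lists of length two or more, so the value 0 is harmless
  there.\<close>

lemma smooth_map_jetn:
  assumes ns: "normed_ns E" "normed_ns F" and f: "smooth_map E F U f" and U: "U \<subseteq> carr E"
  obtains d where "jetn 1 E F U d" "\<And>x. d x [] = f x"
proof -
  obtain D where D0: "\<And>x. x \<in> U \<Longrightarrow> D 0 x [] = f x"
    and D: "\<And>k x. x \<in> U \<Longrightarrow> D k x \<in> carr (multilin k E F)"
    and Dd: "\<And>k x. x \<in> U \<Longrightarrow> has_fderiv E (multilin k E F) U (D k) (\<lambda>h vs. D (Suc k) x (h # vs)) x"
    using f unfolding smooth_map_def by blast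
  \<comment> \<open>The only list in \<open>args 0 E\<close> is empty, so the operator norm is the
    norm of a single value.\<close>
  have n0: "nrm (multilin 0 E F) T = nrm F (T [])" for T :: "'a list \<Rightarrow> 'b"
  proof -
    have "{nrm F (T vs) |vs. vs \<in> args 0 E \<and> (\<forall>v\<in>set vs. nrm E v \<le> 1)} = {nrm F (T [])}"
      by (auto simp: args_def)
    then show ?thesis by (simp add: multilin_def)
  qed
  define d where "d = (\<lambda>x vs. case vs of [] \<Rightarrow> f x | v # ws \<Rightarrow> if ws = [] then D 1 x [v] else 0)"
  have "jetn 1 E F U d"
  proof (rule jetnI)
    fix x assume x: "x \<in> U"
    have fx: "f x \<in> carr F" using D[OF x, of 0] D0[OF x] by (auto simp: multilin_def args_def)
    have D1: "D 1 x [v] \<in> carr F" if "v \<in> carr E" for v using D[OF x, of 1] that by (auto simp: multilin_def args_def)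
    obtain C where C: "\<And>v. v \<in> carr E \<Longrightarrow> nrm F (D 1 x [v]) \<le> C * nrm E v"
      using Dd[OF x, of 0] unfolding has_fderiv_def n0 by auto
    have lin: "lin_on E F (\<lambda>v. D 1 x [v])"
    proof -
      have "lin_on E (multilin 0 E F) (\<lambda>h vs. D 1 x (h # vs))" using Dd[OF x, of 0] by (simp add: has_fderiv_def)
      then show ?thesis unfolding lin_on_def using D1 by (auto simp: fun_eq_iff scaleR_fun_def)
    qed
    define M where "M = max \<bar>C\<bar> (nrm F (f x))"
    have "C * nrm E v \<le> M * nrm E v" if "v \<in> carr E" for v
      using nrm_ge0[OF ns(1) that] by (intro mult_right_mono) (auto simp: M_def)
    with C have C': "nrm F (D 1 x [v]) \<le> M * nrm E v" if "v \<in> carr E" for v using that by (meson order_trans)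
    have "bnd 1 E F M (d x)" unfolding bnd_def
    proof (intro allI impI)
      fix vs assume vs: "set vs \<subseteq> carr E" "length vs \<le> 1"
      then consider "vs = []" | v where "vs = [v]" by (cases vs; cases "tl vs") auto
      then show "d x vs \<in> carr F \<and> nrm F (d x vs) \<le> M * pnrm E vs"
        by cases (use vs fx D1 C' in \<open>auto simp: d_def M_def\<close>)
    qed
    moreover have "lin_on E F (\<lambda>v. d x (xs @ v # ys))" if "length xs + length ys < 1" for xs ys
      using lin that by (simp add: d_def)
    moreover have "M \<ge> 0" by (simp add: M_def)
    ultimately show "mlin 1 E F (d x)" unfolding mlin_def by blast
  next
    fix m x and \<epsilon> :: real assume m: "1 = Suc m" and x: "x \<in> U" and \<epsilon>: "\<epsilon> > 0"
    obtain \<delta> where \<delta>: "\<delta> > 0" "\<And>h. h \<in> carr E \<Longrightarrow> x + h \<in> U \<Longrightarrow> nrm E h < \<delta> \<Longrightarrow>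
      nrm F (D 0 (x + h) [] - D 0 x [] - D 1 x [h]) \<le> \<epsilon> * nrm E h"
      using Dd[OF x, of 0] \<epsilon> unfolding has_fderiv_def n0 by auto
    have c: "d (x + h) [] - d x [] - d x [h] \<in> carr F" if "h \<in> carr E" "x + h \<in> U" for h
      using D[OF x, of 0] D[OF that(2), of 0] D[OF x, of 1] D0[OF x] D0[OF that(2)] that ns
      by (auto simp: multilin_def args_def d_def intro!: ns_diff)
    show "\<exists>\<delta>>0. \<forall>h\<in>carr E. x + h \<in> U \<longrightarrow> nrm E h < \<delta> \<longrightarrow>
      bnd m E F (\<epsilon> * nrm E h) (\<lambda>vs. d (x + h) vs - d x vs - d x (h # vs))"
      using \<delta> c m D0 x by (intro exI[of _ \<delta>]) (auto simp: bnd_def d_def)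
  qed
  moreover have "d x [] = f x" for x by (simp add: d_def)
  ultimately show thesis using that by blast
qed

text \<open>Both derivatives are tested on \<open>t *\<^sub>R h\<close> with small t; dividing by t
  brings the norm of \<open>f' h - f'' h\<close> below every \<epsilon>. The neighbourhood of
  \<open>x\<close> inside \<open>U\<close> supplies the test points. This makes the choice in
  \<open>fderiv\<close> immaterial.\<close>

lemma has_fderiv_unique:
  assumes ns: "normed_ns E" "normed_ns F" and f: "has_fderiv E F U f f' x" "has_fderiv E F U f f'' x"
    and h: "h \<in> carr E" and op: "\<eta> > 0" "\<And>k. k \<in> carr E \<Longrightarrow> nrm E k < \<eta> \<Longrightarrow> x + k \<in> U"
    and fU: "\<And>y. y \<in> U \<Longrightarrow> f y \<in> carr F"
  shows "f' h = f'' h"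
proof -
  have l: "lin_on E F f'" "lin_on E F f''" using f by (auto simp: has_fderiv_def)
  note c = lin_onD(1)[OF l(1) h] lin_onD(1)[OF l(2) h]
  \<comment> \<open>The \<open>+ 1\<close> avoids a division by zero when \<open>h\<close> has norm
    0.\<close>
  define N where "N = nrm E h + 1"
  have N: "N > 0" "nrm E h \<le> N" using nrm_ge0[OF ns(1) h] by (auto simp: N_def)
  have "nrm F (f' h - f'' h) \<le> \<epsilon>" if \<epsilon>: "\<epsilon> > 0" for \<epsilon>
  proof -
    define e where "e = \<epsilon> / (2 * N)"
    have e: "e > 0" using N \<epsilon> by (simp add: e_def)
    obtain \<delta>1 where \<delta>1: "\<delta>1 > 0" "\<And>h. h \<in> carr E \<Longrightarrow> x + h \<in> U \<Longrightarrow> nrm E h < \<delta>1 \<Longrightarrow>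
        nrm F (f (x + h) - f x - f' h) \<le> e * nrm E h" using f(1) e unfolding has_fderiv_def by blast
    obtain \<delta>2 where \<delta>2: "\<delta>2 > 0" "\<And>h. h \<in> carr E \<Longrightarrow> x + h \<in> U \<Longrightarrow> nrm E h < \<delta>2 \<Longrightarrow>
        nrm F (f (x + h) - f x - f'' h) \<le> e * nrm E h" using f(2) e unfolding has_fderiv_def by blast
    define t where "t = min \<eta> (min \<delta>1 \<delta>2) / (2 * N)"
    have t: "t > 0" using N \<delta>1 \<delta>2 op by (simp add: t_def)
    let ?k = "t *\<^sub>R h"
    have k: "?k \<in> carr E" "nrm E ?k = t * nrm E h" using ns h t by (auto simp: ns_scale nrm_scale)
    have "t * nrm E h \<le> t * N" using N t by simp
    also have "\<dots> = min \<eta> (min \<delta>1 \<delta>2) / 2" using N by (simp add: t_def)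
    also have "\<dots> < min \<eta> (min \<delta>1 \<delta>2)" using op(1) \<delta>1(1) \<delta>2(1) by (simp add: min_def)
    finally have kn: "nrm E ?k < \<eta>" "nrm E ?k < \<delta>1" "nrm E ?k < \<delta>2" using k by auto
    have xk: "x + ?k \<in> U" using op(2)[OF k(1) kn(1)] .
    have x: "x \<in> U" using op(2)[OF ns_zero[OF ns(1)]] nrm_zero[OF ns(1)] op(1) by simp
    let ?a = "f (x + ?k) - f x"
    have ck: "f' ?k \<in> carr F" "f'' ?k \<in> carr F" "?a \<in> carr F"
      using lin_onD(1)[OF l(1) k(1)] lin_onD(1)[OF l(2) k(1)] fU xk x ns by (auto intro!: ns_diff)
    have "t * nrm F (f' h - f'' h) = nrm F (t *\<^sub>R (f' h - f'' h))" using t c ns by (simp add: nrm_scale ns_diff)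
    also have "t *\<^sub>R (f' h - f'' h) = (?a - f'' ?k) - (?a - f' ?k)"
      using lin_onD(3)[OF l(1) h] lin_onD(3)[OF l(2) h] by (simp add: scaleR_diff_right)
    also have "nrm F \<dots> \<le> nrm F (?a - f'' ?k) + nrm F (?a - f' ?k)" by (rule nrm_diff[OF ns(2) ns_diff[OF ns(2) ck(3,2)] ns_diff[OF ns(2) ck(3,1)]])
    also have "\<dots> \<le> e * nrm E ?k + e * nrm E ?k" using \<delta>1(2)[OF k(1) xk kn(2)] \<delta>2(2)[OF k(1) xk kn(3)] by simp
    also have "\<dots> = t * (2 * e * nrm E h)" using k by simp
    also have "\<dots> \<le> t * (2 * e * N)" using t e N by simp
    also have "2 * e * N = \<epsilon>" using N by (simp add: e_def)
    finally show ?thesis using t by simp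
  qed
  then have "nrm F (f' h - f'' h) \<le> 0" using field_le_epsilon[of "nrm F (f' h - f'' h)" 0] by simp
  then have "nrm F (f' h - f'' h) = 0" using nrm_ge0[OF ns(2) ns_diff[OF ns(2) c]] by simp
  then show ?thesis using nrm_eq0[OF ns(2) ns_diff[OF ns(2) c]] by simp
qed

section \<open>The normed space of bounded symmetric bilinear maps\<close>

lemma sb_nrm_le:
  assumes "normed_ns E" "C \<ge> 0" "\<And>u v. u \<in> carr E \<Longrightarrow> v \<in> carr E \<Longrightarrow> nrm F (B u v) \<le> C * nrm E u * nrm E v"
  shows "nrm (sym_bilin E F) B \<le> C"
  unfolding sym_bilin_def nspace.simps
proof (rule cSup_least)
  show "{nrm F (B u v) |u v. u \<in> carr E \<and> v \<in> carr E \<and> nrm E u \<le> 1 \<and> nrm E v \<le> 1} \<noteq> {}"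
    using ns_zero[OF assms(1)] nrm_zero[OF assms(1)] by fastforce
  fix y assume "y \<in> {nrm F (B u v) |u v. u \<in> carr E \<and> v \<in> carr E \<and> nrm E u \<le> 1 \<and> nrm E v \<le> 1}"
  then obtain u v where uv: "y = nrm F (B u v)" "u \<in> carr E" "v \<in> carr E" "nrm E u \<le> 1" "nrm E v \<le> 1" by blast
  have "C * nrm E u * nrm E v \<le> C * 1 * 1"
    using uv assms(2) nrm_ge0[OF assms(1)] by (intro mult_mono) auto
  then show "y \<le> C" using assms(3)[OF uv(2,3)] uv(1) by simp
qed

lemma sbI:
  assumes "normed_ns E" "\<And>u v. u \<in> carr E \<Longrightarrow> v \<in> carr E \<Longrightarrow> B u v \<in> carr F"
    "\<And>a b u v w. u \<in> carr E \<Longrightarrow> v \<in> carr E \<Longrightarrow> w \<in> carr E \<Longrightarrow> B (a *\<^sub>R u + b *\<^sub>R v) w = a *\<^sub>R B u w + b *\<^sub>R B v w"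
    "\<And>u v. u \<in> carr E \<Longrightarrow> v \<in> carr E \<Longrightarrow> B u v = B v u"
    "\<And>u v. u \<in> carr E \<Longrightarrow> v \<in> carr E \<Longrightarrow> nrm F (B u v) \<le> C * nrm E u * nrm E v"
    "\<And>u v. u \<notin> carr E \<or> v \<notin> carr E \<Longrightarrow> B u v = 0"
  shows "B \<in> carr (sym_bilin E F)"
proof -
  have 1: "lin_on E F (\<lambda>u. B u v)" if "v \<in> carr E" for v by (rule lin_on_combI) (use assms that in auto)
  have 2: "lin_on E F (\<lambda>v. B u v)" if "u \<in> carr E" for u
    using 1[OF that] assms(1,4) that unfolding lin_on_def by (simp add: ns_add ns_scale)
  show ?thesis unfolding sym_bilin_def using 1 2 assms(4-) by (auto intro!: exI[of _ C])
qed

lemma sb_carr: "B \<in> carr (sym_bilin E F) \<Longrightarrow> u \<in> carr E \<Longrightarrow> v \<in> carr E \<Longrightarrow> B u v \<in> carr F"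
  and sb_out: "B \<in> carr (sym_bilin E F) \<Longrightarrow> u \<notin> carr E \<or> v \<notin> carr E \<Longrightarrow> B u v = 0"
  and sb_sym: "B \<in> carr (sym_bilin E F) \<Longrightarrow> u \<in> carr E \<Longrightarrow> v \<in> carr E \<Longrightarrow> B u v = B v u"
  and sb_lin: "B \<in> carr (sym_bilin E F) \<Longrightarrow> v \<in> carr E \<Longrightarrow> lin_on E F (\<lambda>u. B u v)"
  by (auto simp: sym_bilin_def lin_on_def)

lemma sb_lin2: "B \<in> carr (sym_bilin E F) \<Longrightarrow> u \<in> carr E \<Longrightarrow> lin_on E F (B u)"
  by (auto simp: sym_bilin_def)

lemma sb_ge0_upper:
  assumes "normed_ns E" "normed_ns F" "B \<in> carr (sym_bilin E F)"
  shows "0 \<le> nrm (sym_bilin E F) B"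
    and "u \<in> carr E \<Longrightarrow> v \<in> carr E \<Longrightarrow> nrm E u \<le> 1 \<Longrightarrow> nrm E v \<le> 1 \<Longrightarrow> nrm F (B u v) \<le> nrm (sym_bilin E F) B"
proof -
  obtain C where C: "\<And>u v. u \<in> carr E \<Longrightarrow> v \<in> carr E \<Longrightarrow> nrm F (B u v) \<le> C * nrm E u * nrm E v"
    using assms(3) unfolding sym_bilin_def nspace.simps mem_Collect_eq by blast
  show *: "nrm F (B u v) \<le> nrm (sym_bilin E F) B" if "u \<in> carr E" "v \<in> carr E" "nrm E u \<le> 1" "nrm E v \<le> 1" for u v
    unfolding sym_bilin_def nspace.simps
  proof (rule cSup_upper)
    show "nrm F (B u v) \<in> {nrm F (B u v) |u v. u \<in> carr E \<and> v \<in> carr E \<and> nrm E u \<le> 1 \<and> nrm E v \<le> 1}" using that by blast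
    show "bdd_above {nrm F (B u v) |u v. u \<in> carr E \<and> v \<in> carr E \<and> nrm E u \<le> 1 \<and> nrm E v \<le> 1}"
    proof (rule bdd_aboveI[of _ "\<bar>C\<bar>"], clarify)
      fix u v assume z: "u \<in> carr E" "nrm E u \<le> 1" "v \<in> carr E" "nrm E v \<le> 1"
      have "C * nrm E u * nrm E v \<le> \<bar>C\<bar> * 1 * 1" using z nrm_ge0[OF assms(1)] by (intro mult_mono) auto
      then show "nrm F (B u v) \<le> \<bar>C\<bar>" using C[OF z(1,3)] by simp
    qed
  qed
  have "B 0 0 = 0" using lin_on_zero[OF sb_lin[OF assms(3) ns_zero[OF assms(1)]] assms(1)] .
  then show "0 \<le> nrm (sym_bilin E F) B" using *[of 0 0] assms ns_zero by auto
qed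

lemma sb_apply:
  assumes "normed_ns E" "normed_ns F" "B \<in> carr (sym_bilin E F)" "u \<in> carr E" "v \<in> carr E"
  shows "nrm F (B u v) \<le> nrm (sym_bilin E F) B * nrm E u * nrm E v"
proof (cases "nrm E u = 0 \<or> nrm E v = 0")
  case True
  then have "u = 0 \<or> v = 0" using nrm_eq0[OF assms(1)] assms by blast
  then have "B u v = 0"
    using lin_on_zero[OF sb_lin[OF assms(3,5)] assms(1)] lin_on_zero[OF sb_lin2[OF assms(3,4)] assms(1)] by auto
  then show ?thesis using True assms by auto
next
  case False
  define M where "M = nrm E u"
  define N where "N = nrm E v"
  have N: "M > 0" "N > 0" using False nrm_ge0[OF assms(1)] assms by (auto simp: N_def M_def order_less_le)
  let ?x = "(1 / M) *\<^sub>R u" and ?y = "(1 / N) *\<^sub>R v"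
  have y: "?x \<in> carr E" "nrm E ?x = 1" "?y \<in> carr E" "nrm E ?y = 1"
    using N assms by (auto simp: ns_scale nrm_scale N_def M_def)
  have "nrm F (B ?x ?y) \<le> nrm (sym_bilin E F) B" using sb_ge0_upper(2)[OF assms(1-3)] y by simp
  moreover have "B ?x ?y = (1 / M * (1 / N)) *\<^sub>R B u v"
    using lin_onD(3)[OF sb_lin[OF assms(3) y(3)] assms(4)] lin_onD(3)[OF sb_lin2[OF assms(3,4)] assms(5)] by simp
  moreover have "nrm F ((1 / M * (1 / N)) *\<^sub>R B u v) = 1 / M * (1 / N) * nrm F (B u v)"
    using N assms(2) sb_carr[OF assms(3-5)] by (simp add: nrm_scale)
  ultimately have "1 / M * (1 / N) * nrm F (B u v) \<le> nrm (sym_bilin E F) B" by simp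
  then show ?thesis using N by (simp add: N_def[symmetric] M_def[symmetric] field_simps)
qed

lemma normed_sb:
  assumes "normed_ns E" "normed_ns F"
  shows "normed_ns (sym_bilin E F)"
proof (rule normed_nsI)
  show "0 \<in> carr (sym_bilin E F)"
    by (rule sbI[of _ _ _ 0]) (use assms ns_zero in auto)
next
  fix S T assume ST: "S \<in> carr (sym_bilin E F)" "T \<in> carr (sym_bilin E F)"
  have le: "nrm F (S x y + T x y) \<le> (nrm (sym_bilin E F) S + nrm (sym_bilin E F) T) * nrm E x * nrm E y"
    if "x \<in> carr E" "y \<in> carr E" for x y
    using nrm_triangle[OF assms(2) sb_carr[OF ST(1) that] sb_carr[OF ST(2) that]]
      sb_apply[OF assms ST(1) that] sb_apply[OF assms ST(2) that] by (simp add: algebra_simps)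
  show "S + T \<in> carr (sym_bilin E F)"
    by (rule sbI[OF assms(1), of _ _ "nrm (sym_bilin E F) S + nrm (sym_bilin E F) T"])
       (use ST le assms sb_sym[OF ST(1)] sb_sym[OF ST(2)] in
         \<open>auto simp: sb_out sb_carr lin_on_comb[OF sb_lin] ns_add algebra_simps\<close>)
  show "nrm (sym_bilin E F) (S + T) \<le> nrm (sym_bilin E F) S + nrm (sym_bilin E F) T"
    by (rule sb_nrm_le) (use assms ST le sb_ge0_upper(1)[OF assms] in auto)
next
  fix c S assume S: "S \<in> carr (sym_bilin E F)"
  have le: "nrm F (c *\<^sub>R S x y) \<le> (\<bar>c\<bar> * nrm (sym_bilin E F) S) * nrm E x * nrm E y" if "x \<in> carr E" "y \<in> carr E" for x y
    using nrm_scale[OF assms(2) sb_carr[OF S that]] mult_left_mono[OF sb_apply[OF assms S that], of "\<bar>c\<bar>"]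
    by (simp add: mult.assoc)
  show cS: "c *\<^sub>R S \<in> carr (sym_bilin E F)"
    by (rule sbI[OF assms(1), of _ _ "\<bar>c\<bar> * nrm (sym_bilin E F) S"])
       (use S le assms sb_sym[OF S] in \<open>auto simp: scaleR_fun_def sb_out sb_carr lin_on_comb[OF sb_lin] ns_scale algebra_simps\<close>)
  have 1: "nrm (sym_bilin E F) (c *\<^sub>R S) \<le> \<bar>c\<bar> * nrm (sym_bilin E F) S"
    by (rule sb_nrm_le) (use assms S le sb_ge0_upper(1)[OF assms] in \<open>auto simp: scaleR_fun_def\<close>)
  have "\<bar>c\<bar> * nrm (sym_bilin E F) S \<le> nrm (sym_bilin E F) (c *\<^sub>R S)"
  proof (cases "c = 0")
    case True
    then show ?thesis using sb_ge0_upper(1)[OF assms cS] by simp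
  next
    case False
    have "nrm (sym_bilin E F) S \<le> nrm (sym_bilin E F) (c *\<^sub>R S) / \<bar>c\<bar>"
    proof (rule sb_nrm_le)
      fix x y assume x: "x \<in> carr E" "y \<in> carr E"
      have "\<bar>c\<bar> * nrm F (S x y) \<le> nrm (sym_bilin E F) (c *\<^sub>R S) * nrm E x * nrm E y"
        using sb_apply[OF assms cS x] nrm_scale[OF assms(2) sb_carr[OF S x]] by (simp add: scaleR_fun_def)
      then show "nrm F (S x y) \<le> nrm (sym_bilin E F) (c *\<^sub>R S) / \<bar>c\<bar> * nrm E x * nrm E y"
        using False by (simp add: field_simps)
    qed (use assms sb_ge0_upper(1)[OF assms cS] in auto)
    then show ?thesis using False by (simp add: field_simps)
  qed
  with 1 show "nrm (sym_bilin E F) (c *\<^sub>R S) = \<bar>c\<bar> * nrm (sym_bilin E F) S" by simp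
next
  fix S assume S: "S \<in> carr (sym_bilin E F)" "nrm (sym_bilin E F) S = 0"
  show "S = 0"
  proof (intro ext)
    fix x y show "S x y = 0 x y"
    proof (cases "x \<in> carr E \<and> y \<in> carr E")
      case True
      then have "nrm F (S x y) \<le> 0" using sb_apply[OF assms S(1)] S(2) by simp
      moreover have "S x y \<in> carr F" using sb_carr[OF S(1)] True by simp
      ultimately show ?thesis using nrm_eq0[OF assms(2)] nrm_ge0[OF assms(2)] by force
    next
      case False
      then show ?thesis using sb_out[OF S(1)] by simp
    qed
  qed
qed

section \<open>Constructions with bounded maps\<close>

lemma bdd_bil_comp:
  assumes B: "bdd_bil F G H B" and S: "bdd_lin F' F S" and T: "bdd_lin G' G T" and R: "bdd_lin H H' R"
    and ns: "normed_ns F" "normed_ns G" "normed_ns H" "normed_ns F'" "normed_ns G'"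
  shows "bdd_bil F' G' H' (\<lambda>x y. R (B (S x) (T y)))"
proof -
  obtain KB where KB: "KB \<ge> 0" "\<And>x y. x \<in> carr F \<Longrightarrow> y \<in> carr G \<Longrightarrow> nrm H (B x y) \<le> KB * nrm F x * nrm G y"
    using bdd_bil_bound[OF B] by blast
  obtain KS where KS: "KS \<ge> 0" "\<And>x. x \<in> carr F' \<Longrightarrow> nrm F (S x) \<le> KS * nrm F' x" and S': "lin_on F' F S"
    using S unfolding bdd_lin_def by blast
  obtain KT where KT: "KT \<ge> 0" "\<And>x. x \<in> carr G' \<Longrightarrow> nrm G (T x) \<le> KT * nrm G' x" and T': "lin_on G' G T"
    using T unfolding bdd_lin_def by blast
  obtain KR where KR: "KR \<ge> 0" "\<And>x. x \<in> carr H \<Longrightarrow> nrm H' (R x) \<le> KR * nrm H x" and R': "lin_on H H' R"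
    using R unfolding bdd_lin_def by blast
  show ?thesis
  proof (rule bdd_bilI[OF ns(4,5)])
    fix x y assume xy: "x \<in> carr F'" "y \<in> carr G'"
    note Sx = lin_onD(1)[OF S' xy(1)] and Ty = lin_onD(1)[OF T' xy(2)]
    show "R (B (S x) (T y)) \<in> carr H'" using lin_onD(1)[OF R' bdd_bilD(1)[OF B Sx Ty]] .
    have "nrm H' (R (B (S x) (T y))) \<le> KR * nrm H (B (S x) (T y))" by (rule KR(2)[OF bdd_bilD(1)[OF B Sx Ty]])
    also have "\<dots> \<le> KR * (KB * nrm F (S x) * nrm G (T y))" by (rule mult_left_mono[OF KB(2)[OF Sx Ty] KR(1)])
    also have "\<dots> \<le> KR * (KB * (KS * nrm F' x) * (KT * nrm G' y))"
      using KS KT KB KR xy nrm_ge0[OF ns(1) Sx] nrm_ge0[OF ns(2) Ty] nrm_ge0[OF ns(4) xy(1)]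
      by (intro mult_left_mono mult_mono) auto
    finally show "nrm H' (R (B (S x) (T y))) \<le> (KR * KB * KS * KT) * nrm F' x * nrm G' y" by (simp add: mult_ac)
  qed (auto simp: lin_on_comb[OF S' ns(4)] lin_on_comb[OF T' ns(5)] lin_on_comb[OF R' ns(3)] lin_onD(1)[OF S'] lin_onD(1)[OF T']
      bdd_bilD(1)[OF B] bdd_bilD(2)[OF B ns(1)] bdd_bilD(3)[OF B ns(2)])
qed

lemma bdd_lin_comp:
  assumes S: "bdd_lin E F S" and T: "bdd_lin F G T" and ns: "normed_ns E"
  shows "bdd_lin E G (\<lambda>x. T (S x))"
proof -
  obtain KS where KS: "KS \<ge> 0" "\<And>x. x \<in> carr E \<Longrightarrow> nrm F (S x) \<le> KS * nrm E x" and S': "lin_on E F S"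
    using S unfolding bdd_lin_def by blast
  obtain KT where KT: "KT \<ge> 0" "\<And>x. x \<in> carr F \<Longrightarrow> nrm G (T x) \<le> KT * nrm F x" and T': "lin_on F G T"
    using T unfolding bdd_lin_def by blast
  show ?thesis
  proof (rule bdd_linI[OF _ ns])
    show "lin_on E G (\<lambda>x. T (S x))" using S' T' by (simp add: lin_on_def)
    fix x assume x: "x \<in> carr E"
    have "nrm G (T (S x)) \<le> KT * nrm F (S x)" using KT(2) lin_onD(1)[OF S' x] by blast
    also have "\<dots> \<le> KT * (KS * nrm E x)" using KS(2)[OF x] KT(1) by (rule mult_left_mono)
    finally show "nrm G (T (S x)) \<le> (KT * KS) * nrm E x" by (simp add: mult.assoc)
  qed
qed

lemma bdd_lin_id: "normed_ns E \<Longrightarrow> bdd_lin E E (\<lambda>x. x)"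
  by (rule bdd_linI[where C = 1]) (auto simp: lin_on_def)

lemma bdd_lin_neg: "bdd_lin E F T \<Longrightarrow> normed_ns E \<Longrightarrow> normed_ns F \<Longrightarrow> bdd_lin E F (\<lambda>x. - T x)"
  unfolding bdd_lin_def lin_on_def by (auto simp: ns_uminus nrm_uminus)

lemma bdd_bil_apply:
  assumes "normed_ns E" "normed_ns F"
  shows "bdd_bil (blin E F) E F (\<lambda>T x. T x)"
proof (rule bdd_bilI[OF normed_blin[OF assms] assms(1), where C = 1])
  fix T x assume "T \<in> carr (blin E F)" "x \<in> carr E"
  then show "nrm F (T x) \<le> 1 * nrm (blin E F) T * nrm E x" using blin_apply[OF assms] by simp
qed (auto simp: scaleR_fun_def lin_onD(1)[OF blin_lin] lin_on_comb[OF blin_lin assms(1)])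

lemma bdd_bil_blin_comp:
  assumes "normed_ns E" "normed_ns F" "normed_ns G"
  shows "bdd_bil (blin F G) (blin E F) (blin E G) (\<lambda>L T v. if v \<in> carr E then L (T v) else 0)"
  by (rule bdd_bil_blin_right[OF assms(1) normed_blin[OF assms(2,3)] assms(2,3) bdd_bil_apply[OF assms(2,3)]])

lemma bdd_lin_curry:
  assumes ns: "normed_ns F" "normed_ns G" "normed_ns H" and B: "bdd_bil F G H B"
  shows "bdd_lin F (blin G H) (\<lambda>x y. if y \<in> carr G then B x y else 0)"
proof -
  obtain K where K: "K \<ge> 0" "\<And>x y. x \<in> carr F \<Longrightarrow> y \<in> carr G \<Longrightarrow> nrm H (B x y) \<le> K * nrm F x * nrm G y"
    using bdd_bil_bound[OF B] by blast
  show ?thesis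
  proof (rule bdd_linI[OF _ ns(1)])
    show "lin_on F (blin G H) (\<lambda>x y. if y \<in> carr G then B x y else 0)"
    proof (rule lin_on_combI)
      fix x assume x: "x \<in> carr F"
      show "(\<lambda>y. if y \<in> carr G then B x y else 0) \<in> carr (blin G H)"
        by (rule blinI[OF ns(2), of _ _ "K * nrm F x"])
           (use x K in \<open>auto simp: bdd_bilD(1)[OF B] bdd_bilD(3)[OF B ns(2)] ns_add ns_scale ns\<close>)
    next
      fix a b x y assume xy: "x \<in> carr F" "y \<in> carr F"
      show "(\<lambda>z. if z \<in> carr G then B (a *\<^sub>R x + b *\<^sub>R y) z else 0) =
         a *\<^sub>R (\<lambda>z. if z \<in> carr G then B x z else 0) + b *\<^sub>R (\<lambda>z. if z \<in> carr G then B y z else 0)"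
        using bdd_bilD(2)[OF B ns(1) xy] by (auto simp: fun_eq_iff scaleR_fun_def)
    qed
    fix x assume x: "x \<in> carr F"
    show "nrm (blin G H) (\<lambda>y. if y \<in> carr G then B x y else 0) \<le> K * nrm F x"
      by (rule blin_nrm_le[OF ns(2)]) (use x K nrm_ge0[OF ns(1) x] in auto)
  qed
qed

text \<open>Meant for the solution operator of the elliptic equation: L \<mapsto> T L S is bounded
  and linear in L, so it carries jets of operators to jets of operators.\<close>

lemma bdd_lin_conj:
  assumes ns: "normed_ns E" "normed_ns F" "normed_ns E'" "normed_ns F'"
    and S: "bdd_lin E' E S" and T: "bdd_lin F F' T"
  shows "bdd_lin (blin E F) (blin E' F') (\<lambda>L x. if x \<in> carr E' then T (L (S x)) else 0)"
  by (rule bdd_lin_curry[OF normed_blin[OF ns(1,2)] ns(3,4)])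
     (rule bdd_bil_comp[OF bdd_bil_apply[OF ns(1,2)] bdd_lin_id[OF normed_blin[OF ns(1,2)]] S T normed_blin[OF ns(1,2)] ns(1,2)
        normed_blin[OF ns(1,2)] ns(3)])

text \<open>Makes a coefficient that enters linearly the argument of a bounded operator with values
  in bilinear maps; smoothness of the coefficient then passes to the bilinear map by
  \<open>jet_lin\<close>.\<close>

lemma bdd_lin_sb:
  assumes ns: "normed_ns F" "normed_ns E"
    and car: "\<And>x u v. x \<in> carr F \<Longrightarrow> u \<in> carr E \<Longrightarrow> v \<in> carr E \<Longrightarrow> T x u v \<in> carr G"
    and lin: "\<And>a b x y u v. x \<in> carr F \<Longrightarrow> y \<in> carr F \<Longrightarrow> u \<in> carr E \<Longrightarrow> v \<in> carr E \<Longrightarrow>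
      T (a *\<^sub>R x + b *\<^sub>R y) u v = a *\<^sub>R T x u v + b *\<^sub>R T y u v"
    and lin': "\<And>a b x u v w. x \<in> carr F \<Longrightarrow> u \<in> carr E \<Longrightarrow> v \<in> carr E \<Longrightarrow> w \<in> carr E \<Longrightarrow>
      T x (a *\<^sub>R u + b *\<^sub>R v) w = a *\<^sub>R T x u w + b *\<^sub>R T x v w"
    and sym: "\<And>x u v. x \<in> carr F \<Longrightarrow> u \<in> carr E \<Longrightarrow> v \<in> carr E \<Longrightarrow> T x u v = T x v u"
    and bd: "\<And>x u v. x \<in> carr F \<Longrightarrow> u \<in> carr E \<Longrightarrow> v \<in> carr E \<Longrightarrow> nrm G (T x u v) \<le> C * nrm F x * nrm E u * nrm E v"
    and C: "C \<ge> 0"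
  shows "bdd_lin F (sym_bilin E G) (\<lambda>x u v. if u \<in> carr E \<and> v \<in> carr E then T x u v else 0)"
proof (rule bdd_linI[OF _ ns(1)])
  show "lin_on F (sym_bilin E G) (\<lambda>x u v. if u \<in> carr E \<and> v \<in> carr E then T x u v else 0)"
  proof (rule lin_on_combI)
    fix x assume x: "x \<in> carr F"
    show "(\<lambda>u v. if u \<in> carr E \<and> v \<in> carr E then T x u v else 0) \<in> carr (sym_bilin E G)"
      by (rule sbI[OF ns(2), of _ _ "C * nrm F x"]) (use x car lin' sym bd in \<open>auto simp: ns_add ns_scale ns\<close>)
  qed (use lin in \<open>auto simp: fun_eq_iff scaleR_fun_def\<close>)
  fix x assume x: "x \<in> carr F"
  show "nrm (sym_bilin E G) (\<lambda>u v. if u \<in> carr E \<and> v \<in> carr E then T x u v else 0) \<le> C * nrm F x"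
    by (rule sb_nrm_le[OF ns(2)]) (use x bd C nrm_ge0[OF ns(1) x] in auto)
qed

lemma bdd_bil_sb_comp:
  assumes ns: "normed_ns E" "normed_ns F" "normed_ns G"
  shows "bdd_bil (blin F G) (sym_bilin E F) (sym_bilin E G) (\<lambda>L B u v. if u \<in> carr E \<and> v \<in> carr E then L (B u v) else 0)"
proof (rule bdd_bilI[OF normed_blin[OF ns(2,3)] normed_sb[OF ns(1,2)], where C = 1])
  fix L B assume LB: "L \<in> carr (blin F G)" "B \<in> carr (sym_bilin E F)"
  have le: "nrm G (L (B u v)) \<le> nrm (blin F G) L * nrm (sym_bilin E F) B * nrm E u * nrm E v"
    if uv: "u \<in> carr E" "v \<in> carr E" for u v
  proof -
    have "nrm G (L (B u v)) \<le> nrm (blin F G) L * nrm F (B u v)" by (rule blin_apply[OF ns(2,3) LB(1) sb_carr[OF LB(2) uv]])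
    also have "\<dots> \<le> nrm (blin F G) L * (nrm (sym_bilin E F) B * nrm E u * nrm E v)"
      by (rule mult_left_mono[OF sb_apply[OF ns(1,2) LB(2) uv] blin_ge0[OF ns(2,3) LB(1)]])
    finally show ?thesis by (simp add: mult.assoc)
  qed
  show "(\<lambda>u v. if u \<in> carr E \<and> v \<in> carr E then L (B u v) else 0) \<in> carr (sym_bilin E G)"
    by (rule sbI[OF ns(1), of _ _ "nrm (blin F G) L * nrm (sym_bilin E F) B"])
       (use LB le sb_sym[OF LB(2)] ns in \<open>auto simp: ns_add ns_scale lin_onD(1)[OF blin_lin] sb_carr lin_on_comb[OF sb_lin]
          lin_on_comb[OF blin_lin]\<close>)
  show "nrm (sym_bilin E G) (\<lambda>u v. if u \<in> carr E \<and> v \<in> carr E then L (B u v) else 0) \<le> 1 * nrm (blin F G) L * nrm (sym_bilin E F) B"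
    by (rule sb_nrm_le[OF ns(1)]) (use LB le blin_ge0[OF ns(2,3)] sb_ge0_upper(1)[OF ns(1,2)] in auto)
qed (auto simp: fun_eq_iff scaleR_fun_def lin_on_comb[OF blin_lin ns(2)] sb_carr)

section \<open>The real line and products as normed spaces\<close>

lemma normed_real: "normed_ns real_ns"
  by (rule normed_nsI) (auto simp: real_ns_def abs_mult)

lemma carr_prod: "x \<in> carr (prod_ns E F) \<longleftrightarrow> fst x \<in> carr E \<and> snd x \<in> carr F"
  by (cases x) (auto simp: prod_ns_def)

lemma nrm_prod: "nrm (prod_ns E F) x = norm (nrm E (fst x), nrm F (snd x))"
  by (cases x) (simp add: prod_ns_def norm_Pair)

lemma norm_Pair_mono: "0 \<le> a \<Longrightarrow> a \<le> a' \<Longrightarrow> 0 \<le> b \<Longrightarrow> b \<le> b' \<Longrightarrow> norm (a, b) \<le> norm (a', b')" for a b :: real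
  by (auto simp: norm_Pair intro!: add_mono power_mono)

lemma normed_prod:
  assumes "normed_ns E" "normed_ns F"
  shows "normed_ns (prod_ns E F)"
proof (rule normed_nsI)
  fix x y assume xy: "x \<in> carr (prod_ns E F)" "y \<in> carr (prod_ns E F)"
  have "nrm (prod_ns E F) (x + y) \<le> norm ((nrm E (fst x), nrm F (snd x)) + (nrm E (fst y), nrm F (snd y)))"
    unfolding nrm_prod plus_prod_def fst_conv snd_conv
    by (intro norm_Pair_mono) (use xy assms in \<open>auto simp: carr_prod nrm_triangle nrm_ge0 ns_add\<close>)
  also have "\<dots> \<le> nrm (prod_ns E F) x + nrm (prod_ns E F) y" unfolding nrm_prod by (rule norm_triangle_ineq)
  finally show "nrm (prod_ns E F) (x + y) \<le> nrm (prod_ns E F) x + nrm (prod_ns E F) y" .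
next
  fix c x assume x: "x \<in> carr (prod_ns E F)"
  then have "nrm (prod_ns E F) (c *\<^sub>R x) = norm (\<bar>c\<bar> *\<^sub>R (nrm E (fst x), nrm F (snd x)))"
    using assms by (simp add: nrm_prod carr_prod nrm_scale)
  then show "nrm (prod_ns E F) (c *\<^sub>R x) = \<bar>c\<bar> * nrm (prod_ns E F) x" unfolding norm_scaleR by (simp add: nrm_prod)
next
  fix x assume "x \<in> carr (prod_ns E F)" "nrm (prod_ns E F) x = 0"
  then show "x = 0" using nrm_eq0[OF assms(1)] nrm_eq0[OF assms(2)] by (simp add: nrm_prod carr_prod zero_prod_def prod_eq_iff)
qed (use assms in \<open>auto simp: carr_prod ns_add ns_scale ns_zero\<close>)

lemma bdd_lin_fst: "normed_ns E \<Longrightarrow> normed_ns F \<Longrightarrow> bdd_lin (prod_ns E F) E fst"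
  by (rule bdd_linI[where C = 1])
     (auto simp: lin_on_def carr_prod normed_prod nrm_prod norm_Pair intro!: real_le_rsqrt)

lemma bdd_lin_snd: "normed_ns E \<Longrightarrow> normed_ns F \<Longrightarrow> bdd_lin (prod_ns E F) F snd"
  by (rule bdd_linI[where C = 1])
     (auto simp: lin_on_def carr_prod normed_prod nrm_prod norm_Pair intro!: real_le_rsqrt)

lemma bdd_lin_inl: "normed_ns E \<Longrightarrow> normed_ns F \<Longrightarrow> bdd_lin E (prod_ns E F) (\<lambda>x. (x, 0))"
  by (rule bdd_linI[where C = 1]) (auto simp: lin_on_def carr_prod nrm_prod ns_zero norm_Pair nrm_ge0)

lemma bdd_lin_inr: "normed_ns E \<Longrightarrow> normed_ns F \<Longrightarrow> bdd_lin F (prod_ns E F) (\<lambda>x. (0, x))"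
  by (rule bdd_linI[where C = 1]) (auto simp: lin_on_def carr_prod nrm_prod ns_zero norm_Pair nrm_ge0)

section \<open>Fourier series on the unit interval\<close>

definition ech :: "int \<Rightarrow> real \<Rightarrow> complex"
  where "ech k t = cis (2 * pi * of_int k * t)"

definition fc :: "(real \<Rightarrow> complex) \<Rightarrow> int \<Rightarrow> complex"
  where "fc f k = integral {0..1} (\<lambda>t. f t * ech (- k) t)"

lemma ech_mult: "ech k t * ech l t = ech (k + l) t"
  by (simp add: ech_def cis_mult algebra_simps)

lemma cnj_ech [simp]: "cnj (ech k t) = ech (- k) t"
  by (simp add: ech_def cis_cnj)

lemma norm_ech [simp]: "cmod (ech k t) = 1"
  by (simp add: ech_def)

lemma ech_0 [simp]: "ech 0 t = 1"
  by (simp add: ech_def)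

lemma ech_add_int: "ech k (t + of_int n) = ech k t"
proof -
  have "ech k (t + of_int n) = cis (2 * pi * of_int k * t) * cis (2 * pi * of_int (k * n))"
    by (simp add: ech_def cis_mult algebra_simps)
  also have "cis (2 * pi * of_int (k * n)) = 1" using cis_multiple_2pi[of "of_int (k * n)"] by simp
  finally show ?thesis by (simp add: ech_def)
qed

lemma continuous_on_ech [continuous_intros]: "continuous_on S (ech k)"
  unfolding ech_def[abs_def] by (intro continuous_intros)

lemma ech_deriv: "(ech k has_vector_derivative (2 * pi * of_int k) *\<^sub>R (\<i> * ech k t)) (at t within S)"
proof -
  have eq: "ech k = (\<lambda>t. exp (t *\<^sub>R (\<i> * of_real (2 * pi * of_int k))))"
    by (simp add: ech_def fun_eq_iff cis_conv_exp scaleR_conv_of_real mult_ac)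
  show ?thesis
    unfolding eq by (rule has_vector_derivative_eq_rhs[OF exp_scaleR_has_vector_derivative_right])
      (simp add: scaleR_conv_of_real mult_ac)
qed

lemma int_ech: "integral {0..1} (ech k) = (if k = 0 then 1 else 0)"
proof (cases "k = 0")
  case False
  define c where "c = \<i> * of_real (2 * pi * of_int k)"
  have c: "c \<noteq> 0" using False by (simp add: c_def)
  have "((\<lambda>t. ech k t / c) has_vector_derivative ech k t) (at t within {0..1})" for t
  proof -
    have "((\<lambda>t. (1 / c) * ech k t) has_vector_derivative (1 / c) * ((2 * pi * of_int k) *\<^sub>R (\<i> * ech k t))) (at t within {0..1})"
      by (rule has_vector_derivative_mult_right[OF ech_deriv])
    moreover have "(1 / c) * ((2 * pi * of_int k) *\<^sub>R (\<i> * ech k t)) = ech k t"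
      using c by (simp add: c_def scaleR_conv_of_real)
    ultimately show ?thesis by simp
  qed
  then have "(ech k has_integral (ech k 1 / c - ech k 0 / c)) {0..1}"
    by (intro fundamental_theorem_of_calculus) auto
  moreover have "ech k 1 = ech k 0" using ech_add_int[of k 0 1] by simp
  ultimately show ?thesis using False by (simp add: integral_unique)
next
  case True
  have "ech 0 = (\<lambda>_. 1)" by (simp add: fun_eq_iff)
  then show ?thesis using True by simp
qed

lemma fc_integrable: "continuous_on {0..1} f \<Longrightarrow> (\<lambda>t. f t * ech k t) integrable_on {0..1}"
  by (intro integrable_continuous_real continuous_intros)

lemma fc_ech: "fc (ech l) k = (if k = l then 1 else 0)"
  unfolding fc_def by (simp add: ech_mult int_ech)

lemma fc_add: "continuous_on {0..1} f \<Longrightarrow> continuous_on {0..1} g \<Longrightarrow> fc (\<lambda>t. f t + g t) k = fc f k + fc g k"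
  unfolding fc_def distrib_right by (intro integral_add fc_integrable)

lemma fc_diff: "continuous_on {0..1} f \<Longrightarrow> continuous_on {0..1} g \<Longrightarrow> fc (\<lambda>t. f t - g t) k = fc f k - fc g k"
  unfolding fc_def left_diff_distrib by (intro integral_diff fc_integrable)

lemma fc_cmul: "fc (\<lambda>t. c * f t) k = c * fc f k"
  unfolding fc_def mult.assoc by (rule integral_mult_right)

lemma fc_cnj: "fc (\<lambda>t. cnj (f t)) k = cnj (fc f (- k))"
  unfolding fc_def by (simp add: integral_cnj)

lemma fc_sum: "finite K \<Longrightarrow> (\<And>i. i \<in> K \<Longrightarrow> continuous_on {0..1} (f i)) \<Longrightarrow> fc (\<lambda>t. \<Sum>i\<in>K. f i t) k = (\<Sum>i\<in>K. fc (f i) k)"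
  unfolding fc_def sum_distrib_right by (intro integral_sum fc_integrable)

text \<open>The partial sum \<open>p\<close> is the orthogonal projection of \<open>f\<close>: the
  inner products of \<open>f\<close> with \<open>p\<close> and of \<open>p\<close> with itself are
  both \<open>S\<close>. So the squared distance of \<open>f\<close> and \<open>p\<close>, which is
  nonnegative, is the squared norm of \<open>f\<close> minus \<open>S\<close>.\<close>

lemma bessel:
  assumes f: "continuous_on {0..1} f" and K: "finite K"
  shows "(\<Sum>k\<in>K. (cmod (fc f k))\<^sup>2) \<le> integral {0..1} (\<lambda>t. (cmod (f t))\<^sup>2)"
proof -
  define p where "p = (\<lambda>t. \<Sum>k\<in>K. fc f k * ech k t)"
  define S where "S = (\<Sum>k\<in>K. (cmod (fc f k))\<^sup>2)"
  have cp: "continuous_on {0..1} p" unfolding p_def by (intro continuous_intros)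
  have I: "integral {0..1} (\<lambda>t. g t * cnj (p t)) = (\<Sum>k\<in>K. cnj (fc f k) * fc g k)" if g: "continuous_on {0..1} g" for g
  proof -
    have "integral {0..1} (\<lambda>t. g t * cnj (p t)) = integral {0..1} (\<lambda>t. \<Sum>k\<in>K. cnj (fc f k) * (g t * ech (- k) t))"
      by (simp add: p_def sum_distrib_left mult_ac)
    also have "\<dots> = (\<Sum>k\<in>K. integral {0..1} (\<lambda>t. cnj (fc f k) * (g t * ech (- k) t)))"
      using g K by (intro integral_sum integrable_continuous_real continuous_intros)
    finally show ?thesis by (simp add: fc_def)
  qed
  have sq: "cnj z * z = of_real ((cmod z)\<^sup>2)" for z
    by (metis complex_norm_square mult.commute of_real_power)
  have fp: "fc p k = fc f k" if "k \<in> K" for k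
  proof -
    have "fc p k = (\<Sum>i\<in>K. fc (\<lambda>t. fc f i * ech i t) k)" unfolding p_def by (intro fc_sum K continuous_intros)
    also have "\<dots> = (\<Sum>i\<in>K. if i = k then fc f k else 0)" by (intro sum.cong refl) (auto simp: fc_cmul fc_ech)
    finally show ?thesis using that K by simp
  qed
  have 1: "integral {0..1} (\<lambda>t. f t * cnj (p t)) = of_real S" unfolding I[OF f] S_def by (simp add: sq)
  have 2: "integral {0..1} (\<lambda>t. p t * cnj (p t)) = of_real S"
    unfolding I[OF cp] S_def using fp by (simp add: sq)
  have 3: "integral {0..1} (\<lambda>t. cnj (f t) * p t) = of_real S"
    using arg_cong[OF 1, of cnj] by (simp add: integral_cnj)
  have eq: "of_real ((cmod (f t - p t))\<^sup>2) = f t * cnj (f t) - f t * cnj (p t) - (cnj (f t) * p t - p t * cnj (p t))" for t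
    unfolding complex_norm_square by (simp add: algebra_simps)
  have "complex_of_real (integral {0..1} (\<lambda>t. (cmod (f t - p t))\<^sup>2)) = integral {0..1} (\<lambda>t. of_real ((cmod (f t - p t))\<^sup>2))"
    using f cp by (intro integral_linear[OF _ bounded_linear_of_real, unfolded o_def, symmetric] integrable_continuous_real continuous_intros)
  also have "\<dots> = integral {0..1} (\<lambda>t. f t * cnj (f t)) - of_real S - (of_real S - of_real S)"
    unfolding eq
    by (subst integral_diff integral_diff, (intro integrable_continuous_real continuous_intros f cp)+)+
       (simp add: 1 2 3)
  also have "integral {0..1} (\<lambda>t. f t * cnj (f t)) = integral {0..1} (\<lambda>t. of_real ((cmod (f t))\<^sup>2))"
    by (simp only: complex_norm_square)
  also have "\<dots> = of_real (integral {0..1} (\<lambda>t. (cmod (f t))\<^sup>2))"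
    using f by (intro integral_linear[OF _ bounded_linear_of_real, unfolded o_def] integrable_continuous_real continuous_intros)
  finally have "integral {0..1} (\<lambda>t. (cmod (f t - p t))\<^sup>2) = integral {0..1} (\<lambda>t. (cmod (f t))\<^sup>2) - S"
    by (simp add: of_real_diff[symmetric] del: of_real_diff)
  moreover have "integral {0..1} (\<lambda>t. (cmod (f t - p t))\<^sup>2) \<ge> 0"
    using f cp by (intro integral_nonneg integrable_continuous_real continuous_intros) auto
  ultimately show ?thesis by (simp add: S_def)
qed

section \<open>Absolutely convergent Fourier series\<close>

definition synth :: "(int \<Rightarrow> complex) \<Rightarrow> real \<Rightarrow> complex"
  where "synth a t = (\<Sum>\<^sub>\<infinity>k. a k * ech k t)"

lemma synth_limit:
  assumes "(\<lambda>k. cmod (a k)) summable_on UNIV"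
  shows "uniform_limit S (\<lambda>K t. \<Sum>k\<in>K. a k * ech k t) (synth a) (finite_subsets_at_top UNIV)"
  unfolding synth_def[abs_def]
  by (rule Weierstrass_m_test_general[OF _ assms]) (simp add: norm_mult)

lemma synth_continuous:
  assumes "(\<lambda>k. cmod (a k)) summable_on UNIV"
  shows "continuous_on S (synth a)"
  by (rule uniform_limit_theorem[OF _ synth_limit[OF assms]])
     (auto intro!: always_eventually continuous_intros)

lemma synth_periodic: "synth a (t + of_int n) = synth a t"
  by (simp add: synth_def ech_add_int)

lemma synth_bound:
  assumes "(\<lambda>k. cmod (a k)) summable_on UNIV"
  shows "cmod (synth a t) \<le> (\<Sum>\<^sub>\<infinity>k. cmod (a k))"
  unfolding synth_def
  by (rule norm_infsum_bound[THEN order_trans]) (use assms in \<open>auto simp: norm_mult\<close>)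

text \<open>Uniform convergence allows termwise integration. The weight \<open>g\<close> and the
  free interval let this serve for Fourier coefficients, Parseval, products and primitives
  alike.\<close>

lemma synth_integral:
  assumes a: "(\<lambda>k. cmod (a k)) summable_on UNIV" and g: "continuous_on {l..u} g"
  shows "((\<lambda>k. a k * integral {l..u} (\<lambda>t. ech k t * g t)) has_sum integral {l..u} (\<lambda>t. synth a t * g t)) UNIV"
proof -
  have "uniform_limit {l..u} (\<lambda>K t. (\<Sum>k\<in>K. a k * ech k t) * g t) (\<lambda>t. synth a t * g t) (finite_subsets_at_top UNIV)"
  proof (rule uniform_lim_mult[OF synth_limit[OF a] uniform_limit_const])
    show "bounded (synth a ` {l..u})"
      by (intro compact_imp_bounded compact_continuous_image synth_continuous a) simp
    show "bounded (g ` {l..u})" by (intro compact_imp_bounded compact_continuous_image g) simp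
  qed
  then obtain I J where IJ: "\<And>K. ((\<lambda>t. (\<Sum>k\<in>K. a k * ech k t) * g t) has_integral I K) {l..u}"
      "((\<lambda>t. synth a t * g t) has_integral J) {l..u}" "(I \<longlongrightarrow> J) (finite_subsets_at_top UNIV)"
    by (rule uniform_limit_integral[where f = "\<lambda>K t. (\<Sum>k\<in>K. a k * ech k t) * g t"])
       (use g in \<open>auto intro!: continuous_intros\<close>)
  have "I K = (\<Sum>k\<in>K. a k * integral {l..u} (\<lambda>t. ech k t * g t))" if "finite K" for K
  proof -
    have "I K = integral {l..u} (\<lambda>t. \<Sum>k\<in>K. a k * (ech k t * g t))"
      using integral_unique[OF IJ(1)] by (simp add: sum_distrib_right mult.assoc)
    also have "\<dots> = (\<Sum>k\<in>K. integral {l..u} (\<lambda>t. a k * (ech k t * g t)))"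
      using that g by (intro integral_sum integrable_continuous_real continuous_intros)
    finally show ?thesis by simp
  qed
  then have "eventually (\<lambda>K. I K = (\<Sum>k\<in>K. a k * integral {l..u} (\<lambda>t. ech k t * g t))) (finite_subsets_at_top UNIV)"
    by (auto intro: eventually_finite_subsets_at_top_weakI)
  then have "((\<lambda>K. \<Sum>k\<in>K. a k * integral {l..u} (\<lambda>t. ech k t * g t)) \<longlongrightarrow> J) (finite_subsets_at_top UNIV)"
    using IJ(3) tendsto_cong by blast
  then show ?thesis using integral_unique[OF IJ(2)] by (simp add: has_sum_def)
qed

lemma fc_synth:
  assumes "(\<lambda>k. cmod (a k)) summable_on UNIV"
  shows "fc (synth a) k = a k"
proof -
  have "((\<lambda>j. a j * (if j = k then 1 else 0)) has_sum fc (synth a) k) UNIV"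
    using synth_integral[OF assms, where g = "ech (- k)" and l = 0 and u = 1] by (simp add: fc_def ech_mult int_ech continuous_on_ech)
  moreover have "((\<lambda>j. a j * (if j = k then 1 else 0)) has_sum a k) UNIV"
    by (subst has_sum_cong_neutral[where T = "{k}" and g = a]) (auto intro: has_sum_finiteI)
  ultimately show ?thesis using has_sum_unique by blast
qed

text \<open>The series is integrated termwise against its own conjugate. Where the equality is
  applied the coefficients are absolutely summable; for merely continuous functions Bessel's
  inequality takes its place.\<close>

lemma synth_parseval:
  assumes "(\<lambda>k. cmod (a k)) summable_on UNIV"
  shows "((\<lambda>k. (cmod (a k))\<^sup>2) has_sum integral {0..1} (\<lambda>t. (cmod (synth a t))\<^sup>2)) UNIV"
proof -
  have c: "continuous_on {0..1} (synth a)" by (rule synth_continuous[OF assms])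
  have "integral {0..1} (\<lambda>t. ech k t * cnj (synth a t)) = cnj (a k)" for k
  proof -
    have "fc (\<lambda>t. cnj (synth a t)) (- k) = cnj (fc (synth a) k)" by (simp add: fc_cnj)
    then show ?thesis by (simp add: fc_synth[OF assms]) (simp add: fc_def mult.commute)
  qed
  then have "((\<lambda>k. a k * cnj (a k)) has_sum integral {0..1} (\<lambda>t. synth a t * cnj (synth a t))) UNIV"
    using synth_integral[OF assms, where g = "\<lambda>t. cnj (synth a t)" and l = 0 and u = 1] c by (simp add: continuous_intros)
  also have "integral {0..1} (\<lambda>t. synth a t * cnj (synth a t)) = integral {0..1} (\<lambda>t. of_real ((cmod (synth a t))\<^sup>2))"
    by (simp only: complex_norm_square)
  also have "\<dots> = of_real (integral {0..1} (\<lambda>t. (cmod (synth a t))\<^sup>2))"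
    using c by (intro integral_linear[OF _ bounded_linear_of_real, unfolded o_def] integrable_continuous_real continuous_intros)
  finally have "((\<lambda>k. Re (a k * cnj (a k))) has_sum integral {0..1} (\<lambda>t. (cmod (synth a t))\<^sup>2)) UNIV"
    by (metis (no_types, lifting) Re_complex_of_real has_sum_Re has_sum_cong)
  moreover have "Re (a k * cnj (a k)) = (cmod (a k))\<^sup>2" for k
    by (simp add: complex_norm_square[symmetric] flip: of_real_power)
  ultimately show ?thesis by simp
qed

text \<open>Integration by parts; the boundary term vanishes because \<open>G\<close> and the
  characters agree at 0 and 1.\<close>

lemma fc_deriv:
  assumes d: "\<And>t. (G has_vector_derivative G' t) (at t)" and c: "continuous_on UNIV G'" and per: "G 1 = G 0"
  shows "fc G' k = \<i> * of_real (2 * pi * of_int k) * fc G k"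
proof -
  let ?c = "\<i> * of_real (2 * pi * of_int k)"
  have cG: "continuous_on {0..1} G" "continuous_on {0..1} G'"
    using d c by (auto intro: continuous_on_vector_derivative has_vector_derivative_at_within continuous_on_subset)
  have "((\<lambda>t. G t * ((2 * pi * of_int (- k)) *\<^sub>R (\<i> * ech (- k) t)) + G' t * ech (- k) t)
      has_integral (G 1 * ech (- k) 1 - G 0 * ech (- k) 0)) {0..1}"
    by (rule fundamental_theorem_of_calculus)
       (simp, intro has_vector_derivative_mult ech_deriv has_vector_derivative_at_within[OF d])
  moreover have "ech (- k) 1 = ech (- k) 0" using ech_add_int[of "- k" 0 1] by simp
  moreover have "(\<lambda>t. G t * ((2 * pi * of_int (- k)) *\<^sub>R (\<i> * ech (- k) t)) + G' t * ech (- k) t)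
     = (\<lambda>t. G' t * ech (- k) t - ?c * (G t * ech (- k) t))"
    by (simp add: fun_eq_iff scaleR_conv_of_real algebra_simps)
  ultimately have "((\<lambda>t. G' t * ech (- k) t - ?c * (G t * ech (- k) t)) has_integral 0) {0..1}"
    by (simp add: per)
  then have "integral {0..1} (\<lambda>t. G' t * ech (- k) t - ?c * (G t * ech (- k) t)) = 0"
    by (rule integral_unique)
  then have "fc G' k - ?c * fc G k = 0"
    unfolding fc_def integral_mult_right[symmetric]
    by (subst integral_diff[symmetric]) (auto intro!: integrable_continuous_real continuous_intros cG)
  then show ?thesis by simp
qed

section \<open>Uniqueness of Fourier coefficients\<close>

lemma one_plus_cos_ge0: "0 \<le> 1 + cos (x :: real)"
  using cos_ge_minus_one[of x] by linarith

text \<open>A peaking argument. If f(t0) \<noteq> 0, the real function \<open>g\<close> is at least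
  \<open>c > 0\<close> near t0. Integrals of \<open>g\<close> against powers of the trigonometric
  polynomial \<open>q\<close> vanish, yet \<open>q\<close> is at least \<open>q1\<close> close to t0
  and at most \<open>q2 < q1\<close> away from it. This gives
  \<open>c * d * q1 ^ n \<le> M * q2 ^ n\<close> for all n, which fails for large n. The end points
  follow by continuity.\<close>

lemma fc_uniqueness:
  assumes f: "continuous_on {0..1} f" and z: "\<And>k. fc f k = 0" and t: "t \<in> {0..1}"
  shows "f t = 0"
proof -
  have in0: "f t0 = 0" if t0: "t0 \<in> {0<..<1}" for t0
  proof (rule ccontr)
    assume nz: "f t0 \<noteq> 0"
    define g where "g = (\<lambda>t. Re (cnj (f t0) * f t))"
    define c where "c = g t0 / 2"
    have g: "continuous_on {0..1} g" unfolding g_def by (intro continuous_intros f)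
    have "g t0 = (cmod (f t0))\<^sup>2"
      unfolding g_def by (metis Re_complex_of_real complex_norm_square mult.commute of_real_power)
    then have c: "c > 0" "g t0 = 2 * c" using nz by (auto simp: c_def)
    \<comment> \<open>Its values lie between 0 and 1, and modulo 1 the value 1 is taken only at t0,
      so its powers concentrate there.\<close>
    define q where "q = (\<lambda>t. (1 + cos (2 * pi * (t - t0))) / 2)"
    have q: "complex_of_real (q t) = 1 / 2 + ech (- 1) t0 / 4 * ech 1 t + ech 1 t0 / 4 * ech (- 1) t" for t
    proof -
      have "ech (- 1) t0 * ech 1 t = cis (2 * pi * (t - t0))" "ech 1 t0 * ech (- 1) t = cis (- (2 * pi * (t - t0)))"
        by (simp_all add: ech_def cis_mult algebra_simps)
      then show ?thesis by (simp add: q_def complex_eq_iff)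
    qed
    have qc: "continuous_on S q" for S unfolding q_def by (intro continuous_intros) auto
    \<comment> \<open>Multiplication by \<open>q\<close> shifts frequencies by at most one, so the
      induction has to run over all \<open>k\<close> simultaneously.\<close>
    have I: "integral {0..1} (\<lambda>t. f t * of_real (q t) ^ n * ech k t) = 0" for n k
    proof (induction n arbitrary: k)
      case 0
      then show ?case using z[of "- k"] by (simp add: fc_def)
    next
      case (Suc n)
      have "(\<lambda>t. f t * of_real (q t) ^ Suc n * ech k t) =
        (\<lambda>t. (1 / 2) * (f t * of_real (q t) ^ n * ech k t) + ((ech (- 1) t0 / 4) * (f t * of_real (q t) ^ n * ech (k + 1) t)
          + (ech 1 t0 / 4) * (f t * of_real (q t) ^ n * ech (k - 1) t)))"
      proof
        fix t
        have e: "ech (k + 1) t = ech k t * ech 1 t" "ech (k - 1) t = ech k t * ech (- 1) t" by (simp_all add: ech_mult)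
        show "f t * of_real (q t) ^ Suc n * ech k t =
          (1 / 2) * (f t * of_real (q t) ^ n * ech k t) + ((ech (- 1) t0 / 4) * (f t * of_real (q t) ^ n * ech (k + 1) t)
          + (ech 1 t0 / 4) * (f t * of_real (q t) ^ n * ech (k - 1) t))"
          unfolding e power_Suc q[of t] by (simp add: algebra_simps)
      qed
      moreover have hi: "((\<lambda>t. f t * of_real (q t) ^ n * ech k t) has_integral 0) {0..1}" for k
      proof -
        have "(\<lambda>t. f t * of_real (q t) ^ n * ech k t) integrable_on {0..1}"
          by (intro integrable_continuous_real continuous_intros f qc)
        then show ?thesis using Suc[of k] by (simp add: has_integral_iff)
      qed
      ultimately show ?case
        using has_integral_add[OF has_integral_mult_right[OF hi[of k], of "1 / 2"]
          has_integral_add[OF has_integral_mult_right[OF hi[of "k + 1"], of "ech (- 1) t0 / 4"]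
            has_integral_mult_right[OF hi[of "k - 1"], of "ech 1 t0 / 4"]]]
        by (simp only: integral_unique) simp
    qed
    have J: "integral {0..1} (\<lambda>t. g t * q t ^ n) = 0" for n
    proof -
      have "integral {0..1} (\<lambda>t. g t * q t ^ n) = integral {0..1} (\<lambda>t. Re (cnj (f t0) * (f t * of_real (q t) ^ n * ech 0 t)))"
        by (simp add: g_def flip: of_real_power) (simp add: algebra_simps)
      also have "\<dots> = Re (integral {0..1} (\<lambda>t. cnj (f t0) * (f t * of_real (q t) ^ n * ech 0 t)))"
        by (intro integral_linear[OF _ bounded_linear_Re, unfolded o_def] integrable_continuous_real continuous_intros f qc)
      finally show ?thesis using I[of n 0] by simp
    qed
    obtain d0 where d0: "d0 > 0" "\<And>t. t \<in> {0..1} \<Longrightarrow> \<bar>t - t0\<bar> < d0 \<Longrightarrow> \<bar>g t - g t0\<bar> < c"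
      using g t0 c(1) unfolding continuous_on_iff dist_real_def by (metis greaterThanLessThan_subseteq_atLeastAtMost_iff order_refl subsetD)
    \<comment> \<open>The bound 1/2 keeps the cosine in its decreasing range; the minima with
      \<open>t0\<close> and \<open>1 - t0\<close> keep the interval of radius d around t0 inside the
      unit interval.\<close>
    define d where "d = min (d0 / 2) (min (1 / 2) (min t0 (1 - t0)))"
    have d: "d > 0" "d < d0" "d \<le> 1 / 2" "d \<le> t0" "t0 + d \<le> 1" using d0 t0 by (auto simp: d_def min_def)
    define q1 where "q1 = (1 + cos (pi * d)) / 2"
    define q2 where "q2 = (1 + cos (2 * pi * d)) / 2"
    have cmono: "cos (2 * pi * x) \<le> cos (2 * pi * y)" if "0 \<le> y" "y \<le> x" "x \<le> 1 / 2" for x y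
      using that by (intro cos_monotone_0_pi_le) auto
    have "cos (2 * pi * d) < cos (pi * d)"
      using d by (intro cos_monotone_0_pi) auto
    then have q12: "q2 < q1" "0 \<le> q2"
      using one_plus_cos_ge0[of "2 * pi * d"] by (simp_all add: q1_def q2_def)
    have cabs: "cos (2 * pi * x) = cos (2 * pi * \<bar>x\<bar>)" for x :: real by (cases "x \<ge> 0") (auto simp: abs_if)
    have ql: "q1 \<le> q t" if "\<bar>t - t0\<bar> \<le> d / 2" for t
      using cmono[of "\<bar>t - t0\<bar>" "d / 2"] that d cabs[of "t - t0"] by (simp add: q1_def q_def)
    have qu: "q t \<le> q2" if "t \<in> {0..1}" "\<bar>t - t0\<bar> \<ge> d" for t
    proof (cases "\<bar>t - t0\<bar> \<le> 1 / 2")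
      case True
      then show ?thesis using cmono[of d "\<bar>t - t0\<bar>"] that d cabs[of "t - t0"] by (simp add: q2_def q_def)
    next
      case False
      \<comment> \<open>Beyond distance 1/2 the shorter way around the circle has length
        \<open>1 - \<bar>t - t0\<bar>\<close>, which is still at least \<open>d\<close>.\<close>
      have "cos (2 * pi * \<bar>t - t0\<bar>) = cos (2 * pi * (1 - \<bar>t - t0\<bar>))"
        using cos_2pi_minus[of "2 * pi * \<bar>t - t0\<bar>"] by (simp add: algebra_simps)
      moreover have "1 - \<bar>t - t0\<bar> \<ge> d" using that d by auto
      ultimately show ?thesis using cmono[of d "1 - \<bar>t - t0\<bar>"] False d cabs[of "t - t0"] by (simp add: q2_def q_def)
    qed
    have q0: "0 \<le> q t" for t using one_plus_cos_ge0[of "2 * pi * (t - t0)"] by (simp add: q_def)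
    obtain M where M: "\<And>t. t \<in> {0..1} \<Longrightarrow> \<bar>g t\<bar> \<le> M"
      using compact_imp_bounded[OF compact_continuous_image[OF g compact_Icc]]
      unfolding bounded_iff by (metis imageI real_norm_def)
    have M0: "M \<ge> 0" using M[of 0] by simp
    have gl: "g t \<ge> c" if "t \<in> {0..1}" "\<bar>t - t0\<bar> \<le> d" for t using d0(2)[OF that(1)] that d c by auto
    have key: "c * d * q1 ^ n \<le> M * q2 ^ n" for n
    proof -
      \<comment> \<open>Adding \<open>M * q2 ^ n\<close> makes the integrand nonnegative on the
        whole unit interval, so its integral over the inner interval is bounded by the full
        integral, in which the term with \<open>g\<close> vanishes.\<close>
      have ge: "0 \<le> g t * q t ^ n + M * q2 ^ n" if "t \<in> {0..1}" for t
      proof (cases "\<bar>t - t0\<bar> \<le> d")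
        case True
        then show ?thesis using gl[OF that True] c q0[of t] M0 q12 by (intro add_nonneg_nonneg mult_nonneg_nonneg) auto
      next
        case False
        have "- (g t * q t ^ n) \<le> M * q2 ^ n"
        proof -
          have "- (g t * q t ^ n) \<le> M * q t ^ n"
            using mult_right_mono[of "- g t" M "q t ^ n"] M[OF that] q0[of t] by (simp add: abs_le_iff)
          also have "\<dots> \<le> M * q2 ^ n" using qu[OF that] False q0[of t] M0 by (intro mult_left_mono power_mono) auto
          finally show ?thesis .
        qed
        then show ?thesis by simp
      qed
      have ii: "(\<lambda>t. g t * q t ^ n + M * q2 ^ n) integrable_on T" if "T = {0..1} \<or> T = {t0 - d/2..t0 + d/2}" for T
        using that d by (auto intro!: integrable_continuous_real continuous_intros qc continuous_on_subset[OF g])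
      have "c * q1 ^ n * d = integral {t0 - d/2..t0 + d/2} (\<lambda>t. c * q1 ^ n)" using d by simp
      also have "\<dots> \<le> integral {t0 - d/2..t0 + d/2} (\<lambda>t. g t * q t ^ n + M * q2 ^ n)"
      proof (rule integral_le)
        fix t assume "t \<in> {t0 - d/2..t0 + d/2}"
        then have "t0 - d/2 \<le> t" "t \<le> t0 + d/2" by auto
        then have t: "t \<in> {0..1}" "\<bar>t - t0\<bar> \<le> d / 2" using d by (auto simp: abs_if)
        have "q1 \<ge> 0" using one_plus_cos_ge0[of "pi * d"] by (simp add: q1_def)
        then have "c * q1 ^ n \<le> g t * q t ^ n"
          using gl[OF t(1)] t(2) d ql[OF t(2)] c q0[of t] by (intro mult_mono power_mono) auto
        then show "c * q1 ^ n \<le> g t * q t ^ n + M * q2 ^ n" using M0 q12 by (simp add: add_increasing2)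
      qed (use ii in auto)
      also have "\<dots> \<le> integral {0..1} (\<lambda>t. g t * q t ^ n + M * q2 ^ n)"
        by (rule integral_subset_le) (use ii ge d in auto)
      also have "\<dots> = integral {0..1} (\<lambda>t. g t * q t ^ n) + integral {0..1} (\<lambda>t::real. M * q2 ^ n)"
        by (rule integral_add; intro integrable_continuous_real continuous_intros qc g)
      finally show ?thesis using J[of n] by (simp add: mult_ac)
    qed
    have "(\<lambda>n. M * (q2 / q1) ^ n) \<longlonglongrightarrow> M * 0"
      using q12 by (intro tendsto_intros LIMSEQ_power_zero) auto
    moreover have "c * d \<le> M * (q2 / q1) ^ n" for n
      using key[of n] q12 by (simp add: power_divide field_simps)
    ultimately have "c * d \<le> M * 0" by (intro LIMSEQ_le_const) auto
    then show False using c d by (simp add: mult_le_0_iff)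
  qed
  have "f x = 0" if "x \<in> closure {0<..<1}" for x
    by (rule continuous_constant_on_closure[of "{0<..<1}" f 0]) (use f in0 that in auto)
  then show ?thesis using t by simp
qed

lemma periodic_add_int:
  fixes f :: "real \<Rightarrow> 'a"
  assumes per: "\<And>t. f (t + 1) = f t"
  shows "f (t + of_int n) = f t"
proof -
  have pn: "f (t + of_nat n) = f t" for t n
    by (induction n) (use per[of "t + of_nat _"] in \<open>simp_all add: algebra_simps\<close>)
  show ?thesis
    using pn[of t "nat n"] pn[of "t + of_int n" "nat (- n)"] by (cases "n \<ge> 0") auto
qed

lemma synth_fc:
  assumes f: "continuous_on UNIV f" and per: "\<And>t. f (t + 1) = f t" and s: "(\<lambda>k. cmod (fc f k)) summable_on UNIV"
  shows "f t = synth (fc f) t"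
proof -
  have c: "continuous_on {0..1} f" "continuous_on {0..1} (synth (fc f))"
    using f synth_continuous[OF s] by (auto intro: continuous_on_subset)
  have 1: "f t = synth (fc f) t" if "t \<in> {0..1}" for t
    using fc_uniqueness[of "\<lambda>t. f t - synth (fc f) t" t] c that
    by (simp add: fc_diff fc_synth[OF s] continuous_intros)
  note pi = periodic_add_int[of f, OF per]
  have "f t = f (frac t)" using pi[of "frac t" "\<lfloor>t\<rfloor>"] by (simp add: frac_def)
  also have "\<dots> = synth (fc f) (frac t)" by (rule 1) (simp add: frac_lt_1 less_imp_le)
  also have "\<dots> = synth (fc f) t" using synth_periodic[of "fc f" "frac t" "\<lfloor>t\<rfloor>"] by (simp add: frac_def)
  finally show ?thesis .
qed

section \<open>Weighted square summable sequences\<close>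

definition wt :: "int \<Rightarrow> real"
  where "wt k = 1 + (2 * pi * of_int k)\<^sup>2"

lemma wt_ge1: "wt k \<ge> 1"
  by (simp add: wt_def)

lemma wt_pos: "wt k > 0"
  using wt_ge1[of k] by linarith

definition h2 :: "real \<Rightarrow> (int \<Rightarrow> complex) \<Rightarrow> bool"
  where "h2 r a \<longleftrightarrow> (\<lambda>k. wt k powr r * (cmod (a k))\<^sup>2) summable_on UNIV"

definition hn :: "real \<Rightarrow> (int \<Rightarrow> complex) \<Rightarrow> real"
  where "hn r a = sqrt (\<Sum>\<^sub>\<infinity>k. wt k powr r * (cmod (a k))\<^sup>2)"

lemma hn_ge0: "hn r a \<ge> 0"
  by (simp add: hn_def infsum_nonneg)

lemma hn_sq: "(hn r a)\<^sup>2 = (\<Sum>\<^sub>\<infinity>k. wt k powr r * (cmod (a k))\<^sup>2)"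
  by (simp add: hn_def infsum_nonneg)

lemma nonneg_bound_summable:
  fixes f :: "'a \<Rightarrow> real"
  assumes "\<And>x. f x \<ge> 0" "\<And>F. finite F \<Longrightarrow> sum f F \<le> B"
  shows "f summable_on UNIV" "infsum f UNIV \<le> B"
proof -
  show s: "f summable_on UNIV"
    by (rule nonneg_bdd_above_summable_on) (use assms in \<open>auto intro!: bdd_aboveI[of _ B]\<close>)
  show "infsum f UNIV \<le> B" by (rule infsum_le_finite_sums[OF s]) (use assms in auto)
qed

lemma sq_le_sqrt: "0 \<le> x \<Longrightarrow> x\<^sup>2 \<le> A * B \<Longrightarrow> 0 \<le> A \<Longrightarrow> x \<le> sqrt A * sqrt B" for x :: real
  by (metis real_le_rsqrt real_sqrt_mult)

lemma infsum_cauchy_schwarz: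
  fixes f g :: "'a \<Rightarrow> real"
  assumes nn: "\<And>x. f x \<ge> 0" "\<And>x. g x \<ge> 0"
    and s: "(\<lambda>x. (f x)\<^sup>2) summable_on UNIV" "(\<lambda>x. (g x)\<^sup>2) summable_on UNIV"
  shows "(\<lambda>x. f x * g x) summable_on UNIV"
    and "infsum (\<lambda>x. f x * g x) UNIV \<le> sqrt (infsum (\<lambda>x. (f x)\<^sup>2) UNIV) * sqrt (infsum (\<lambda>x. (g x)\<^sup>2) UNIV)"
proof -
  have b: "(\<Sum>x\<in>F. f x * g x) \<le> sqrt (infsum (\<lambda>x. (f x)\<^sup>2) UNIV) * sqrt (infsum (\<lambda>x. (g x)\<^sup>2) UNIV)" if F: "finite F" for F
  proof (rule sq_le_sqrt)
    have "(\<Sum>x\<in>F. f x * g x)\<^sup>2 \<le> (\<Sum>x\<in>F. (f x)\<^sup>2) * (\<Sum>x\<in>F. (g x)\<^sup>2)"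
      by (rule Cauchy_Schwarz_ineq_sum)
    also have "\<dots> \<le> infsum (\<lambda>x. (f x)\<^sup>2) UNIV * infsum (\<lambda>x. (g x)\<^sup>2) UNIV"
      using F s by (intro mult_mono finite_sum_le_infsum) (auto intro!: infsum_nonneg sum_nonneg)
    finally show "(\<Sum>x\<in>F. f x * g x)\<^sup>2 \<le> infsum (\<lambda>x. (f x)\<^sup>2) UNIV * infsum (\<lambda>x. (g x)\<^sup>2) UNIV" .
  qed (use nn in \<open>auto intro!: sum_nonneg infsum_nonneg\<close>)
  show "(\<lambda>x. f x * g x) summable_on UNIV" "infsum (\<lambda>x. f x * g x) UNIV \<le> sqrt (infsum (\<lambda>x. (f x)\<^sup>2) UNIV) * sqrt (infsum (\<lambda>x. (g x)\<^sup>2) UNIV)"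
    by (rule nonneg_bound_summable[OF _ b]; use nn in simp)+
qed

lemma powr_half_sq: "x > 0 \<Longrightarrow> (x powr (r / 2) * y)\<^sup>2 = x powr r * y\<^sup>2" for x y :: real
  by (simp add: power_mult_distrib powr_power)

lemma hn_triangle:
  assumes "h2 r a" "h2 r b"
  shows "h2 r (\<lambda>k. a k + b k)" "hn r (\<lambda>k. a k + b k) \<le> hn r a + hn r b"
proof -
  define x where "x = (\<lambda>k. wt k powr (r / 2) * cmod (a k))"
  define y where "y = (\<lambda>k. wt k powr (r / 2) * cmod (b k))"
  have x2: "(x k)\<^sup>2 = wt k powr r * (cmod (a k))\<^sup>2" and y2: "(y k)\<^sup>2 = wt k powr r * (cmod (b k))\<^sup>2" for k
    using powr_half_sq wt_pos by (auto simp: x_def y_def)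
  have s: "(\<lambda>k. (x k)\<^sup>2) summable_on UNIV" "(\<lambda>k. (y k)\<^sup>2) summable_on UNIV"
    using assms by (auto simp: x2 y2 h2_def)
  have nn: "x k \<ge> 0" "y k \<ge> 0" for k by (auto simp: x_def y_def)
  note cs = infsum_cauchy_schwarz[OF nn s]
  have le: "wt k powr r * (cmod (a k + b k))\<^sup>2 \<le> (x k)\<^sup>2 + (2 * (x k * y k) + (y k)\<^sup>2)" for k
  proof -
    have "wt k powr r * (cmod (a k + b k))\<^sup>2 = (wt k powr (r / 2) * cmod (a k + b k))\<^sup>2"
      using powr_half_sq wt_pos by simp
    also have "\<dots> \<le> (x k + y k)\<^sup>2"
      unfolding x_def y_def distrib_left[symmetric]
      by (intro power_mono mult_left_mono norm_triangle_ineq) auto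
    finally show ?thesis by (simp add: power2_eq_square algebra_simps)
  qed
  have sm: "(\<lambda>k. (x k)\<^sup>2 + (2 * (x k * y k) + (y k)\<^sup>2)) summable_on UNIV"
    by (intro summable_on_add s summable_on_cmult_right cs)
  show h: "h2 r (\<lambda>k. a k + b k)"
    unfolding h2_def by (rule summable_on_comparison_test[OF sm]) (use le in auto)
  have "(hn r (\<lambda>k. a k + b k))\<^sup>2 \<le> infsum (\<lambda>k. (x k)\<^sup>2 + (2 * (x k * y k) + (y k)\<^sup>2)) UNIV"
    unfolding hn_sq by (rule infsum_mono[OF h[unfolded h2_def] sm le])
  also have "\<dots> = infsum (\<lambda>k. (x k)\<^sup>2) UNIV + (2 * infsum (\<lambda>k. x k * y k) UNIV + infsum (\<lambda>k. (y k)\<^sup>2) UNIV)"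
    by (subst infsum_add infsum_cmult_right | intro summable_on_add s summable_on_cmult_right cs)+ simp
  also have "\<dots> \<le> (hn r a)\<^sup>2 + (2 * (hn r a * hn r b) + (hn r b)\<^sup>2)"
    using cs(2) unfolding hn_sq by (simp add: x2 y2 hn_def)
  also have "\<dots> = (hn r a + hn r b)\<^sup>2" by (simp add: power2_eq_square algebra_simps)
  finally show "hn r (\<lambda>k. a k + b k) \<le> hn r a + hn r b"
    by (rule power2_le_imp_le) (simp add: hn_ge0)
qed

lemma hn_scale:
  shows "h2 r a \<Longrightarrow> h2 r (\<lambda>k. c * a k)" "hn r (\<lambda>k. c * a k) = cmod c * hn r a"
proof -
  have eq: "wt k powr r * (cmod (c * a k))\<^sup>2 = (cmod c)\<^sup>2 * (wt k powr r * (cmod (a k))\<^sup>2)" for k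
    by (simp add: norm_mult power_mult_distrib)
  show "h2 r a \<Longrightarrow> h2 r (\<lambda>k. c * a k)" unfolding h2_def eq by (rule summable_on_cmult_right)
  show "hn r (\<lambda>k. c * a k) = cmod c * hn r a"
    unfolding hn_def eq by (simp add: infsum_cmult_right' real_sqrt_mult)
qed

lemma hn_mono:
  assumes "h2 q b" "\<And>k. wt k powr r * (cmod (a k))\<^sup>2 \<le> wt k powr q * (cmod (b k))\<^sup>2"
  shows "h2 r a" "hn r a \<le> hn q b"
proof -
  show h: "h2 r a" unfolding h2_def
    by (rule summable_on_comparison_test[OF assms(1)[unfolded h2_def]]) (use assms(2) in auto)
  show "hn r a \<le> hn q b" unfolding hn_def
    by (rule real_sqrt_le_mono, rule infsum_mono) (use h assms in \<open>auto simp: h2_def\<close>)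
qed

lemma wt_summable:
  assumes "r > 1 / 2"
  shows "(\<lambda>k. wt k powr (- r)) summable_on UNIV"
proof -
  have n: "(\<lambda>n::nat. wt (int n) powr (- r)) summable_on UNIV"
  proof (rule summable_nonneg_imp_summable_on)
    have "summable (\<lambda>n::nat. real n powr (- (2 * r)))" using assms by (subst summable_real_powr_iff) simp
    then show "summable (\<lambda>n. wt (int n) powr (- r))"
    proof (rule summable_comparison_test'[where N = 1])
      fix n :: nat assume n: "n \<ge> 1"
      have "1 * (real n)\<^sup>2 \<le> (2 * pi)\<^sup>2 * (real n)\<^sup>2"
        using pi_ge_two power_mono[of 1 "2 * pi" 2] by (intro mult_right_mono) auto
      then have "(real n)\<^sup>2 \<le> wt (int n)" by (simp add: wt_def power_mult_distrib)
      then have "wt (int n) powr (- r) \<le> ((real n)\<^sup>2) powr (- r)"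
        using n assms by (intro powr_mono2') auto
      also have "\<dots> = real n powr (- (2 * r))" using n by (simp add: powr_powr flip: powr_numeral)
      finally show "norm (wt (int n) powr (- r)) \<le> real n powr (- (2 * r))" by simp
    qed
  qed auto
  have neg: "wt (- k) = wt k" for k by (simp add: wt_def)
  have 1: "(\<lambda>k. wt k powr (- r)) summable_on range int"
    using n by (subst summable_on_reindex) (auto simp: o_def)
  have 2: "(\<lambda>k. wt k powr (- r)) summable_on range (\<lambda>n. - int n)"
    using n by (subst summable_on_reindex) (auto simp: o_def neg inj_on_def)
  have "(UNIV :: int set) = range int \<union> (range (\<lambda>n. - int n) - range int)"
    by (auto simp: image_iff) (metis int_cases2)
  moreover have "(\<lambda>k. wt k powr (- r)) summable_on (range int \<union> (range (\<lambda>n. - int n) - range int))"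
    by (intro summable_on_Un_disjoint 1 summable_on_subset_banach[OF 2]) auto
  ultimately show ?thesis by simp
qed

text \<open>The Sobolev embedding: Cauchy-Schwarz against \<open>wt k powr (- r)\<close>, which
  behaves like |k| to the power -2r and is summable for r > 1/2. This is the origin of the lower
  bound 1/2 on the orders.\<close>

lemma h2_l1:
  assumes r: "r > 1 / 2" and h: "h2 r a"
  shows "(\<lambda>k. cmod (a k)) summable_on UNIV"
    and "infsum (\<lambda>k. cmod (a k)) UNIV \<le> sqrt (infsum (\<lambda>k. wt k powr (- r)) UNIV) * hn r a"
proof -
  have eq: "wt k powr (- r / 2) * (wt k powr (r / 2) * cmod (a k)) = cmod (a k)" for k
    using wt_pos[of k] by (simp add: powr_minus field_simps)
  have sq: "(wt k powr (- r / 2))\<^sup>2 = wt k powr (- r)" for k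
    using powr_half_sq[OF wt_pos, of k "- r" 1] by simp
  have sq2: "(wt k powr (r / 2) * cmod (a k))\<^sup>2 = wt k powr r * (cmod (a k))\<^sup>2" for k
    using powr_half_sq[OF wt_pos] by simp
  have "(\<lambda>k. (wt k powr (- r / 2))\<^sup>2) summable_on UNIV" unfolding sq by (rule wt_summable[OF r])
  moreover have "(\<lambda>k. (wt k powr (r / 2) * cmod (a k))\<^sup>2) summable_on UNIV" unfolding sq2 using h by (simp add: h2_def)
  ultimately show "(\<lambda>k. cmod (a k)) summable_on UNIV"
     "infsum (\<lambda>k. cmod (a k)) UNIV \<le> sqrt (infsum (\<lambda>k. wt k powr (- r)) UNIV) * hn r a"
    using infsum_cauchy_schwarz[of "\<lambda>k. wt k powr (- r / 2)" "\<lambda>k. wt k powr (r / 2) * cmod (a k)"]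
    unfolding eq sq sq2 by (auto simp: hn_def)
qed

section \<open>Convolutions and the algebra estimate\<close>

lemma has_sum_finite_sum:
  fixes f :: "'i \<Rightarrow> 'a \<Rightarrow> 'b::{topological_comm_monoid_add}"
  assumes "finite N" "\<And>n. n \<in> N \<Longrightarrow> (f n has_sum s n) A"
  shows "((\<lambda>k. \<Sum>n\<in>N. f n k) has_sum (\<Sum>n\<in>N. s n)) A"
  using assms by (induction N rule: finite_induct) (auto intro: has_sum_add)

lemma summable_shift:
  fixes g :: "int \<Rightarrow> 'b::{topological_comm_monoid_add, t2_space}"
  shows "(\<lambda>k. g (n - k)) summable_on UNIV \<longleftrightarrow> g summable_on UNIV"
    and "infsum (\<lambda>k. g (n - k)) UNIV = infsum g UNIV"
proof -
  have "bij (\<lambda>k. n - k)" by (rule o_bij[of "\<lambda>k. n - k"]) auto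
  then show "(\<lambda>k. g (n - k)) summable_on UNIV \<longleftrightarrow> g summable_on UNIV"
     "infsum (\<lambda>k. g (n - k)) UNIV = infsum g UNIV"
    using summable_on_reindex_bij_betw[of "\<lambda>k. n - k" UNIV UNIV g] infsum_reindex_bij_betw[of "\<lambda>k. n - k" UNIV UNIV g]
    by auto
qed

text \<open>Cauchy-Schwarz with \<open>x\<close> as weight bounds the square of each entry of the
  convolution; summing over n first then uses that shifts preserve the sum of squares of
  \<open>y\<close>. Only finite sets of n are summed, so a finite sum is exchanged with an infinite
  one.\<close>

lemma young_convolution:
  fixes x y :: "int \<Rightarrow> real"
  assumes nn: "\<And>k. x k \<ge> 0" "\<And>k. y k \<ge> 0" and x: "x summable_on UNIV" and y: "(\<lambda>k. (y k)\<^sup>2) summable_on UNIV"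
  shows "(\<lambda>k. x k * y (n - k)) summable_on UNIV"
    and "(\<lambda>n. (\<Sum>\<^sub>\<infinity>k. x k * y (n - k))\<^sup>2) summable_on UNIV"
    and "(\<Sum>\<^sub>\<infinity>n. (\<Sum>\<^sub>\<infinity>k. x k * y (n - k))\<^sup>2) \<le> (infsum x UNIV)\<^sup>2 * (\<Sum>\<^sub>\<infinity>k. (y k)\<^sup>2)"
proof -
  define X where "X = infsum x UNIV"
  define Y where "Y = (\<Sum>\<^sub>\<infinity>k. (y k)\<^sup>2)"
  have XY: "X \<ge> 0" "Y \<ge> 0" using nn by (auto simp: X_def Y_def intro: infsum_nonneg)
  have yb: "(y k)\<^sup>2 \<le> Y" for k
    using finite_sum_le_infsum[OF y, of "{k}"] by (simp add: Y_def)
  have yb1: "y k \<le> sqrt Y" for k using yb[of k] by (rule real_le_rsqrt)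
  have s1: "(\<lambda>k. x k * y (n - k)) summable_on UNIV" for n
    by (rule summable_on_comparison_test[OF summable_on_cmult_left[OF x, of "sqrt Y"]])
       (use nn yb1 in \<open>auto intro: mult_left_mono\<close>)
  show "(\<lambda>k. x k * y (n - k)) summable_on UNIV" by (rule s1)
  have s2: "(\<lambda>k. x k * (y (n - k))\<^sup>2) summable_on UNIV" for n
    by (rule summable_on_comparison_test[OF summable_on_cmult_left[OF x, of Y]])
       (use nn yb in \<open>auto intro: mult_left_mono\<close>)
  have cs: "(\<Sum>\<^sub>\<infinity>k. x k * y (n - k))\<^sup>2 \<le> X * (\<Sum>\<^sub>\<infinity>k. x k * (y (n - k))\<^sup>2)" for n
  proof -
    have eq: "sqrt (x k) * (sqrt (x k) * y (n - k)) = x k * y (n - k)" for k using nn by simp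
    have sq: "(sqrt (x k))\<^sup>2 = x k" "(sqrt (x k) * y (n - k))\<^sup>2 = x k * (y (n - k))\<^sup>2" for k
      using nn by (auto simp: power_mult_distrib)
    have "(\<Sum>\<^sub>\<infinity>k. x k * y (n - k)) \<le> sqrt X * sqrt (\<Sum>\<^sub>\<infinity>k. x k * (y (n - k))\<^sup>2)"
      using infsum_cauchy_schwarz(2)[of "\<lambda>k. sqrt (x k)" "\<lambda>k. sqrt (x k) * y (n - k)"] nn x s2[of n]
      unfolding eq sq X_def by auto
    then have "(\<Sum>\<^sub>\<infinity>k. x k * y (n - k))\<^sup>2 \<le> (sqrt X * sqrt (\<Sum>\<^sub>\<infinity>k. x k * (y (n - k))\<^sup>2))\<^sup>2"
      using nn by (intro power_mono) (auto intro!: infsum_nonneg)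
    also have "\<dots> = X * (\<Sum>\<^sub>\<infinity>k. x k * (y (n - k))\<^sup>2)"
      using XY nn by (simp add: power_mult_distrib infsum_nonneg)
    finally show ?thesis .
  qed
  have fin: "(\<Sum>n\<in>N. (\<Sum>\<^sub>\<infinity>k. x k * y (n - k))\<^sup>2) \<le> X\<^sup>2 * Y" if N: "finite N" for N
  proof -
    have hs: "((\<lambda>k. \<Sum>n\<in>N. x k * (y (n - k))\<^sup>2) has_sum (\<Sum>n\<in>N. \<Sum>\<^sub>\<infinity>k. x k * (y (n - k))\<^sup>2)) UNIV"
      by (rule has_sum_finite_sum[OF N]) (use s2 in auto)
    have le: "(\<Sum>n\<in>N. x k * (y (n - k))\<^sup>2) \<le> x k * Y" for k
    proof -
      have "(\<Sum>n\<in>N. (y (n - k))\<^sup>2) = (\<Sum>m\<in>(\<lambda>n. n - k) ` N. (y m)\<^sup>2)"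
        by (subst sum.reindex) (auto simp: inj_on_def)
      also have "\<dots> \<le> Y" unfolding Y_def by (rule finite_sum_le_infsum[OF y]) (use N in auto)
      finally show ?thesis using nn by (simp add: sum_distrib_left[symmetric] mult_left_mono)
    qed
    have "(\<Sum>n\<in>N. (\<Sum>\<^sub>\<infinity>k. x k * y (n - k))\<^sup>2) \<le> (\<Sum>n\<in>N. X * (\<Sum>\<^sub>\<infinity>k. x k * (y (n - k))\<^sup>2))"
      by (intro sum_mono cs)
    also have "\<dots> = X * (\<Sum>n\<in>N. \<Sum>\<^sub>\<infinity>k. x k * (y (n - k))\<^sup>2)" by (simp add: sum_distrib_left)
    also have "(\<Sum>n\<in>N. \<Sum>\<^sub>\<infinity>k. x k * (y (n - k))\<^sup>2) \<le> (\<Sum>\<^sub>\<infinity>k. x k * Y)"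
      by (rule has_sum_mono[OF hs _ le]) (use x in \<open>auto intro!: has_sum_infsum summable_on_cmult_left\<close>)
    also have "(\<Sum>\<^sub>\<infinity>k. x k * Y) = X * Y" by (simp add: X_def infsum_cmult_left')
    finally show ?thesis using XY by (simp add: mult_left_mono power2_eq_square mult.assoc)
  qed
  show "(\<lambda>n. (\<Sum>\<^sub>\<infinity>k. x k * y (n - k))\<^sup>2) summable_on UNIV"
    "(\<Sum>\<^sub>\<infinity>n. (\<Sum>\<^sub>\<infinity>k. x k * y (n - k))\<^sup>2) \<le> (infsum x UNIV)\<^sup>2 * (\<Sum>\<^sub>\<infinity>k. (y k)\<^sup>2)"
    using nonneg_bound_summable[OF _ fin] by (auto simp: X_def Y_def)
qed

text \<open>The weight at k + l is at most four times the larger of the two weights, by (x + y)^2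
  \<le> 2 x^2 + 2 y^2. Under the exponent r/2 this 4 becomes \<open>2 powr r\<close>.\<close>

lemma wt_subadd: "r \<ge> 0 \<Longrightarrow> wt (k + l) powr (r / 2) \<le> 2 powr r * (wt k powr (r / 2) + wt l powr (r / 2))"
proof -
  assume r: "r \<ge> 0"
  have "wt (k + l) \<le> 4 * max (wt k) (wt l)"
  proof -
    have aux: "x \<le> 2 * y + 2 * z \<Longrightarrow> 1 + x \<le> 2 * (1 + y) + 2 * (1 + z)" for x y z :: real by simp
    have "(2 * pi * of_int (k + l))\<^sup>2 \<le> 2 * (2 * pi * of_int k)\<^sup>2 + 2 * (2 * pi * of_int l)\<^sup>2"
      using zero_le_power2[of "2 * pi * of_int k - 2 * pi * of_int l"] by (simp add: power2_eq_square algebra_simps)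
    then have "wt (k + l) \<le> 2 * wt k + 2 * wt l" unfolding wt_def by (rule aux)
    then show ?thesis by linarith
  qed
  then have "wt (k + l) powr (r / 2) \<le> (4 * max (wt k) (wt l)) powr (r / 2)"
    using r wt_pos[of "k + l"] by (intro powr_mono2) auto
  also have "\<dots> = 4 powr (r / 2) * max (wt k) (wt l) powr (r / 2)" by (rule powr_mult)
  also have "(4::real) powr (r / 2) = 2 powr r" using powr_powr[of 2 2 "r / 2"] by simp
  also have "max (wt k) (wt l) powr (r / 2) \<le> wt k powr (r / 2) + wt l powr (r / 2)" by (simp add: max_def)
  finally show ?thesis by (simp add: mult_left_mono)
qed

text \<open>The weight at n = k + (n - k) is moved onto one of the two factors. Each half is then
  the convolution of a weighted square summable sequence with a summable one, to which Young's
  inequality applies.\<close>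

lemma h2_conv:
  assumes r: "r > 1 / 2" and a: "h2 r a" and b: "h2 r b"
  defines "S \<equiv> sqrt (infsum (\<lambda>k. wt k powr (- r)) UNIV)"
  shows "h2 r (\<lambda>n. \<Sum>\<^sub>\<infinity>k. a k * b (n - k))"
    and "hn r (\<lambda>n. \<Sum>\<^sub>\<infinity>k. a k * b (n - k)) \<le> 2 * 2 powr r * S * hn r a * hn r b"
proof -
  define \<omega> where "\<omega> = (\<lambda>k. wt k powr (r / 2))"
  define A where "A = (\<lambda>k. \<omega> k * cmod (a k))"
  define B where "B = (\<lambda>k. \<omega> k * cmod (b k))"
  have \<omega>: "\<omega> k \<ge> 0" for k by (simp add: \<omega>_def)
  have A2: "(A k)\<^sup>2 = wt k powr r * (cmod (a k))\<^sup>2" and B2: "(B k)\<^sup>2 = wt k powr r * (cmod (b k))\<^sup>2" for k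
    using powr_half_sq wt_pos by (auto simp: A_def B_def \<omega>_def)
  have sA: "(\<lambda>k. (A k)\<^sup>2) summable_on UNIV" and sB: "(\<lambda>k. (B k)\<^sup>2) summable_on UNIV"
    using a b by (auto simp: A2 B2 h2_def)
  have nn: "A k \<ge> 0" "B k \<ge> 0" for k using \<omega> by (auto simp: A_def B_def)
  note la = h2_l1[OF r a] and lb = h2_l1[OF r b]
  note ya = young_convolution[of "\<lambda>k. cmod (a k)" B, OF _ nn(2) la(1) sB, simplified]
  note yb = young_convolution[of "\<lambda>k. cmod (b k)" A, OF _ nn(1) lb(1) sA, simplified]
  define P where "P = (\<lambda>n. \<Sum>\<^sub>\<infinity>k. cmod (a k) * B (n - k))"
  define Q where "Q = (\<lambda>n. \<Sum>\<^sub>\<infinity>k. cmod (b k) * A (n - k))"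
  have PQ: "P n \<ge> 0" "Q n \<ge> 0" for n using nn by (auto simp: P_def Q_def intro!: infsum_nonneg)
  have sab: "(\<lambda>k. cmod (a k) * cmod (b (n - k))) summable_on UNIV" for n
  proof (rule summable_on_comparison_test[OF ya(1)[of n]])
    fix k
    have "1 \<le> \<omega> (n - k)" unfolding \<omega>_def using wt_ge1 r by (intro ge_one_powr_ge_zero) auto
    then have "1 * cmod (b (n - k)) \<le> B (n - k)" unfolding B_def by (rule mult_right_mono) simp
    then show "cmod (a k) * cmod (b (n - k)) \<le> cmod (a k) * B (n - k)" by (intro mult_left_mono) auto
  qed auto
  have pt: "\<omega> n * cmod (\<Sum>\<^sub>\<infinity>k. a k * b (n - k)) \<le> 2 powr r * (P n + Q n)" for n
  proof -
    have "cmod (\<Sum>\<^sub>\<infinity>k. a k * b (n - k)) \<le> (\<Sum>\<^sub>\<infinity>k. cmod (a k) * cmod (b (n - k)))"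
      using norm_infsum_bound[of "\<lambda>k. a k * b (n - k)" UNIV] sab[of n] by (simp add: norm_mult)
    then have "\<omega> n * cmod (\<Sum>\<^sub>\<infinity>k. a k * b (n - k)) \<le> \<omega> n * (\<Sum>\<^sub>\<infinity>k. cmod (a k) * cmod (b (n - k)))"
      using \<omega> by (rule mult_left_mono)
    also have "\<dots> = (\<Sum>\<^sub>\<infinity>k. \<omega> n * (cmod (a k) * cmod (b (n - k))))" by (simp add: infsum_cmult_right')
    also have "\<dots> \<le> (\<Sum>\<^sub>\<infinity>k. 2 powr r * (cmod (a k) * B (n - k) + cmod (b (n - k)) * A k))"
    proof (rule infsum_mono)
      show "(\<lambda>k. \<omega> n * (cmod (a k) * cmod (b (n - k)))) summable_on UNIV" by (intro summable_on_cmult_right sab)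
      have "(\<lambda>k. cmod (b (n - k)) * A k) summable_on UNIV"
        using yb(1)[of n] summable_shift(1)[of "\<lambda>k. cmod (b k) * A (n - k)" n] by simp
      then show "(\<lambda>k. 2 powr r * (cmod (a k) * B (n - k) + cmod (b (n - k)) * A k)) summable_on UNIV"
        by (intro summable_on_cmult_right summable_on_add ya)
      fix k
      have "\<omega> n \<le> 2 powr r * (\<omega> k + \<omega> (n - k))" using wt_subadd[of r k "n - k"] r by (simp add: \<omega>_def)
      then have "\<omega> n * (cmod (a k) * cmod (b (n - k))) \<le> 2 powr r * (\<omega> k + \<omega> (n - k)) * (cmod (a k) * cmod (b (n - k)))"
        by (rule mult_right_mono) simp
      then show "\<omega> n * (cmod (a k) * cmod (b (n - k))) \<le> 2 powr r * (cmod (a k) * B (n - k) + cmod (b (n - k)) * A k)"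
        by (simp add: A_def B_def algebra_simps)
    qed
    also have "\<dots> = 2 powr r * (\<Sum>\<^sub>\<infinity>k. cmod (a k) * B (n - k) + cmod (b (n - k)) * A k)" by (simp add: infsum_cmult_right')
    also have "(\<Sum>\<^sub>\<infinity>k. cmod (a k) * B (n - k) + cmod (b (n - k)) * A k) = P n + (\<Sum>\<^sub>\<infinity>k. cmod (b (n - k)) * A k)"
      unfolding P_def using ya(1)[of n] yb(1)[of n] summable_shift(1)[of "\<lambda>k. cmod (b k) * A (n - k)" n] by (intro infsum_add) auto
    also have "(\<Sum>\<^sub>\<infinity>k. cmod (b (n - k)) * A k) = Q n"
      unfolding Q_def using summable_shift(2)[of "\<lambda>k. cmod (b k) * A (n - k)" n] by simp
    finally show ?thesis .
  qed
  \<comment> \<open>\<open>2 powr r\<close> comes squared from the distribution of the weight, and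
    the factor 2 is that of (P + Q)^2 \<le> 2 (P^2 + Q^2).\<close>
  define c where "c = 2 * (2 powr r)\<^sup>2"
  have le: "wt n powr r * (cmod (\<Sum>\<^sub>\<infinity>k. a k * b (n - k)))\<^sup>2 \<le> c * ((P n)\<^sup>2 + (Q n)\<^sup>2)" for n
  proof -
    have "wt n powr r * (cmod (\<Sum>\<^sub>\<infinity>k. a k * b (n - k)))\<^sup>2 = (\<omega> n * cmod (\<Sum>\<^sub>\<infinity>k. a k * b (n - k)))\<^sup>2"
      unfolding \<omega>_def using powr_half_sq[OF wt_pos] by simp
    also have "\<dots> \<le> (2 powr r * (P n + Q n))\<^sup>2" using pt \<omega> by (intro power_mono) auto
    also have "\<dots> = (2 powr r)\<^sup>2 * (P n + Q n)\<^sup>2" by (rule power_mult_distrib)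
    also have "\<dots> \<le> (2 powr r)\<^sup>2 * (2 * ((P n)\<^sup>2 + (Q n)\<^sup>2))"
      using zero_le_power2[of "P n - Q n"] by (intro mult_left_mono) (auto simp: power2_eq_square algebra_simps)
    finally show ?thesis by (simp add: c_def algebra_simps)
  qed
  have sPQ: "(\<lambda>n. c * ((P n)\<^sup>2 + (Q n)\<^sup>2)) summable_on UNIV"
    unfolding P_def Q_def by (intro summable_on_cmult_right summable_on_add ya yb)
  show h: "h2 r (\<lambda>n. \<Sum>\<^sub>\<infinity>k. a k * b (n - k))"
    unfolding h2_def by (rule summable_on_comparison_test[OF sPQ]) (use le in auto)
  have c0: "c \<ge> 0" by (simp add: c_def)
  have ha: "infsum (\<lambda>k. (A k)\<^sup>2) UNIV = (hn r a)\<^sup>2" and hb: "infsum (\<lambda>k. (B k)\<^sup>2) UNIV = (hn r b)\<^sup>2"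
    by (simp_all add: A2 B2 hn_sq)
  have "(hn r (\<lambda>n. \<Sum>\<^sub>\<infinity>k. a k * b (n - k)))\<^sup>2 \<le> infsum (\<lambda>n. c * ((P n)\<^sup>2 + (Q n)\<^sup>2)) UNIV"
    unfolding hn_sq by (rule infsum_mono[OF h[unfolded h2_def] sPQ le])
  also have "\<dots> = c * (infsum (\<lambda>n. (P n)\<^sup>2) UNIV + infsum (\<lambda>n. (Q n)\<^sup>2) UNIV)"
    unfolding P_def Q_def by (simp add: infsum_cmult_right' infsum_add ya yb)
  also have "\<dots> \<le> c * ((S * hn r a)\<^sup>2 * (hn r b)\<^sup>2 + (S * hn r b)\<^sup>2 * (hn r a)\<^sup>2)"
  proof (intro mult_left_mono[OF _ c0] add_mono)
    have "infsum (\<lambda>n. (P n)\<^sup>2) UNIV \<le> (infsum (\<lambda>k. cmod (a k)) UNIV)\<^sup>2 * (hn r b)\<^sup>2" using ya(3) by (simp add: P_def hb)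
    also have "\<dots> \<le> (S * hn r a)\<^sup>2 * (hn r b)\<^sup>2"
      using la(2) by (intro mult_right_mono power_mono) (auto simp: S_def infsum_nonneg)
    finally show "infsum (\<lambda>n. (P n)\<^sup>2) UNIV \<le> (S * hn r a)\<^sup>2 * (hn r b)\<^sup>2" .
    have "infsum (\<lambda>n. (Q n)\<^sup>2) UNIV \<le> (infsum (\<lambda>k. cmod (b k)) UNIV)\<^sup>2 * (hn r a)\<^sup>2" using yb(3) by (simp add: Q_def ha)
    also have "\<dots> \<le> (S * hn r b)\<^sup>2 * (hn r a)\<^sup>2"
      using lb(2) by (intro mult_right_mono power_mono) (auto simp: S_def infsum_nonneg)
    finally show "infsum (\<lambda>n. (Q n)\<^sup>2) UNIV \<le> (S * hn r b)\<^sup>2 * (hn r a)\<^sup>2" .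
  qed
  also have "\<dots> = (2 * 2 powr r * S * hn r a * hn r b)\<^sup>2" by (simp add: c_def power2_eq_square)
  finally show "hn r (\<lambda>n. \<Sum>\<^sub>\<infinity>k. a k * b (n - k)) \<le> 2 * 2 powr r * S * hn r a * hn r b"
    by (rule power2_le_imp_le) (auto intro!: mult_nonneg_nonneg hn_ge0 infsum_nonneg simp: S_def)
qed

section \<open>Functions on the circle\<close>

lemma cir_add: "cir (a + b) = cir a + cir b"
  by transfer (simp add: circle_rel_def)

lemma cir_eq_iff: "cir a = cir b \<longleftrightarrow> a - b \<in> \<int>"
  by transfer (simp add: circle_rel_def)

lemma cir_0 [simp]: "cir 0 = 0"
  by transfer (simp add: circle_rel_def)

lemma cir_1 [simp]: "cir 1 = 0"
  by transfer (simp add: circle_rel_def)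

lemma cir_int [simp]: "cir (of_int n) = 0"
  by transfer (simp add: circle_rel_def)

lemma cir_surj: obtains t where "x = cir t"
  by (metis Quotient3_abs_rep Quotient3_circle cir.abs_eq)

definition ccont :: "(circle \<Rightarrow> real) \<Rightarrow> bool"
  where "ccont u \<longleftrightarrow> continuous_on UNIV (\<lambda>t. u (cir t))"

definition has_cderiv :: "(circle \<Rightarrow> real) \<Rightarrow> (circle \<Rightarrow> real) \<Rightarrow> bool"
  where "has_cderiv u v \<longleftrightarrow> (\<forall>t. ((\<lambda>t. u (cir t)) has_real_derivative v (cir t)) (at t))"

lemma has_cderivI: "(\<And>t. ((\<lambda>t. u (cir t)) has_real_derivative v (cir t)) (at t)) \<Longrightarrow> has_cderiv u v"
  by (simp add: has_cderiv_def)

lemma has_cderivD: "has_cderiv u v \<Longrightarrow> ((\<lambda>t. u (cir t)) has_real_derivative v (cir t)) (at t within S)"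
  by (auto simp: has_cderiv_def intro: has_field_derivative_at_within)

lemma cderiv_eq:
  assumes "has_cderiv u v"
  shows "cderiv u = v"
proof
  fix x
  obtain t where x: "x = cir t" by (rule cir_surj)
  have "((\<lambda>s. u (cir (t + s))) has_real_derivative v (cir t)) (at 0)"
    using has_cderivD[OF assms, of t UNIV] DERIV_shift[of "\<lambda>t. u (cir t)" "v (cir t)" 0 t] by (simp add: add.commute)
  then show "cderiv u x = v x" unfolding cderiv_def x by (intro DERIV_imp_deriv) (simp add: cir_add)
qed

lemma has_cderiv_add: "has_cderiv u v \<Longrightarrow> has_cderiv u' v' \<Longrightarrow> has_cderiv (u + u') (v + v')"
  by (auto simp: has_cderiv_def intro!: derivative_eq_intros)

lemma has_cderiv_scale: "has_cderiv u v \<Longrightarrow> has_cderiv (c *\<^sub>R u) (c *\<^sub>R v)"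
  by (auto simp: has_cderiv_def scaleR_fun_def intro!: derivative_eq_intros)

lemma has_cderiv_mult: "has_cderiv u v \<Longrightarrow> has_cderiv u' v' \<Longrightarrow> has_cderiv (u * u') (v * u' + u * v')"
  by (auto simp: has_cderiv_def algebra_simps intro!: derivative_eq_intros)

lemma has_cderiv_ccont: "has_cderiv u v \<Longrightarrow> ccont u"
  unfolding has_cderiv_def ccont_def by (meson DERIV_continuous_on has_field_derivative_at_within)

lemma ccont_add: "ccont u \<Longrightarrow> ccont v \<Longrightarrow> ccont (u + v)"
  and ccont_diff: "ccont u \<Longrightarrow> ccont v \<Longrightarrow> ccont (u - v)"
  and ccont_mult: "ccont u \<Longrightarrow> ccont v \<Longrightarrow> ccont (u * v)"
  and ccont_scale: "ccont u \<Longrightarrow> ccont (c *\<^sub>R u)"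
  and ccont_one: "ccont 1"
  and ccont_zero: "ccont 0"
  by (auto simp: ccont_def scaleR_fun_def intro!: continuous_intros)

lemma ccont_on: "ccont u \<Longrightarrow> continuous_on S (\<lambda>t. u (cir t))"
  unfolding ccont_def by (rule continuous_on_subset) auto

lemma ccont_on_complex: "ccont u \<Longrightarrow> continuous_on S (\<lambda>t. complex_of_real (u (cir t)))"
  by (intro continuous_intros ccont_on)

lemma ccont_integrable: "ccont u \<Longrightarrow> (\<lambda>t. u (cir t)) integrable_on {a..b}"
  by (intro integrable_continuous_real ccont_on)

lemma ccont_bounded: assumes "ccont u" obtains M where "M \<ge> 0" "\<And>x. \<bar>u x\<bar> \<le> M"
proof -
  obtain M where M: "\<And>t. t \<in> {0..1} \<Longrightarrow> \<bar>u (cir t)\<bar> \<le> M"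
    using compact_imp_bounded[OF compact_continuous_image[OF ccont_on[OF assms, of "{0..1}"] compact_Icc]]
    unfolding bounded_iff by (metis imageI real_norm_def)
  have "\<bar>u x\<bar> \<le> M" for x
  proof -
    obtain t where "x = cir t" by (rule cir_surj)
    then have "x = cir (frac t)" by (simp add: cir_eq_iff frac_def)
    then show ?thesis using M[of "frac t"] by (simp add: frac_lt_1 less_imp_le)
  qed
  moreover have "M \<ge> 0" using M[of 0] by simp
  ultimately show thesis using that by blast
qed

lemma fourier_coeff_fc: "fourier_coeff u k = fc (\<lambda>t. of_real (u (cir t))) k"
  by (simp add: fourier_coeff_def fc_def ech_def)

lemma fourier_coeff_uminus: "fourier_coeff u (- k) = cnj (fourier_coeff u k)"
  using fc_cnj[of "\<lambda>t. of_real (u (cir t))" "- k"] by (simp add: fourier_coeff_fc)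

lemma fourier_coeff_add: "ccont u \<Longrightarrow> ccont v \<Longrightarrow> fourier_coeff (u + v) k = fourier_coeff u k + fourier_coeff v k"
  by (simp add: fourier_coeff_fc fc_add ccont_on ccont_on_complex)

lemma fourier_coeff_scale: "fourier_coeff (c *\<^sub>R u) k = of_real c * fourier_coeff u k"
  by (simp add: fourier_coeff_fc scaleR_fun_def fc_cmul)

lemma ccont_eqI:
  assumes "ccont u" "ccont v" "\<And>k. fourier_coeff u k = fourier_coeff v k"
  shows "u = v"
proof
  fix x
  obtain t where "x = cir t" by (rule cir_surj)
  then have x: "x = cir (frac t)" by (simp add: cir_eq_iff frac_def)
  have "complex_of_real (u (cir (frac t))) - of_real (v (cir (frac t))) = 0"
    by (rule fc_uniqueness[of "\<lambda>t. of_real (u (cir t)) - of_real (v (cir t))"])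
       (use assms in \<open>auto simp: fc_diff fourier_coeff_fc ccont_on ccont_on_complex frac_lt_1 less_imp_le intro!: continuous_intros\<close>)
  then show "u x = v x" using x by simp
qed

lemma ccont_inversion:
  assumes "ccont u" "(\<lambda>k. cmod (fourier_coeff u k)) summable_on UNIV"
  shows "complex_of_real (u (cir t)) = synth (fourier_coeff u) t"
proof -
  have "fourier_coeff u = fc (\<lambda>t. of_real (u (cir t)))" by (simp add: fourier_coeff_fc fun_eq_iff)
  then show ?thesis
    using synth_fc[of "\<lambda>t. of_real (u (cir t))" t] assms by (simp add: ccont_on ccont_on_complex cir_add)
qed

text \<open>Any lift of the point gives the same value because \<open>synth a\<close> has period 1;
  for hermitian coefficients the real part is the whole value.\<close>

definition csynth :: "(int \<Rightarrow> complex) \<Rightarrow> circle \<Rightarrow> real"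
  where "csynth a x = Re (synth a (SOME t. cir t = x))"

lemma csynth_cir: "csynth a (cir t) = Re (synth a t)"
proof -
  define s where "s = (SOME s. cir s = cir t)"
  have "cir s = cir t" unfolding s_def by (rule someI[of _ t]) simp
  then obtain n where "s - t = of_int n" by (auto simp: cir_eq_iff elim: Ints_cases)
  then have "s = t + of_int n" by simp
  then show ?thesis by (simp add: csynth_def synth_periodic flip: s_def)
qed

lemma synth_real:
  assumes "\<And>k. a (- k) = cnj (a k)"
  shows "synth a t = of_real (Re (synth a t))"
proof -
  have "bij (uminus :: int \<Rightarrow> int)" by (rule o_bij[of uminus]) auto
  then have "synth a t = (\<Sum>\<^sub>\<infinity>k. a (- k) * ech (- k) t)"
    unfolding synth_def using infsum_reindex_bij_betw[of uminus UNIV UNIV "\<lambda>k. a k * ech k t"] by simp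
  also have "\<dots> = (\<Sum>\<^sub>\<infinity>k. cnj (a k * ech k t))" by (simp add: assms)
  also have "\<dots> = cnj (synth a t)" by (simp add: synth_def del: complex_cnj_mult)
  finally show ?thesis by (metis Reals_cnj_iff of_real_Re)
qed

lemma csynth:
  assumes "\<And>k. a (- k) = cnj (a k)" "(\<lambda>k. cmod (a k)) summable_on UNIV"
  shows "ccont (csynth a)" "fourier_coeff (csynth a) k = a k" "complex_of_real (csynth a (cir t)) = synth a t"
proof -
  show eq: "complex_of_real (csynth a (cir t)) = synth a t" for t
    using synth_real[of a t, OF assms(1)] by (simp add: csynth_cir)
  show "ccont (csynth a)"
    unfolding ccont_def csynth_cir by (intro continuous_intros synth_continuous assms)
  show "fourier_coeff (csynth a) k = a k" unfolding fourier_coeff_fc eq by (rule fc_synth[OF assms(2)])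
qed

lemma cintegral_cderiv:
  assumes "has_cderiv u v"
  shows "cintegral v = 0"
proof -
  have "((\<lambda>t. v (cir t)) has_integral (u (cir 1) - u (cir 0))) {0..1}"
    by (rule fundamental_theorem_of_calculus)
       (use has_cderivD[OF assms] in \<open>auto simp: has_real_derivative_iff_has_vector_derivative\<close>)
  then show ?thesis by (simp add: cintegral_def integral_unique)
qed

lemma fourier_coeff_cderiv:
  assumes "has_cderiv u v" "ccont v"
  shows "fourier_coeff v k = \<i> * of_real (2 * pi * of_int k) * fourier_coeff u k"
  unfolding fourier_coeff_fc
proof (rule fc_deriv)
  show "((\<lambda>t. complex_of_real (u (cir t))) has_vector_derivative of_real (v (cir t))) (at t)" for t
    using has_cderivD[OF assms(1), of t UNIV]
    by (intro has_vector_derivative_of_real) (simp add: has_real_derivative_iff_has_vector_derivative)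
qed (simp_all add: ccont_on ccont_on_complex assms(2))

section \<open>Sobolev spaces on the circle\<close>

lemma Hs_iff: "u \<in> carr (Hs r) \<longleftrightarrow> ccont u \<and> h2 r (fourier_coeff u)"
  by (simp add: Hs_def ccont_def h2_def sobolev_weight_def wt_def[symmetric] cong: summable_on_cong)

lemma nrm_Hs: "nrm (Hs r) u = hn r (fourier_coeff u)"
  by (simp add: Hs_def hn_def sobolev_weight_def[abs_def] wt_def[symmetric])

lemma Hs_ccont: "u \<in> carr (Hs r) \<Longrightarrow> ccont u"
  by (simp add: Hs_iff)

lemma fourier_coeff_zero: "fourier_coeff 0 k = 0"
  by (simp add: fourier_coeff_fc fc_def)

lemma normed_Hs: "normed_ns (Hs r)"
proof (rule normed_nsI)
  show "0 \<in> carr (Hs r)" by (simp add: Hs_iff ccont_zero h2_def fourier_coeff_zero)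
next
  fix u v assume uv: "u \<in> carr (Hs r)" "v \<in> carr (Hs r)"
  then have eq: "fourier_coeff (u + v) = (\<lambda>k. fourier_coeff u k + fourier_coeff v k)"
    by (auto simp: fun_eq_iff fourier_coeff_add Hs_iff)
  show "u + v \<in> carr (Hs r)" "nrm (Hs r) (u + v) \<le> nrm (Hs r) u + nrm (Hs r) v"
    using uv hn_triangle[of r "fourier_coeff u" "fourier_coeff v"] by (auto simp: Hs_iff nrm_Hs ccont_add eq)
next
  fix c u assume u: "u \<in> carr (Hs r)"
  have eq: "fourier_coeff (c *\<^sub>R u) = (\<lambda>k. of_real c * fourier_coeff u k)"
    by (auto simp: fun_eq_iff fourier_coeff_scale)
  show "c *\<^sub>R u \<in> carr (Hs r)" "nrm (Hs r) (c *\<^sub>R u) = \<bar>c\<bar> * nrm (Hs r) u"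
    using u hn_scale[where r = r and a = "fourier_coeff u" and c = "of_real c"] by (auto simp: Hs_iff nrm_Hs ccont_scale eq)
next
  fix u assume u: "u \<in> carr (Hs r)" "nrm (Hs r) u = 0"
  have "fourier_coeff u k = 0" for k
  proof -
    have "(\<Sum>\<^sub>\<infinity>k. wt k powr r * (cmod (fourier_coeff u k))\<^sup>2) = 0" using u(2) by (simp add: nrm_Hs hn_def)
    then have "wt k powr r * (cmod (fourier_coeff u k))\<^sup>2 = 0"
      by (intro nonneg_infsum_le_0D[of _ UNIV]) (use u in \<open>auto simp: Hs_iff h2_def\<close>)
    then show ?thesis using wt_pos[of k] by simp
  qed
  then show "u = 0" using u by (intro ccont_eqI) (auto simp: Hs_iff ccont_zero fourier_coeff_zero)
qed

lemma Hs_mono: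
  assumes "u \<in> carr (Hs q)" "r \<le> q"
  shows "u \<in> carr (Hs r)" "nrm (Hs r) u \<le> nrm (Hs q) u"
proof -
  have le: "wt k powr r * (cmod (fourier_coeff u k))\<^sup>2 \<le> wt k powr q * (cmod (fourier_coeff u k))\<^sup>2" for k
    by (intro mult_right_mono powr_mono assms wt_ge1) simp
  show "u \<in> carr (Hs r)" "nrm (Hs r) u \<le> nrm (Hs q) u"
    using hn_mono[OF _ le] assms(1) by (auto simp: Hs_iff nrm_Hs)
qed

lemma Hs_sup:
  assumes "r > 1 / 2"
  obtains C where "C \<ge> 0" "\<And>u x. u \<in> carr (Hs r) \<Longrightarrow> \<bar>u x\<bar> \<le> C * nrm (Hs r) u"
proof -
  define C where "C = sqrt (infsum (\<lambda>k. wt k powr (- r)) UNIV)"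
  have "\<bar>u x\<bar> \<le> C * nrm (Hs r) u" if u: "u \<in> carr (Hs r)" for u x
  proof -
    obtain t where x: "x = cir t" by (rule cir_surj)
    have s: "(\<lambda>k. cmod (fourier_coeff u k)) summable_on UNIV" using h2_l1(1)[OF assms] u by (simp add: Hs_iff)
    have "\<bar>u x\<bar> = cmod (synth (fourier_coeff u) t)"
      using ccont_inversion[OF Hs_ccont[OF u] s, of t] x by (metis norm_of_real real_norm_def)
    also have "\<dots> \<le> infsum (\<lambda>k. cmod (fourier_coeff u k)) UNIV" by (rule synth_bound[OF s])
    also have "\<dots> \<le> C * nrm (Hs r) u" using h2_l1(2)[OF assms] u by (simp add: Hs_iff nrm_Hs C_def)
    finally show ?thesis .
  qed
  moreover have "C \<ge> 0" by (simp add: C_def infsum_nonneg)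
  ultimately show thesis using that by blast
qed

lemma fourier_coeff_mult:
  assumes r: "r > 1 / 2" and u: "u \<in> carr (Hs r)" and v: "ccont v"
  shows "fourier_coeff (u * v) n = (\<Sum>\<^sub>\<infinity>k. fourier_coeff u k * fourier_coeff v (n - k))"
proof -
  have s: "(\<lambda>k. cmod (fourier_coeff u k)) summable_on UNIV" using h2_l1(1)[OF r] u by (simp add: Hs_iff)
  have "((\<lambda>k. fourier_coeff u k * integral {0..1} (\<lambda>t. ech k t * (of_real (v (cir t)) * ech (- n) t))) has_sum
     integral {0..1} (\<lambda>t. synth (fourier_coeff u) t * (of_real (v (cir t)) * ech (- n) t))) UNIV"
    by (rule synth_integral[OF s]) (intro continuous_intros ccont_on_complex v)
  moreover have "ech k t * (of_real (v (cir t)) * ech (- n) t) = of_real (v (cir t)) * ech (- (n - k)) t" for k t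
    using ech_mult[of k t "- n"] by (simp add: algebra_simps)
  moreover have "integral {0..1} (\<lambda>t. synth (fourier_coeff u) t * (of_real (v (cir t)) * ech (- n) t)) = fourier_coeff (u * v) n"
    unfolding fourier_coeff_fc[of "u * v"] fc_def ccont_inversion[OF Hs_ccont[OF u] s, symmetric] by (simp add: mult.assoc)
  ultimately show ?thesis by (simp add: fourier_coeff_fc fc_def infsumI)
qed

lemma bdd_bil_mult:
  assumes "r > 1 / 2"
  shows "bdd_bil (Hs r) (Hs r) (Hs r) (\<lambda>u v. u * v)"
proof (rule bdd_bilI[OF normed_Hs normed_Hs])
  fix u v assume uv: "u \<in> carr (Hs r)" "v \<in> carr (Hs r)"
  have eq: "fourier_coeff (u * v) = (\<lambda>n. \<Sum>\<^sub>\<infinity>k. fourier_coeff u k * fourier_coeff v (n - k))"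
    using fourier_coeff_mult[OF assms uv(1) Hs_ccont[OF uv(2)]] by (simp add: fun_eq_iff)
  show "u * v \<in> carr (Hs r)"
    "nrm (Hs r) (u * v) \<le> (2 * 2 powr r * sqrt (infsum (\<lambda>k. wt k powr (- r)) UNIV)) * nrm (Hs r) u * nrm (Hs r) v"
    using uv h2_conv[OF assms, of "fourier_coeff u" "fourier_coeff v"] by (auto simp: Hs_iff nrm_Hs eq ccont_mult)
qed (auto simp: fun_eq_iff scaleR_fun_def algebra_simps)

lemma Hs_mult: "r > 1 / 2 \<Longrightarrow> u \<in> carr (Hs r) \<Longrightarrow> v \<in> carr (Hs r) \<Longrightarrow> u * v \<in> carr (Hs r)"
  using bdd_bilD(1)[OF bdd_bil_mult] by blast

lemma Hs_one: "1 \<in> carr (Hs r)"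
proof -
  have eq: "fourier_coeff 1 k = (if k = 0 then 1 else 0)" for k
    by (simp add: fourier_coeff_fc fc_def int_ech)
  have "(\<lambda>k. wt k powr r * (cmod (fourier_coeff 1 k))\<^sup>2) summable_on UNIV"
    unfolding eq by (rule summable_on_cong_neutral[where T = "{0}" and g = "\<lambda>k. wt k powr r", THEN iffD2]) auto
  then show ?thesis by (simp add: Hs_iff ccont_one h2_def)
qed

section \<open>Differentiation as a map between Sobolev spaces\<close>

lemma wt_deriv: "wt k powr (r + 1) * (cmod a)\<^sup>2 = wt k powr r * (cmod a)\<^sup>2 + wt k powr r * (cmod (\<i> * of_real (2 * pi * of_int k) * a))\<^sup>2"
  using wt_pos[of k] by (simp add: powr_add wt_def norm_mult power_mult_distrib algebra_simps)

text \<open>By \<open>wt_deriv\<close> the squared norm of order r + 1 is the sum of the squared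
  norms of order r of \<open>u\<close> and \<open>v\<close>; the stated bound only adds the cross
  term.\<close>

lemma Hs_Suc:
  assumes "u \<in> carr (Hs r)" "has_cderiv u v" "v \<in> carr (Hs r)"
  shows "u \<in> carr (Hs (r + 1))" "nrm (Hs (r + 1)) u \<le> nrm (Hs r) u + nrm (Hs r) v"
proof -
  have eq: "wt k powr (r + 1) * (cmod (fourier_coeff u k))\<^sup>2
     = wt k powr r * (cmod (fourier_coeff u k))\<^sup>2 + wt k powr r * (cmod (fourier_coeff v k))\<^sup>2" for k
    using wt_deriv[of k r "fourier_coeff u k"] fourier_coeff_cderiv[OF assms(2) Hs_ccont[OF assms(3)]] by simp
  have s: "(\<lambda>k. wt k powr r * (cmod (fourier_coeff u k))\<^sup>2) summable_on UNIV" "(\<lambda>k. wt k powr r * (cmod (fourier_coeff v k))\<^sup>2) summable_on UNIV"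
    using assms by (auto simp: Hs_iff h2_def)
  show "u \<in> carr (Hs (r + 1))" unfolding Hs_iff h2_def eq using s assms by (auto intro: summable_on_add Hs_ccont)
  have "(nrm (Hs (r + 1)) u)\<^sup>2 = (nrm (Hs r) u)\<^sup>2 + (nrm (Hs r) v)\<^sup>2"
    unfolding nrm_Hs hn_sq eq by (rule infsum_add[OF s])
  also have "\<dots> \<le> (nrm (Hs r) u + nrm (Hs r) v)\<^sup>2"
    using hn_ge0 by (simp add: power2_sum nrm_Hs)
  finally show "nrm (Hs (r + 1)) u \<le> nrm (Hs r) u + nrm (Hs r) v"
    by (rule power2_le_imp_le) (simp add: nrm_Hs hn_ge0)
qed

text \<open>The candidate \<open>csynth a\<close> has the formally differentiated coefficients,
  which are absolutely summable since they have order r > 1/2. Integrating its series termwise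
  recovers the increments of \<open>u\<close>, and the fundamental theorem of calculus then gives
  the derivative.\<close>

lemma Hs_deriv:
  assumes r: "r > 1 / 2" and u: "u \<in> carr (Hs (r + 1))"
  shows "has_cderiv u (cderiv u)" "cderiv u \<in> carr (Hs r)" "nrm (Hs r) (cderiv u) \<le> nrm (Hs (r + 1)) u"
proof -
  define a where "a = (\<lambda>k. \<i> * of_real (2 * pi * of_int k) * fourier_coeff u k)"
  have am: "h2 r a" "hn r a \<le> hn (r + 1) (fourier_coeff u)"
    using hn_mono[of "r + 1" "fourier_coeff u" r a] u wt_deriv by (auto simp: Hs_iff a_def)
  have sym: "a (- k) = cnj (a k)" for k by (simp add: a_def fourier_coeff_uminus)
  have sa: "(\<lambda>k. cmod (a k)) summable_on UNIV" by (rule h2_l1(1)[OF r am(1)])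
  have su: "(\<lambda>k. cmod (fourier_coeff u k)) summable_on UNIV"
    by (rule h2_l1(1)[of "r + 1"]) (use r u in \<open>auto simp: Hs_iff\<close>)
  note cs = csynth[of a, OF sym sa]
  have int: "u (cir t) - u (cir s) = integral {s..t} (\<lambda>x. csynth a (cir x))" if "s \<le> t" for s t
  proof -
    have "((\<lambda>k. a k * integral {s..t} (\<lambda>x. ech k x * 1)) has_sum integral {s..t} (\<lambda>x. synth a x * 1)) UNIV"
      by (rule synth_integral[OF sa]) auto
    moreover have "a k * integral {s..t} (\<lambda>x. ech k x * 1) = fourier_coeff u k * ech k t - fourier_coeff u k * ech k s" for k
    proof -
      have "((\<lambda>x. (2 * pi * of_int k) *\<^sub>R (\<i> * ech k x)) has_integral (ech k t - ech k s)) {s..t}"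
        by (rule fundamental_theorem_of_calculus[OF that]) (rule ech_deriv)
      moreover have "(\<lambda>x. (2 * pi * of_int k) *\<^sub>R (\<i> * ech k x)) = (\<lambda>x. (\<i> * of_real (2 * pi * of_int k)) * ech k x)"
        by (simp add: fun_eq_iff scaleR_conv_of_real)
      ultimately have "integral {s..t} (\<lambda>x. (\<i> * of_real (2 * pi * of_int k)) * ech k x) = ech k t - ech k s"
        using integral_unique by metis
      then have I: "(\<i> * of_real (2 * pi * of_int k)) * integral {s..t} (ech k) = ech k t - ech k s"
        unfolding integral_mult_right .
      have "a k * integral {s..t} (\<lambda>x. ech k x * 1) = fourier_coeff u k * ((\<i> * of_real (2 * pi * of_int k)) * integral {s..t} (ech k))"
        by (simp add: a_def)
      then show ?thesis unfolding I by (simp add: right_diff_distrib)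
    qed
    ultimately have "((\<lambda>k. fourier_coeff u k * ech k t - fourier_coeff u k * ech k s) has_sum integral {s..t} (synth a)) UNIV"
      by simp
    moreover have "((\<lambda>k. fourier_coeff u k * ech k t - fourier_coeff u k * ech k s) has_sum
        (of_real (u (cir t)) - of_real (u (cir s)))) UNIV"
    proof -
      have "((\<lambda>k. fourier_coeff u k * ech k t) has_sum synth (fourier_coeff u) t) UNIV" for t
        unfolding synth_def by (rule has_sum_infsum, rule abs_summable_summable) (use su in \<open>simp add: norm_mult\<close>)
      then have h: "((\<lambda>k. fourier_coeff u k * ech k t) has_sum of_real (u (cir t))) UNIV" for t
        using ccont_inversion[OF Hs_ccont[OF u] su] by simp
      have "((\<lambda>k. - (fourier_coeff u k * ech k s)) has_sum - of_real (u (cir s))) UNIV"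
        using h[of s] by (simp add: has_sum_uminus)
      from has_sum_add[OF h[of t] this] show ?thesis by simp
    qed
    ultimately have "of_real (u (cir t)) - of_real (u (cir s)) = integral {s..t} (synth a)" by (rule has_sum_unique[rotated])
    also have "synth a = (\<lambda>x. complex_of_real (csynth a (cir x)))" using cs(3) by (simp add: fun_eq_iff)
    also have "integral {s..t} \<dots> = of_real (integral {s..t} (\<lambda>x. csynth a (cir x)))"
      by (intro integral_linear[OF _ bounded_linear_of_real, unfolded o_def] ccont_integrable cs)
    finally show ?thesis by (simp flip: of_real_diff)
  qed
  have hd: "has_cderiv u (csynth a)"
  proof (rule has_cderivI)
    fix t
    have "((\<lambda>x. integral {t - 1..x} (\<lambda>x. csynth a (cir x))) has_real_derivative csynth a (cir t)) (at t within {t - 1..t + 1})"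
      by (rule integral_has_real_derivative) (use ccont_on[OF cs(1)] in auto)
    then have "((\<lambda>x. u (cir (t - 1)) + integral {t - 1..x} (\<lambda>x. csynth a (cir x))) has_real_derivative csynth a (cir t)) (at t within {t - 1..t + 1})"
      by (auto intro!: derivative_eq_intros)
    then have "((\<lambda>x. u (cir x)) has_real_derivative csynth a (cir t)) (at t within {t - 1..t + 1})"
    proof (rule has_field_derivative_transform_within[of _ _ _ _ 1])
      fix x assume "x \<in> {t - 1..t + 1}"
      then show "u (cir (t - 1)) + integral {t - 1..x} (\<lambda>x. csynth a (cir x)) = u (cir x)"
        using int[of "t - 1" x] by simp
    qed auto
    then show "((\<lambda>x. u (cir x)) has_real_derivative csynth a (cir t)) (at t)"
      by (simp add: at_within_Icc_at)
  qed
  have fa: "fourier_coeff (csynth a) = a" using cs(2) by (simp add: fun_eq_iff)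
  have ce: "cderiv u = csynth a" by (rule cderiv_eq[OF hd])
  show "has_cderiv u (cderiv u)" unfolding ce by (rule hd)
  show "cderiv u \<in> carr (Hs r)" unfolding ce Hs_iff fa using cs am by simp
  show "nrm (Hs r) (cderiv u) \<le> nrm (Hs (r + 1)) u" unfolding ce nrm_Hs fa by (rule am(2))
qed

lemma bessel_circle:
  assumes "ccont u"
  shows "(\<lambda>k. (cmod (fourier_coeff u k))\<^sup>2) summable_on UNIV"
    and "infsum (\<lambda>k. (cmod (fourier_coeff u k))\<^sup>2) UNIV \<le> integral {0..1} (\<lambda>t. (u (cir t))\<^sup>2)"
proof -
  have "(\<Sum>k\<in>F. (cmod (fourier_coeff u k))\<^sup>2) \<le> integral {0..1} (\<lambda>t. (u (cir t))\<^sup>2)" if "finite F" for F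
    using bessel[OF ccont_on_complex[OF assms] that] by (simp add: fourier_coeff_fc)
  from nonneg_bound_summable[OF _ this]
  show "(\<lambda>k. (cmod (fourier_coeff u k))\<^sup>2) summable_on UNIV"
    "infsum (\<lambda>k. (cmod (fourier_coeff u k))\<^sup>2) UNIV \<le> integral {0..1} (\<lambda>t. (u (cir t))\<^sup>2)"
    by auto
qed

text \<open>Bessel's inequality for \<open>u\<close> and its derivative bounds the norm of order 1.
  This starts the bootstrap for reciprocals.\<close>

lemma C1_Hs:
  assumes "has_cderiv u v" "ccont v" "r \<le> 1"
  shows "u \<in> carr (Hs r)"
proof -
  have c: "ccont u" by (rule has_cderiv_ccont[OF assms(1)])
  have "wt k powr (0 + 1) * (cmod (fourier_coeff u k))\<^sup>2 = (cmod (fourier_coeff u k))\<^sup>2 + (cmod (fourier_coeff v k))\<^sup>2" for k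
    using wt_deriv[of k 0 "fourier_coeff u k"] fourier_coeff_cderiv[OF assms(1,2)] wt_pos[of k] by simp
  then have "u \<in> carr (Hs 1)"
    unfolding Hs_iff h2_def using c bessel_circle(1)[OF c] bessel_circle(1)[OF assms(2)] by (simp add: summable_on_add)
  then show ?thesis by (rule Hs_mono(1)[OF _ assms(3)])
qed

lemma cintegral_add: "ccont u \<Longrightarrow> ccont v \<Longrightarrow> cintegral (u + v) = cintegral u + cintegral v"
  unfolding cintegral_def by (simp add: integral_add ccont_integrable)

lemma cintegral_scale: "cintegral (c *\<^sub>R u) = c * cintegral u"
  unfolding cintegral_def scaleR_fun_def by simp

lemma bdd_lin_cintegral:
  assumes "r > 1 / 2"
  shows "bdd_lin (Hs r) real_ns cintegral"
proof -
  obtain C where C: "C \<ge> 0" "\<And>u x. u \<in> carr (Hs r) \<Longrightarrow> \<bar>u x\<bar> \<le> C * nrm (Hs r) u"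
    using Hs_sup[OF assms] by blast
  show ?thesis
  proof (rule bdd_linI[OF _ normed_Hs])
    show "lin_on (Hs r) real_ns cintegral"
      by (auto simp: lin_on_def real_ns_def cintegral_add cintegral_scale Hs_ccont)
    fix u assume u: "u \<in> carr (Hs r)"
    have "\<bar>integral {0..1} (\<lambda>t. u (cir t))\<bar> \<le> integral {0..1} (\<lambda>t::real. C * nrm (Hs r) u)"
      using integral_norm_bound_integral[of "\<lambda>t. u (cir t)" "{0..1}" "\<lambda>t. C * nrm (Hs r) u"] C(2)[OF u]
      by (simp add: ccont_integrable Hs_ccont[OF u] integrable_const_ivl)
    then show "nrm real_ns (cintegral u) \<le> C * nrm (Hs r) u" by (simp add: real_ns_def cintegral_def)
  qed
qed

section \<open>The operator A on the Fourier side\<close>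

lemma A_op_ccont_fourier:
  assumes r: "r > 1 / 2" and w: "w \<in> carr (Hs (r + 2))"
  shows "ccont (A_op w)" "fourier_coeff (A_op w) k = of_real (wt k) * fourier_coeff w k"
proof -
  have w': "w \<in> carr (Hs (r + 1 + 1))" using w by (simp add: add.assoc)
  have r1: "r + 1 > 1 / 2" using r by simp
  note d1 = Hs_deriv[OF r1 w']
  note d2 = Hs_deriv[OF r d1(2)]
  show A: "ccont (A_op w)" unfolding A_op_def by (intro ccont_diff Hs_ccont[OF w] Hs_ccont[OF d2(2)])
  have "fourier_coeff w k = fourier_coeff (A_op w + cderiv (cderiv w)) k" by (simp add: A_op_def)
  also have "\<dots> = fourier_coeff (A_op w) k + fourier_coeff (cderiv (cderiv w)) k"
    by (rule fourier_coeff_add[OF A Hs_ccont[OF d2(2)]])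
  also have "fourier_coeff (cderiv (cderiv w)) k = (\<i> * of_real (2 * pi * of_int k))\<^sup>2 * fourier_coeff w k"
    using fourier_coeff_cderiv[OF d1(1) Hs_ccont[OF d1(2)]] fourier_coeff_cderiv[OF d2(1) Hs_ccont[OF d2(2)]]
    by (simp add: power2_eq_square mult.assoc)
  finally show "fourier_coeff (A_op w) k = of_real (wt k) * fourier_coeff w k"
    by (simp add: wt_def power_mult_distrib algebra_simps)
qed

text \<open>A multiplies the coefficients by \<open>wt k\<close>, so division inverts it. The
  weights of orders r + 2 and r differ by the square of \<open>wt k\<close>, which makes the inverse
  an isometry.\<close>

lemma A_inverse:
  assumes r: "r > 1 / 2" and f: "f \<in> carr (Hs r)"
  obtains w where "w \<in> carr (Hs (r + 2))" "A_op w = f" "nrm (Hs (r + 2)) w = nrm (Hs r) f"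
proof -
  define a where "a = (\<lambda>k. fourier_coeff f k / of_real (wt k))"
  have eq: "wt k powr (r + 2) * (cmod (a k))\<^sup>2 = wt k powr r * (cmod (fourier_coeff f k))\<^sup>2" for k
    using wt_pos[of k] by (simp add: a_def norm_divide powr_add power_divide powr_numeral)
  have ha: "h2 (r + 2) a" using f unfolding h2_def eq by (simp add: Hs_iff h2_def)
  have sa: "(\<lambda>k. cmod (a k)) summable_on UNIV" by (rule h2_l1(1)[OF _ ha]) (use r in auto)
  have "wt (- k) = wt k" for k by (simp add: wt_def)
  then have sym: "a (- k) = cnj (a k)" for k by (simp add: a_def fourier_coeff_uminus)
  note cs = csynth[of a, OF sym sa]
  have fw: "fourier_coeff (csynth a) = a" using cs(2) by (simp add: fun_eq_iff)
  have w: "csynth a \<in> carr (Hs (r + 2))" using cs ha by (simp add: Hs_iff fw)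
  note A = A_op_ccont_fourier[OF r w]
  have "A_op (csynth a) = f"
  proof (rule ccont_eqI[OF A(1) Hs_ccont[OF f]])
    show "fourier_coeff (A_op (csynth a)) k = fourier_coeff f k" for k
      unfolding A(2) fw using wt_pos[of k] by (simp add: a_def)
  qed
  moreover have "nrm (Hs (r + 2)) (csynth a) = nrm (Hs r) f" unfolding nrm_Hs fw hn_def eq by simp
  ultimately show thesis using that w by blast
qed

lemma A_op_inj:
  assumes r: "r > 1 / 2"
  shows "inj_on A_op (carr (Hs (r + 2)))"
proof (rule inj_onI)
  fix u v assume uv: "u \<in> carr (Hs (r + 2))" "v \<in> carr (Hs (r + 2))" "A_op u = A_op v"
  have "fourier_coeff u k = fourier_coeff v k" for k
    using A_op_ccont_fourier(2)[OF r uv(1), of k] A_op_ccont_fourier(2)[OF r uv(2), of k] uv(3) wt_pos[of k] by simp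
  then show "u = v" using ccont_eqI uv Hs_ccont by blast
qed

section \<open>Diffeomorphisms of the circle\<close>

text \<open>Differentiability of a circle map is expressed through a lift \<Phi> to the real line;
  the last condition says that the map has degree one. The derivative \<open>b\<close> is a function
  on the circle, as it does not depend on the lift.\<close>

definition has_cdiff :: "(circle \<Rightarrow> circle) \<Rightarrow> (circle \<Rightarrow> real) \<Rightarrow> bool"
  where "has_cdiff \<phi> b \<longleftrightarrow> (\<exists>\<Phi>. (\<forall>t. cir (\<Phi> t) = \<phi> (cir t)) \<and>
    (\<forall>t. (\<Phi> has_real_derivative b (cir t)) (at t)) \<and> (\<forall>t. \<Phi> (t + 1) = \<Phi> t + 1))"

definition recip :: "(circle \<Rightarrow> real) \<Rightarrow> circle \<Rightarrow> real"
  where "recip f = (\<lambda>x. 1 / f x)"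

lemma ccont_uminus: "ccont u \<Longrightarrow> ccont (- u)"
  by (auto simp: ccont_def intro!: continuous_intros)

lemma ccont_recip: "ccont f \<Longrightarrow> (\<And>x. f x > 0) \<Longrightarrow> ccont (recip f)"
  unfolding ccont_def recip_def by (intro continuous_intros) (auto simp: less_imp_neq[symmetric])

lemma has_cderiv_recip:
  assumes "has_cderiv f g" "\<And>x. f x > 0"
  shows "has_cderiv (recip f) (- (g * (recip f * recip f)))"
proof (rule has_cderivI)
  fix t
  have "f (cir t) \<noteq> 0" using assms(2)[of "cir t"] by simp
  then show "((\<lambda>t. recip f (cir t)) has_real_derivative (- (g * (recip f * recip f))) (cir t)) (at t)"
    unfolding recip_def using has_cderivD[OF assms(1), of t UNIV]
    by (auto intro!: derivative_eq_intros simp: field_simps power2_eq_square)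
qed

lemma has_cdiff_comp_ccont: "has_cdiff \<phi> b \<Longrightarrow> ccont u \<Longrightarrow> ccont (u \<circ> \<phi>)"
proof -
  assume \<phi>: "has_cdiff \<phi> b" and u: "ccont u"
  obtain \<Phi> where \<Phi>: "\<And>t. cir (\<Phi> t) = \<phi> (cir t)" "\<And>t. (\<Phi> has_real_derivative b (cir t)) (at t)"
    using \<phi> unfolding has_cdiff_def by blast
  have "continuous_on UNIV \<Phi>" using \<Phi>(2) by (meson DERIV_continuous_on has_field_derivative_at_within)
  then have "continuous_on UNIV (\<lambda>t. u (cir (\<Phi> t)))"
    using continuous_on_compose2[of UNIV "\<lambda>t. u (cir t)" UNIV \<Phi>] u by (auto simp: ccont_def)
  then show "ccont (u \<circ> \<phi>)" by (simp add: ccont_def \<Phi>(1))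
qed

lemma has_cdiff_chain: "has_cdiff \<phi> b \<Longrightarrow> has_cderiv u v \<Longrightarrow> has_cderiv (u \<circ> \<phi>) ((v \<circ> \<phi>) * b)"
proof -
  assume \<phi>: "has_cdiff \<phi> b" and u: "has_cderiv u v"
  obtain \<Phi> where \<Phi>: "\<And>t. cir (\<Phi> t) = \<phi> (cir t)" "\<And>t. (\<Phi> has_real_derivative b (cir t)) (at t)"
    using \<phi> unfolding has_cdiff_def by blast
  show ?thesis
  proof (rule has_cderivI)
    fix t
    have "((\<lambda>s. u (cir (\<Phi> s))) has_real_derivative v (cir (\<Phi> t)) * b (cir t)) (at t)"
      by (rule DERIV_chain2[OF has_cderivD[OF u] \<Phi>(2)])
    then show "((\<lambda>t. (u \<circ> \<phi>) (cir t)) has_real_derivative ((v \<circ> \<phi>) * b) (cir t)) (at t)" by (simp add: \<Phi>(1))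
  qed
qed

lemma integral_periodic:
  fixes f :: "real \<Rightarrow> real"
  assumes f: "continuous_on UNIV f" and per: "\<And>t. f (t + 1) = f t"
  shows "integral {c..c + 1} f = integral {0..1} f"
proof -
  define n where "n = \<lfloor>c\<rfloor>"
  define \<theta> where "\<theta> = frac c"
  have c: "c = \<theta> + of_int n" and \<theta>: "0 \<le> \<theta>" "\<theta> \<le> 1" by (auto simp: n_def \<theta>_def frac_def frac_lt_1 less_imp_le) linarith
  have co: "continuous_on S f" for S using f by (rule continuous_on_subset) auto
  note pn = periodic_add_int[of f, OF per]
  have "integral {c..c + 1} f = integral {\<theta> + of_int n..\<theta> + 1 + of_int n} f" unfolding c by (simp add: algebra_simps)
  also have "\<dots> = integral {\<theta>..\<theta> + 1} (f \<circ> (\<lambda>x. x + of_int n))" by (rule integral_shift[symmetric, OF co])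
  also have "f \<circ> (\<lambda>x. x + of_int n) = f" using pn by (auto simp: fun_eq_iff)
  also have "integral {\<theta>..\<theta> + 1} f = integral {\<theta>..1} f + integral {1..\<theta> + 1} f"
    using Henstock_Kurzweil_Integration.integral_combine[where a = \<theta> and c = 1 and b = "\<theta> + 1" and f = f] \<theta> by (simp add: integrable_continuous_real co)
  also have "integral {1..\<theta> + 1} f = integral {0..\<theta>} (f \<circ> (\<lambda>x. x + 1))"
    using integral_shift[of 0 1 \<theta> f, OF co] by simp
  also have "f \<circ> (\<lambda>x. x + 1) = f" using per by (auto simp: fun_eq_iff)
  also have "integral {\<theta>..1} f + integral {0..\<theta>} f = integral {0..1} f"
    using Henstock_Kurzweil_Integration.integral_combine[where a = 0 and c = \<theta> and b = 1 and f = f] \<theta> by (simp add: integrable_continuous_real co)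
  finally show ?thesis .
qed

text \<open>Over one period \<Phi> advances by exactly 1, and the integral of a 1-periodic function
  over an interval of length 1 does not depend on its position.\<close>

lemma subst_periodic:
  fixes f :: "real \<Rightarrow> real"
  assumes f: "continuous_on UNIV f" "\<And>t. f (t + 1) = f t"
    and \<Phi>: "\<And>t. (\<Phi> has_real_derivative b (cir t)) (at t)" "\<And>t. \<Phi> (t + 1) = \<Phi> t + 1"
  shows "((\<lambda>t. b (cir t) * f (\<Phi> t)) has_integral integral {0..1} f) {0..1}"
proof -
  have c: "continuous_on {0..1} \<Phi>" using \<Phi>(1) by (meson DERIV_continuous_on has_field_derivative_at_within)
  obtain M where M: "\<And>t. t \<in> {0..1} \<Longrightarrow> \<bar>\<Phi> t\<bar> \<le> M"
    using compact_imp_bounded[OF compact_continuous_image[OF c compact_Icc]]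
    unfolding bounded_iff by (metis imageI real_norm_def)
  have "((\<lambda>t. b (cir t) *\<^sub>R f (\<Phi> t)) has_integral integral {\<Phi> 0..\<Phi> 1} f) {0..1}"
  proof (rule has_integral_substitution)
    show "\<Phi> 0 \<le> \<Phi> 1" using \<Phi>(2)[of 0] by simp
    show "\<Phi> ` {0..1} \<subseteq> {- M..M}" using M by (auto simp: abs_le_iff minus_le_iff)
    show "(\<Phi> has_real_derivative b (cir t)) (at t within {0..1})" for t by (rule has_field_derivative_at_within[OF \<Phi>(1)])
  qed (use f in \<open>auto intro: continuous_on_subset\<close>)
  moreover have "integral {\<Phi> 0..\<Phi> 1} f = integral {0..1} f"
    using integral_periodic[OF f, of "\<Phi> 0"] \<Phi>(2)[of 0] by simp
  ultimately show ?thesis by simp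
qed

lemma cintegral_subst:
  assumes "has_cdiff \<phi> b" "ccont u"
  shows "cintegral (b * (u \<circ> \<phi>)) = cintegral u"
proof -
  obtain \<Phi> where \<Phi>: "\<And>t. cir (\<Phi> t) = \<phi> (cir t)" "\<And>t. (\<Phi> has_real_derivative b (cir t)) (at t)" "\<And>t. \<Phi> (t + 1) = \<Phi> t + 1"
    using assms(1) unfolding has_cdiff_def by blast
  have "((\<lambda>t. b (cir t) * u (cir (\<Phi> t))) has_integral integral {0..1} (\<lambda>t. u (cir t))) {0..1}"
    by (rule subst_periodic[OF _ _ \<Phi>(2,3)]) (use assms in \<open>auto simp: ccont_def cir_add\<close>)
  then show ?thesis by (simp add: cintegral_def \<Phi>(1) integral_unique)
qed

text \<open>All work is done on the lift \<Phi>, a strictly increasing bijection commuting with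
  integer translations. Its inverse commutes with them as well and descends to the inverse of
  \<phi>.\<close>

lemma has_cdiff_inverse:
  assumes \<phi>: "has_cdiff \<phi> b" and b: "\<And>x. b x > 0"
  shows "bij \<phi>" "has_cdiff (inv \<phi>) (recip b \<circ> inv \<phi>)"
proof -
  obtain \<Phi> where \<Phi>: "\<And>t. cir (\<Phi> t) = \<phi> (cir t)" "\<And>t. (\<Phi> has_real_derivative b (cir t)) (at t)" "\<And>t. \<Phi> (t + 1) = \<Phi> t + 1"
    using \<phi> unfolding has_cdiff_def by blast
  have mono: "\<Phi> s < \<Phi> t" if "s < t" for s t
    by (rule DERIV_pos_imp_increasing[OF that]) (use \<Phi>(2) b in blast)
  then have inj: "\<Phi> s = \<Phi> t \<longleftrightarrow> s = t" for s t by (metis less_irrefl linorder_neqE_linordered_idom)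
  have per: "\<Phi> (t + of_int n) = \<Phi> t + of_int n" for t n
    using periodic_add_int[of "\<lambda>t. \<Phi> t - t" t n] \<Phi>(3) by simp
  have cont: "isCont \<Phi> t" for t using \<Phi>(2) DERIV_isCont by blast
  have surj: "\<exists>t. \<Phi> t = y" for y
  proof -
    \<comment> \<open>With this integer, \<open>y\<close> lies between the values of \<Phi> at
      \<open>n\<close> and \<open>n + 1\<close>, which brackets it for the intermediate value
      theorem.\<close>
    define n where "n = \<lfloor>y - \<Phi> 0\<rfloor>"
    have "\<Phi> (of_int n) \<le> y" "y \<le> \<Phi> (of_int n + 1)"
      using per[of 0 n] \<Phi>(3)[of "of_int n"] by (auto simp: n_def) linarith+
    then show ?thesis using IVT[of \<Phi> "of_int n" y "of_int n + 1"] cont by auto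
  qed
  define \<Psi> where "\<Psi> = inv \<Phi>"
  have bij: "bij \<Phi>" using inj surj by (auto simp: bij_def inj_def surj_def) metis
  have 1: "\<Phi> (\<Psi> y) = y" "\<Psi> (\<Phi> t) = t" for y t
    using bij by (auto simp: \<Psi>_def bij_is_surj surj_f_inv_f bij_is_inj)
  have cinj: "x = y" if eq: "\<phi> x = \<phi> y" for x y
  proof -
    obtain s t where st: "x = cir s" "y = cir t" by (metis cir_surj)
    then have "cir (\<Phi> s) = cir (\<Phi> t)" using eq \<Phi>(1) by simp
    then obtain n where "\<Phi> s - \<Phi> t = of_int n" by (auto simp: cir_eq_iff elim: Ints_cases)
    then have "\<Phi> s = \<Phi> (t + of_int n)" using per by simp
    then have "s = t + of_int n" using inj by simp
    then show ?thesis using st by (simp add: cir_add)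
  qed
  have csurj: "\<exists>x. \<phi> x = y" for y
  proof -
    obtain s where "y = cir s" by (rule cir_surj)
    then show ?thesis using \<Phi>(1)[of "\<Psi> s"] 1(1)[of s] by (intro exI[of _ "cir (\<Psi> s)"]) simp
  qed
  show cb: "bij \<phi>" using cinj csurj by (auto simp: bij_def inj_def surj_def) metis
  have a: "cir (\<Psi> y) = inv \<phi> (cir y)" for y
  proof -
    have "\<phi> (cir (\<Psi> y)) = cir y" using \<Phi>(1)[of "\<Psi> y"] 1 by simp
    then show ?thesis using cb by (metis bij_is_inj inv_f_f)
  qed
  have "(\<Psi> has_real_derivative inverse (b (cir (\<Psi> y)))) (at y)" for y
  proof (rule DERIV_inverse_function[where f = \<Phi> and a = "y - 1" and b = "y + 1"])
    show "isCont \<Psi> y" using isCont_inverse_function[of 1 "\<Psi> y" \<Psi> \<Phi>] 1 cont by simp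
    show "b (cir (\<Psi> y)) \<noteq> 0" using b[of "cir (\<Psi> y)"] by simp
  qed (use \<Phi>(2) 1 in auto)
  then have d: "(\<Psi> has_real_derivative (recip b \<circ> inv \<phi>) (cir y)) (at y)" for y
    by (simp add: recip_def inverse_eq_divide a[symmetric])
  have "\<Psi> (y + 1) = \<Psi> y + 1" for y
    using \<Phi>(3)[of "\<Psi> y"] 1 by metis
  then show "has_cdiff (inv \<phi>) (recip b \<circ> inv \<phi>)"
    unfolding has_cdiff_def using a d by blast
qed

section \<open>Composition in low regularity by interpolation\<close>

lemma sum_cube_le: "real k ^ 3 \<le> 3 * (\<Sum>N=1..k. real N ^ 2)"
proof (induction k)
  case (Suc k)
  have "real (Suc k) ^ 3 = real k ^ 3 + 3 * real k ^ 2 + 3 * real k + 1" by (simp add: algebra_simps power3_eq_cube power2_eq_square)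
  also have "\<dots> \<le> 3 * (\<Sum>N=1..k. real N ^ 2) + 3 * (real (Suc k))\<^sup>2" using Suc by (simp add: algebra_simps power2_eq_square)
  finally show ?case by (simp add: algebra_simps)
qed simp

text \<open>A discrete form of writing k^q as q times the integral of N^(q-1). It presents the
  Sobolev weight as a sum over cut-off frequencies N \<le> k. For q \<le> 3 the power N^(q-3)
  decreases in N, which reduces the claim to cubes.\<close>

lemma powr_le_sum:
  assumes "q \<le> 3"
  shows "real k powr q \<le> 3 * (\<Sum>N=1..k. real N powr (q - 1))"
proof (cases "k = 0")
  case False
  have "real k powr q = real k powr (q - 3) * real k ^ 3" using False by (simp add: powr_diff)
  also have "\<dots> \<le> real k powr (q - 3) * (3 * (\<Sum>N=1..k. real N ^ 2))" by (rule mult_left_mono[OF sum_cube_le]) simp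
  also have "\<dots> = 3 * (\<Sum>N=1..k. real k powr (q - 3) * real N ^ 2)" by (simp add: sum_distrib_left mult_ac)
  also have "\<dots> \<le> 3 * (\<Sum>N=1..k. real N powr (q - 1))"
  proof (intro mult_left_mono sum_mono)
    fix N assume N: "N \<in> {1..k}"
    have "real k powr (q - 3) \<le> real N powr (q - 3)" using N assms by (intro powr_mono2') auto
    then have "real k powr (q - 3) * real N ^ 2 \<le> real N powr (q - 3) * real N ^ 2" by (rule mult_right_mono) simp
    also have "\<dots> = real N powr (q - 1)" using N powr_add[of "real N" "q - 3" 2] by simp
    finally show "real k powr (q - 3) * real N ^ 2 \<le> real N powr (q - 1)" .
  qed simp
  finally show ?thesis .
qed simp

lemma sum_inverse_squares:
  assumes "l \<ge> 1" "l \<le> M"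
  shows "(\<Sum>N=l..M. 1 / real N ^ 2) \<le> 2 / real l - 1 / real M"
  using assms(2)
proof (induction M rule: dec_induct)
  case base
  have "1 / real l ^ 2 \<le> 1 / real l" using assms by (intro divide_left_mono) (auto simp: power2_eq_square)
  then show ?case by simp
next
  case (step M)
  have M: "M \<ge> 1" using step assms by simp
  have "1 / real (Suc M) ^ 2 \<le> 1 / (real M * real (Suc M))"
    using M by (intro divide_left_mono) (auto simp: power2_eq_square)
  also have "\<dots> = 1 / real M - 1 / real (Suc M)" using M by (simp add: field_simps)
  finally show ?case using step by simp
qed

text \<open>When a Fourier series is split at frequency \<open>N\<close>, the low part is measured in \<open>H\<^sup>2\<close> with the gain
  \<open>N\<^sup>-\<^sup>4\<close> and the high part in \<open>L\<^sup>2\<close>; \<open>split_wt N l\<close> is the resulting weight of the frequency \<open>l\<close>.\<close>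

definition split_wt :: "nat \<Rightarrow> int \<Rightarrow> real"
  where "split_wt N l = (if \<bar>l\<bar> \<le> int N then of_int l ^ 4 / real N ^ 4 else 1)"

lemma split_wt_bounds: "0 \<le> split_wt N l" "split_wt N l \<le> 1"
proof -
  have "\<bar>real_of_int l\<bar> ^ 4 \<le> real N ^ 4" if "\<bar>l\<bar> \<le> int N"
    using that by (intro power_mono) (auto simp: of_int_abs[symmetric] simp del: of_int_abs)
  then show "split_wt N l \<le> 1" by (cases "N = 0") (auto simp: split_wt_def divide_le_eq_1)
  show "0 \<le> split_wt N l" by (auto simp: split_wt_def)
qed

text \<open>The sum is split at j = |l|. Below j the weight is 1 and the sum is at most j^q; from j
  on it is j^4 times a sum of N^(q-5), at most 2 j^q by q \<le> 3 and the telescoping bound for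
  inverse squares. Together this gives the 3.\<close>

lemma split_wt_sum:
  assumes q: "1 < q" "q \<le> 3"
  shows "(\<Sum>N=1..M. real N powr (q - 1) * split_wt N l) \<le> 3 * \<bar>of_int l\<bar> powr q"
proof (cases "l = 0")
  case True
  then show ?thesis by (simp add: split_wt_def)
next
  case False
  define j where "j = nat \<bar>l\<bar>"
  have j: "j \<ge> 1" "\<bar>l\<bar> = int j" "\<bar>real_of_int l\<bar> = real j" using False by (auto simp: j_def)
  have l4: "(of_int l :: real) ^ 4 = real j ^ 4" by (metis j(3) power4_eq_xxxx power_even_abs_numeral even_numeral)
  have "(\<Sum>N=1..M. real N powr (q - 1) * split_wt N l) \<le> (\<Sum>N\<in>{j..M} \<union> {1..<j}. real N powr (q - 1) * split_wt N l)"
    by (rule sum_mono2) (use j in \<open>auto simp: split_wt_def\<close>)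
  also have "\<dots> = (\<Sum>N=j..M. real N powr (q - 1) * split_wt N l) + (\<Sum>N=1..<j. real N powr (q - 1) * split_wt N l)"
    by (rule sum.union_disjoint) auto
  also have "(\<Sum>N=1..<j. real N powr (q - 1) * split_wt N l) \<le> (\<Sum>N=1..<j. real j powr (q - 1))"
    by (rule sum_mono) (use j q in \<open>auto simp: split_wt_def intro!: powr_mono2\<close>)
  also have "\<dots> \<le> real j * real j powr (q - 1)" by (simp add: mult_right_mono)
  also have "\<dots> = real j powr q" using j by (simp add: powr_diff)
  also have "(\<Sum>N=j..M. real N powr (q - 1) * split_wt N l) \<le> 2 * real j powr q"
  proof (cases "j \<le> M")
    case True
    have "(\<Sum>N=j..M. real N powr (q - 1) * split_wt N l) \<le> (\<Sum>N=j..M. real j powr (q - 3) * real j ^ 4 * (1 / real N ^ 2))"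
    proof (rule sum_mono)
      fix N assume N: "N \<in> {j..M}"
      have N1: "real N > 0" using N j by auto
      have "real N powr (q - 1) * split_wt N l = real N powr (q - 3) * (real j ^ 4 / real N ^ 2)"
        using N j l4 N1 powr_add[of "real N" "q - 3" 2] by (simp add: split_wt_def power2_eq_square power4_eq_xxxx)
      also have "\<dots> \<le> real j powr (q - 3) * (real j ^ 4 / real N ^ 2)"
        using N j q by (intro mult_right_mono powr_mono2') auto
      finally show "real N powr (q - 1) * split_wt N l \<le> real j powr (q - 3) * real j ^ 4 * (1 / real N ^ 2)" by simp
    qed
    also have "\<dots> = real j powr (q - 3) * real j ^ 4 * (\<Sum>N=j..M. 1 / real N ^ 2)" by (simp add: sum_distrib_left)
    also have "\<dots> \<le> real j powr (q - 3) * real j ^ 4 * (2 / real j)"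
      using sum_inverse_squares[OF j(1) True] by (intro mult_left_mono) (auto elim: order_trans)
    also have "\<dots> = 2 * (real j powr (q - 3) * real j ^ 3)" using j by (simp add: power4_eq_xxxx power3_eq_cube)
    also have "real j powr (q - 3) * real j ^ 3 = real j powr q" using j powr_add[of "real j" "q - 3" 3] by simp
    finally show ?thesis .
  qed simp
  finally show ?thesis using j by simp
qed

section \<open>Composition with a diffeomorphism on square integrable and twice differentiable
  functions\<close>

lemma L2_comp:
  assumes \<Phi>: "\<And>t. (\<Phi> has_real_derivative b (cir t)) (at t)" "\<And>t. \<Phi> (t + 1) = \<Phi> t + 1"
    and b: "ccont b" "\<And>x. 1 \<le> M * b x" and M: "M \<ge> 0" and a: "(\<lambda>k. cmod (a k)) summable_on UNIV"
  shows "integral {0..1} (\<lambda>t. (cmod (synth a (\<Phi> t)))\<^sup>2) \<le> M * (\<Sum>\<^sub>\<infinity>k. (cmod (a k))\<^sup>2)"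
proof -
  let ?f = "\<lambda>t. (cmod (synth a t))\<^sup>2"
  have f: "continuous_on UNIV ?f" by (intro continuous_intros synth_continuous a)
  have per: "?f (t + 1) = ?f t" for t using synth_periodic[of a t 1] by simp
  have c: "continuous_on {0..1} \<Phi>" using \<Phi>(1) by (meson DERIV_continuous_on has_field_derivative_at_within)
  have cf: "continuous_on {0..1} (\<lambda>t. ?f (\<Phi> t))"
    by (rule continuous_on_compose2[OF f c]) auto
  have I: "((\<lambda>t. b (cir t) * ?f (\<Phi> t)) has_integral integral {0..1} ?f) {0..1}"
    by (rule subst_periodic[OF f per \<Phi>])
  \<comment> \<open>The inequality \<open>1 \<le> M * b x\<close> inserts the Jacobian, so that the
    substitution rule applies.\<close>
  have "integral {0..1} (\<lambda>t. ?f (\<Phi> t)) \<le> integral {0..1} (\<lambda>t. M * (b (cir t) * ?f (\<Phi> t)))"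
  proof (rule integral_le)
    show "(\<lambda>t. M * (b (cir t) * ?f (\<Phi> t))) integrable_on {0..1}" using I by (auto simp: integrable_on_def intro!: has_integral_mult_right)
    fix t show "?f (\<Phi> t) \<le> M * (b (cir t) * ?f (\<Phi> t))"
      using mult_right_mono[OF b(2), of "?f (\<Phi> t)" "cir t"] by (simp add: mult.assoc)
  qed (use cf in \<open>auto intro: integrable_continuous_real\<close>)
  also have "\<dots> = M * integral {0..1} ?f" using integral_unique[OF I] by simp
  also have "integral {0..1} ?f = (\<Sum>\<^sub>\<infinity>k. (cmod (a k))\<^sup>2)" using infsumI[OF synth_parseval[OF a]] by simp
  finally show ?thesis .
qed

lemma trig_deriv:
  "((\<lambda>t. \<Sum>k\<in>K. c k * ech k t) has_vector_derivative (\<Sum>k\<in>K. \<i> * of_real (2 * pi * of_int k) * c k * ech k t)) (at t within S)"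
proof -
  have "((\<lambda>t. \<Sum>k\<in>K. c k * ech k t) has_vector_derivative (\<Sum>k\<in>K. c k * ((2 * pi * of_int k) *\<^sub>R (\<i> * ech k t)))) (at t within S)"
    by (intro has_vector_derivative_sum has_vector_derivative_mult_right ech_deriv)
  then show ?thesis by (simp add: scaleR_conv_of_real mult_ac)
qed

lemma synth_finite:
  assumes "finite K"
  shows "synth (\<lambda>k. if k \<in> K then c k else 0) t = (\<Sum>k\<in>K. c k * ech k t)"
proof -
  have "((\<lambda>k. (if k \<in> K then c k else 0) * ech k t) has_sum (\<Sum>k\<in>K. c k * ech k t)) UNIV"
    by (subst has_sum_cong_neutral[where T = K and g = "\<lambda>k. c k * ech k t"]) (use assms in \<open>auto intro: has_sum_finiteI\<close>)
  then show ?thesis unfolding synth_def by (rule infsumI)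
qed

lemma finite_supp_summable:
  fixes f :: "int \<Rightarrow> real"
  shows "finite K \<Longrightarrow> (\<And>k. k \<notin> K \<Longrightarrow> f k = 0) \<Longrightarrow> f summable_on UNIV \<and> infsum f UNIV = sum f K"
proof -
  assume "finite K" "\<And>k. k \<notin> K \<Longrightarrow> f k = 0"
  then have "(f has_sum sum f K) UNIV"
    by (subst has_sum_cong_neutral[where T = K and g = f]) (auto intro: has_sum_finiteI)
  then show ?thesis by (auto simp: has_sum_iff)
qed

lemma L2_comp_trig:
  assumes \<Phi>: "\<And>t. (\<Phi> has_real_derivative b (cir t)) (at t)" "\<And>t. \<Phi> (t + 1) = \<Phi> t + 1"
    and b: "ccont b" "\<And>x. 1 \<le> M * b x" and M: "M \<ge> 0" and K: "finite K"
  shows "integral {0..1} (\<lambda>t. (cmod (\<Sum>k\<in>K. c k * ech k (\<Phi> t)))\<^sup>2) \<le> M * (\<Sum>k\<in>K. (cmod (c k))\<^sup>2)"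
proof -
  let ?a = "\<lambda>k. if k \<in> K then c k else 0"
  have "(\<lambda>k. cmod (?a k)) summable_on UNIV"
    using finite_supp_summable[OF K, of "\<lambda>k. cmod (?a k)"] by simp
  from L2_comp[OF \<Phi> b M this] show ?thesis
    using finite_supp_summable[OF K, of "\<lambda>k. (cmod (?a k))\<^sup>2"] by (simp add: synth_finite[OF K])
qed

lemma int_sq_le_4: "(of_int l :: real)\<^sup>2 \<le> of_int l ^ 4"
proof (cases "l = 0")
  case False
  then have "l\<^sup>2 \<ge> 1" by (simp add: int_one_le_iff_zero_less)
  then have "(of_int l :: real)\<^sup>2 \<ge> 1" by (metis of_int_1_le_iff of_int_power)
  then have "(of_int l :: real)\<^sup>2 * 1 \<le> (of_int l)\<^sup>2 * (of_int l)\<^sup>2" by (intro mult_left_mono) auto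
  then show ?thesis by (simp add: power2_eq_square power4_eq_xxxx)
qed simp

text \<open>By Bessel's inequality for the second
  derivative, the coefficients of the composition decay like those of an \<open>H\<^sup>2\<close> function.\<close>

lemma trig_comp_decay:
  assumes \<Phi>: "\<And>t. (\<Phi> has_real_derivative b (cir t)) (at t)" "\<And>t. \<Phi> (t + 1) = \<Phi> t + 1"
    and b: "has_cderiv b b'" "ccont b'" "\<And>x. 1 \<le> M * b x" and M: "M \<ge> 0" and K: "finite K" and F: "finite F"
    and B: "\<And>x. \<bar>b x\<bar> \<le> B" "\<And>x. \<bar>b' x\<bar> \<le> B'"
  shows "(\<Sum>k\<in>F. of_int k ^ 4 * (cmod (fc (\<lambda>t. \<Sum>l\<in>K. c l * ech l (\<Phi> t)) k))\<^sup>2)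
    \<le> M * (2 * B ^ 4 + 2 * B'\<^sup>2) * (\<Sum>l\<in>K. of_int l ^ 4 * (cmod (c l))\<^sup>2)"
proof -
  define p where "p = (\<lambda>t. \<Sum>l\<in>K. c l * ech l t)"
  define c1 where "c1 = (\<lambda>l. \<i> * of_real (2 * pi * of_int l) * c l)"
  define c2 where "c2 = (\<lambda>l. \<i> * of_real (2 * pi * of_int l) * c1 l)"
  define p1 where "p1 = (\<lambda>t. \<Sum>l\<in>K. c1 l * ech l t)"
  define p2 where "p2 = (\<lambda>t. \<Sum>l\<in>K. c2 l * ech l t)"
  have cb: "ccont b" by (rule has_cderiv_ccont[OF b(1)])
  have d1: "(p has_vector_derivative p1 t) (at t within S)" and d2: "(p1 has_vector_derivative p2 t) (at t within S)" for t S
    unfolding p_def p1_def p2_def c1_def c2_def by (rule trig_deriv)+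
  define P where "P = (\<lambda>t. p (\<Phi> t))"
  define P1 where "P1 = (\<lambda>t. of_real (b (cir t)) * p1 (\<Phi> t))"
  define P2 where "P2 = (\<lambda>t. of_real (b (cir t)) * (of_real (b (cir t)) * p2 (\<Phi> t)) + of_real (b' (cir t)) * p1 (\<Phi> t))"
  have \<Phi>v: "(\<Phi> has_vector_derivative b (cir t)) (at t)" for t using \<Phi>(1) by (simp add: has_real_derivative_iff_has_vector_derivative)
  have chain: "((\<lambda>t. f (\<Phi> t)) has_vector_derivative of_real (b (cir t)) * f' (\<Phi> t)) (at t)"
    if "\<And>t S. (f has_vector_derivative f' t) (at t within S)" for f f' :: "real \<Rightarrow> complex" and t
    using vector_diff_chain_within[OF \<Phi>v[of t] that] by (simp add: o_def scaleR_conv_of_real)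
  have D1: "(P has_vector_derivative P1 t) (at t)" for t unfolding P_def P1_def by (rule chain[OF d1])
  have D2: "(P1 has_vector_derivative P2 t) (at t)" for t
    unfolding P1_def P2_def
    by (intro has_vector_derivative_mult has_vector_derivative_of_real chain[OF d2])
       (use has_cderivD[OF b(1), of t UNIV] in \<open>simp add: has_real_derivative_iff_has_vector_derivative\<close>)
  have c\<Phi>: "continuous_on S \<Phi>" for S using \<Phi>(1) by (meson DERIV_continuous_on has_field_derivative_at_within)
  have cp: "continuous_on S p" "continuous_on S p1" "continuous_on S p2" for S
    unfolding p_def p1_def p2_def by (intro continuous_intros)+
  have cpc: "continuous_on S (\<lambda>t. p1 (\<Phi> t))" "continuous_on S (\<lambda>t. p2 (\<Phi> t))" for S
    by (rule continuous_on_compose2[OF _ c\<Phi>, of UNIV], rule cp, simp)+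
  have cP1: "continuous_on S P1" and cP2: "continuous_on S P2" for S
    unfolding P1_def P2_def by (intro continuous_intros cpc ccont_on b cb)+
  have per: "P 1 = P 0" "P1 1 = P1 0"
    using \<Phi>(2)[of 0] ech_add_int[of _ "\<Phi> 0" 1] by (simp_all add: P_def P1_def p_def p1_def)
  have f2: "fc P2 k = (\<i> * of_real (2 * pi * of_int k))\<^sup>2 * fc P k" for k
    using fc_deriv[OF D1 cP1 per(1)] fc_deriv[OF D2 cP2 per(2)] by (simp add: power2_eq_square mult.assoc)
  have f2n: "(cmod (fc P2 k))\<^sup>2 = (2 * pi) ^ 4 * (of_int k ^ 4 * (cmod (fc P k))\<^sup>2)" for k
    unfolding f2 by (simp add: norm_mult norm_power power_mult_distrib flip: power_mult)
  have "(\<Sum>k\<in>F. (cmod (fc P2 k))\<^sup>2) \<le> integral {0..1} (\<lambda>t. (cmod (P2 t))\<^sup>2)" by (rule bessel[OF cP2 F])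
  also have "\<dots> \<le> integral {0..1} (\<lambda>t. 2 * B ^ 4 * (cmod (p2 (\<Phi> t)))\<^sup>2 + 2 * B'\<^sup>2 * (cmod (p1 (\<Phi> t)))\<^sup>2)"
  proof (rule integral_le)
    fix t
    let ?x = "cmod (p2 (\<Phi> t))" and ?y = "cmod (p1 (\<Phi> t))"
    have "cmod (P2 t) \<le> cmod (of_real (b (cir t)) * (of_real (b (cir t)) * p2 (\<Phi> t))) + cmod (of_real (b' (cir t)) * p1 (\<Phi> t))"
      unfolding P2_def by (rule norm_triangle_ineq)
    also have "\<dots> = \<bar>b (cir t)\<bar> * (\<bar>b (cir t)\<bar> * ?x) + \<bar>b' (cir t)\<bar> * ?y" by (simp add: norm_mult)
    also have "\<dots> \<le> B * (B * ?x) + B' * ?y"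
      using B by (intro add_mono mult_mono) (auto intro: order_trans[OF abs_ge_zero] mult_nonneg_nonneg)
    finally have "(cmod (P2 t))\<^sup>2 \<le> (B * (B * ?x) + B' * ?y)\<^sup>2" by (rule power_mono) simp
    also have "\<dots> \<le> 2 * (B * (B * ?x))\<^sup>2 + 2 * (B' * ?y)\<^sup>2"
      using zero_le_power2[of "B * (B * ?x) - B' * ?y"] by (simp add: power2_sum power2_diff)
    also have "\<dots> = 2 * B ^ 4 * ?x\<^sup>2 + 2 * B'\<^sup>2 * ?y\<^sup>2" by (simp add: power_mult_distrib power4_eq_xxxx power2_eq_square)
    finally show "(cmod (P2 t))\<^sup>2 \<le> 2 * B ^ 4 * ?x\<^sup>2 + 2 * B'\<^sup>2 * ?y\<^sup>2" .
  qed (intro integrable_continuous_real continuous_intros cP2 cpc)+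
  also have "\<dots> = 2 * B ^ 4 * integral {0..1} (\<lambda>t. (cmod (p2 (\<Phi> t)))\<^sup>2) + 2 * B'\<^sup>2 * integral {0..1} (\<lambda>t. (cmod (p1 (\<Phi> t)))\<^sup>2)"
    by (subst integral_add) (auto intro!: integrable_continuous_real continuous_intros cpc)
  also have "\<dots> \<le> 2 * B ^ 4 * (M * (\<Sum>l\<in>K. (cmod (c2 l))\<^sup>2)) + 2 * B'\<^sup>2 * (M * (\<Sum>l\<in>K. (cmod (c1 l))\<^sup>2))"
    unfolding p1_def p2_def by (intro add_mono mult_left_mono L2_comp_trig[OF \<Phi> cb b(3) M K]) auto
  also have "\<dots> \<le> 2 * B ^ 4 * (M * ((2 * pi) ^ 4 * (\<Sum>l\<in>K. of_int l ^ 4 * (cmod (c l))\<^sup>2)))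
     + 2 * B'\<^sup>2 * (M * ((2 * pi) ^ 4 * (\<Sum>l\<in>K. of_int l ^ 4 * (cmod (c l))\<^sup>2)))"
  proof -
    have e2: "(cmod (c2 l))\<^sup>2 = (2 * pi) ^ 4 * (of_int l ^ 4 * (cmod (c l))\<^sup>2)" for l
      by (simp add: c2_def c1_def norm_mult power_mult_distrib power4_eq_xxxx power2_eq_square)
    \<comment> \<open>The chain rule leaves a term with the first derivative, which carries l^2
      only; it is dominated by l^4 because l is an integer.\<close>
    have e1: "(cmod (c1 l))\<^sup>2 \<le> (2 * pi) ^ 4 * (of_int l ^ 4 * (cmod (c l))\<^sup>2)" for l
    proof -
      have p: "(2 * pi)\<^sup>2 \<le> (2 * pi) ^ 4" using pi_ge_two by (intro power_increasing) auto
      have "(cmod (c1 l))\<^sup>2 = (2 * pi)\<^sup>2 * ((of_int l)\<^sup>2 * (cmod (c l))\<^sup>2)"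
        by (simp add: c1_def norm_mult power_mult_distrib)
      also have "\<dots> \<le> (2 * pi) ^ 4 * (of_int l ^ 4 * (cmod (c l))\<^sup>2)"
        using p int_sq_le_4[of l] by (intro mult_mono) auto
      finally show ?thesis .
    qed
    show ?thesis
      unfolding sum_distrib_left[of "(2 * pi) ^ 4"] e2 using M
      by (intro add_mono mult_left_mono sum_mono e1) auto
  qed
  finally have "(2 * pi) ^ 4 * (\<Sum>k\<in>F. of_int k ^ 4 * (cmod (fc P k))\<^sup>2)
      \<le> (2 * pi) ^ 4 * (M * (2 * B ^ 4 + 2 * B'\<^sup>2) * (\<Sum>l\<in>K. of_int l ^ 4 * (cmod (c l))\<^sup>2))"
    unfolding f2n sum_distrib_left[symmetric] by (simp add: algebra_simps)
  then have "(\<Sum>k\<in>F. of_int k ^ 4 * (cmod (fc P k))\<^sup>2) \<le> M * (2 * B ^ 4 + 2 * B'\<^sup>2) * (\<Sum>l\<in>K. of_int l ^ 4 * (cmod (c l))\<^sup>2)"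
    by (rule mult_left_le_imp_le) simp
  then show ?thesis by (simp add: P_def p_def)
qed

text \<open>The series is cut at the same N above which the output frequencies lie. There the low
  part contributes N^-4 times its size in order 2 and the high part its square norm; together these
  form the sum weighted by \<open>split_wt\<close>. In the constant, the outer 2 is that of (x +
  y)^2 \<le> 2 x^2 + 2 y^2, and the summand 1 is due to the high part.\<close>

lemma comp_tail_bound:
  assumes \<Phi>: "\<And>t. (\<Phi> has_real_derivative b (cir t)) (at t)" "\<And>t. \<Phi> (t + 1) = \<Phi> t + 1"
    and b: "has_cderiv b b'" "ccont b'" "\<And>x. 1 \<le> M * b x" and M: "M \<ge> 0"
    and B: "\<And>x. \<bar>b x\<bar> \<le> B" "\<And>x. \<bar>b' x\<bar> \<le> B'"
    and a: "(\<lambda>k. cmod (a k)) summable_on UNIV" and F: "finite F" "\<And>k. k \<in> F \<Longrightarrow> int N \<le> \<bar>k\<bar>" and N: "N \<ge> 1"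
  shows "(\<Sum>k\<in>F. (cmod (fc (\<lambda>t. synth a (\<Phi> t)) k))\<^sup>2)
    \<le> 2 * M * (2 * B ^ 4 + 2 * B'\<^sup>2 + 1) * (\<Sum>\<^sub>\<infinity>l. (cmod (a l))\<^sup>2 * split_wt N l)"
proof -
  define L where "L = {l :: int. \<bar>l\<bar> \<le> int N}"
  have L: "finite L" by (rule finite_subset[of _ "{- int N..int N}"]) (auto simp: L_def)
  define h where "h = (\<lambda>l. if l \<in> L then 0 else a l)"
  have sh: "(\<lambda>l. cmod (h l)) summable_on UNIV"
    by (rule summable_on_comparison_test[OF a]) (auto simp: h_def)
  have a2: "(\<lambda>l. (cmod (a l))\<^sup>2) summable_on UNIV" using synth_parseval[OF a] by (auto simp: has_sum_iff)
  have cb: "ccont b" by (rule has_cderiv_ccont[OF b(1)])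
  have c\<Phi>: "continuous_on S \<Phi>" for S using \<Phi>(1) by (meson DERIV_continuous_on has_field_derivative_at_within)
  define p where "p = (\<lambda>t. \<Sum>l\<in>L. a l * ech l (\<Phi> t))"
  define g where "g = (\<lambda>t. synth h (\<Phi> t))"
  have cp: "continuous_on {0..1} p" unfolding p_def
    by (intro continuous_intros continuous_on_compose2[OF continuous_on_ech[of UNIV] c\<Phi>]) auto
  have cg: "continuous_on {0..1} g" unfolding g_def
    by (rule continuous_on_compose2[OF synth_continuous[OF sh, of UNIV] c\<Phi>]) auto
  have split: "synth a t = (\<Sum>l\<in>L. a l * ech l t) + synth h t" for t
  proof -
    have "(\<lambda>k. (if k \<in> L then a k else 0) * ech k t) summable_on UNIV" "(\<lambda>k. h k * ech k t) summable_on UNIV"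
      by (rule abs_summable_summable, rule summable_on_comparison_test[OF a], auto simp: norm_mult h_def)+
    from infsum_add[OF this] have "(\<Sum>\<^sub>\<infinity>k. (if k \<in> L then a k else 0) * ech k t + h k * ech k t) = synth (\<lambda>k. if k \<in> L then a k else 0) t + synth h t"
      by (simp add: synth_def)
    moreover have "(if k \<in> L then a k else 0) * ech k t + h k * ech k t = a k * ech k t" for k by (simp add: h_def)
    ultimately show ?thesis by (simp add: synth_finite[OF L]) (simp add: synth_def)
  qed
  define T where "T = (\<Sum>\<^sub>\<infinity>l. (cmod (a l))\<^sup>2 * split_wt N l)"
  note wl = split_wt_bounds[of N]
  have sT: "(\<lambda>l. (cmod (a l))\<^sup>2 * split_wt N l) summable_on UNIV"
    by (rule summable_on_comparison_test[OF a2]) (use wl in \<open>auto intro: mult_right_le_one_le\<close>)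
  have lo: "(\<Sum>k\<in>F. (cmod (fc p k))\<^sup>2) \<le> M * (2 * B ^ 4 + 2 * B'\<^sup>2) * T"
  proof -
    have "real N ^ 4 * (\<Sum>k\<in>F. (cmod (fc p k))\<^sup>2) \<le> (\<Sum>k\<in>F. of_int k ^ 4 * (cmod (fc p k))\<^sup>2)"
      unfolding sum_distrib_left
    proof (rule sum_mono, rule mult_right_mono)
      fix k assume "k \<in> F"
      then have "real N ^ 4 \<le> \<bar>real_of_int k\<bar> ^ 4" using F(2)[of k] by (intro power_mono) linarith+
      then show "real N ^ 4 \<le> real_of_int k ^ 4" by simp
    qed simp
    also have "\<dots> \<le> M * (2 * B ^ 4 + 2 * B'\<^sup>2) * (\<Sum>l\<in>L. of_int l ^ 4 * (cmod (a l))\<^sup>2)"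
      unfolding p_def by (rule trig_comp_decay[OF \<Phi> b M L F(1) B])
    also have "(\<Sum>l\<in>L. of_int l ^ 4 * (cmod (a l))\<^sup>2) = real N ^ 4 * (\<Sum>l\<in>L. (cmod (a l))\<^sup>2 * split_wt N l)"
      unfolding sum_distrib_left by (rule sum.cong) (use N in \<open>auto simp: L_def split_wt_def\<close>)
    also have "M * (2 * B ^ 4 + 2 * B'\<^sup>2) * (real N ^ 4 * (\<Sum>l\<in>L. (cmod (a l))\<^sup>2 * split_wt N l))
        \<le> M * (2 * B ^ 4 + 2 * B'\<^sup>2) * (real N ^ 4 * T)"
      unfolding T_def using M sT L wl by (intro mult_left_mono finite_sum_le_infsum) auto
    finally have "real N ^ 4 * (\<Sum>k\<in>F. (cmod (fc p k))\<^sup>2) \<le> real N ^ 4 * (M * (2 * B ^ 4 + 2 * B'\<^sup>2) * T)"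
      by (simp add: mult_ac)
    then show ?thesis by (rule mult_left_le_imp_le) (use N in simp)
  qed
  have hi: "(\<Sum>k\<in>F. (cmod (fc g k))\<^sup>2) \<le> M * T"
  proof -
    have "(\<Sum>k\<in>F. (cmod (fc g k))\<^sup>2) \<le> integral {0..1} (\<lambda>t. (cmod (g t))\<^sup>2)" by (rule bessel[OF cg F(1)])
    also have "\<dots> \<le> M * (\<Sum>\<^sub>\<infinity>l. (cmod (h l))\<^sup>2)" unfolding g_def by (rule L2_comp[OF \<Phi> cb b(3) M sh])
    also have "(\<Sum>\<^sub>\<infinity>l. (cmod (h l))\<^sup>2) \<le> T"
      unfolding T_def by (rule infsum_mono[OF _ sT])
        (use synth_parseval[OF sh] wl in \<open>auto simp: has_sum_iff h_def L_def split_wt_def\<close>)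
    finally show ?thesis using M by (simp add: mult_left_mono)
  qed
  have eq: "fc (\<lambda>t. synth a (\<Phi> t)) k = fc p k + fc g k" for k
    unfolding split using fc_add[OF cp cg] by (simp add: p_def g_def)
  have "(\<Sum>k\<in>F. (cmod (fc (\<lambda>t. synth a (\<Phi> t)) k))\<^sup>2) \<le> (\<Sum>k\<in>F. 2 * (cmod (fc p k))\<^sup>2 + 2 * (cmod (fc g k))\<^sup>2)"
  proof (rule sum_mono)
    fix k
    have "(cmod (fc p k + fc g k))\<^sup>2 \<le> (cmod (fc p k) + cmod (fc g k))\<^sup>2" by (intro power_mono norm_triangle_ineq) simp
    also have "\<dots> \<le> 2 * (cmod (fc p k))\<^sup>2 + 2 * (cmod (fc g k))\<^sup>2"
      using zero_le_power2[of "cmod (fc p k) - cmod (fc g k)"] by (simp add: power2_sum power2_diff)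
    finally show "(cmod (fc (\<lambda>t. synth a (\<Phi> t)) k))\<^sup>2 \<le> 2 * (cmod (fc p k))\<^sup>2 + 2 * (cmod (fc g k))\<^sup>2" unfolding eq .
  qed
  also have "\<dots> = 2 * (\<Sum>k\<in>F. (cmod (fc p k))\<^sup>2) + 2 * (\<Sum>k\<in>F. (cmod (fc g k))\<^sup>2)"
    by (simp add: sum.distrib sum_distrib_left)
  also have "\<dots> \<le> 2 * (M * (2 * B ^ 4 + 2 * B'\<^sup>2) * T) + 2 * (M * T)" using lo hi by simp
  finally show ?thesis by (simp add: T_def algebra_simps)
qed

text \<open>Real interpolation carried out by hand. With q = 2 r, \<open>powr_le_sum\<close> writes
  the weight of the output as a sum of N^(q-1) over cut-offs, \<open>comp_tail_bound\<close>
  estimates each tail, and \<open>split_wt_sum\<close> turns the sum of the resulting weights over N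
  back into |l|^q. The bound r \<le> 3/2 is q \<le> 3.\<close>

lemma comp_interpolation:
  assumes r: "1 / 2 < r" "r \<le> 3 / 2" and \<phi>: "has_cdiff \<phi> b" and pos: "\<And>x. b x > 0"
    and b: "has_cderiv b b'" "ccont b'"
  obtains C where "C \<ge> 0" "\<And>u. u \<in> carr (Hs r) \<Longrightarrow> u \<circ> \<phi> \<in> carr (Hs r) \<and> nrm (Hs r) (u \<circ> \<phi>) \<le> C * nrm (Hs r) u"
proof -
  obtain \<Phi> where \<Phi>c: "\<And>t. cir (\<Phi> t) = \<phi> (cir t)"
    and \<Phi>: "\<And>t. (\<Phi> has_real_derivative b (cir t)) (at t)" "\<And>t. \<Phi> (t + 1) = \<Phi> t + 1"
    using \<phi> unfolding has_cdiff_def by blast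
  have cb: "ccont b" by (rule has_cderiv_ccont[OF b(1)])
  obtain M where M: "M \<ge> 0" "\<And>x. \<bar>recip b x\<bar> \<le> M" using ccont_bounded[OF ccont_recip[OF cb pos]] by blast
  have Mb: "1 \<le> M * b x" for x using M(2)[of x] pos[of x] by (simp add: recip_def field_simps)
  obtain B where B: "\<And>x. \<bar>b x\<bar> \<le> B" using ccont_bounded[OF cb] by blast
  obtain B' where B': "\<And>x. \<bar>b' x\<bar> \<le> B'" using ccont_bounded[OF b(2)] by blast
  define q where "q = 2 * r"
  have q: "1 < q" "q \<le> 3" using r by (auto simp: q_def)
  define K where "K = 2 * M * (2 * B ^ 4 + 2 * B'\<^sup>2 + 1)"
  have K: "K \<ge> 0" using M by (auto simp: K_def intro!: mult_nonneg_nonneg add_nonneg_nonneg)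
  \<comment> \<open>For k \<noteq> 0, \<open>wt k\<close> is at most the base of this power times
    k^2; the frequency 0 is covered by the summand 1 in \<open>wle\<close>.\<close>
  define D where "D = (1 + (2 * pi)\<^sup>2) powr r"
  have D: "D \<ge> 0" by (simp add: D_def)
  \<comment> \<open>\<open>M\<close> belongs to the part without weight; 9 is the product of the
    constants 3 of \<open>powr_le_sum\<close> and \<open>split_wt_sum\<close>.\<close>
  define C where "C = D * (M + 9 * K)"
  have C: "C \<ge> 0" using D M K by (simp add: C_def)
  have wle: "wt k powr r \<le> D * (1 + \<bar>of_int k\<bar> powr q)" for k
  proof (cases "k = 0")
    case True
    have "1 \<le> D" unfolding D_def using r by (intro ge_one_powr_ge_zero) auto
    then show ?thesis using True by (simp add: wt_def)
  next
    case False
    then have "1 \<le> \<bar>k\<bar>" by simp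
    then have k1: "1 \<le> \<bar>real_of_int k\<bar>" by (metis of_int_abs of_int_1_le_iff)
    then have k2: "1 \<le> (real_of_int k)\<^sup>2" using one_le_power[of "\<bar>real_of_int k\<bar>" 2] by simp
    have "wt k \<le> (1 + (2 * pi)\<^sup>2) * (real_of_int k)\<^sup>2" using k2 by (simp add: wt_def power_mult_distrib algebra_simps)
    then have "wt k powr r \<le> ((1 + (2 * pi)\<^sup>2) * (real_of_int k)\<^sup>2) powr r"
      using r wt_pos[of k] by (intro powr_mono2) auto
    also have "\<dots> = D * ((real_of_int k)\<^sup>2) powr r" by (simp add: D_def powr_mult)
    also have "((real_of_int k)\<^sup>2) powr r = \<bar>real_of_int k\<bar> powr q"
    proof -
      have "(real_of_int k)\<^sup>2 = \<bar>real_of_int k\<bar> powr 2" using k1 by simp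
      then have "((real_of_int k)\<^sup>2) powr r = (\<bar>real_of_int k\<bar> powr 2) powr r" by (simp only:)
      then show ?thesis by (simp only: powr_powr q_def)
    qed
    finally show ?thesis using D by (simp add: distrib_left)
  qed
  have wge: "\<bar>of_int k\<bar> powr q \<le> wt k powr r" for k
  proof -
    have "\<bar>real_of_int k\<bar> powr q = (\<bar>real_of_int k\<bar> powr 2) powr r" by (simp only: powr_powr q_def)
    also have "\<bar>real_of_int k\<bar> powr 2 = (real_of_int k)\<^sup>2" by (cases "k = 0") auto
    also have "((real_of_int k)\<^sup>2) powr r \<le> wt k powr r"
    proof (rule powr_mono2)
      have "1 * (real_of_int k)\<^sup>2 \<le> (2 * pi)\<^sup>2 * (real_of_int k)\<^sup>2"
        using pi_ge_two power_mono[of 1 "2 * pi" 2] by (intro mult_right_mono) auto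
      then show "(real_of_int k)\<^sup>2 \<le> wt k" by (simp add: wt_def power_mult_distrib)
    qed (use r in auto)
    finally show ?thesis .
  qed
  have main: "u \<circ> \<phi> \<in> carr (Hs r) \<and> nrm (Hs r) (u \<circ> \<phi>) \<le> sqrt C * nrm (Hs r) u" if u: "u \<in> carr (Hs r)" for u
  proof -
    define a where "a = fourier_coeff u"
    have ha: "h2 r a" using u by (simp add: Hs_iff a_def)
    have sa: "(\<lambda>k. cmod (a k)) summable_on UNIV" by (rule h2_l1(1)[OF r(1) ha])
    have a2: "(\<lambda>l. (cmod (a l))\<^sup>2) summable_on UNIV" using synth_parseval[OF sa] by (auto simp: has_sum_iff)
    define S where "S = (\<Sum>\<^sub>\<infinity>k. wt k powr r * (cmod (a k))\<^sup>2)"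
    have S: "S \<ge> 0" by (simp add: S_def infsum_nonneg)
    have sS: "(\<lambda>k. wt k powr r * (cmod (a k))\<^sup>2) summable_on UNIV" using ha by (simp add: h2_def)
    define c where "c = fourier_coeff (u \<circ> \<phi>)"
    have cu: "ccont (u \<circ> \<phi>)" by (rule has_cdiff_comp_ccont[OF \<phi> Hs_ccont[OF u]])
    have fun_eq: "complex_of_real ((u \<circ> \<phi>) (cir t)) = synth a (\<Phi> t)" for t
      using ccont_inversion[OF Hs_ccont[OF u], of "\<Phi> t"] sa by (simp add: a_def \<Phi>c)
    have c: "c k = fc (\<lambda>t. synth a (\<Phi> t)) k" for k
      unfolding c_def fourier_coeff_fc fun_eq ..
    have low: "(\<Sum>k\<in>F. (cmod (c k))\<^sup>2) \<le> M * S" if F: "finite F" for F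
    proof -
      have "(\<Sum>k\<in>F. (cmod (c k))\<^sup>2) \<le> integral {0..1} (\<lambda>t. (cmod (complex_of_real ((u \<circ> \<phi>) (cir t))))\<^sup>2)"
        unfolding c_def fourier_coeff_fc by (rule bessel[OF ccont_on_complex[OF cu] F])
      also have "\<dots> \<le> M * (\<Sum>\<^sub>\<infinity>k. (cmod (a k))\<^sup>2)" unfolding fun_eq by (rule L2_comp[OF \<Phi> cb Mb M(1) sa])
      also have "(\<Sum>\<^sub>\<infinity>k. (cmod (a k))\<^sup>2) \<le> S"
        unfolding S_def
      proof (rule infsum_mono[OF a2 sS])
        fix k
        have "1 \<le> wt k powr r" using wt_ge1[of k] r by (intro ge_one_powr_ge_zero) auto
        then have "1 * (cmod (a k))\<^sup>2 \<le> wt k powr r * (cmod (a k))\<^sup>2" by (rule mult_right_mono) simp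
        then show "(cmod (a k))\<^sup>2 \<le> wt k powr r * (cmod (a k))\<^sup>2" by simp
      qed
      finally show ?thesis using M by (simp add: mult_left_mono)
    qed
    have high: "(\<Sum>k\<in>F. \<bar>of_int k\<bar> powr q * (cmod (c k))\<^sup>2) \<le> 9 * K * S" if F: "finite F" for F
    proof -
      \<comment> \<open>A largest cut-off common to all \<open>k\<close> in \<open>F\<close>, so
        that the two finite sums can be exchanged.\<close>
      define m where "m = Max (insert 0 ((\<lambda>k. nat \<bar>k\<bar>) ` F))"
      have m: "nat \<bar>k\<bar> \<le> m" if "k \<in> F" for k unfolding m_def using that F by (intro Max_ge) auto
      have "\<bar>real_of_int k\<bar> powr q * (cmod (c k))\<^sup>2
         \<le> 3 * (\<Sum>N=1..m. real N powr (q - 1) * (if int N \<le> \<bar>k\<bar> then (cmod (c k))\<^sup>2 else 0))" if k: "k \<in> F" for k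
      proof -
        have "\<bar>real_of_int k\<bar> powr q = real (nat \<bar>k\<bar>) powr q" by simp
        also have "\<dots> \<le> 3 * (\<Sum>N=1..nat \<bar>k\<bar>. real N powr (q - 1))" by (rule powr_le_sum[OF q(2)])
        finally have "\<bar>real_of_int k\<bar> powr q * (cmod (c k))\<^sup>2 \<le> 3 * (\<Sum>N=1..nat \<bar>k\<bar>. real N powr (q - 1)) * (cmod (c k))\<^sup>2"
          by (rule mult_right_mono) simp
        also have "\<dots> = 3 * (\<Sum>N=1..nat \<bar>k\<bar>. real N powr (q - 1) * (if int N \<le> \<bar>k\<bar> then (cmod (c k))\<^sup>2 else 0))"
          by (simp add: sum_distrib_right mult.assoc) (intro sum.cong, auto)
        also have "\<dots> \<le> 3 * (\<Sum>N=1..m. real N powr (q - 1) * (if int N \<le> \<bar>k\<bar> then (cmod (c k))\<^sup>2 else 0))"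
          using m[OF k] by (intro mult_left_mono sum_mono2) auto
        finally show ?thesis .
      qed
      then have "(\<Sum>k\<in>F. \<bar>of_int k\<bar> powr q * (cmod (c k))\<^sup>2)
        \<le> (\<Sum>k\<in>F. 3 * (\<Sum>N=1..m. real N powr (q - 1) * (if int N \<le> \<bar>k\<bar> then (cmod (c k))\<^sup>2 else 0)))"
        by (rule sum_mono)
      also have "\<dots> = 3 * (\<Sum>N=1..m. real N powr (q - 1) * (\<Sum>k\<in>F. if int N \<le> \<bar>k\<bar> then (cmod (c k))\<^sup>2 else 0))"
        unfolding sum_distrib_left[symmetric] by (subst sum.swap) (simp add: sum_distrib_left[symmetric])
      also have "\<dots> \<le> 3 * (\<Sum>N=1..m. real N powr (q - 1) * (K * (\<Sum>\<^sub>\<infinity>l. (cmod (a l))\<^sup>2 * split_wt N l)))"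
      proof (intro mult_left_mono sum_mono)
        fix N assume N: "N \<in> {1..m}"
        have "(\<Sum>k\<in>F. if int N \<le> \<bar>k\<bar> then (cmod (c k))\<^sup>2 else 0) = (\<Sum>k\<in>{k\<in>F. int N \<le> \<bar>k\<bar>}. (cmod (c k))\<^sup>2)"
          using F by (simp add: sum.inter_filter)
        also have "\<dots> \<le> K * (\<Sum>\<^sub>\<infinity>l. (cmod (a l))\<^sup>2 * split_wt N l)"
          unfolding c K_def by (rule comp_tail_bound[OF \<Phi> b Mb M(1) B B' sa]) (use F N in auto)
        finally show "(\<Sum>k\<in>F. if int N \<le> \<bar>k\<bar> then (cmod (c k))\<^sup>2 else 0) \<le> K * (\<Sum>\<^sub>\<infinity>l. (cmod (a l))\<^sup>2 * split_wt N l)" .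
      qed auto
      also have "\<dots> = 3 * K * (\<Sum>N=1..m. real N powr (q - 1) * (\<Sum>\<^sub>\<infinity>l. (cmod (a l))\<^sup>2 * split_wt N l))"
        by (simp add: sum_distrib_left mult_ac)
      also have "(\<Sum>N=1..m. real N powr (q - 1) * (\<Sum>\<^sub>\<infinity>l. (cmod (a l))\<^sup>2 * split_wt N l)) \<le> 3 * S"
      proof -
        have st: "(\<lambda>l. (cmod (a l))\<^sup>2 * split_wt N l) summable_on UNIV" for N
          by (rule summable_on_comparison_test[OF a2]) (use split_wt_bounds[of N] in \<open>auto intro: mult_right_le_one_le\<close>)
        have hs: "((\<lambda>l. \<Sum>N=1..m. real N powr (q - 1) * ((cmod (a l))\<^sup>2 * split_wt N l)) has_sum
          (\<Sum>N=1..m. real N powr (q - 1) * (\<Sum>\<^sub>\<infinity>l. (cmod (a l))\<^sup>2 * split_wt N l))) UNIV"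
          by (rule has_sum_finite_sum) (use st in \<open>auto intro!: has_sum_cmult_right has_sum_infsum\<close>)
        have "((\<lambda>l. 3 * (wt l powr r * (cmod (a l))\<^sup>2)) has_sum 3 * S) UNIV"
          unfolding S_def by (intro has_sum_cmult_right has_sum_infsum sS)
        with hs show ?thesis
        proof (rule has_sum_mono)
          fix l
          have "(\<Sum>N=1..m. real N powr (q - 1) * ((cmod (a l))\<^sup>2 * split_wt N l)) = (cmod (a l))\<^sup>2 * (\<Sum>N=1..m. real N powr (q - 1) * split_wt N l)"
            by (simp add: sum_distrib_left mult_ac)
          also have "\<dots> \<le> (cmod (a l))\<^sup>2 * (3 * \<bar>of_int l\<bar> powr q)" by (rule mult_left_mono[OF split_wt_sum[OF q]]) simp
          also have "\<dots> \<le> (cmod (a l))\<^sup>2 * (3 * (wt l powr r))" by (intro mult_left_mono wge) auto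
          finally show "(\<Sum>N=1..m. real N powr (q - 1) * ((cmod (a l))\<^sup>2 * split_wt N l)) \<le> 3 * (wt l powr r * (cmod (a l))\<^sup>2)"
            by (simp add: mult_ac)
        qed
      qed
      finally show ?thesis using K by (simp add: mult_left_mono)
    qed
    have bd: "(\<Sum>k\<in>F. wt k powr r * (cmod (c k))\<^sup>2) \<le> C * S" if F: "finite F" for F
    proof -
      have "(\<Sum>k\<in>F. wt k powr r * (cmod (c k))\<^sup>2) \<le> (\<Sum>k\<in>F. D * (1 + \<bar>of_int k\<bar> powr q) * (cmod (c k))\<^sup>2)"
        by (intro sum_mono mult_right_mono wle) simp
      also have "\<dots> = D * ((\<Sum>k\<in>F. (cmod (c k))\<^sup>2) + (\<Sum>k\<in>F. \<bar>of_int k\<bar> powr q * (cmod (c k))\<^sup>2))"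
        by (simp add: sum_distrib_left sum.distrib[symmetric] algebra_simps)
      also have "\<dots> \<le> D * (M * S + 9 * K * S)" using low[OF F] high[OF F] D by (intro mult_left_mono add_mono)
      finally show ?thesis by (simp add: C_def algebra_simps)
    qed
    have h: "h2 r c" "infsum (\<lambda>k. wt k powr r * (cmod (c k))\<^sup>2) UNIV \<le> C * S"
      unfolding h2_def by (rule nonneg_bound_summable[OF _ bd]; simp)+
    have "nrm (Hs r) (u \<circ> \<phi>) \<le> sqrt (C * S)"
      unfolding nrm_Hs hn_def c_def[symmetric] by (rule real_sqrt_le_mono[OF h(2)])
    also have "sqrt (C * S) = sqrt C * nrm (Hs r) u" by (simp add: real_sqrt_mult nrm_Hs hn_def S_def a_def)
    finally show ?thesis using cu h(1) by (simp add: Hs_iff c_def)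
  qed
  show thesis by (rule that[of "sqrt C"]) (use C main in auto)
qed

section \<open>Composition in high regularity\<close>

definition comp_bdd :: "real \<Rightarrow> (circle \<Rightarrow> circle) \<Rightarrow> bool"
  where "comp_bdd r \<phi> \<longleftrightarrow> (\<exists>C\<ge>0. \<forall>u\<in>carr (Hs r). u \<circ> \<phi> \<in> carr (Hs r) \<and> nrm (Hs r) (u \<circ> \<phi>) \<le> C * nrm (Hs r) u)"

text \<open>By the chain rule the derivative of the composition is
  \<open>(cderiv u \<circ> \<phi>) * b\<close>, and multiplication by \<open>b\<close> is bounded in
  order \<open>r\<close>.\<close>

lemma comp_bdd_step:
  assumes r: "r > 1 / 2" and \<phi>: "has_cdiff \<phi> b" and b: "b \<in> carr (Hs r)" and c: "comp_bdd r \<phi>"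
  shows "comp_bdd (r + 1) \<phi>"
proof -
  obtain C where C: "C \<ge> 0" "\<And>u. u \<in> carr (Hs r) \<Longrightarrow> u \<circ> \<phi> \<in> carr (Hs r)"
     "\<And>u. u \<in> carr (Hs r) \<Longrightarrow> nrm (Hs r) (u \<circ> \<phi>) \<le> C * nrm (Hs r) u"
    using c unfolding comp_bdd_def by blast
  obtain K where K: "K \<ge> 0" "\<And>u v. u \<in> carr (Hs r) \<Longrightarrow> v \<in> carr (Hs r) \<Longrightarrow> nrm (Hs r) (u * v) \<le> K * nrm (Hs r) u * nrm (Hs r) v"
    using bdd_bil_bound[OF bdd_bil_mult[OF r]] by blast
  have b0: "nrm (Hs r) b \<ge> 0" by (rule nrm_ge0[OF normed_Hs b])
  have "u \<circ> \<phi> \<in> carr (Hs (r + 1)) \<and> nrm (Hs (r + 1)) (u \<circ> \<phi>) \<le> (C + K * C * nrm (Hs r) b) * nrm (Hs (r + 1)) u"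
    if u: "u \<in> carr (Hs (r + 1))" for u
  proof -
    note d = Hs_deriv[OF r u]
    have ur: "u \<in> carr (Hs r)" "nrm (Hs r) u \<le> nrm (Hs (r + 1)) u" using Hs_mono[OF u, of r] by auto
    have h: "has_cderiv (u \<circ> \<phi>) ((cderiv u \<circ> \<phi>) * b)" by (rule has_cdiff_chain[OF \<phi> d(1)])
    have v: "(cderiv u \<circ> \<phi>) * b \<in> carr (Hs r)" by (rule Hs_mult[OF r C(2)[OF d(2)] b])
    note S = Hs_Suc[OF C(2)[OF ur(1)] h v]
    have "nrm (Hs r) (u \<circ> \<phi>) \<le> C * nrm (Hs (r + 1)) u"
      using C(3)[OF ur(1)] mult_left_mono[OF ur(2) C(1)] by linarith
    moreover have "nrm (Hs r) ((cderiv u \<circ> \<phi>) * b) \<le> K * (C * nrm (Hs (r + 1)) u) * nrm (Hs r) b"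
    proof -
      have "nrm (Hs r) (cderiv u \<circ> \<phi>) \<le> C * nrm (Hs (r + 1)) u"
        using C(3)[OF d(2)] mult_left_mono[OF d(3) C(1)] by linarith
      then have "K * nrm (Hs r) (cderiv u \<circ> \<phi>) * nrm (Hs r) b \<le> K * (C * nrm (Hs (r + 1)) u) * nrm (Hs r) b"
        using K b0 by (intro mult_right_mono mult_left_mono) auto
      then show ?thesis using K(2)[OF C(2)[OF d(2)] b] by linarith
    qed
    ultimately show ?thesis using S by (simp add: algebra_simps)
  qed
  moreover have "C + K * C * nrm (Hs r) b \<ge> 0" using C K b0 by simp
  ultimately show ?thesis unfolding comp_bdd_def by blast
qed

lemma comp_bdd_low:
  assumes "1 / 2 < r" "r \<le> 3 / 2" "has_cdiff \<phi> b" "\<And>x. b x > 0" "has_cderiv b b'" "ccont b'"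
  shows "comp_bdd r \<phi>"
  using comp_interpolation[OF assms] unfolding comp_bdd_def by metis

lemma Hs_deriv_shifted:
  assumes "\<sigma> > 3 / 2" "b \<in> carr (Hs \<sigma>)"
  shows "has_cderiv b (cderiv b)" "cderiv b \<in> carr (Hs (\<sigma> - 1))" "ccont (cderiv b)"
  using Hs_deriv[of "\<sigma> - 1" b] assms by (auto intro: Hs_ccont)

text \<open>The order descends in steps of one until it lies between 1/2 and 3/2, where
  interpolation takes over. The top order is \<sigma> + 1 because a step to order r multiplies by
  \<open>b\<close> in order r - 1.\<close>

lemma comp_bdd_all:
  assumes \<sigma>: "\<sigma> > 3 / 2" and \<phi>: "has_cdiff \<phi> b" and b: "b \<in> carr (Hs \<sigma>)" "\<And>x. b x > 0"
    and r: "1 / 2 < r" "r \<le> \<sigma> + 1"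
  shows "comp_bdd r \<phi>"
proof -
  have "comp_bdd r \<phi>" if "1 / 2 < r" "r \<le> \<sigma> + 1" "r \<le> real n + 3 / 2" for n r
    using that
  proof (induction n arbitrary: r)
    case 0
    then show ?case using comp_bdd_low[OF _ _ \<phi> b(2) Hs_deriv_shifted(1,3)[OF \<sigma> b(1)]] by simp
  next
    case (Suc n)
    show ?case
    proof (cases "r \<le> 3 / 2")
      case True
      then show ?thesis using comp_bdd_low[OF _ _ \<phi> b(2) Hs_deriv_shifted(1,3)[OF \<sigma> b(1)]] Suc by simp
    next
      case False
      have "comp_bdd (r - 1) \<phi>" using Suc.IH[of "r - 1"] Suc.prems False by simp
      moreover have "b \<in> carr (Hs (r - 1))" by (rule Hs_mono[OF b(1)]) (use Suc.prems in simp)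
      ultimately show ?thesis using comp_bdd_step[of "r - 1" \<phi> b] \<phi> False by simp
    qed
  qed
  from this[of r "nat \<lceil>r\<rceil>"] show ?thesis using r by linarith
qed

text \<open>A bootstrap through (1/f)' = - f' (1/f)^2: each round gains one order, until the order
  \<sigma> - 1 of f' limits the gain. The \<open>min\<close> records both limits.\<close>

lemma Hs_recip:
  assumes \<sigma>: "\<sigma> > 3 / 2" and f: "f \<in> carr (Hs \<sigma>)" "\<And>x. f x > 0"
  shows "recip f \<in> carr (Hs \<sigma>)"
proof -
  note d = Hs_deriv_shifted[OF \<sigma> f(1)]
  have rd: "has_cderiv (recip f) (- (cderiv f * (recip f * recip f)))" by (rule has_cderiv_recip[OF d(1) f(2)])
  have rc: "ccont (recip f)" by (rule has_cderiv_ccont[OF rd])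
  have neg: "- w \<in> carr (Hs r)" if "w \<in> carr (Hs r)" for w r by (rule ns_uminus[OF normed_Hs that])
  have "recip f \<in> carr (Hs (min (real n + 1) \<sigma>))" for n
  proof (induction n)
    case 0
    have "ccont (- (cderiv f * (recip f * recip f)))" by (intro ccont_uminus ccont_mult d rc)
    then show ?case by (intro C1_Hs[OF rd]) auto
  next
    case (Suc n)
    \<comment> \<open>The order in which the formula for the derivative is evaluated: limited by
      what is already known of \<open>recip f\<close> and by the order of \<open>cderiv f\<close>.
      It exceeds 1/2 because \<sigma> > 3/2.\<close>
    define q where "q = min (real n + 1) (\<sigma> - 1)"
    have q: "q > 1 / 2" using \<sigma> by (auto simp: q_def min_def)
    have "recip f \<in> carr (Hs q)" by (rule Hs_mono(1)[OF Suc]) (auto simp: q_def)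
    moreover have "cderiv f \<in> carr (Hs q)" by (rule Hs_mono(1)[OF d(2)]) (auto simp: q_def)
    ultimately have "recip f \<in> carr (Hs (q + 1))" by (intro Hs_Suc(1)[OF _ rd] neg Hs_mult q)
    moreover have "q + 1 = min (real (Suc n) + 1) \<sigma>" by (auto simp: q_def min_def)
    ultimately show ?case by simp
  qed
  from this[of "nat \<lceil>\<sigma>\<rceil>"] have "recip f \<in> carr (Hs (min (real (nat \<lceil>\<sigma>\<rceil>) + 1) \<sigma>))" .
  moreover have "min (real (nat \<lceil>\<sigma>\<rceil>) + 1) \<sigma> = \<sigma>" using \<sigma> by linarith
  ultimately show ?thesis by simp
qed

text \<open>The task looks circular: \<open>comp_bdd_all\<close> for the inverse presupposes the
  regularity of its derivative, which is itself a composition with the inverse. Both are raised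
  together: boundedness of the composition in order r - 1 puts the derivative into order r - 1, and
  this gives boundedness in order r.\<close>

lemma cdiff_inverse_regular:
  assumes \<sigma>: "\<sigma> > 3 / 2" and \<phi>: "has_cdiff \<phi> b" and b: "b \<in> carr (Hs \<sigma>)" "\<And>x. b x > 0"
  shows "recip b \<circ> inv \<phi> \<in> carr (Hs \<sigma>)"
proof -
  let ?c = "recip b \<circ> inv \<phi>"
  note inv = has_cdiff_inverse[OF \<phi> b(2)]
  have c0: "?c x > 0" for x using b(2) by (simp add: recip_def)
  have rb: "recip b \<in> carr (Hs \<sigma>)" by (rule Hs_recip[OF \<sigma> b])
  have cd: "has_cderiv ?c ((cderiv (recip b) \<circ> inv \<phi>) * ?c)" by (rule has_cdiff_chain[OF inv(2) Hs_deriv_shifted(1)[OF \<sigma> rb]])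
  have cc: "ccont ((cderiv (recip b) \<circ> inv \<phi>) * ?c)"
    by (intro ccont_mult has_cdiff_comp_ccont[OF inv(2)] Hs_deriv_shifted(3)[OF \<sigma> rb] Hs_ccont[OF rb])
  have low: "comp_bdd r (inv \<phi>)" if "1 / 2 < r" "r \<le> 3 / 2" for r
    by (rule comp_bdd_low[OF that inv(2) c0 cd cc])
  have "comp_bdd r (inv \<phi>)" if "1 / 2 < r" "r \<le> \<sigma>" "r \<le> real n + 3 / 2" for n r
    using that
  proof (induction n arbitrary: r)
    case 0
    then show ?case using low by simp
  next
    case (Suc n)
    show ?case
    proof (cases "r \<le> 3 / 2")
      case True
      then show ?thesis using low Suc by simp
    next
      case False
      have c: "comp_bdd (r - 1) (inv \<phi>)" using Suc.IH[of "r - 1"] Suc.prems False by simp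
      have "recip b \<in> carr (Hs (r - 1))" by (rule Hs_mono[OF rb]) (use Suc.prems in simp)
      then have "?c \<in> carr (Hs (r - 1))" using c unfolding comp_bdd_def by blast
      then show ?thesis using comp_bdd_step[of "r - 1" "inv \<phi>" ?c] inv(2) c False by simp
    qed
  qed
  from this[of \<sigma> "nat \<lceil>\<sigma>\<rceil>"] have "comp_bdd \<sigma> (inv \<phi>)" using \<sigma> by linarith
  then show ?thesis using rb unfolding comp_bdd_def by blast
qed

section \<open>The group in the coordinate \<open>u\<close>\<close>

lemma bdd_lin_Hs_incl:
  assumes "r \<le> q"
  shows "bdd_lin (Hs q) (Hs r) (\<lambda>u. u)"
  by (rule bdd_linI[OF _ normed_Hs, where C = 1]) (auto simp: lin_on_def Hs_mono[OF _ assms])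

lemma bdd_lin_cderiv:
  assumes "r > 1 / 2"
  shows "bdd_lin (Hs (r + 1)) (Hs r) cderiv"
proof (rule bdd_linI[OF _ normed_Hs, where C = 1])
  note d = Hs_deriv[OF assms]
  show "lin_on (Hs (r + 1)) (Hs r) cderiv"
    unfolding lin_on_def
    using cderiv_eq[OF has_cderiv_add[OF d(1) d(1)]] cderiv_eq[OF has_cderiv_scale[OF d(1)]] d(2) by blast
  show "nrm (Hs r) (cderiv u) \<le> 1 * nrm (Hs (r + 1)) u" if "u \<in> carr (Hs (r + 1))" for u
    using d(3)[OF that] by simp
qed

lemma A_inv:
  assumes s: "s > 5 / 2" and f: "f \<in> carr (Hs (s - 2))"
  shows "A_inv s f \<in> carr (Hs s)" "A_op (A_inv s f) = f" "nrm (Hs s) (A_inv s f) = nrm (Hs (s - 2)) f"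
proof -
  have r: "s - 2 > 1 / 2" using s by simp
  obtain w where w: "w \<in> carr (Hs s)" "A_op w = f" "nrm (Hs s) w = nrm (Hs (s - 2)) f"
    using A_inverse[OF r f] by auto
  have inj: "inj_on A_op (carr (Hs s))" using A_op_inj[OF r] by simp
  have "A_inv s f = w" unfolding A_inv_def using the_inv_into_f_f[OF inj w(1)] w(2) by simp
  then show "A_inv s f \<in> carr (Hs s)" "A_op (A_inv s f) = f" "nrm (Hs s) (A_inv s f) = nrm (Hs (s - 2)) f"
    using w by auto
qed

lemma A_inv_A:
  assumes s: "s > 5 / 2" and w: "w \<in> carr (Hs s)"
  shows "A_inv s (A_op w) = w"
  unfolding A_inv_def by (rule the_inv_into_f_f[OF _ w]) (use A_op_inj[of "s - 2"] s in simp)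

definition jac :: "(circle \<Rightarrow> real) \<Rightarrow> circle \<Rightarrow> real"
  where "jac u = 1 + cderiv u"

context
  fixes s :: real
  assumes s: "s > 5 / 2"
begin

lemma s_minus1_gt: "s - 1 > 3 / 2" and s_minus1_gt_half: "s - 1 > 1 / 2" and s_minus2_gt_half: "s - 2 > 1 / 2"
  using s by auto

lemma Hs_s_deriv:
  assumes "u \<in> carr (Hs s)"
  shows "has_cderiv u (cderiv u)" "cderiv u \<in> carr (Hs (s - 1))" "nrm (Hs (s - 1)) (cderiv u) \<le> nrm (Hs s) u"
  using Hs_deriv[OF s_minus1_gt_half, of u] assms by auto

lemma Hs_s1_deriv:
  assumes "u \<in> carr (Hs (s - 1))"
  shows "has_cderiv u (cderiv u)" "cderiv u \<in> carr (Hs (s - 2))"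
  using Hs_deriv[OF s_minus2_gt_half, of u] assms by auto

lemma Hs_s_s1: "u \<in> carr (Hs s) \<Longrightarrow> u \<in> carr (Hs (s - 1))"
  and Hs_s1_s2: "u \<in> carr (Hs (s - 1)) \<Longrightarrow> u \<in> carr (Hs (s - 2))"
  and Hs_s_s2: "u \<in> carr (Hs s) \<Longrightarrow> u \<in> carr (Hs (s - 2))"
  using Hs_mono(1)[of u s "s - 1"] Hs_mono(1)[of u "s - 1" "s - 2"] Hs_mono(1)[of u s "s - 2"] by simp_all

lemma bdd_lin_deriv: "bdd_lin (Hs s) (Hs (s - 1)) cderiv"
  and bdd_lin_deriv1: "bdd_lin (Hs (s - 1)) (Hs (s - 2)) cderiv"
  using bdd_lin_cderiv[OF s_minus1_gt_half] bdd_lin_cderiv[OF s_minus2_gt_half] by simp_all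

lemma carr_E: "X \<in> carr (HsE s) \<longleftrightarrow> fst X \<in> carr (Hs s) \<and> snd X \<in> carr (Hs (s - 1))"
  by (simp add: HsE_def carr_prod)

lemma normed_E: "normed_ns (HsE s)"
  unfolding HsE_def by (intro normed_prod normed_Hs)

lemma bdd_lin_E_fst: "bdd_lin (HsE s) (Hs s) fst"
  and bdd_lin_E_snd: "bdd_lin (HsE s) (Hs (s - 1)) snd"
  unfolding HsE_def by (intro bdd_lin_fst bdd_lin_snd normed_Hs)+

lemma bdd_lin_E_fst1: "bdd_lin (HsE s) (Hs (s - 1)) fst"
  using bdd_lin_comp[OF bdd_lin_E_fst bdd_lin_Hs_incl normed_E, of "s - 1"] by simp

lemma bdd_lin_E_dfst: "bdd_lin (HsE s) (Hs (s - 1)) (\<lambda>p. cderiv (fst p))"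
  by (rule bdd_lin_comp[OF bdd_lin_E_fst bdd_lin_deriv normed_E])

lemma G_dom_iff: "p \<in> G_dom s \<longleftrightarrow> p \<in> carr (HsE s) \<and> (\<forall>x. jac (fst p) x > 0)"
proof -
  have "0 < 1 + t \<longleftrightarrow> - 1 < t" for t :: real by linarith
  then show ?thesis by (cases p) (auto simp: G_dom_def diff_dom_def carr_E jac_def)
qed

lemma G_dom_carr: "G_dom s \<subseteq> carr (HsE s)"
  using G_dom_iff by blast

lemma jac_carr:
  assumes "p \<in> G_dom s"
  shows "jac (fst p) \<in> carr (Hs (s - 1))" "\<And>x. jac (fst p) x > 0"
  using assms Hs_s_deriv(2)[of "fst p"] unfolding G_dom_iff carr_E jac_def
  by (auto intro!: ns_add normed_Hs Hs_one)

lemma has_cdiff_diff_of: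
  assumes "p \<in> G_dom s"
  shows "has_cdiff (diff_of (fst p)) (jac (fst p))"
proof -
  have d: "has_cderiv (fst p) (cderiv (fst p))" using assms Hs_s_deriv unfolding G_dom_iff carr_E by blast
  have "((\<lambda>t. t + fst p (cir t)) has_real_derivative jac (fst p) (cir t)) (at t)" for t
    unfolding jac_def using has_cderivD[OF d, of t UNIV] by (auto intro!: derivative_eq_intros)
  then show ?thesis
    unfolding has_cdiff_def by (intro exI[of _ "\<lambda>t. t + fst p (cir t)"]) (auto simp: diff_of_def cir_add)
qed

lemma comp_bdd_diff_of:
  assumes p: "p \<in> G_dom s" and r: "1 / 2 < r" "r \<le> s"
  shows "comp_bdd r (diff_of (fst p))" "comp_bdd r (inv (diff_of (fst p)))"
proof -
  note h = has_cdiff_diff_of[OF p] and b = jac_carr[OF p]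
  show "comp_bdd r (diff_of (fst p))" by (rule comp_bdd_all[OF s_minus1_gt h b]) (use r in auto)
  show "comp_bdd r (inv (diff_of (fst p)))"
    by (rule comp_bdd_all[OF s_minus1_gt has_cdiff_inverse(2)[OF h b(2)] cdiff_inverse_regular[OF s_minus1_gt h b]])
       (use r b in \<open>auto simp: recip_def\<close>)
qed

lemma comp_carr:
  assumes p: "p \<in> G_dom s" and r: "1 / 2 < r" "r \<le> s" and u: "u \<in> carr (Hs r)"
  shows "u \<circ> diff_of (fst p) \<in> carr (Hs r)" "u \<circ> inv (diff_of (fst p)) \<in> carr (Hs r)"
  using comp_bdd_diff_of[OF p r] u unfolding comp_bdd_def by auto

lemma diff_of_inv:
  assumes "p \<in> G_dom s"
  shows "(u \<circ> inv (diff_of (fst p))) \<circ> diff_of (fst p) = u" "(u \<circ> diff_of (fst p)) \<circ> inv (diff_of (fst p)) = u"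
proof -
  have "bij (diff_of (fst p))" using has_cdiff_inverse(1)[OF has_cdiff_diff_of[OF assms] jac_carr(2)[OF assms]] .
  then show "(u \<circ> inv (diff_of (fst p))) \<circ> diff_of (fst p) = u" "(u \<circ> diff_of (fst p)) \<circ> inv (diff_of (fst p)) = u"
    by (auto simp: fun_eq_iff bij_is_inj bij_is_surj surj_f_inv_f)
qed

lemma cderiv_comp_inv:
  assumes p: "p \<in> G_dom s" and u: "has_cderiv u v"
  shows "has_cderiv (u \<circ> inv (diff_of (fst p))) ((recip (jac (fst p)) * v) \<circ> inv (diff_of (fst p)))"
proof -
  have "has_cderiv (u \<circ> inv (diff_of (fst p))) ((v \<circ> inv (diff_of (fst p))) * (recip (jac (fst p)) \<circ> inv (diff_of (fst p))))"
    by (rule has_cdiff_chain[OF has_cdiff_inverse(2)[OF has_cdiff_diff_of[OF p] jac_carr(2)[OF p]] u])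
  moreover have "(v \<circ> inv (diff_of (fst p))) * (recip (jac (fst p)) \<circ> inv (diff_of (fst p))) = (recip (jac (fst p)) * v) \<circ> inv (diff_of (fst p))"
    by (auto simp: fun_eq_iff)
  ultimately show ?thesis by simp
qed

lemma recip_jac_carr: "p \<in> G_dom s \<Longrightarrow> recip (jac (fst p)) \<in> carr (Hs (s - 1))"
  by (rule Hs_recip[OF s_minus1_gt jac_carr])

lemma recip_jac: "p \<in> G_dom s \<Longrightarrow> recip (jac (fst p)) * jac (fst p) = 1" "p \<in> G_dom s \<Longrightarrow> jac (fst p) * recip (jac (fst p)) = 1"
  using jac_carr(2) by (auto simp: recip_def fun_eq_iff less_imp_neq[symmetric])

section \<open>The operator \<open>A\<close> transported to Lagrangian coordinates\<close>

text \<open>\<open>lop b a\<close> is \<open>- b A\<^sub>\<phi>\<close>, where \<open>A\<^sub>\<phi> w = A(w \<circ> \<phi>\<^sup>-\<^sup>1) \<circ> \<phi> = w - a (a w\<^sub>x)\<^sub>x\<close>, \<open>b = \<phi>\<^sub>x\<close> and \<open>a = 1/b\<close>.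
  It is linear in \<open>(b, a)\<close>.\<close>

definition lop :: "(circle \<Rightarrow> real) \<Rightarrow> (circle \<Rightarrow> real) \<Rightarrow> (circle \<Rightarrow> real) \<Rightarrow> circle \<Rightarrow> real"
  where "lop b a w = - (b * w) + cderiv (a * cderiv w)"

definition lop_at :: "gvec \<Rightarrow> (circle \<Rightarrow> real) \<Rightarrow> circle \<Rightarrow> real"
  where "lop_at p = lop (jac (fst p)) (recip (jac (fst p)))"

text \<open>The inverse of \<open>b A\<^sub>\<phi>\<close>: divide by b, then apply the transported
  inverse of A. It inverts \<open>lop_at\<close> up to sign, and the sign chosen in
  \<open>lop\<close> brings the difference equation into the form of \<open>jet_quadratic\<close>
  without a minus.\<close>

definition res_at :: "gvec \<Rightarrow> (circle \<Rightarrow> real) \<Rightarrow> circle \<Rightarrow> real"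
  where "res_at p f = A_inv s ((recip (jac (fst p)) * f) \<circ> inv (diff_of (fst p))) \<circ> diff_of (fst p)"

lemma lop_at_carr:
  assumes p: "p \<in> G_dom s" and w: "w \<in> carr (Hs s)"
  shows "lop_at p w \<in> carr (Hs (s - 2))"
  unfolding lop_at_def lop_def
  by (intro ns_add ns_uminus normed_Hs Hs_mult s_minus2_gt_half Hs_s1_s2[OF jac_carr(1)[OF p]] Hs_s_s2[OF w] Hs_s1_deriv(2)
      Hs_mult[OF s_minus1_gt_half] recip_jac_carr[OF p] Hs_s_deriv(2)[OF w])

lemma A_op_comp:
  assumes p: "p \<in> G_dom s" and w: "w \<in> carr (Hs s)"
  shows "A_op (w \<circ> inv (diff_of (fst p))) = - ((recip (jac (fst p)) * lop_at p w) \<circ> inv (diff_of (fst p)))"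
proof -
  let ?\<psi> = "inv (diff_of (fst p))" and ?a = "recip (jac (fst p))"
  have 1: "cderiv (w \<circ> ?\<psi>) = (?a * cderiv w) \<circ> ?\<psi>"
    by (rule cderiv_eq[OF cderiv_comp_inv[OF p Hs_s_deriv(1)[OF w]]])
  have v: "?a * cderiv w \<in> carr (Hs (s - 1))" by (rule Hs_mult[OF s_minus1_gt_half recip_jac_carr[OF p] Hs_s_deriv(2)[OF w]])
  have 2: "cderiv ((?a * cderiv w) \<circ> ?\<psi>) = (?a * cderiv (?a * cderiv w)) \<circ> ?\<psi>"
    by (rule cderiv_eq[OF cderiv_comp_inv[OF p Hs_s1_deriv(1)[OF v]]])
  have "?a x * (jac (fst p) x * w x) = w x" for x
    using fun_cong[OF recip_jac(1)[OF p], of x] by (simp add: mult.assoc[symmetric])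
  then show ?thesis unfolding A_op_def 1 2 by (simp add: fun_eq_iff lop_at_def lop_def algebra_simps)
qed

lemma res_at_carr:
  assumes p: "p \<in> G_dom s" and f: "f \<in> carr (Hs (s - 2))"
  shows "(recip (jac (fst p)) * f) \<circ> inv (diff_of (fst p)) \<in> carr (Hs (s - 2))" "res_at p f \<in> carr (Hs s)"
proof -
  have "recip (jac (fst p)) * f \<in> carr (Hs (s - 2))"
    by (rule Hs_mult[OF s_minus2_gt_half Hs_s1_s2[OF recip_jac_carr[OF p]] f])
  then show *: "(recip (jac (fst p)) * f) \<circ> inv (diff_of (fst p)) \<in> carr (Hs (s - 2))"
    by (intro comp_carr[OF p]) (use s in auto)
  show "res_at p f \<in> carr (Hs s)" unfolding res_at_def
    by (intro comp_carr[OF p] A_inv[OF s *]) (use s in auto)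
qed

lemma lop_res:
  assumes p: "p \<in> G_dom s" and f: "f \<in> carr (Hs (s - 2))"
  shows "lop_at p (res_at p f) = - f"
proof -
  let ?\<psi> = "inv (diff_of (fst p))" and ?\<phi> = "diff_of (fst p)" and ?a = "recip (jac (fst p))"
  let ?w = "res_at p f"
  have "A_op (?w \<circ> ?\<psi>) = (?a * f) \<circ> ?\<psi>"
    unfolding res_at_def diff_of_inv(2)[OF p] by (rule A_inv(2)[OF s res_at_carr(1)[OF p f]])
  then have "- ((?a * lop_at p ?w) \<circ> ?\<psi>) = (?a * f) \<circ> ?\<psi>" unfolding A_op_comp[OF p res_at_carr(2)[OF p f]] .
  then have "(- ((?a * lop_at p ?w) \<circ> ?\<psi>)) \<circ> ?\<phi> = ((?a * f) \<circ> ?\<psi>) \<circ> ?\<phi>" by simp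
  then have "- (?a * lop_at p ?w) = ?a * f"
    using diff_of_inv(1)[OF p, of "?a * lop_at p ?w"] diff_of_inv(1)[OF p, of "?a * f"] by (auto simp: fun_eq_iff)
  then have "jac (fst p) x * (- (?a x * lop_at p ?w x)) = jac (fst p) x * (?a x * f x)" for x
    by (simp add: fun_eq_iff)
  moreover have "jac (fst p) x * (?a x * z) = z" for x z
    using fun_cong[OF recip_jac(2)[OF p], of x] by (simp add: mult.assoc[symmetric])
  ultimately have "- lop_at p ?w x = f x" for x by (metis mult_minus_right)
  then show ?thesis by (auto simp: fun_eq_iff) (metis minus_minus)
qed

lemma res_lop:
  assumes p: "p \<in> G_dom s" and w: "w \<in> carr (Hs s)"
  shows "res_at p (lop_at p w) = - w"
proof -
  have w': "- w \<in> carr (Hs s)" by (rule ns_uminus[OF normed_Hs w])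
  have "(recip (jac (fst p)) * lop_at p w) \<circ> inv (diff_of (fst p)) = - A_op (w \<circ> inv (diff_of (fst p)))"
    unfolding A_op_comp[OF p w] by simp
  also have "\<dots> = A_op (- w \<circ> inv (diff_of (fst p)))"
  proof -
    have c: "w \<circ> inv (diff_of (fst p)) \<in> carr (Hs s)" by (rule comp_carr[OF p _ _ w]) (use s in auto)
    have n: "cderiv (- u) = - cderiv u" if "has_cderiv u (cderiv u)" for u
      using cderiv_eq[OF has_cderiv_scale[OF that, of "-1"]] by simp
    have "(- w \<circ> inv (diff_of (fst p))) = - (w \<circ> inv (diff_of (fst p)))" by (auto simp: fun_eq_iff)
    then show ?thesis
      unfolding A_op_def by (simp add: n Hs_s_deriv(1)[OF c] Hs_s1_deriv(1)[OF Hs_s_deriv(2)[OF c]])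
  qed
  finally have "A_inv s ((recip (jac (fst p)) * lop_at p w) \<circ> inv (diff_of (fst p))) = - w \<circ> inv (diff_of (fst p))"
    using A_inv_A[OF s comp_carr(2)[OF p _ _ w']] s by simp
  then show ?thesis unfolding res_at_def using diff_of_inv(1)[OF p, of "- w"] by simp
qed

lemma lop_at_lin:
  assumes p: "p \<in> G_dom s" and w: "w \<in> carr (Hs s)" "w' \<in> carr (Hs s)"
  shows "lop_at p (c *\<^sub>R w + c' *\<^sub>R w') = c *\<^sub>R lop_at p w + c' *\<^sub>R lop_at p w'"
proof -
  let ?a = "recip (jac (fst p))"
  note d = Hs_s_deriv[OF w(1)] and d' = Hs_s_deriv[OF w(2)]
  have 1: "cderiv (c *\<^sub>R w + c' *\<^sub>R w') = c *\<^sub>R cderiv w + c' *\<^sub>R cderiv w'"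
    by (intro cderiv_eq has_cderiv_add has_cderiv_scale d d')
  have 2: "?a * (c *\<^sub>R cderiv w + c' *\<^sub>R cderiv w') = c *\<^sub>R (?a * cderiv w) + c' *\<^sub>R (?a * cderiv w')"
    by (auto simp: fun_eq_iff scaleR_fun_def algebra_simps)
  have 3: "cderiv (c *\<^sub>R (?a * cderiv w) + c' *\<^sub>R (?a * cderiv w')) = c *\<^sub>R cderiv (?a * cderiv w) + c' *\<^sub>R cderiv (?a * cderiv w')"
    by (intro cderiv_eq has_cderiv_add has_cderiv_scale Hs_s1_deriv(1) Hs_mult[OF s_minus1_gt_half] recip_jac_carr[OF p] d d')
  show ?thesis unfolding lop_at_def lop_def 1 2 3 by (auto simp: fun_eq_iff scaleR_fun_def algebra_simps)
qed

text \<open>Linearity is inherited from \<open>lop_at\<close>: the linear combination on the right,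
  negated, is a preimage under \<open>lop_at\<close> of the argument on the left, and
  \<open>res_lop\<close> recovers it.\<close>

lemma res_at_lin:
  assumes p: "p \<in> G_dom s" and f: "f \<in> carr (Hs (s - 2))" "f' \<in> carr (Hs (s - 2))"
  shows "res_at p (c *\<^sub>R f + c' *\<^sub>R f') = c *\<^sub>R res_at p f + c' *\<^sub>R res_at p f'"
proof -
  let ?w = "(- c) *\<^sub>R res_at p f + (- c') *\<^sub>R res_at p f'"
  have w: "?w \<in> carr (Hs s)" by (intro ns_add ns_scale normed_Hs res_at_carr[OF p] f)
  have "lop_at p ?w = c *\<^sub>R f + c' *\<^sub>R f'"
    using lop_at_lin[OF p res_at_carr(2)[OF p f(1)] res_at_carr(2)[OF p f(2)], of "- c" "- c'"]
    by (simp add: lop_res[OF p f(1)] lop_res[OF p f(2)])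
  then show ?thesis using res_lop[OF p w] by simp
qed

definition lop_map :: "gvec \<Rightarrow> (circle \<Rightarrow> real) \<Rightarrow> circle \<Rightarrow> real"
  where "lop_map p = (\<lambda>w. if w \<in> carr (Hs s) then lop_at p w else 0)"

definition res_map :: "gvec \<Rightarrow> (circle \<Rightarrow> real) \<Rightarrow> circle \<Rightarrow> real"
  where "res_map p = (\<lambda>f. if f \<in> carr (Hs (s - 2)) then res_at p f else 0)"

text \<open>The constants depend on \<open>p\<close> without any control; a bound at each single
  point is what \<open>jet_quadratic\<close> asks for.\<close>

lemma res_map_carr:
  assumes p: "p \<in> G_dom s"
  shows "res_map p \<in> carr (blin (Hs (s - 2)) (Hs s))"
proof -
  let ?a = "recip (jac (fst p))"
  obtain C1 where C1: "C1 \<ge> 0" "\<And>u. u \<in> carr (Hs s) \<Longrightarrow> nrm (Hs s) (u \<circ> diff_of (fst p)) \<le> C1 * nrm (Hs s) u"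
    using comp_bdd_diff_of(1)[OF p, of s] s unfolding comp_bdd_def by auto
  obtain C2 where C2: "C2 \<ge> 0" "\<And>u. u \<in> carr (Hs (s - 2)) \<Longrightarrow> nrm (Hs (s - 2)) (u \<circ> inv (diff_of (fst p))) \<le> C2 * nrm (Hs (s - 2)) u"
    using comp_bdd_diff_of(2)[OF p, of "s - 2"] s unfolding comp_bdd_def by auto
  obtain K where K: "K \<ge> 0" "\<And>u v. u \<in> carr (Hs (s - 2)) \<Longrightarrow> v \<in> carr (Hs (s - 2)) \<Longrightarrow> nrm (Hs (s - 2)) (u * v) \<le> K * nrm (Hs (s - 2)) u * nrm (Hs (s - 2)) v"
    using bdd_bil_bound[OF bdd_bil_mult[OF s_minus2_gt_half]] by blast
  have a: "?a \<in> carr (Hs (s - 2))" by (rule Hs_s1_s2[OF recip_jac_carr[OF p]])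
  have "nrm (Hs s) (res_at p f) \<le> (C1 * C2 * K * nrm (Hs (s - 2)) ?a) * nrm (Hs (s - 2)) f"
    if f: "f \<in> carr (Hs (s - 2))" for f
  proof -
    have "nrm (Hs s) (res_at p f) \<le> C1 * nrm (Hs (s - 2)) ((?a * f) \<circ> inv (diff_of (fst p)))"
      unfolding res_at_def using C1(2)[OF A_inv(1)[OF s res_at_carr(1)[OF p f]]] A_inv(3)[OF s res_at_carr(1)[OF p f]] by simp
    also have "\<dots> \<le> C1 * (C2 * nrm (Hs (s - 2)) (?a * f))" by (rule mult_left_mono[OF C2(2)[OF Hs_mult[OF s_minus2_gt_half a f]] C1(1)])
    also have "\<dots> \<le> C1 * (C2 * (K * nrm (Hs (s - 2)) ?a * nrm (Hs (s - 2)) f))"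
      using K(2)[OF a f] C1 C2 by (intro mult_left_mono) auto
    finally show ?thesis by (simp add: mult_ac)
  qed
  then show ?thesis
    unfolding res_map_def
    by (intro blinI[OF normed_Hs]) (auto simp: res_at_carr(2)[OF p] res_at_lin[OF p] ns_add ns_scale normed_Hs)
qed

section \<open>Smooth dependence on the diffeomorphism\<close>

lemma jet_jac: obtains d where "jet (HsE s) (Hs (s - 1)) (G_dom s) d" "\<And>p. d p [] = jac (fst p)"
    "\<And>p h. d p [h] = cderiv (fst h)"
proof
  show "jet (HsE s) (Hs (s - 1)) (G_dom s) (\<lambda>p vs. case vs of [] \<Rightarrow> 1 + cderiv (fst p) | [v] \<Rightarrow> cderiv (fst v) | _ \<Rightarrow> 0)"
    unfolding jet_def by (intro allI jetn_affine normed_E normed_Hs bdd_lin_E_dfst Hs_one G_dom_carr)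
qed (auto simp: jac_def)

text \<open>For two positive functions b and c, 1/c - 1/b = (1/c) (b - c) (1/b). This is the
  quadratic equation for the map -b, whose jet is therefore the one supplied.\<close>

lemma jet_recip_jac: obtains d where "jet (HsE s) (Hs (s - 1)) (G_dom s) d" "\<And>p. d p [] = recip (jac (fst p))"
    "\<And>p h. h \<in> carr (HsE s) \<Longrightarrow> d p [h] = - (recip (jac (fst p)) * cderiv (fst h) * recip (jac (fst p)))"
proof -
  obtain b where b: "jet (HsE s) (Hs (s - 1)) (G_dom s) b" "\<And>p. b p [] = jac (fst p)" "\<And>p h. b p [h] = cderiv (fst h)"
    by (rule jet_jac) blast
  have nb: "jet (HsE s) (Hs (s - 1)) (G_dom s) (\<lambda>p vs. - b p vs)"
    by (rule jet_lin[OF bdd_lin_neg[OF bdd_lin_id[OF normed_Hs] normed_Hs normed_Hs] normed_E normed_Hs b(1)])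
  obtain d where d: "jet (HsE s) (Hs (s - 1)) (G_dom s) d" "\<And>p. d p [] = recip (jac (fst p))"
    "\<And>p h. h \<in> carr (HsE s) \<Longrightarrow> d p [h] = (recip (jac (fst p)) * - b p [h]) * recip (jac (fst p))"
  proof (rule jet_quadratic[OF normed_E normed_Hs normed_Hs normed_Hs G_dom_carr bdd_bil_mult[OF s_minus1_gt_half] bdd_bil_mult[OF s_minus1_gt_half] nb recip_jac_carr])
    fix p h assume p: "p \<in> G_dom s" and ph: "p + h \<in> G_dom s"
    show "recip (jac (fst (p + h))) - recip (jac (fst p)) =
      recip (jac (fst (p + h))) * (- b (p + h) [] - - b p []) * recip (jac (fst p))"
    proof
      fix x
      have "jac (fst p) x \<noteq> 0" "jac (fst (p + h)) x \<noteq> 0" using jac_carr(2)[OF p, of x] jac_carr(2)[OF ph, of x] by auto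
      then show "(recip (jac (fst (p + h))) - recip (jac (fst p))) x =
        (recip (jac (fst (p + h))) * (- b (p + h) [] - - b p []) * recip (jac (fst p))) x"
        by (simp add: b(2) recip_def field_simps)
    qed
  qed auto
  show thesis by (rule that[OF d(1,2)]) (use d(3) b(3) in \<open>simp add: fun_eq_iff\<close>)
qed

lemma bdd_lin_lop1: "bdd_lin (Hs (s - 1)) (blin (Hs s) (Hs (s - 2))) (\<lambda>b w. if w \<in> carr (Hs s) then - (b * w) else 0)"
proof (rule bdd_lin_curry[OF normed_Hs normed_Hs normed_Hs])
  show "bdd_bil (Hs (s - 1)) (Hs s) (Hs (s - 2)) (\<lambda>b w. - (b * w))"
    using bdd_bil_comp[OF bdd_bil_mult[OF s_minus2_gt_half] bdd_lin_Hs_incl[of "s - 2" "s - 1"] bdd_lin_Hs_incl[of "s - 2" s]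
        bdd_lin_neg[OF bdd_lin_id[OF normed_Hs] normed_Hs normed_Hs] normed_Hs normed_Hs normed_Hs normed_Hs normed_Hs] by simp
qed

lemma bdd_lin_lop2: "bdd_lin (Hs (s - 1)) (blin (Hs s) (Hs (s - 2))) (\<lambda>a w. if w \<in> carr (Hs s) then cderiv (a * cderiv w) else 0)"
  by (rule bdd_lin_curry[OF normed_Hs normed_Hs normed_Hs])
     (rule bdd_bil_comp[OF bdd_bil_mult[OF s_minus1_gt_half] bdd_lin_id[OF normed_Hs] bdd_lin_deriv bdd_lin_deriv1
        normed_Hs normed_Hs normed_Hs normed_Hs normed_Hs])

lemma jet_lop: obtains d where "jet (HsE s) (blin (Hs s) (Hs (s - 2))) (G_dom s) d" "\<And>p. d p [] = lop_map p"
proof -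
  obtain b where b: "jet (HsE s) (Hs (s - 1)) (G_dom s) b" "\<And>p. b p [] = jac (fst p)"
    by (rule jet_jac) blast
  obtain a where a: "jet (HsE s) (Hs (s - 1)) (G_dom s) a" "\<And>p. a p [] = recip (jac (fst p))"
    by (rule jet_recip_jac) blast
  show thesis
    by (rule that, rule jet_add[OF normed_E normed_blin[OF normed_Hs normed_Hs]
        jet_lin[OF bdd_lin_lop1 normed_E normed_Hs b(1)] jet_lin[OF bdd_lin_lop2 normed_E normed_Hs a(1)]])
       (auto simp: fun_eq_iff a b lop_map_def lop_at_def lop_def)
qed

text \<open>With w = \<open>res_at p f\<close> one has \<open>lop_at p w = - f\<close>, so the
  increment of \<open>lop\<close> at w is \<open>lop_at (p + h) w + f\<close>. The new inverse sends
  this to -w plus its value at f, which is the increment of the inverse.\<close>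

lemma jet_res: obtains d where "jet (HsE s) (blin (Hs (s - 2)) (Hs s)) (G_dom s) d" "\<And>p. d p [] = res_map p"
proof -
  obtain l where l: "jet (HsE s) (blin (Hs s) (Hs (s - 2))) (G_dom s) l" "\<And>p. l p [] = lop_map p"
    by (rule jet_lop) blast
  note nb = normed_blin[OF normed_Hs normed_Hs]
  show thesis
  proof (rule jet_quadratic[OF normed_E nb nb nb G_dom_carr bdd_bil_blin_comp[OF normed_Hs normed_Hs normed_Hs]
        bdd_bil_blin_comp[OF normed_Hs normed_Hs normed_Hs] l(1) res_map_carr])
    fix p h assume p: "p \<in> G_dom s" and ph: "p + h \<in> G_dom s"
    show "res_map (p + h) - res_map p = (\<lambda>v. if v \<in> carr (Hs (s - 2))
       then (\<lambda>v. if v \<in> carr (Hs s) then res_map (p + h) ((l (p + h) [] - l p []) v) else 0) (res_map p v) else 0)"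
    proof
      fix f
      show "(res_map (p + h) - res_map p) f = (if f \<in> carr (Hs (s - 2))
       then (\<lambda>v. if v \<in> carr (Hs s) then res_map (p + h) ((l (p + h) [] - l p []) v) else 0) (res_map p f) else 0)"
      proof (cases "f \<in> carr (Hs (s - 2))")
        case True
        let ?w = "res_at p f"
        have w: "?w \<in> carr (Hs s)" by (rule res_at_carr(2)[OF p True])
        have lw: "lop_at (p + h) ?w \<in> carr (Hs (s - 2))" by (rule lop_at_carr[OF ph w])
        have "(l (p + h) [] - l p []) ?w = 1 *\<^sub>R lop_at (p + h) ?w + 1 *\<^sub>R f"
          using w by (simp add: l lop_map_def lop_res[OF p True])
        moreover have "1 *\<^sub>R lop_at (p + h) ?w + 1 *\<^sub>R f \<in> carr (Hs (s - 2))"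
          by (intro ns_add ns_scale normed_Hs lw True)
        ultimately have "res_map (p + h) ((l (p + h) [] - l p []) ?w) = res_at (p + h) (1 *\<^sub>R lop_at (p + h) ?w + 1 *\<^sub>R f)"
          by (simp add: res_map_def)
        also have "\<dots> = - ?w + res_at (p + h) f"
          unfolding res_at_lin[OF ph lw True] res_lop[OF ph w] by simp
        finally show ?thesis using True w by (simp add: res_map_def)
      qed (simp add: res_map_def)
    qed
  next
    fix d assume "jet (HsE s) (blin (Hs (s - 2)) (Hs s)) (G_dom s) d" "\<And>p. d p [] = res_map p"
    then show thesis by (rule that)
  qed
qed

section \<open>Smoothness of the spray and of the metric\<close>

lemma bdd_bil_add:
  assumes "bdd_bil E F G B" "bdd_bil E F G B'" "normed_ns E" "normed_ns F" "normed_ns G"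
  shows "bdd_bil E F G (\<lambda>x y. B x y + B' x y)"
proof -
  obtain K where K: "K \<ge> 0" "\<And>x y. x \<in> carr E \<Longrightarrow> y \<in> carr F \<Longrightarrow> nrm G (B x y) \<le> K * nrm E x * nrm F y"
    using bdd_bil_bound[OF assms(1)] by blast
  obtain K' where K': "K' \<ge> 0" "\<And>x y. x \<in> carr E \<Longrightarrow> y \<in> carr F \<Longrightarrow> nrm G (B' x y) \<le> K' * nrm E x * nrm F y"
    using bdd_bil_bound[OF assms(2)] by blast
  show ?thesis
  proof (rule bdd_bilI[OF assms(3,4)])
    fix x y assume xy: "x \<in> carr E" "y \<in> carr F"
    note c = bdd_bilD(1)[OF assms(1) xy] bdd_bilD(1)[OF assms(2) xy]
    show "B x y + B' x y \<in> carr G" by (rule ns_add[OF assms(5) c])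
    show "nrm G (B x y + B' x y) \<le> (K + K') * nrm E x * nrm F y"
      using nrm_triangle[OF assms(5) c] K(2)[OF xy] K'(2)[OF xy] by (simp add: algebra_simps)
  qed (auto simp: bdd_bilD(2)[OF assms(1,3)] bdd_bilD(2)[OF assms(2,3)] bdd_bilD(3)[OF assms(1,4)] bdd_bilD(3)[OF assms(2,4)]
      algebra_simps)
qed

lemma bdd_lin_scale: "normed_ns E \<Longrightarrow> bdd_lin E E (\<lambda>x. c *\<^sub>R x)"
  by (rule bdd_linI[where C = "\<bar>c\<bar>"]) (auto simp: lin_on_def ns_scale nrm_scale scaleR_add_right)

lemma bdd_bil_fst_fst: "bdd_bil (HsE s) (HsE s) (Hs (s - 1)) (\<lambda>X Y. fst X * fst Y)"
  using bdd_bil_comp[OF bdd_bil_mult[OF s_minus1_gt_half] bdd_lin_E_fst1 bdd_lin_E_fst1 bdd_lin_id[OF normed_Hs]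
    normed_Hs normed_Hs normed_Hs normed_E normed_E] .

lemma bdd_bil_snd_snd: "bdd_bil (HsE s) (HsE s) (Hs (s - 1)) (\<lambda>X Y. snd X * snd Y)"
  using bdd_bil_comp[OF bdd_bil_mult[OF s_minus1_gt_half] bdd_lin_E_snd bdd_lin_E_snd bdd_lin_id[OF normed_Hs]
    normed_Hs normed_Hs normed_Hs normed_E normed_E] .

lemma bdd_bil_cderiv_cderiv: "bdd_bil (HsE s) (HsE s) (Hs (s - 1)) (\<lambda>X Y. cderiv (fst X) * cderiv (fst Y))"
  using bdd_bil_comp[OF bdd_bil_mult[OF s_minus1_gt_half] bdd_lin_E_dfst bdd_lin_E_dfst bdd_lin_id[OF normed_Hs]
    normed_Hs normed_Hs normed_Hs normed_E normed_E] .

lemma bdd_bil_cderiv_snd: "bdd_bil (HsE s) (HsE s) (Hs (s - 1)) (\<lambda>X Y. cderiv (fst X) * snd Y + cderiv (fst Y) * snd X)"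
proof -
  have 1: "bdd_bil (HsE s) (HsE s) (Hs (s - 1)) (\<lambda>X Y. cderiv (fst X) * snd Y)"
    using bdd_bil_comp[OF bdd_bil_mult[OF s_minus1_gt_half] bdd_lin_E_dfst bdd_lin_E_snd bdd_lin_id[OF normed_Hs]
      normed_Hs normed_Hs normed_Hs normed_E normed_E] .
  show ?thesis by (rule bdd_bil_add[OF 1 bdd_bil_flip[OF 1] normed_E normed_E normed_Hs])
qed

lemma bdd_bil_fst_snd: "bdd_bil (HsE s) (HsE s) (Hs (s - 1)) (\<lambda>X Y. fst X * fst Y + snd X * snd Y)"
  by (rule bdd_bil_add[OF bdd_bil_fst_fst bdd_bil_snd_snd normed_E normed_E normed_Hs])

lemma bdd_bil_fst_half_snd: "bdd_bil (HsE s) (HsE s) (Hs (s - 1)) (\<lambda>X Y. fst X * fst Y + (1/2) *\<^sub>R (snd X * snd Y))"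
  by (rule bdd_bil_add[OF bdd_bil_fst_fst _ normed_E normed_E normed_Hs])
     (rule bdd_bil_comp[OF bdd_bil_snd_snd bdd_lin_id[OF normed_E] bdd_lin_id[OF normed_E] bdd_lin_scale[OF normed_Hs] normed_E normed_E normed_Hs normed_E normed_E])

text \<open>The pieces of the transported formulas have the form L(w M(X, Y)) with a coefficient w
  of order s - 1 depending on the base point, a fixed bilinear M and a fixed linear L. Smoothness in
  the base point thus reduces to that of w.\<close>

lemma bdd_lin_weighted:
  assumes L: "bdd_lin (Hs (s - 1)) G L" and M: "bdd_bil (HsE s) (HsE s) (Hs (s - 1)) M"
    and sym: "\<And>X Y. M X Y = M Y X"
  shows "bdd_lin (Hs (s - 1)) (sym_bilin (HsE s) G)
    (\<lambda>w X Y. if X \<in> carr (HsE s) \<and> Y \<in> carr (HsE s) then L (w * M X Y) else 0)"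
proof -
  obtain KL where KL: "KL \<ge> 0" "\<And>x. x \<in> carr (Hs (s - 1)) \<Longrightarrow> nrm G (L x) \<le> KL * nrm (Hs (s - 1)) x"
    and L': "lin_on (Hs (s - 1)) G L" using L unfolding bdd_lin_def by blast
  obtain KM where KM: "KM \<ge> 0" "\<And>x y. x \<in> carr (HsE s) \<Longrightarrow> y \<in> carr (HsE s) \<Longrightarrow> nrm (Hs (s - 1)) (M x y) \<le> KM * nrm (HsE s) x * nrm (HsE s) y"
    using bdd_bil_bound[OF M] by blast
  obtain K where K: "K \<ge> 0" "\<And>u v. u \<in> carr (Hs (s - 1)) \<Longrightarrow> v \<in> carr (Hs (s - 1)) \<Longrightarrow> nrm (Hs (s - 1)) (u * v) \<le> K * nrm (Hs (s - 1)) u * nrm (Hs (s - 1)) v"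
    using bdd_bil_bound[OF bdd_bil_mult[OF s_minus1_gt_half]] by blast
  note mc = Hs_mult[OF s_minus1_gt_half] bdd_bilD(1)[OF M]
  show ?thesis
  proof (rule bdd_lin_sb[OF normed_Hs normed_E])
    fix w X Y assume wXY: "w \<in> carr (Hs (s - 1))" "X \<in> carr (HsE s)" "Y \<in> carr (HsE s)"
    show "L (w * M X Y) \<in> carr G" using lin_onD(1)[OF L'] mc wXY by blast
    have "nrm G (L (w * M X Y)) \<le> KL * nrm (Hs (s - 1)) (w * M X Y)" using KL(2) mc wXY by blast
    also have "\<dots> \<le> KL * (K * nrm (Hs (s - 1)) w * nrm (Hs (s - 1)) (M X Y))"
      using K(2) mc wXY KL(1) by (intro mult_left_mono) blast+
    also have "\<dots> \<le> KL * (K * nrm (Hs (s - 1)) w * (KM * nrm (HsE s) X * nrm (HsE s) Y))"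
      using KM(2)[OF wXY(2,3)] KL K nrm_ge0[OF normed_Hs wXY(1)] by (intro mult_left_mono) auto
    finally show "nrm G (L (w * M X Y)) \<le> (KL * K * KM) * nrm (Hs (s - 1)) w * nrm (HsE s) X * nrm (HsE s) Y" by (simp add: mult_ac)
    show "L (w * M X Y) = L (w * M Y X)" using sym by metis
  next
    fix a b w w' X Y assume h: "w \<in> carr (Hs (s - 1))" "w' \<in> carr (Hs (s - 1))" "X \<in> carr (HsE s)" "Y \<in> carr (HsE s)"
    have "(a *\<^sub>R w + b *\<^sub>R w') * M X Y = a *\<^sub>R (w * M X Y) + b *\<^sub>R (w' * M X Y)"
      by (auto simp: fun_eq_iff scaleR_fun_def algebra_simps)
    then show "L ((a *\<^sub>R w + b *\<^sub>R w') * M X Y) = a *\<^sub>R L (w * M X Y) + b *\<^sub>R L (w' * M X Y)"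
      using lin_on_comb[OF L' normed_Hs] mc h by simp
  next
    fix a b w X Y Z assume h: "w \<in> carr (Hs (s - 1))" "X \<in> carr (HsE s)" "Y \<in> carr (HsE s)" "Z \<in> carr (HsE s)"
    have "w * M (a *\<^sub>R X + b *\<^sub>R Y) Z = a *\<^sub>R (w * M X Z) + b *\<^sub>R (w * M Y Z)"
      unfolding bdd_bilD(2)[OF M normed_E h(2,3,4)] by (auto simp: fun_eq_iff scaleR_fun_def algebra_simps)
    then show "L (w * M (a *\<^sub>R X + b *\<^sub>R Y) Z) = a *\<^sub>R L (w * M X Z) + b *\<^sub>R L (w * M Y Z)"
      using lin_on_comb[OF L' normed_Hs] mc h by simp
  qed (use KL K KM in auto)
qed

section \<open>The Christoffel map in Lagrangian coordinates\<close>

definition Qbil :: "gvec \<Rightarrow> gvec \<Rightarrow> gvec \<Rightarrow> circle \<Rightarrow> real"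
  where "Qbil p X Y = (fst X * fst Y + (1/2) *\<^sub>R (snd X * snd Y)) +
    (1/2) *\<^sub>R ((recip (jac (fst p)) * recip (jac (fst p))) * (cderiv (fst X) * cderiv (fst Y)))"

lemma Qbil_carr: "p \<in> G_dom s \<Longrightarrow> X \<in> carr (HsE s) \<Longrightarrow> Y \<in> carr (HsE s) \<Longrightarrow> Qbil p X Y \<in> carr (Hs (s - 1))"
  unfolding Qbil_def
  by (intro ns_add ns_scale normed_Hs bdd_bilD(1)[OF bdd_bil_fst_half_snd] Hs_mult[OF s_minus1_gt_half] recip_jac_carr bdd_bilD(1)[OF bdd_bil_cderiv_cderiv])

text \<open>The factor a produced by differentiating after composition with the inverse is the one
  built into \<open>res_at\<close>. So both terms with \<open>A_inv\<close> take the form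
  \<open>res_at p (cderiv P)\<close>, and linearity of \<open>res_at\<close> merges them.\<close>

lemma christoffel_eq:
  assumes p: "p \<in> G_dom s" and X: "X \<in> carr (HsE s)" and Y: "Y \<in> carr (HsE s)"
  shows "christoffel s (G_cover p) X Y = (- res_at p (cderiv (Qbil p X Y)),
    - ((1/2) *\<^sub>R (recip (jac (fst p)) * (cderiv (fst X) * snd Y + cderiv (fst Y) * snd X))))"
proof -
  let ?\<phi> = "diff_of (fst p)" and ?\<psi> = "inv (diff_of (fst p))" and ?a = "recip (jac (fst p))"
  have Xc: "fst X \<in> carr (Hs s)" "snd X \<in> carr (Hs (s - 1))" and Yc: "fst Y \<in> carr (Hs s)" "snd Y \<in> carr (Hs (s - 1))"
    using X Y by (auto simp: carr_E)
  note ac = recip_jac_carr[OF p]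
  define P1 where "P1 = fst X * fst Y + (1/2) *\<^sub>R ((?a * ?a) * (cderiv (fst X) * cderiv (fst Y)))"
  define P2 where "P2 = snd X * snd Y"
  have P1c: "P1 \<in> carr (Hs (s - 1))" unfolding P1_def
    by (intro ns_add ns_scale normed_Hs Hs_mult[OF s_minus1_gt_half] ac Hs_s_deriv Xc Yc Hs_s_s1)
  have P2c: "P2 \<in> carr (Hs (s - 1))" unfolding P2_def by (intro Hs_mult[OF s_minus1_gt_half] Xc Yc)
  have dX: "cderiv (fst X \<circ> ?\<psi>) = (?a * cderiv (fst X)) \<circ> ?\<psi>" and dY: "cderiv (fst Y \<circ> ?\<psi>) = (?a * cderiv (fst Y)) \<circ> ?\<psi>"
    by (intro cderiv_eq cderiv_comp_inv[OF p] Hs_s_deriv Xc Yc)+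
  have e1: "(fst X \<circ> ?\<psi>) * (fst Y \<circ> ?\<psi>) + (1/2) *\<^sub>R (cderiv (fst X \<circ> ?\<psi>) * cderiv (fst Y \<circ> ?\<psi>)) = P1 \<circ> ?\<psi>"
    unfolding dX dY P1_def by (auto simp: fun_eq_iff scaleR_fun_def)
  have e2: "(snd X \<circ> ?\<psi>) * (snd Y \<circ> ?\<psi>) = P2 \<circ> ?\<psi>" unfolding P2_def by (auto simp: fun_eq_iff)
  have r: "A_inv s (cderiv (P \<circ> ?\<psi>)) \<circ> ?\<phi> = res_at p (cderiv P)" if "P \<in> carr (Hs (s - 1))" for P
    unfolding res_at_def cderiv_eq[OF cderiv_comp_inv[OF p Hs_s1_deriv(1)[OF that]]] ..
  have Q: "Qbil p X Y = P1 + (1/2) *\<^sub>R P2" unfolding Qbil_def P1_def P2_def by (simp add: algebra_simps)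
  have cQ: "cderiv (Qbil p X Y) = 1 *\<^sub>R cderiv P1 + (1/2) *\<^sub>R cderiv P2"
    unfolding Q using cderiv_eq[OF has_cderiv_add[OF Hs_s1_deriv(1)[OF P1c] has_cderiv_scale[OF Hs_s1_deriv(1)[OF P2c]]]] by simp
  have "fst (christoffel s (G_cover p) X Y) = - (A_inv s (cderiv (P1 \<circ> ?\<psi>)) \<circ> ?\<phi>) - (1/2) *\<^sub>R (A_inv s (cderiv (P2 \<circ> ?\<psi>)) \<circ> ?\<phi>)"
  proof -
    have "fst (christoffel s (G_cover p) X Y) = (christoffel0_id s (fst X \<circ> ?\<psi>) (fst Y \<circ> ?\<psi>) -
        (1/2) *\<^sub>R A_inv s (cderiv ((snd X \<circ> ?\<psi>) * (snd Y \<circ> ?\<psi>)))) \<circ> ?\<phi>"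
      using X Y by (simp add: G_cover_def vcomp_def map_prod_def split_beta)
    also have "\<dots> = - (A_inv s (cderiv (P1 \<circ> ?\<psi>)) \<circ> ?\<phi>) - (1/2) *\<^sub>R (A_inv s (cderiv (P2 \<circ> ?\<psi>)) \<circ> ?\<phi>)"
      unfolding christoffel0_id_def e1 e2 by (auto simp: fun_eq_iff scaleR_fun_def)
    finally show ?thesis .
  qed
  also have "\<dots> = - (res_at p (cderiv (Qbil p X Y)))"
    unfolding r[OF P1c] r[OF P2c] cQ res_at_lin[OF p Hs_s1_deriv(2)[OF P1c] Hs_s1_deriv(2)[OF P2c]] by simp
  finally have 1: "fst (christoffel s (G_cover p) X Y) = - (res_at p (cderiv (Qbil p X Y)))" .
  have inv: "?\<psi> (?\<phi> x) = x" for x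
    using has_cdiff_inverse(1)[OF has_cdiff_diff_of[OF p] jac_carr(2)[OF p]] by (simp add: bij_is_inj)
  have "snd (christoffel s (G_cover p) X Y) = - ((1/2) *\<^sub>R (?a * (cderiv (fst X) * snd Y + cderiv (fst Y) * snd X)))"
    using X Y by (auto simp: G_cover_def vcomp_def dX dY map_prod_def split_beta fun_eq_iff scaleR_fun_def inv algebra_simps)
  with 1 show ?thesis by (simp add: prod_eq_iff)
qed

text \<open>A constant coefficient, so that the part of \<open>Qbil\<close> independent of the base
  point is also covered by \<open>bdd_lin_weighted\<close>.\<close>

lemma jet_one: obtains d where "jet (HsE s) (Hs (s - 1)) (G_dom s) d" "\<And>p. d p [] = 1"
proof
  have z: "bdd_lin (HsE s) (Hs (s - 1)) (\<lambda>_. 0)"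
    by (rule bdd_linI[where C = 0]) (auto simp: lin_on_def ns_zero normed_E normed_Hs)
  show "jet (HsE s) (Hs (s - 1)) (G_dom s) (\<lambda>p vs. case vs of [] \<Rightarrow> 1 + 0 | [v] \<Rightarrow> 0 | _ \<Rightarrow> 0)"
    unfolding jet_def by (intro allI jetn_affine normed_E normed_Hs z Hs_one G_dom_carr)
qed auto

lemma jet_christoffel: obtains d where "jet (HsE s) (sym_bilin (HsE s) (HsE s)) (G_dom s) d"
    "\<And>p. p \<in> G_dom s \<Longrightarrow> d p [] = christoffel s (G_cover p)"
proof -
  obtain a where a: "jet (HsE s) (Hs (s - 1)) (G_dom s) a" "\<And>p. a p [] = recip (jac (fst p))"
    by (rule jet_recip_jac) blast
  obtain o1 where o1: "jet (HsE s) (Hs (s - 1)) (G_dom s) o1" "\<And>p. o1 p [] = 1" by (rule jet_one) blast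
  obtain R where R: "jet (HsE s) (blin (Hs (s - 2)) (Hs s)) (G_dom s) R" "\<And>p. R p [] = res_map p"
    by (rule jet_res) blast
  note nE = normed_E and nH = normed_Hs and nS = normed_sb[OF normed_E normed_Hs] normed_sb[OF normed_E normed_E]
  have aa: "jet (HsE s) (Hs (s - 1)) (G_dom s) (\<lambda>p. leib (*) (a p) (a p))"
    by (rule jet_leib[OF bdd_bil_mult[OF s_minus1_gt_half] nE nH nH nH a(1) a(1)])
  have L0: "bdd_lin (Hs (s - 1)) (sym_bilin (HsE s) (Hs (s - 1)))
    (\<lambda>w X Y. if X \<in> carr (HsE s) \<and> Y \<in> carr (HsE s) then w * (fst X * fst Y + (1/2) *\<^sub>R (snd X * snd Y)) else 0)"
    by (rule bdd_lin_weighted[OF bdd_lin_id[OF nH] bdd_bil_fst_half_snd]) (simp add: mult.commute)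
  have L3: "bdd_lin (Hs (s - 1)) (sym_bilin (HsE s) (Hs (s - 1)))
    (\<lambda>w X Y. if X \<in> carr (HsE s) \<and> Y \<in> carr (HsE s) then (1/2) *\<^sub>R (w * (cderiv (fst X) * cderiv (fst Y))) else 0)"
    by (rule bdd_lin_weighted[OF bdd_lin_scale[OF nH] bdd_bil_cderiv_cderiv]) (simp add: mult.commute)
  have inr: "bdd_lin (Hs (s - 1)) (HsE s) (\<lambda>x. (0, x))" and inl: "bdd_lin (Hs s) (HsE s) (\<lambda>x. (x, 0))"
    unfolding HsE_def by (intro bdd_lin_inr bdd_lin_inl nH)+
  have L4: "bdd_lin (Hs (s - 1)) (sym_bilin (HsE s) (HsE s))
    (\<lambda>w X Y. if X \<in> carr (HsE s) \<and> Y \<in> carr (HsE s) then (0, (- 1/2) *\<^sub>R (w * (cderiv (fst X) * snd Y + cderiv (fst Y) * snd X))) else 0)"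
    by (rule bdd_lin_weighted[OF bdd_lin_comp[OF bdd_lin_scale[OF nH] inr nH] bdd_bil_cderiv_snd]) (simp add: add.commute)
  note JQ = jet_add[OF nE nS(1) jet_lin[OF L0 nE nH o1(1)] jet_lin[OF L3 nE nH aa]]
  have KL: "bdd_lin (blin (Hs (s - 2)) (Hs s)) (blin (Hs (s - 1)) (HsE s))
     (\<lambda>L P. if P \<in> carr (Hs (s - 1)) then (- L (cderiv P), 0) else 0)"
    by (rule bdd_lin_conj[OF nH nH nH nE bdd_lin_deriv1 bdd_lin_comp[OF bdd_lin_neg[OF bdd_lin_id[OF nH] nH nH] inl nH]])
  note JK = jet_lin[OF KL nE normed_blin[OF nH nH] R(1)]
  \<comment> \<open>The first component is an operator-valued jet applied to the jet of
    \<open>Qbil\<close>. The second component is linear in a and enters through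
    \<open>L4\<close>.\<close>
  note J1 = jet_leib[OF bdd_bil_sb_comp[OF nE nH nE] nE normed_blin[OF nH nE] nS(1) nS(2) JK JQ]
  note J = jet_add[OF nE nS(2) J1 jet_lin[OF L4 nE nH a(1)]]
  show thesis
  proof (rule that[OF J])
    fix p assume p: "p \<in> G_dom s"
    show "leib (\<lambda>L B u v. if u \<in> carr (HsE s) \<and> v \<in> carr (HsE s) then L (B u v) else 0)
           (\<lambda>vs P. if P \<in> carr (Hs (s - 1)) then (- R p vs (cderiv P), 0) else 0)
           (\<lambda>vs. (\<lambda>X Y. if X \<in> carr (HsE s) \<and> Y \<in> carr (HsE s) then o1 p vs * (fst X * fst Y + (1/2) *\<^sub>R (snd X * snd Y)) else 0) +
                 (\<lambda>X Y. if X \<in> carr (HsE s) \<and> Y \<in> carr (HsE s) then (1/2) *\<^sub>R (leib (*) (a p) (a p) vs * (cderiv (fst X) * cderiv (fst Y))) else 0)) [] +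
          (\<lambda>X Y. if X \<in> carr (HsE s) \<and> Y \<in> carr (HsE s) then (0, (- 1/2) *\<^sub>R (a p [] * (cderiv (fst X) * snd Y + cderiv (fst Y) * snd X))) else 0)
         = christoffel s (G_cover p)"
      (is "?L = _")
    proof (intro ext)
      fix X Y
      show "?L X Y = christoffel s (G_cover p) X Y"
      proof (cases "X \<in> carr (HsE s) \<and> Y \<in> carr (HsE s)")
        case True
        note Qc = Qbil_carr[OF p conjunct1[OF True] conjunct2[OF True]]
        show ?thesis
          unfolding christoffel_eq[OF p conjunct1[OF True] conjunct2[OF True]]
          using True Qc Hs_s1_deriv(2)[OF Qc] by (simp add: a o1 R Qbil_def[symmetric] res_map_def)
      qed (auto simp: G_cover_def map_prod_def split_beta)
    qed
  qed
qed

section \<open>The metric in Lagrangian coordinates\<close>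

lemma metric_eq:
  assumes p: "p \<in> G_dom s" and X: "X \<in> carr (HsE s)" and Y: "Y \<in> carr (HsE s)"
  shows "metric2CH s (G_cover p) X Y =
    cintegral (jac (fst p) * (fst X * fst Y + snd X * snd Y)) + cintegral (recip (jac (fst p)) * (cderiv (fst X) * cderiv (fst Y)))"
proof -
  let ?\<phi> = "diff_of (fst p)" and ?\<psi> = "inv (diff_of (fst p))" and ?a = "recip (jac (fst p))" and ?b = "jac (fst p)"
  have Xc: "fst X \<in> carr (Hs s)" "snd X \<in> carr (Hs (s - 1))" and Yc: "fst Y \<in> carr (Hs s)" "snd Y \<in> carr (Hs (s - 1))"
    using X Y by (auto simp: carr_E)
  note ac = recip_jac_carr[OF p]
  note cc = Hs_ccont[OF Xc(1)] Hs_ccont[OF Xc(2)] Hs_ccont[OF Yc(1)] Hs_ccont[OF Yc(2)] Hs_ccont[OF ac]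
     Hs_ccont[OF Hs_s_deriv(2)[OF Xc(1)]] Hs_ccont[OF Hs_s_deriv(2)[OF Yc(1)]] Hs_ccont[OF jac_carr(1)[OF p]]
  note inv = has_cdiff_inverse(2)[OF has_cdiff_diff_of[OF p] jac_carr(2)[OF p]]
  have sub: "cintegral (w \<circ> ?\<psi>) = cintegral (?b * w)" if "ccont w" for w
    using cintegral_subst[OF has_cdiff_diff_of[OF p] has_cdiff_comp_ccont[OF inv that]] diff_of_inv(1)[OF p, of w] by simp
  have dX: "cderiv (fst X \<circ> ?\<psi>) = (?a * cderiv (fst X)) \<circ> ?\<psi>" and dY: "cderiv (fst Y \<circ> ?\<psi>) = (?a * cderiv (fst Y)) \<circ> ?\<psi>"
    by (intro cderiv_eq cderiv_comp_inv[OF p] Hs_s_deriv Xc Yc)+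
  have e1: "(fst X \<circ> ?\<psi>) * (fst Y \<circ> ?\<psi>) + cderiv (fst X \<circ> ?\<psi>) * cderiv (fst Y \<circ> ?\<psi>)
      = (fst X * fst Y + (?a * cderiv (fst X)) * (?a * cderiv (fst Y))) \<circ> ?\<psi>"
    unfolding dX dY by (auto simp: fun_eq_iff)
  have e2: "(snd X \<circ> ?\<psi>) * (snd Y \<circ> ?\<psi>) = (snd X * snd Y) \<circ> ?\<psi>" by (auto simp: fun_eq_iff)
  have "metric2CH s (G_cover p) X Y = cintegral ((fst X * fst Y + (?a * cderiv (fst X)) * (?a * cderiv (fst Y))) \<circ> ?\<psi>) + cintegral ((snd X * snd Y) \<circ> ?\<psi>)"
    using X Y by (simp add: G_cover_def map_prod_def split_beta vcomp_def e1 e2)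
  also have "\<dots> = cintegral (?b * (fst X * fst Y + (?a * cderiv (fst X)) * (?a * cderiv (fst Y)))) + cintegral (?b * (snd X * snd Y))"
    by (subst (1 2) sub) (auto intro!: ccont_add ccont_mult cc)
  \<comment> \<open>One of the two factors a cancels against the Jacobian b of the
    substitution.\<close>
  also have "?b * (fst X * fst Y + (?a * cderiv (fst X)) * (?a * cderiv (fst Y))) = ?b * (fst X * fst Y) + ?a * (cderiv (fst X) * cderiv (fst Y))"
  proof -
    have "?b * (fst X * fst Y + (?a * cderiv (fst X)) * (?a * cderiv (fst Y))) = ?b * (fst X * fst Y) + (?b * ?a) * (?a * (cderiv (fst X) * cderiv (fst Y)))"
      by (simp add: algebra_simps)
    then show ?thesis by (simp add: recip_jac[OF p])
  qed
  also have "cintegral \<dots> = cintegral (?b * (fst X * fst Y)) + cintegral (?a * (cderiv (fst X) * cderiv (fst Y)))"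
    by (intro cintegral_add ccont_mult cc)
  finally have "metric2CH s (G_cover p) X Y = (cintegral (?b * (fst X * fst Y)) + cintegral (?b * (snd X * snd Y))) + cintegral (?a * (cderiv (fst X) * cderiv (fst Y)))"
    by (simp add: times_fun_def)
  also have "cintegral (?b * (fst X * fst Y)) + cintegral (?b * (snd X * snd Y)) = cintegral (?b * (fst X * fst Y + snd X * snd Y))"
    unfolding distrib_left by (intro cintegral_add[symmetric] ccont_mult cc)
  finally show ?thesis .
qed

lemma jet_metric: obtains d where "jet (HsE s) (sym_bilin (HsE s) real_ns) (G_dom s) d"
    "\<And>p. p \<in> G_dom s \<Longrightarrow> d p [] = metric2CH s (G_cover p)"
proof -
  obtain a where a: "jet (HsE s) (Hs (s - 1)) (G_dom s) a" "\<And>p. a p [] = recip (jac (fst p))"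
    by (rule jet_recip_jac) blast
  obtain b where b: "jet (HsE s) (Hs (s - 1)) (G_dom s) b" "\<And>p. b p [] = jac (fst p)"
    by (rule jet_jac) blast
  note nE = normed_E and nH = normed_Hs and nS = normed_sb[OF normed_E normed_real]
  have L5: "bdd_lin (Hs (s - 1)) (sym_bilin (HsE s) real_ns)
    (\<lambda>w X Y. if X \<in> carr (HsE s) \<and> Y \<in> carr (HsE s) then cintegral (w * (fst X * fst Y + snd X * snd Y)) else 0)"
    by (rule bdd_lin_weighted[OF bdd_lin_cintegral[OF s_minus1_gt_half] bdd_bil_fst_snd]) (simp add: mult.commute)
  have L3: "bdd_lin (Hs (s - 1)) (sym_bilin (HsE s) real_ns)
    (\<lambda>w X Y. if X \<in> carr (HsE s) \<and> Y \<in> carr (HsE s) then cintegral (w * (cderiv (fst X) * cderiv (fst Y))) else 0)"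
    by (rule bdd_lin_weighted[OF bdd_lin_cintegral[OF s_minus1_gt_half] bdd_bil_cderiv_cderiv]) (simp add: mult.commute)
  note J = jet_add[OF nE nS jet_lin[OF L5 nE nH b(1)] jet_lin[OF L3 nE nH a(1)]]
  show thesis
  proof (rule that[OF J])
    fix p assume p: "p \<in> G_dom s"
    have "(if X \<in> carr (HsE s) \<and> Y \<in> carr (HsE s) then cintegral (jac (fst p) * (fst X * fst Y + snd X * snd Y)) else 0) +
       (if X \<in> carr (HsE s) \<and> Y \<in> carr (HsE s) then cintegral (recip (jac (fst p)) * (cderiv (fst X) * cderiv (fst Y))) else 0)
       = metric2CH s (G_cover p) X Y" for X Y
    proof (cases "X \<in> carr (HsE s) \<and> Y \<in> carr (HsE s)")
      case True
      then show ?thesis using metric_eq[OF p conjunct1[OF True] conjunct2[OF True]] by simp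
    qed (auto simp: G_cover_def map_prod_def split_beta)
    then show "(\<lambda>X Y. if X \<in> carr (HsE s) \<and> Y \<in> carr (HsE s) then cintegral (b p [] * (fst X * fst Y + snd X * snd Y)) else 0) +
         (\<lambda>X Y. if X \<in> carr (HsE s) \<and> Y \<in> carr (HsE s) then cintegral (a p [] * (cderiv (fst X) * cderiv (fst Y))) else 0)
       = metric2CH s (G_cover p)"
      by (intro ext) (simp only: plus_fun_apply a b)
  qed
qed

lemma christoffel_smooth: "smooth_spray s (christoffel s)"
proof -
  obtain d where d: "jet (HsE s) (sym_bilin (HsE s) (HsE s)) (G_dom s) d"
    "\<And>p. p \<in> G_dom s \<Longrightarrow> d p [] = christoffel s (G_cover p)" by (rule jet_christoffel) blast
  show ?thesis
    unfolding smooth_spray_def smooth_G_def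
    by (rule jet_smooth_map[OF normed_E normed_sb[OF normed_E normed_E] G_dom_carr d(1)]) (simp add: d(2))
qed

lemma cintegral_pos:
  assumes w: "ccont w" "\<And>x. w x \<ge> 0" "w y > 0"
  shows "cintegral w > 0"
proof -
  have nn: "cintegral w \<ge> 0"
    unfolding cintegral_def by (rule integral_nonneg[OF ccont_integrable[OF w(1)]]) (use w in auto)
  moreover have "cintegral w \<noteq> 0"
  proof
    assume "cintegral w = 0"
    then have hi: "((\<lambda>t. w (cir t)) has_integral 0) {0..1}"
      using integrable_integral[OF ccont_integrable[OF w(1), of 0 1]] by (simp add: cintegral_def)
    obtain t where "y = cir t" by (rule cir_surj)
    then have "y = cir (frac t)" by (simp add: cir_eq_iff frac_def)
    moreover have "w (cir (frac t)) = 0"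
      using has_integral_0_cbox_imp_0[of 0 1 "\<lambda>t. w (cir t)" "frac t"] hi w ccont_on[OF w(1)]
      by (auto simp: frac_lt_1 less_imp_le)
    ultimately show False using w(3) by simp
  qed
  ultimately show ?thesis by simp
qed

lemma HsG_cover: "p \<in> HsG s \<Longrightarrow> \<exists>q\<in>G_dom s. p = G_cover q"
  unfolding HsG_def HsDiff_def G_dom_def G_cover_def by force

lemma metric_pos:
  assumes p: "p \<in> G_dom s" and V: "V \<in> carr (HsE s)" "V \<noteq> 0"
  shows "metric2CH s (G_cover p) V V > 0"
proof -
  let ?a = "recip (jac (fst p))" and ?b = "jac (fst p)"
  have Vc: "fst V \<in> carr (Hs s)" "snd V \<in> carr (Hs (s - 1))" using V by (auto simp: carr_E)
  note cc = Hs_ccont[OF Vc(1)] Hs_ccont[OF Vc(2)] Hs_ccont[OF recip_jac_carr[OF p]]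
     Hs_ccont[OF Hs_s_deriv(2)[OF Vc(1)]] Hs_ccont[OF jac_carr(1)[OF p]]
  have b: "?b x > 0" "?a x > 0" for x using jac_carr(2)[OF p] by (auto simp: recip_def)
  have "cintegral (?a * (cderiv (fst V) * cderiv (fst V))) \<ge> 0"
    unfolding cintegral_def
    by (rule integral_nonneg[OF ccont_integrable[OF ccont_mult[OF cc(3) ccont_mult[OF cc(4) cc(4)]]]])
       (simp add: less_imp_le[OF b(2)])
  moreover have "cintegral (?b * (fst V * fst V + snd V * snd V)) > 0"
  proof -
    obtain x where x: "fst V x \<noteq> 0 \<or> snd V x \<noteq> 0" using V(2) by (auto simp: prod_eq_iff fun_eq_iff)
    show ?thesis
    proof (rule cintegral_pos[where y = x])
      show "ccont (?b * (fst V * fst V + snd V * snd V))" by (intro ccont_mult ccont_add cc)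
      show "0 < (?b * (fst V * fst V + snd V * snd V)) x"
        using x b(1)[of x] by (auto simp: zero_less_mult_iff not_square_less_zero sum_squares_gt_zero_iff)
      show "0 \<le> (?b * (fst V * fst V + snd V * snd V)) y" for y
        using b(1)[of y] by (auto intro!: mult_nonneg_nonneg)
    qed
  qed
  ultimately show ?thesis unfolding metric_eq[OF p V(1) V(1)] by linarith
qed

lemma metric_smooth: "smooth_weak_metric s (metric2CH s)"
proof -
  obtain d where d: "jet (HsE s) (sym_bilin (HsE s) real_ns) (G_dom s) d"
    "\<And>p. p \<in> G_dom s \<Longrightarrow> d p [] = metric2CH s (G_cover p)" by (rule jet_metric) blast
  have "smooth_G s (sym_bilin (HsE s) real_ns) (metric2CH s)"
    unfolding smooth_G_def
    by (rule jet_smooth_map[OF normed_E normed_sb[OF normed_E normed_real] G_dom_carr d(1)]) (simp add: d(2))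
  moreover have "metric2CH s p V V > 0" if "p \<in> HsG s" "V \<in> carr (HsE s)" "V \<noteq> 0" for p V
    using HsG_cover[OF that(1)] metric_pos that by blast
  ultimately show ?thesis unfolding smooth_weak_metric_def by blast
qed

section \<open>Compatibility\<close>

text \<open>Boundedness and symmetry are already contained in order 0 of the jet.\<close>

lemma christoffel_carr:
  assumes p: "p \<in> G_dom s"
  shows "christoffel s (G_cover p) \<in> carr (sym_bilin (HsE s) (HsE s))"
proof -
  obtain d where d: "jet (HsE s) (sym_bilin (HsE s) (HsE s)) (G_dom s) d"
    "\<And>p. p \<in> G_dom s \<Longrightarrow> d p [] = christoffel s (G_cover p)" by (rule jet_christoffel) blast
  show ?thesis using mlin_carr[OF jetn_mlin[OF jet_jetn[OF d(1), of 0] p], of "[]"] d(2)[OF p] by simp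
qed

lemma metric_carr:
  assumes p: "p \<in> G_dom s"
  shows "metric2CH s (G_cover p) \<in> carr (sym_bilin (HsE s) real_ns)"
proof -
  obtain d where d: "jet (HsE s) (sym_bilin (HsE s) real_ns) (G_dom s) d"
    "\<And>p. p \<in> G_dom s \<Longrightarrow> d p [] = metric2CH s (G_cover p)" by (rule jet_metric) blast
  show ?thesis using mlin_carr[OF jetn_mlin[OF jet_jetn[OF d(1), of 0] p], of "[]"] d(2)[OF p] by simp
qed

text \<open>A perturbation small in \<open>H\<^sup>s\<close> has a derivative small in the supremum
  norm, while \<open>jac\<close> is bounded below by \<open>1 / (M + 1)\<close>. Openness is what
  makes derivatives on \<open>G_dom s\<close> unique.\<close>

lemma G_dom_open:
  assumes p: "p \<in> G_dom s"
  obtains \<eta> where "\<eta> > 0" "\<And>k. k \<in> carr (HsE s) \<Longrightarrow> nrm (HsE s) k < \<eta> \<Longrightarrow> p + k \<in> G_dom s"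
proof -
  obtain M where M: "M \<ge> 0" "\<And>x. \<bar>recip (jac (fst p)) x\<bar> \<le> M" using ccont_bounded[OF Hs_ccont[OF recip_jac_carr[OF p]]] by blast
  obtain C where C: "C \<ge> 0" "\<And>u x. u \<in> carr (Hs (s - 1)) \<Longrightarrow> \<bar>u x\<bar> \<le> C * nrm (Hs (s - 1)) u" using Hs_sup[OF s_minus1_gt_half] by blast
  define \<eta> where "\<eta> = 1 / ((C + 1) * (M + 1))"
  have \<eta>: "\<eta> > 0" using C M by (simp add: \<eta>_def)
  have "p + k \<in> G_dom s" if k: "k \<in> carr (HsE s)" "nrm (HsE s) k < \<eta>" for k
  proof -
    have pc: "p \<in> carr (HsE s)" using p G_dom_carr by blast
    have kc: "fst k \<in> carr (Hs s)" "fst p \<in> carr (Hs s)" using k pc by (auto simp: carr_E)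
    have n: "nrm (Hs s) (fst k) \<le> nrm (HsE s) k"
      unfolding HsE_def nrm_prod by (simp add: norm_Pair real_le_rsqrt)
    have "jac (fst (p + k)) x > 0" for x
    proof -
      have eq: "cderiv (fst p + fst k) = cderiv (fst p) + cderiv (fst k)"
        by (rule cderiv_eq[OF has_cderiv_add[OF Hs_s_deriv(1)[OF kc(2)] Hs_s_deriv(1)[OF kc(1)]]])
      have "\<bar>cderiv (fst k) x\<bar> \<le> C * nrm (Hs (s - 1)) (cderiv (fst k))" by (rule C(2)[OF Hs_s_deriv(2)[OF kc(1)]])
      also have "\<dots> \<le> C * \<eta>" using Hs_s_deriv(3)[OF kc(1)] n k(2) C(1) by (intro mult_left_mono) auto
      also have "\<dots> < 1 / (M + 1)"
      proof -
        have "C * \<eta> = C / (C + 1) * (1 / (M + 1))" by (simp add: \<eta>_def)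
        also have "\<dots> < 1 * (1 / (M + 1))" using C M by (intro mult_strict_right_mono) auto
        finally show ?thesis by simp
      qed
      also have "1 / (M + 1) \<le> jac (fst p) x"
        using M(2)[of x] jac_carr(2)[OF p, of x] M(1) by (auto simp: recip_def field_simps)
      finally show ?thesis by (simp add: jac_def eq)
    qed
    then show ?thesis unfolding G_dom_iff using ns_add[OF normed_E pc k(1)] by simp
  qed
  then show thesis using that \<eta> by blast
qed

lemma fderiv_jetn:
  assumes F: "normed_ns F" and d: "jetn 1 (HsE s) F (G_dom s) d" "\<And>q. q \<in> G_dom s \<Longrightarrow> d q [] = f q"
    and p: "p \<in> G_dom s" and h: "h \<in> carr (HsE s)"
  shows "fderiv (HsE s) F (G_dom s) f p h = d p [h]"
proof -
  have "has_fderiv (HsE s) F (G_dom s) (\<lambda>q. d q []) (\<lambda>h. d p [h]) p" by (rule jetn_has_fderiv[OF normed_E F d(1) p])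
  then have hf: "has_fderiv (HsE s) F (G_dom s) f (\<lambda>h. d p [h]) p"
    unfolding has_fderiv_def using d(2) p by (simp cong: conj_cong imp_cong)
  have "has_fderiv (HsE s) F (G_dom s) f (fderiv (HsE s) F (G_dom s) f p) p"
    unfolding fderiv_def by (rule someI[where P = "\<lambda>f'. has_fderiv (HsE s) F (G_dom s) f f' p", OF hf])
  moreover obtain \<eta> where "\<eta> > 0" "\<And>k. k \<in> carr (HsE s) \<Longrightarrow> nrm (HsE s) k < \<eta> \<Longrightarrow> p + k \<in> G_dom s"
    using G_dom_open[OF p] by blast
  moreover have "f q \<in> carr F" if "q \<in> G_dom s" for q
    using mlin_carr[OF jetn_mlin[OF d(1) that], of "[]"] d(2)[OF that] by simp
  ultimately show ?thesis using has_fderiv_unique[OF normed_E F _ hf h] by blast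
qed

lemma cintegral_exact:
  assumes "has_cderiv u v" "ccont v" "ccont g" "f = g + v"
  shows "cintegral f = cintegral g"
  unfolding assms(4) using cintegral_add[OF assms(3,2)] cintegral_cderiv[OF assms(1)] by simp

text \<open>The function \<open>w\<close> solves b w - (a w')' = Q'. Pairing with the first
  component of \<open>Z\<close> and integrating by parts gives the weak form, in which
  \<open>w\<close> no longer occurs; so the nonlocal part of the Christoffel map disappears.\<close>

lemma metric_christoffel:
  assumes p: "p \<in> G_dom s" and X: "X \<in> carr (HsE s)" and Y: "Y \<in> carr (HsE s)" and Z: "Z \<in> carr (HsE s)"
  shows "metric2CH s (G_cover p) (christoffel s (G_cover p) Y X) Z =
    cintegral (Qbil p Y X * cderiv (fst Z) - (1/2) *\<^sub>R ((cderiv (fst Y) * snd X + cderiv (fst X) * snd Y) * snd Z))"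
proof -
  let ?a = "recip (jac (fst p))" and ?b = "jac (fst p)"
  have c: "fst X \<in> carr (Hs s)" "snd X \<in> carr (Hs (s - 1))" "fst Y \<in> carr (Hs s)" "snd Y \<in> carr (Hs (s - 1))"
    "fst Z \<in> carr (Hs s)" "snd Z \<in> carr (Hs (s - 1))"
    using X Y Z by (auto simp: carr_E)
  define Q where "Q = Qbil p Y X"
  have Q: "Q \<in> carr (Hs (s - 1))" unfolding Q_def by (rule Qbil_carr[OF p Y X])
  define w where "w = res_at p (cderiv Q)"
  have w: "w \<in> carr (Hs s)" unfolding w_def by (rule res_at_carr(2)[OF p Hs_s1_deriv(2)[OF Q]])
  define S where "S = cderiv (fst Y) * snd X + cderiv (fst X) * snd Y"
  have aw: "?a * cderiv w \<in> carr (Hs (s - 1))" by (intro Hs_mult[OF s_minus1_gt_half] recip_jac_carr[OF p] Hs_s_deriv(2)[OF w])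
  have bw: "?b * w = cderiv Q + cderiv (?a * cderiv w)"
    using lop_res[OF p Hs_s1_deriv(2)[OF Q]] unfolding lop_at_def lop_def w_def[symmetric]
    by (auto simp: fun_eq_iff algebra_simps)
  have \<Gamma>: "christoffel s (G_cover p) Y X = (- w, - ((1/2) *\<^sub>R (?a * S)))"
    unfolding christoffel_eq[OF p Y X] by (simp add: w_def Q_def S_def)
  have \<Gamma>c: "christoffel s (G_cover p) Y X \<in> carr (HsE s)" by (rule sb_carr[OF christoffel_carr[OF p] Y X])
  have dw: "cderiv (- w) = - cderiv w"
    using cderiv_eq[OF has_cderiv_scale[OF Hs_s_deriv(1)[OF w], of "-1"]] by simp
  note cc = Hs_ccont[OF c(1)] Hs_ccont[OF c(2)] Hs_ccont[OF c(3)] Hs_ccont[OF c(4)] Hs_ccont[OF c(5)] Hs_ccont[OF c(6)]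
    Hs_ccont[OF Hs_s_deriv(2)[OF c(1)]] Hs_ccont[OF Hs_s_deriv(2)[OF c(3)]] Hs_ccont[OF Hs_s_deriv(2)[OF c(5)]]
    Hs_ccont[OF Q] Hs_ccont[OF Hs_s1_deriv(2)[OF Q]] Hs_ccont[OF w] Hs_ccont[OF Hs_s_deriv(2)[OF w]] Hs_ccont[OF aw]
    Hs_ccont[OF Hs_s1_deriv(2)[OF aw]] Hs_ccont[OF recip_jac_carr[OF p]] Hs_ccont[OF jac_carr(1)[OF p]]
  have Sc: "ccont S" unfolding S_def by (intro ccont_add ccont_mult cc)
  \<comment> \<open>A single total derivative accounts for both integrations by parts, that of Q'
    and that of (a w')'.\<close>
  let ?u = "- (Q * fst Z + (?a * cderiv w) * fst Z)"
  let ?v = "- ((cderiv Q * fst Z + Q * cderiv (fst Z)) + (cderiv (?a * cderiv w) * fst Z + (?a * cderiv w) * cderiv (fst Z)))"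
  have uv: "has_cderiv ?u ?v"
    using has_cderiv_scale[OF has_cderiv_add[OF has_cderiv_mult[OF Hs_s1_deriv(1)[OF Q] Hs_s_deriv(1)[OF c(5)]]
        has_cderiv_mult[OF Hs_s1_deriv(1)[OF aw] Hs_s_deriv(1)[OF c(5)]]], of "-1"] by simp
  have "metric2CH s (G_cover p) (christoffel s (G_cover p) Y X) Z =
     cintegral (?b * (- w * fst Z + - ((1/2) *\<^sub>R (?a * S)) * snd Z)) + cintegral (?a * (- cderiv w * cderiv (fst Z)))"
    unfolding metric_eq[OF p \<Gamma>c Z] unfolding \<Gamma> by (simp add: dw)
  also have "\<dots> = cintegral (?b * (- w * fst Z + - ((1/2) *\<^sub>R (?a * S)) * snd Z) + ?a * (- cderiv w * cderiv (fst Z)))"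
    by (intro cintegral_add[symmetric] ccont_mult ccont_add ccont_uminus ccont_scale Sc cc)
  also have "?b * (- w * fst Z + - ((1/2) *\<^sub>R (?a * S)) * snd Z) + ?a * (- cderiv w * cderiv (fst Z))
     = (Q * cderiv (fst Z) - (1/2) *\<^sub>R (S * snd Z)) + ?v"
  proof
    fix x
    have 1: "?b x * w x = cderiv Q x + cderiv (?a * cderiv w) x" using fun_cong[OF bw, of x] by simp
    have 2: "?b x * ?a x = 1" using fun_cong[OF recip_jac(2)[OF p], of x] by simp
    have "(?b * (- w * fst Z + - ((1/2) *\<^sub>R (?a * S)) * snd Z) + ?a * (- cderiv w * cderiv (fst Z))) x
      = - (?b x * w x) * fst Z x - (?b x * ?a x) * (S x * snd Z x / 2) - ?a x * cderiv w x * cderiv (fst Z) x"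
      by (simp add: scaleR_fun_def algebra_simps)
    also have "\<dots> = ((Q * cderiv (fst Z) - (1/2) *\<^sub>R (S * snd Z)) + ?v) x"
      unfolding 1 2 by (simp add: scaleR_fun_def algebra_simps)
    finally show "(?b * (- w * fst Z + - ((1/2) *\<^sub>R (?a * S)) * snd Z) + ?a * (- cderiv w * cderiv (fst Z))) x
      = ((Q * cderiv (fst Z) - (1/2) *\<^sub>R (S * snd Z)) + ?v) x" .
  qed
  also have "cintegral \<dots> = cintegral (Q * cderiv (fst Z) - (1/2) *\<^sub>R (S * snd Z))"
    by (rule cintegral_exact[OF uv _ _ refl]) (intro ccont_mult ccont_add ccont_uminus ccont_scale ccont_diff Sc cc)+
  finally show ?thesis by (simp add: Q_def S_def)
qed

text \<open>The right-hand side is minus the derivative of the metric coefficients in the direction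
  \<open>X\<close>: b changes by \<open>cderiv (fst X)\<close>, and a by minus a^2 times it. Under
  the integral the two sides differ by the total derivative of the product of the three first
  components.\<close>

lemma metric_christoffel_sym:
  assumes p: "p \<in> G_dom s" and X: "X \<in> carr (HsE s)" and Y: "Y \<in> carr (HsE s)" and Z: "Z \<in> carr (HsE s)"
  shows "metric2CH s (G_cover p) (christoffel s (G_cover p) Y X) Z + metric2CH s (G_cover p) Y (christoffel s (G_cover p) Z X) =
    - cintegral (cderiv (fst X) * (fst Y * fst Z + snd Y * snd Z) -
        (recip (jac (fst p)) * cderiv (fst X) * recip (jac (fst p))) * (cderiv (fst Y) * cderiv (fst Z)))"
proof -
  let ?a = "recip (jac (fst p))"
  have c: "fst X \<in> carr (Hs s)" "snd X \<in> carr (Hs (s - 1))" "fst Y \<in> carr (Hs s)" "snd Y \<in> carr (Hs (s - 1))"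
    "fst Z \<in> carr (Hs s)" "snd Z \<in> carr (Hs (s - 1))"
    using X Y Z by (auto simp: carr_E)
  note cc = Hs_ccont[OF c(1)] Hs_ccont[OF c(2)] Hs_ccont[OF c(3)] Hs_ccont[OF c(4)] Hs_ccont[OF c(5)] Hs_ccont[OF c(6)]
    Hs_ccont[OF Hs_s_deriv(2)[OF c(1)]] Hs_ccont[OF Hs_s_deriv(2)[OF c(3)]] Hs_ccont[OF Hs_s_deriv(2)[OF c(5)]]
    Hs_ccont[OF recip_jac_carr[OF p]] Hs_ccont[OF Qbil_carr[OF p Y X]] Hs_ccont[OF Qbil_carr[OF p Z X]]
  have "metric2CH s (G_cover p) Y (christoffel s (G_cover p) Z X) = metric2CH s (G_cover p) (christoffel s (G_cover p) Z X) Y"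
    by (rule sb_sym[OF metric_carr[OF p] Y sb_carr[OF christoffel_carr[OF p] Z X]])
  then have "metric2CH s (G_cover p) (christoffel s (G_cover p) Y X) Z + metric2CH s (G_cover p) Y (christoffel s (G_cover p) Z X) =
    cintegral ((Qbil p Y X * cderiv (fst Z) - (1/2) *\<^sub>R ((cderiv (fst Y) * snd X + cderiv (fst X) * snd Y) * snd Z)) +
      (Qbil p Z X * cderiv (fst Y) - (1/2) *\<^sub>R ((cderiv (fst Z) * snd X + cderiv (fst X) * snd Z) * snd Y)))"
    unfolding metric_christoffel[OF p X Y Z] metric_christoffel[OF p X Z Y]
    by (subst cintegral_add) (auto intro!: ccont_mult ccont_add ccont_diff ccont_scale cc)
  also have "\<dots> = cintegral ((-1) *\<^sub>R (cderiv (fst X) * (fst Y * fst Z + snd Y * snd Z) -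
        (?a * cderiv (fst X) * ?a) * (cderiv (fst Y) * cderiv (fst Z))))"
  proof (rule cintegral_exact[OF has_cderiv_mult[OF Hs_s_deriv(1)[OF c(1)] has_cderiv_mult[OF Hs_s_deriv(1)[OF c(3)] Hs_s_deriv(1)[OF c(5)]]]])
    show "Qbil p Y X * cderiv (fst Z) - (1/2) *\<^sub>R ((cderiv (fst Y) * snd X + cderiv (fst X) * snd Y) * snd Z) +
      (Qbil p Z X * cderiv (fst Y) - (1/2) *\<^sub>R ((cderiv (fst Z) * snd X + cderiv (fst X) * snd Z) * snd Y)) =
      (-1) *\<^sub>R (cderiv (fst X) * (fst Y * fst Z + snd Y * snd Z) - (?a * cderiv (fst X) * ?a) * (cderiv (fst Y) * cderiv (fst Z))) +
      (cderiv (fst X) * (fst Y * fst Z) + fst X * (cderiv (fst Y) * fst Z + fst Y * cderiv (fst Z)))"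
      by (simp add: fun_eq_iff Qbil_def scaleR_fun_def) (simp add: field_simps)
  qed (intro ccont_mult ccont_add ccont_diff ccont_scale cc)+
  finally show ?thesis unfolding cintegral_scale by simp
qed

text \<open>Differentiating the metric along \<open>Y\<close> and \<open>Z\<close> gives two terms
  with the derivatives of the fields and one with the derivative of the coefficients b and a. The
  last one is minus the sum of the two Christoffel terms, by
  \<open>metric_christoffel_sym\<close>.\<close>

lemma compatibility:
  assumes X: "vector_field s X" and Y: "vector_field s Y" and Z: "vector_field s Z" and P: "P \<in> HsG s"
  shows "D_G s real_ns (\<lambda>q. metric2CH s q (Y q) (Z q)) P (X P) =
    metric2CH s P (nabla s X Y P) (Z P) + metric2CH s P (Y P) (nabla s X Z P)"
proof -
  \<comment> \<open>The preimage chosen in \<open>D_G\<close>, so that its definition unfolds to a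
    derivative at this point.\<close>
  define p where "p = inv_into (G_dom s) G_cover P"
  have "P \<in> G_cover ` G_dom s" using HsG_cover[OF P] by blast
  then have p: "p \<in> G_dom s" and Pp: "P = G_cover p" unfolding p_def by (auto simp: inv_into_into f_inv_into_f)
  obtain x where x: "jetn 1 (HsE s) (HsE s) (G_dom s) x" "\<And>q. x q [] = (X \<circ> G_cover) q"
    using smooth_map_jetn[OF normed_E normed_E _ G_dom_carr] X unfolding vector_field_def smooth_G_def by metis
  obtain y where y: "jetn 1 (HsE s) (HsE s) (G_dom s) y" "\<And>q. y q [] = (Y \<circ> G_cover) q"
    using smooth_map_jetn[OF normed_E normed_E _ G_dom_carr] Y unfolding vector_field_def smooth_G_def by metis
  obtain z where z: "jetn 1 (HsE s) (HsE s) (G_dom s) z" "\<And>q. z q [] = (Z \<circ> G_cover) q"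
    using smooth_map_jetn[OF normed_E normed_E _ G_dom_carr] Z unfolding vector_field_def smooth_G_def by metis
  obtain a where a: "jet (HsE s) (Hs (s - 1)) (G_dom s) a" "\<And>p. a p [] = recip (jac (fst p))"
    "\<And>p h. h \<in> carr (HsE s) \<Longrightarrow> a p [h] = - (recip (jac (fst p)) * cderiv (fst h) * recip (jac (fst p)))"
    by (rule jet_recip_jac) blast
  obtain b where b: "jet (HsE s) (Hs (s - 1)) (G_dom s) b" "\<And>p. b p [] = jac (fst p)" "\<And>p h. b p [h] = cderiv (fst h)"
    by (rule jet_jac) blast
  note nE = normed_E and nH = normed_Hs
  define h where "h = X P"
  have val: "d q [] \<in> carr (HsE s)" "k \<in> carr (HsE s) \<Longrightarrow> d q [k] \<in> carr (HsE s)"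
    if "jetn 1 (HsE s) (HsE s) (G_dom s) d" "q \<in> G_dom s" for d q k
    using mlin_carr[OF jetn_mlin[OF that], of "[]"] mlin_carr[OF jetn_mlin[OF that], of "[k]"] by auto
  have h: "h \<in> carr (HsE s)" using val(1)[OF x(1) p] by (simp add: x(2) h_def Pp)
  define Yp where "Yp = y p []"
  define Zp where "Zp = z p []"
  define DY where "DY = y p [h]"
  define DZ where "DZ = z p [h]"
  have car: "Yp \<in> carr (HsE s)" "Zp \<in> carr (HsE s)" "DY \<in> carr (HsE s)" "DZ \<in> carr (HsE s)"
    using val(1)[OF y(1) p] val(1)[OF z(1) p] val(2)[OF y(1) p h] val(2)[OF z(1) p h] by (auto simp: Yp_def Zp_def DY_def DZ_def)
  have YP: "Y P = Yp" "Z P = Zp" by (simp_all add: Yp_def Zp_def y z Pp)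
  have DYe: "D_G s (HsE s) Y P (X P) = DY" "D_G s (HsE s) Z P (X P) = DZ"
    unfolding D_G_def p_def[symmetric] h_def[symmetric] DY_def DZ_def
    using fderiv_jetn[OF nE y(1) y(2) p h] fderiv_jetn[OF nE z(1) z(2) p h] by (simp_all add: o_def)
  have c1: "jetn 1 (HsE s) (Hs (s - 1)) (G_dom s) (\<lambda>q vs. fst (d q vs))"
      "jetn 1 (HsE s) (Hs (s - 1)) (G_dom s) (\<lambda>q vs. snd (d q vs))"
      "jetn 1 (HsE s) (Hs (s - 1)) (G_dom s) (\<lambda>q vs. cderiv (fst (d q vs)))"
    if "jetn 1 (HsE s) (HsE s) (G_dom s) d" for d
    by (rule jetn_lin[OF bdd_lin_E_fst1 nE nE that] jetn_lin[OF bdd_lin_E_snd nE nE that] jetn_lin[OF bdd_lin_E_dfst nE nE that])+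
  note ml = jetn_leib[OF bdd_bil_mult[OF s_minus1_gt_half] nE nH nH nH]
  \<comment> \<open>The metric along the two fields, written as an integral of products of jets; at
    the list \<open>[h]\<close> the Leibniz rule yields the three groups of terms used
    below.\<close>
  define m where "m = (\<lambda>q vs. cintegral (
     leib (*) (b q) (\<lambda>vs. leib (*) (\<lambda>vs. fst (y q vs)) (\<lambda>vs. fst (z q vs)) vs + leib (*) (\<lambda>vs. snd (y q vs)) (\<lambda>vs. snd (z q vs)) vs) vs +
     leib (*) (a q) (leib (*) (\<lambda>vs. cderiv (fst (y q vs))) (\<lambda>vs. cderiv (fst (z q vs)))) vs))"
  have m: "jetn 1 (HsE s) real_ns (G_dom s) m"
    unfolding m_def
    by (rule jetn_lin[OF bdd_lin_cintegral[OF s_minus1_gt_half] nE nH])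
       (intro jetn_add[OF nE nH] ml jet_jetn[OF b(1)] jet_jetn[OF a(1)] c1 y(1) z(1))
  have cc: "ccont (fst V)" "ccont (snd V)" "ccont (cderiv (fst V))" if "V \<in> carr (HsE s)" for V
    using that Hs_ccont Hs_s_deriv(2) by (auto simp: carr_E)
  have ab: "ccont (recip (jac (fst q)))" "ccont (jac (fst q))" if "q \<in> G_dom s" for q
    using Hs_ccont recip_jac_carr jac_carr(1) that by blast+
  have m0: "m q [] = ((\<lambda>q. metric2CH s q (Y q) (Z q)) \<circ> G_cover) q" if q: "q \<in> G_dom s" for q
  proof -
    note v = val(1)[OF y(1) q] val(1)[OF z(1) q]
    have "m q [] = cintegral (jac (fst q) * (fst (y q []) * fst (z q []) + snd (y q []) * snd (z q [])))
        + cintegral (recip (jac (fst q)) * (cderiv (fst (y q [])) * cderiv (fst (z q []))))"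
      unfolding m_def by (simp add: a b) (intro cintegral_add ccont_mult ccont_add cc v ab q)
    also have "\<dots> = metric2CH s (G_cover q) (y q []) (z q [])" by (rule metric_eq[OF q v, symmetric])
    finally show ?thesis by (simp add: y z)
  qed
  have "D_G s real_ns (\<lambda>q. metric2CH s q (Y q) (Z q)) P (X P) = m p [h]"
    unfolding D_G_def p_def[symmetric] h_def[symmetric] by (rule fderiv_jetn[OF normed_real m m0 p h])
  also have "m p [h] = cintegral ((jac (fst p) * (fst DY * fst Zp + snd DY * snd Zp) + recip (jac (fst p)) * (cderiv (fst DY) * cderiv (fst Zp)))
     + ((jac (fst p) * (fst Yp * fst DZ + snd Yp * snd DZ) + recip (jac (fst p)) * (cderiv (fst Yp) * cderiv (fst DZ)))
     + (cderiv (fst h) * (fst Yp * fst Zp + snd Yp * snd Zp) -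
        (recip (jac (fst p)) * cderiv (fst h) * recip (jac (fst p))) * (cderiv (fst Yp) * cderiv (fst Zp)))))"
    unfolding m_def DY_def DZ_def Yp_def Zp_def
    by (rule arg_cong[where f = cintegral]) (simp add: a(2) a(3)[OF h] b algebra_simps)
  also have "\<dots> = metric2CH s P DY Zp + metric2CH s P Yp DZ +
     cintegral (cderiv (fst h) * (fst Yp * fst Zp + snd Yp * snd Zp) -
        (recip (jac (fst p)) * cderiv (fst h) * recip (jac (fst p))) * (cderiv (fst Yp) * cderiv (fst Zp)))"
    unfolding Pp metric_eq[OF p car(3,2)] metric_eq[OF p car(1,4)]
    by (subst cintegral_add; (intro ccont_mult ccont_add ccont_diff cc car h ab p)?)+ simp
  also have "\<dots> = metric2CH s P DY Zp + metric2CH s P Yp DZ -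
     (metric2CH s P (christoffel s P Yp h) Zp + metric2CH s P Yp (christoffel s P Zp h))"
    unfolding Pp metric_christoffel_sym[OF p h car(1,2)] by simp
  also have "\<dots> = metric2CH s P (DY - christoffel s P Yp h) Zp + metric2CH s P Yp (DZ - christoffel s P Zp h)"
  proof -
    note mc = metric_carr[OF p] and gc = sb_carr[OF christoffel_carr[OF p]]
    show ?thesis
      unfolding Pp lin_on_diff[OF sb_lin[OF mc car(2)] nE car(3) gc[OF car(1) h]]
        lin_on_diff[OF sb_lin2[OF mc car(1)] nE car(4) gc[OF car(2) h]] by simp
  qed
  finally show ?thesis unfolding nabla_def DYe YP h_def .
qed

end

theorem proposition3p1:
  fixes s :: real
  assumes "s > 5/2"
  shows "smooth_spray s (christoffel s) \<and>
    smooth_weak_metric s (metric2CH s) \<and>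
    (\<forall>X Y Z. vector_field s X \<and> vector_field s Y \<and> vector_field s Z \<longrightarrow>
      (\<forall>p\<in>HsG s.
        D_G s real_ns (\<lambda>q. metric2CH s q (Y q) (Z q)) p (X p) =
          metric2CH s p (nabla s X Y p) (Z p) + metric2CH s p (Y p) (nabla s X Z p)))"
  using christoffel_smooth[OF assms] metric_smooth[OF assms] compatibility[OF assms] by blast

end
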